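(* Let $(M,J')$ be a $C^\infty$ smooth almost complex manifold of complex dimension $2$, and let $H:\mathbb{D}^2\to M$ be a $C^\infty$ smooth map from the bidisc $\mathbb{D}^2$ with coordinates $(z,w)$. Let $\Sigma\subset\mathbb{D}^2$ be the set of all critical points of $H$, and let $J=H^*J'$ be the pull-back of $J'$, defined on $\mathbb{D}^2\setminus\Sigma$. Suppose (i) for every $z\in\mathbb{D}$, the map $\mathbb{D}\ni w\mapsto H(z,w)\in M$ is a $(J_{\rm st},J')$-holomorphic immersion; (ii) for every $z\in\mathbb{D}$, the set $\{z\}\times\mathbb{D}$ is not contained in $\Sigma$; (iii) the map $H|_{\mathbb{D}^2\setminus\Sigma}$ preserves the canonical orientations defined by $J_{\rm st}$ on $\mathbb{D}^2$ and by $J'$ on $M$. Then for every $z\in\mathbb{D}$ the set $\Sigma\cap(\{z\}\times\mathbb{D})$ is discrete, and the almost complex structure $J$ defined on $\mathbb{D}^2\setminus\Sigma$ extends to a continuous almost complex structure on the whole bidisc $\mathbb{D}^2$. Moreover, on every compact $K\subset\mathbb{D}^2$, for some $0<\alpha<1$, the extension of $J$ is $C^\alpha$ in $z$ uniformly in $w$ and $C^{0,1}$ (Lipschitz) in $w$ uniformly in $z$. If the structure $J'$ is integrable, then the extension of $J$ is $C^\infty$ smooth on $\mathbb{D}^2$.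
   Context: $\mathbb{D}$ is the open unit disc in $\mathbb{C}$, $J_{\rm st}$ the standard complex structure (multiplication by $i$). An almost complex structure $J'$ on $M$ is a smooth field of endomorphisms of $TM$ with $J'^2=-I$. A smooth map $F$ from an open subset of $\mathbb{C}^k$ to $M$ is $(J_{\rm st},J')$-holomorphic if $dF\circ J_{\rm st}=J'\circ dF$. A critical point of $H$ is a point where the real differential $dH$ is not invertible; on $\mathbb{D}^2\setminus\Sigma$ the pull-back is $J=(dH)^{-1}\circ J'\circ dH$. An almost complex structure determines a canonical orientation (the one induced by any complex basis). $C^\alpha$ denotes Hölder continuity with exponent $\alpha$, $C^{0,1}$ the Lipschitz condition. *)

theory Defs
  imports "HOL-Analysis.Analysis"
begin

text \<open>Model space of a real 4-dimensional (complex 2-dimensional) manifold: C x C,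
  i.e. R^4 with its standard (J_st) orientation.\<close>
type_synonym cc = "complex \<times> complex"

fun dderiv :: "'a::real_normed_vector list \<Rightarrow> ('a \<Rightarrow> 'b::real_normed_vector) \<Rightarrow> 'a \<Rightarrow> 'b" where
  "dderiv [] f = f"
| "dderiv (v # vs) f = (\<lambda>x. frechet_derivative (dderiv vs f) (at x) v)"

definition smooth_on :: "'a::real_normed_vector set \<Rightarrow> ('a \<Rightarrow> 'b::real_normed_vector) \<Rightarrow> bool" where
  "smooth_on S f \<longleftrightarrow> (\<forall>vs. \<forall>x\<in>S. dderiv vs f differentiable (at x))"

definition smooth_atlas :: "('m::topological_space set \<times> ('m \<Rightarrow> cc)) set \<Rightarrow> bool" where
  "smooth_atlas A \<longleftrightarrow>
     \<Union>(fst ` A) = UNIV \<and>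
     (\<forall>(U, \<phi>)\<in>A. open U \<and> open (\<phi> ` U) \<and> homeomorphism U (\<phi> ` U) \<phi> (inv_into U \<phi>)) \<and>
     (\<forall>(U, \<phi>)\<in>A. \<forall>(V, \<psi>)\<in>A. smooth_on (\<phi> ` (U \<inter> V)) (\<psi> \<circ> inv_into U \<phi>))"

text \<open>Smooth almost complex structure on the manifold, given in local coordinates:
  for each chart c and point p in its domain, an endomorphism Jc c p of the model space
  (the structure in the coordinates of c), smooth in coordinates, squaring to -I, and
  compatible with the chart transitions.\<close>
definition smooth_almost_complex ::
  "('m::topological_space set \<times> ('m \<Rightarrow> cc)) set \<Rightarrow> (('m set \<times> ('m \<Rightarrow> cc)) \<Rightarrow> 'm \<Rightarrow> (cc \<Rightarrow>\<^sub>L cc)) \<Rightarrow> bool" where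
  "smooth_almost_complex A Jc \<longleftrightarrow>
     (\<forall>c\<in>A. \<forall>p\<in>fst c. Jc c p o\<^sub>L Jc c p = - id_blinfun) \<and>
     (\<forall>(U, \<phi>)\<in>A. smooth_on (\<phi> ` U) (Jc (U, \<phi>) \<circ> inv_into U \<phi>)) \<and>
     (\<forall>(U, \<phi>)\<in>A. \<forall>(V, \<psi>)\<in>A. \<forall>p\<in>U \<inter> V.
        frechet_derivative (\<psi> \<circ> inv_into U \<phi>) (at (\<phi> p)) \<circ> blinfun_apply (Jc (U, \<phi>) p) =
        blinfun_apply (Jc (V, \<psi>) p) \<circ> frechet_derivative (\<psi> \<circ> inv_into U \<phi>) (at (\<phi> p)))"

definition Jst :: "cc \<Rightarrow> cc" where
  "Jst = (\<lambda>(a, b). (\<i> * a, \<i> * b))"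

text \<open>Integrability: around every point there is a (J', J_st)-holomorphic coordinate
  system, i.e. a smooth diffeomorphism f (expressed in an atlas chart) onto an open
  subset of C^2 with df o J' = J_st o df.\<close>
definition integrable_acs ::
  "('m::topological_space set \<times> ('m \<Rightarrow> cc)) set \<Rightarrow> (('m set \<times> ('m \<Rightarrow> cc)) \<Rightarrow> 'm \<Rightarrow> (cc \<Rightarrow>\<^sub>L cc)) \<Rightarrow> bool" where
  "integrable_acs A Jc \<longleftrightarrow>
     (\<forall>p. \<exists>(U, \<phi>)\<in>A. \<exists>W f g. p \<in> W \<and> open W \<and> W \<subseteq> U \<and>
        smooth_on (\<phi> ` W) f \<and> open (f ` \<phi> ` W) \<and> smooth_on (f ` \<phi> ` W) g \<and>
        (\<forall>y\<in>\<phi> ` W. g (f y) = y) \<and>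
        (\<forall>y\<in>\<phi> ` W. frechet_derivative f (at y) \<circ> blinfun_apply (Jc (U, \<phi>) (inv_into U \<phi> y)) =
                      Jst \<circ> frechet_derivative f (at y)))"

definition bidisc :: "cc set" where
  "bidisc = ball 0 1 \<times> ball 0 1"

definition smooth_map_bidisc :: "('m::topological_space set \<times> ('m \<Rightarrow> cc)) set \<Rightarrow> (cc \<Rightarrow> 'm) \<Rightarrow> bool" where
  "smooth_map_bidisc A H \<longleftrightarrow> continuous_on bidisc H \<and>
     (\<forall>(U, \<phi>)\<in>A. smooth_on (bidisc \<inter> H -` U) (\<phi> \<circ> H))"

definition critical_set :: "('m::topological_space set \<times> ('m \<Rightarrow> cc)) set \<Rightarrow> (cc \<Rightarrow> 'm) \<Rightarrow> cc set" where
  "critical_set A H = {x\<in>bidisc. \<exists>(U, \<phi>)\<in>A. H x \<in> U \<and> \<not> bij (frechet_derivative (\<phi> \<circ> H) (at x))}"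

definition ldet :: "('a::euclidean_space \<Rightarrow> 'a) \<Rightarrow> real" where
  "ldet L = (\<Sum>p | p permutes Basis. of_int (sign p) * (\<Prod>b\<in>Basis. inner (L b) (p b)))"

text \<open>The real-linear map sending the ordered basis (1,0),(i,0),(0,1),(0,i) to v, Jv, u, Ju;
  for a J-complex basis (v,u) its determinant sign is the canonical J-orientation.\<close>
definition cframe :: "(cc \<Rightarrow>\<^sub>L cc) \<Rightarrow> cc \<Rightarrow> cc \<Rightarrow> cc \<Rightarrow> cc" where
  "cframe J v u = (\<lambda>(a, b). Re a *\<^sub>R v + Im a *\<^sub>R J v + Re b *\<^sub>R u + Im b *\<^sub>R J u)"

end

theory Submission
  imports Defs "HOL-Complex_Analysis.Complex_Analysis"
begin

text \<open>In a chart, complete the tangent vector of the disc through a point to a smooth complex frame of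
  \<open>J'\<close>. In this frame the differential of the map is
  \<open>(\<zeta>, \<omega>) \<mapsto> (s \<zeta> + s' cnj \<zeta> + \<omega>, a \<zeta> + b cnj \<zeta>)\<close>. Differentiating the holomorphy of the discs along
  \<open>z\<close> gives the linear system \<open>wb a = A a + B cnj b\<close>, \<open>wb b = A b + B cnj a\<close> on each slice, where \<open>wb\<close> is the
  Cauchy-Riemann operator in \<open>w\<close>. Preservation of orientation means \<open>|b| < |a|\<close> off the critical set, and
  the pulled back structure is a smooth function of \<open>s\<close>, \<open>s'\<close> and the Beltrami coefficient \<open>q = b / a\<close>.

  At a zero of \<open>a\<close> the two functions have leading terms \<open>\<alpha> w\<^sup>n\<close> and \<open>\<beta> w\<^sup>n\<close> with \<open>|\<beta>| < |\<alpha>|\<close>: zeros in a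
  slice are isolated and \<open>q\<close> extends continuously with \<open>|q| < 1\<close>. Dividing \<open>a\<close> and \<open>b\<close> by the polynomial \<open>P\<close>
  of the zeros of \<open>a\<close> keeps the system except that \<open>B\<close> becomes \<open>B cnj P / P\<close>. As the second
  Fourier coefficients of \<open>cnj P / P\<close> on circles have integrals bounded by the degree alone, the derivative of
  the quotients, and hence the Lipschitz constant of \<open>q\<close> in \<open>w\<close>, is bounded uniformly in \<open>z\<close>. Comparing two
  slices away from the zeros gives the Hoelder estimate in \<open>z\<close>. If \<open>J'\<close> is integrable, holomorphic
  coordinates give \<open>A = B = 0\<close>, so \<open>q\<close> is holomorphic in \<open>w\<close> and the Cauchy integral formula over a circle
  avoiding the zeros shows that it is smooth.\<close>

subsection \<open>Smooth maps\<close>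

text \<open>The obstacle is uniformity in \<open>z\<close>: the zeros of \<open>a\<close> move and
  collide with \<open>z\<close> and cannot be controlled one by one. A bounded right-hand side of a
  Cauchy-Riemann equation does not bound the remaining derivative, as \<open>1 / rho\<close> is not
  integrable at 0, and \<open>B cnj P / P\<close> oscillates at every zero. The way out is that a
  zero at distance \<open>d\<close> from the centre spoils the second coefficient on the circle of
  radius \<open>rho\<close> by at most a multiple of \<open>rho d / (rho^2 + d^2)\<close>; weighted
  by \<open>1 / rho\<close> this integrates to an arctangent, bounded whatever \<open>d\<close> is.
  The rest of the right-hand side has a square-root modulus of continuity whose constant grows like
  the square root of the unknown bound \<open>L\<close> of the derivatives, so \<open>L\<close> is
  at most a constant plus \<open>L / 2\<close>. The degree of \<open>P\<close> has a uniform bound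
  \<open>N\<close>, because \<open>a\<close> is bounded above and, on an annulus around all zeros,
  below. The exponent in \<open>z\<close> is \<open>1 / (N + 2)\<close>: within distance
  \<open>t\<close> of every point there is one where \<open>a\<close> is at least of order
  \<open>t^N\<close>, and there slices at distance \<open>t^(N + 2)\<close> have quotients differing
  by order \<open>t^2\<close>.\<close>

abbreviation dd :: "('a::real_normed_vector \<Rightarrow> 'b::real_normed_vector) \<Rightarrow> 'a \<Rightarrow> 'a \<Rightarrow> 'b" where
  "dd f v \<equiv> (\<lambda>x. frechet_derivative f (at x) v)"

text \<open>Smoothness of finite order, unfolded from the innermost derivative, while
  \<open>dderiv\<close> is unfolded from the outermost one: this order permits inductions in which a
  function is replaced by its derivative. Level \<open>n\<close> accounts for \<open>n + 1\<close>
  derivatives.\<close>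

primrec ck :: "nat \<Rightarrow> 'a::real_normed_vector set \<Rightarrow> ('a \<Rightarrow> 'b::real_normed_vector) \<Rightarrow> bool" where
  "ck 0 S f = (\<forall>x\<in>S. f differentiable (at x))"
| "ck (Suc n) S f = ((\<forall>x\<in>S. f differentiable (at x)) \<and> (\<forall>v. ck n S (dd f v)))"

lemma dderiv_append: "dderiv (us @ vs) f = dderiv us (dderiv vs f)"
  by (induction us) auto

lemma ck_iff_dderiv:
  "ck n S f \<longleftrightarrow> (\<forall>vs. length vs \<le> n \<longrightarrow> (\<forall>x\<in>S. dderiv vs f differentiable (at x)))"
proof (induction n arbitrary: f)
  case 0
  then show ?case by simp
next
  case (Suc n)
  have *: "dderiv vs (dd f v) = dderiv (vs @ [v]) f" for vs v
    by (simp add: dderiv_append)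
  \<comment> \<open>\<open>dderiv\<close> differentiates along the last entry of the list before all
    others, so the list is split at its end to expose the derivative that \<open>ck\<close> peels
    off.\<close>
  have **: "(\<forall>vs. length vs \<le> Suc n \<longrightarrow> Q vs) \<longleftrightarrow> Q [] \<and> (\<forall>v vs. length vs \<le> n \<longrightarrow> Q (vs @ [v]))"
    for Q :: "'a list \<Rightarrow> bool"
  proof safe
    fix vs :: "'a list" assume "Q []" "\<forall>v vs. length vs \<le> n \<longrightarrow> Q (vs @ [v])" "length vs \<le> Suc n"
    then show "Q vs" by (cases vs rule: rev_cases) auto
  qed auto
  show ?case
    unfolding ck.simps Suc.IH * ** by auto
qed

lemma smooth_on_iff_ck: "smooth_on S f \<longleftrightarrow> (\<forall>n. ck n S f)"
  unfolding smooth_on_def ck_iff_dderiv by auto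

lemma ck_differentiable: "ck n S f \<Longrightarrow> x \<in> S \<Longrightarrow> f differentiable (at x)"
  by (cases n) auto

lemma ck_mono: "ck n S f \<Longrightarrow> m \<le> n \<Longrightarrow> ck m S f"
  unfolding ck_iff_dderiv by auto

lemma ck_subset: "ck n S f \<Longrightarrow> T \<subseteq> S \<Longrightarrow> ck n T f"
  unfolding ck_iff_dderiv by blast

lemma differentiable_transform_open:
  assumes "f differentiable (at x)" "open S" "x \<in> S" "\<And>y. y \<in> S \<Longrightarrow> f y = g y"
  shows "g differentiable (at x)"
  using assms has_derivative_transform_within_open unfolding differentiable_def by blast

lemma ck_cong:
  assumes "open S" "\<And>x. x \<in> S \<Longrightarrow> f x = g x" "ck n S f"
  shows "ck n S g"
  using assms(2,3)
proof (induction n arbitrary: f g)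
  case 0
  then show ?case
    using assms(1) differentiable_transform_open[of f _ S g] unfolding ck.simps by blast
next
  case (Suc n)
  have "frechet_derivative f (at x) = frechet_derivative g (at x)" if "x \<in> S" for x
    by (rule frechet_derivative_transform_within_open[of f x S g])
      (use Suc.prems that assms(1) in auto)
  then have "ck n S (dd g v)" for v
    using Suc.IH[of "dd f v" "dd g v"] Suc.prems unfolding ck.simps by metis
  moreover have "\<forall>x\<in>S. g differentiable (at x)"
    using Suc.prems assms(1) differentiable_transform_open[of f _ S g] unfolding ck.simps by blast
  ultimately show ?case unfolding ck.simps by blast
qed

text \<open>Turns a formula for the derivative into regularity. The closure properties that follow
  are complete inductions on the order: the formula is built from the given functions and their
  derivatives, all available at the lower level.\<close>

lemma ckI:
  assumes "open S" "\<And>x. x \<in> S \<Longrightarrow> (f has_derivative f' x) (at x)"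
    and "\<And>m v. n = Suc m \<Longrightarrow> ck m S (\<lambda>x. f' x v)"
  shows "ck n S f"
proof (cases n)
  case 0
  then show ?thesis using assms(2) by (auto intro: differentiableI)
next
  case (Suc m)
  have "f' x = frechet_derivative f (at x)" if "x \<in> S" for x
    by (rule frechet_derivative_at) (use assms(2) that in auto)
  then have "ck m S (dd f v)" for v
    using ck_cong[OF assms(1), of "\<lambda>x. f' x v" "dd f v" m] assms(3)[OF Suc] by auto
  then show ?thesis using Suc assms(2) by (auto intro: differentiableI)
qed

lemma ck_has_derivative:
  "ck n S f \<Longrightarrow> x \<in> S \<Longrightarrow> (f has_derivative frechet_derivative f (at x)) (at x)"
  using ck_differentiable frechet_derivative_works by blast

section \<open>Closure properties at finite order\<close>

lemma ck_const:
  assumes "open S"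
  shows "ck n S (\<lambda>x. c)"
proof (induction n arbitrary: c rule: less_induct)
  case (less n)
  show ?case
  proof (rule ckI[OF assms has_derivative_const])
    fix m v assume "n = Suc m"
    then show "ck m S (\<lambda>x. 0 :: 'b)" using less.IH[of m 0] by simp
  qed
qed

lemma ck_SucD: "ck (Suc m) S f \<Longrightarrow> ck m S f" "ck (Suc m) S f \<Longrightarrow> ck m S (dd f v)"
  using ck_mono[of "Suc m" S f m] by auto

lemma ck_linear:
  assumes "bounded_linear h" "open S" "ck n S f"
  shows "ck n S (\<lambda>x. h (f x))"
  using assms(3)
proof (induction n arbitrary: f rule: less_induct)
  case (less n)
  show ?case
  proof (rule ckI[OF assms(2) bounded_linear.has_derivative[OF assms(1) ck_has_derivative[OF less.prems]]])
    fix m v assume n: "n = Suc m"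
    show "ck m S (\<lambda>x. h (dd f v x))"
      by (rule less.IH[OF _ ck_SucD(2)[OF less.prems[unfolded n]]]) (simp add: n)
  qed
qed

lemma ck_id: "open S \<Longrightarrow> ck n S (\<lambda>x. x)"
  by (rule ckI[where f'="\<lambda>_ v. v"]) (auto simp: ck_const)

lemma ck_add:
  assumes "open S" "ck n S f" "ck n S g"
  shows "ck n S (\<lambda>x. f x + g x)"
  using assms(2,3)
proof (induction n arbitrary: f g rule: less_induct)
  case (less n)
  show ?case
  proof (rule ckI[OF assms(1) has_derivative_add[OF ck_has_derivative[OF less.prems(1)] ck_has_derivative[OF less.prems(2)]]])
    fix m v assume n: "n = Suc m"
    show "ck m S (\<lambda>x. dd f v x + dd g v x)"
      by (rule less.IH[OF _ ck_SucD(2)[OF less.prems(1)[unfolded n]] ck_SucD(2)[OF less.prems(2)[unfolded n]]]) (simp add: n)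
  qed
qed

lemma ck_bilinear:
  assumes "bounded_bilinear B" "open S" "ck n S f" "ck n S g"
  shows "ck n S (\<lambda>x. B (f x) (g x))"
  using assms(3,4)
proof (induction n arbitrary: f g rule: less_induct)
  case (less n)
  show ?case
  proof (rule ckI[OF assms(2) bounded_bilinear.FDERIV[OF assms(1) ck_has_derivative[OF less.prems(1)] ck_has_derivative[OF less.prems(2)]]])
    fix m v assume n: "n = Suc m"
    note p = ck_SucD[OF less.prems(1)[unfolded n]] ck_SucD[OF less.prems(2)[unfolded n]]
    then show "ck m S (\<lambda>x. B (f x) (dd g v x) + B (dd f v x) (g x))"
      by (intro ck_add[OF assms(2)] less.IH p) (simp_all add: n)
  qed
qed

lemma ck_sum:
  assumes "open S" "\<And>i. i \<in> I \<Longrightarrow> ck n S (f i)"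
  shows "ck n S (\<lambda>x. \<Sum>i\<in>I. f i x)"
  using assms(2) by (induction I rule: infinite_finite_induct) (auto intro!: ck_const ck_add assms(1))

lemma frechet_derivative_expand:
  fixes g :: "'b::euclidean_space \<Rightarrow> 'c::real_normed_vector"
  assumes "g differentiable (at y)"
  shows "frechet_derivative g (at y) v = (\<Sum>b\<in>Basis. (v \<bullet> b) *\<^sub>R dd g b y)"
proof -
  have l: "linear (frechet_derivative g (at y))" by (rule linear_frechet_derivative[OF assms])
  have "frechet_derivative g (at y) v = frechet_derivative g (at y) (\<Sum>b\<in>Basis. (v \<bullet> b) *\<^sub>R b)"
    by (simp add: euclidean_representation)
  also have "\<dots> = (\<Sum>b\<in>Basis. (v \<bullet> b) *\<^sub>R dd g b y)"
    by (simp add: linear_sum[OF l] linear_cmul[OF l])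
  finally show ?thesis .
qed

text \<open>In the chain rule the outer derivative is taken along a direction that moves with the
  point, which \<open>ck\<close> does not express; expanding that direction in a basis leaves
  derivatives along fixed vectors with scalar coefficients.\<close>

lemma ck_compose:
  fixes g :: "'b::euclidean_space \<Rightarrow> 'c::real_normed_vector"
  assumes "open S" "open T" "f ` S \<subseteq> T" "ck n S f" "ck n T g"
  shows "ck n S (\<lambda>x. g (f x))"
  using assms(4,5)
proof (induction n arbitrary: g rule: less_induct)
  case (less n)
  have fS: "f x \<in> T" if "x \<in> S" for x using that assms(3) by blast
  have d: "((\<lambda>x. g (f x)) has_derivative (\<lambda>v. \<Sum>b\<in>Basis. (frechet_derivative f (at x) v \<bullet> b) *\<^sub>R dd g b (f x))) (at x)"
    if "x \<in> S" for x
  proof -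
    have "(\<lambda>v. frechet_derivative g (at (f x)) (frechet_derivative f (at x) v)) =
        (\<lambda>v. \<Sum>b\<in>Basis. (frechet_derivative f (at x) v \<bullet> b) *\<^sub>R dd g b (f x))"
      by (rule ext) (rule frechet_derivative_expand[OF ck_differentiable[OF less.prems(2) fS[OF that]]])
    with has_derivative_compose[OF ck_has_derivative[OF less.prems(1) that] ck_has_derivative[OF less.prems(2) fS[OF that]]]
    show ?thesis by (rule has_derivative_eq_rhs)
  qed
  show ?case
  proof (rule ckI[OF assms(1) d])
    fix m v assume n: "n = Suc m"
    note p = ck_SucD[OF less.prems(1)[unfolded n]] ck_SucD[OF less.prems(2)[unfolded n]]
    show "ck m S (\<lambda>x. \<Sum>b\<in>Basis. (frechet_derivative f (at x) v \<bullet> b) *\<^sub>R dd g b (f x))"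
      by (rule ck_sum[OF assms(1)], rule ck_bilinear[OF bounded_bilinear_scaleR assms(1)],
        rule ck_linear[OF bounded_linear_inner_left assms(1)], rule p, rule less.IH)
        (use p n in simp_all)
  qed
qed

section \<open>Closure properties of smooth maps\<close>

lemma smooth_on_cong:
  "open S \<Longrightarrow> (\<And>x. x \<in> S \<Longrightarrow> f x = g x) \<Longrightarrow> smooth_on S f \<Longrightarrow> smooth_on S g"
  unfolding smooth_on_iff_ck by (meson ck_cong)

lemma smooth_on_subset: "smooth_on S f \<Longrightarrow> T \<subseteq> S \<Longrightarrow> smooth_on T f"
  unfolding smooth_on_iff_ck by (meson ck_subset)

lemma smooth_on_differentiable: "smooth_on S f \<Longrightarrow> x \<in> S \<Longrightarrow> f differentiable (at x)"
  unfolding smooth_on_iff_ck by (meson ck_differentiable)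

lemma smooth_on_has_derivative:
  "smooth_on S f \<Longrightarrow> x \<in> S \<Longrightarrow> (f has_derivative frechet_derivative f (at x)) (at x)"
  unfolding smooth_on_iff_ck by (meson ck_has_derivative)

lemma smooth_on_isCont: "smooth_on S f \<Longrightarrow> x \<in> S \<Longrightarrow> isCont f x"
  using smooth_on_differentiable differentiable_imp_continuous_within by blast

lemma smooth_on_continuous_on: "smooth_on S f \<Longrightarrow> continuous_on S f"
  by (meson continuous_at_imp_continuous_on smooth_on_isCont)

lemma smooth_on_dd: "smooth_on S f \<Longrightarrow> smooth_on S (dd f v)"
  unfolding smooth_on_iff_ck by (intro allI, rule ck_SucD(2)) (erule spec)

lemma smooth_on_const: "open S \<Longrightarrow> smooth_on S (\<lambda>x. c)"
  unfolding smooth_on_iff_ck by (simp add: ck_const)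

lemma smooth_on_id: "open S \<Longrightarrow> smooth_on S (\<lambda>x. x)"
  unfolding smooth_on_iff_ck by (simp add: ck_id)

lemma smooth_on_linear:
  "bounded_linear h \<Longrightarrow> open S \<Longrightarrow> smooth_on S f \<Longrightarrow> smooth_on S (\<lambda>x. h (f x))"
  unfolding smooth_on_iff_ck by (simp add: ck_linear)

lemma smooth_on_add:
  "open S \<Longrightarrow> smooth_on S f \<Longrightarrow> smooth_on S g \<Longrightarrow> smooth_on S (\<lambda>x. f x + g x)"
  unfolding smooth_on_iff_ck by (simp add: ck_add)

lemma smooth_on_minus: "open S \<Longrightarrow> smooth_on S f \<Longrightarrow> smooth_on S (\<lambda>x. - f x)"
  by (rule smooth_on_linear[of uminus]) (auto intro: bounded_linear_minus bounded_linear_ident)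

lemma smooth_on_diff:
  "open S \<Longrightarrow> smooth_on S f \<Longrightarrow> smooth_on S g \<Longrightarrow> smooth_on S (\<lambda>x. f x - g x)"
  using smooth_on_add[of S f "\<lambda>x. - g x"] smooth_on_minus by auto

lemma smooth_on_bilinear:
  "bounded_bilinear B \<Longrightarrow> open S \<Longrightarrow> smooth_on S f \<Longrightarrow> smooth_on S g \<Longrightarrow> smooth_on S (\<lambda>x. B (f x) (g x))"
  unfolding smooth_on_iff_ck by (simp add: ck_bilinear)

lemma smooth_on_mult:
  fixes f g :: "_ \<Rightarrow> 'a::real_normed_algebra"
  shows "open S \<Longrightarrow> smooth_on S f \<Longrightarrow> smooth_on S g \<Longrightarrow> smooth_on S (\<lambda>x. f x * g x)"
  by (rule smooth_on_bilinear[OF bounded_bilinear_mult])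

lemma smooth_on_scaleR:
  "open S \<Longrightarrow> smooth_on S f \<Longrightarrow> smooth_on S g \<Longrightarrow> smooth_on S (\<lambda>x. f x *\<^sub>R g x)"
  by (rule smooth_on_bilinear[OF bounded_bilinear_scaleR])

lemma smooth_on_sum:
  "open S \<Longrightarrow> (\<And>i. i \<in> I \<Longrightarrow> smooth_on S (f i)) \<Longrightarrow> smooth_on S (\<lambda>x. \<Sum>i\<in>I. f i x)"
  unfolding smooth_on_iff_ck by (simp add: ck_sum)

lemma smooth_on_compose:
  fixes g :: "'b::euclidean_space \<Rightarrow> 'c::real_normed_vector"
  shows "open S \<Longrightarrow> open T \<Longrightarrow> f ` S \<subseteq> T \<Longrightarrow> smooth_on S f \<Longrightarrow> smooth_on T g \<Longrightarrow> smooth_on S (\<lambda>x. g (f x))"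
  unfolding smooth_on_iff_ck by (simp add: ck_compose)

lemma smooth_on_inverse:
  fixes f :: "'a::real_normed_vector \<Rightarrow> 'b::real_normed_field"
  assumes "open S" "smooth_on S f" "\<And>x. x \<in> S \<Longrightarrow> f x \<noteq> 0"
  shows "smooth_on S (\<lambda>x. inverse (f x))"
proof -
  have f: "\<And>n. ck n S f" using assms(2) smooth_on_iff_ck by auto
  have d: "((\<lambda>x. inverse (f x)) has_derivative
     (\<lambda>h. - (inverse (f x) * frechet_derivative f (at x) h * inverse (f x)))) (at x)" if "x \<in> S" for x
    by (rule Deriv.has_derivative_inverse[OF _ smooth_on_has_derivative[OF assms(2) that]]) (use assms(3) that in auto)
  have "ck n S (\<lambda>x. inverse (f x))" for n
  proof (induction n rule: less_induct)
    case (less n)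
    show ?case
    proof (rule ckI[OF assms(1) d])
      fix m v assume n: "n = Suc m"
      note IH = less.IH[of m, unfolded n, OF lessI]
      have "ck m S (\<lambda>x. inverse (f x) * dd f v x * inverse (f x))"
        by (rule ck_bilinear[OF bounded_bilinear_mult assms(1)
            ck_bilinear[OF bounded_bilinear_mult assms(1) IH ck_SucD(2)[OF f]] IH])
      then show "ck m S (\<lambda>x. - (inverse (f x) * dd f v x * inverse (f x)))"
        by (rule ck_linear[OF bounded_linear_minus[OF bounded_linear_ident] assms(1)])
    qed
  qed
  then show ?thesis by (simp add: smooth_on_iff_ck)
qed

lemma smooth_on_divide:
  fixes f :: "'a::real_normed_vector \<Rightarrow> 'b::real_normed_field"
  assumes "open S" "smooth_on S f" "smooth_on S g" "\<And>x. x \<in> S \<Longrightarrow> g x \<noteq> 0"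
  shows "smooth_on S (\<lambda>x. f x / g x)"
  unfolding divide_inverse by (intro smooth_on_mult smooth_on_inverse assms)

lemma smooth_on_local:
  assumes "\<And>x. x \<in> S \<Longrightarrow> \<exists>T. x \<in> T \<and> smooth_on T f"
  shows "smooth_on S f"
  using assms unfolding smooth_on_def by blast

text \<open>Source of the symmetry of second derivatives: the second difference is symmetric in
  \<open>u\<close> and \<open>v\<close>, whereas the limit found here names an order of
  differentiation. The proof is the mean value inequality in the direction \<open>u\<close>.\<close>

lemma second_difference_limit:
  fixes f :: "'a::real_normed_vector \<Rightarrow> 'b::real_normed_vector"
  assumes S: "open S" "x \<in> S" and f: "\<And>y. y \<in> S \<Longrightarrow> f differentiable (at y)"
    and fu: "dd f u differentiable (at x)"
  shows "((\<lambda>h::real. (f (x + h *\<^sub>R u + h *\<^sub>R v) - f (x + h *\<^sub>R u) - f (x + h *\<^sub>R v) + f x) /\<^sub>R (h * h))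
           \<longlongrightarrow> dd (dd f u) v x) (at_right 0)"
proof (rule tendstoI)
  fix e :: real assume e: "e > 0"
  define D where "D = frechet_derivative (dd f u) (at x)"
  have linD: "linear D" unfolding D_def by (rule linear_frechet_derivative[OF fu])
  define K where "K = norm u + norm v + 1"
  have K: "K > 0" unfolding K_def by (auto intro: add_nonneg_pos)
  define e' where "e' = e / (4 * K)"
  have e': "e' > 0" using e K by (simp add: e'_def)
  have "(dd f u has_derivative D) (at x)"
    using fu unfolding D_def frechet_derivative_works .
  then obtain d1 where d1: "d1 > 0" and
    D1: "\<And>y. norm (y - x) < d1 \<Longrightarrow> norm (dd f u y - dd f u x - D (y - x)) \<le> e' * norm (y - x)"
    using e' unfolding has_derivative_at_alt by blast
  obtain d2 where d2: "d2 > 0" "ball x d2 \<subseteq> S" using S openE by blast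
  define d where "d = min d1 d2 / K"
  have d: "d > 0" using d1 d2 K by (simp add: d_def)
  have main: "norm ((f (x + h *\<^sub>R u + h *\<^sub>R v) - f (x + h *\<^sub>R u) - f (x + h *\<^sub>R v) + f x) /\<^sub>R (h * h) - D v) < e"
    if h: "0 < h" "h < d" for h
  proof -
    have hK: "h * K < d1" "h * K < d2" using h(2) K unfolding d_def by (auto simp: field_simps)
    have nb: "norm ((x + s *\<^sub>R u + c *\<^sub>R v) - x) \<le> h * K" if "0 \<le> s" "s \<le> h" "0 \<le> c" "c \<le> h" for s c
    proof -
      have "norm ((x + s *\<^sub>R u + c *\<^sub>R v) - x) \<le> s * norm u + c * norm v"
        using norm_triangle_ineq[of "s *\<^sub>R u" "c *\<^sub>R v"] that by simp
      also have "\<dots> \<le> h * norm u + h * norm v"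
        using that by (intro add_mono mult_right_mono) auto
      also have "\<dots> \<le> h * K" using h by (simp add: K_def algebra_simps)
      finally show ?thesis .
    qed
    have inS: "x + s *\<^sub>R u + c *\<^sub>R v \<in> S" if "0 \<le> s" "s \<le> h" "0 \<le> c" "c \<le> h" for s c
      using nb[OF that] hK(2) d2(2) by (auto simp: subset_iff dist_norm norm_minus_commute)
    \<comment> \<open>The increment of \<open>f\<close> along \<open>v\<close>, as a function of the
      displacement along \<open>u\<close>, minus its expected linear part. Its derivative
      \<open>k'\<close> compares two values of \<open>dd f u\<close> with their linearisation, each
      with an error of at most \<open>e' * (h * K)\<close>.\<close>
    define k where "k = (\<lambda>s. f (x + s *\<^sub>R u + h *\<^sub>R v) - f (x + s *\<^sub>R u + 0 *\<^sub>R v) - (s * h) *\<^sub>R D v)"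
    define k' where "k' = (\<lambda>s. dd f u (x + s *\<^sub>R u + h *\<^sub>R v) - dd f u (x + s *\<^sub>R u + 0 *\<^sub>R v) - h *\<^sub>R D v)"
    have df: "((\<lambda>s. f (x + s *\<^sub>R u + c *\<^sub>R v)) has_derivative (\<lambda>t. t *\<^sub>R dd f u (x + s *\<^sub>R u + c *\<^sub>R v))) (at s within {0..h})"
      if "s \<in> {0..h}" "0 \<le> c" "c \<le> h" for s c
    proof -
      have fd: "f differentiable (at (x + s *\<^sub>R u + c *\<^sub>R v))" using f inS that by auto
      have "((\<lambda>s. x + s *\<^sub>R u + c *\<^sub>R v) has_derivative (\<lambda>t. t *\<^sub>R u)) (at s within {0..h})"
        by (auto intro!: derivative_eq_intros)
      from has_derivative_compose[OF this fd[unfolded frechet_derivative_works]]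
      show ?thesis by (simp add: linear_cmul[OF linear_frechet_derivative[OF fd]])
    qed
    have kd: "(k has_derivative (\<lambda>t. t *\<^sub>R k' s)) (at s within {0..h})" if "s \<in> {0..h}" for s
    proof -
      have "((\<lambda>s. (s * h) *\<^sub>R D v) has_derivative (\<lambda>t. t *\<^sub>R h *\<^sub>R D v)) (at s within {0..h})"
        by (auto intro!: derivative_eq_intros)
      with df[OF that, of h] df[OF that, of 0] h(1) show ?thesis unfolding k_def k'_def
        by (auto intro!: has_derivative_eq_rhs[OF has_derivative_diff[OF has_derivative_diff]]
            simp: scaleR_diff_right)
    qed
    have k'b: "norm (k' s) \<le> 2 * e' * (h * K)" if "s \<in> {0..h}" for s
    proof -
      define y1 where "y1 = x + s *\<^sub>R u + h *\<^sub>R v"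
      define y0 where "y0 = x + s *\<^sub>R u + 0 *\<^sub>R v"
      have n: "norm (y1 - x) \<le> h * K" "norm (y0 - x) \<le> h * K"
        unfolding y1_def y0_def using nb[of s h] nb[of s 0] that h by auto
      have "D (y1 - x) - D (y0 - x) = D (h *\<^sub>R v)"
        by (simp add: linear_diff[OF linD, symmetric] y1_def y0_def)
      then have eq: "k' s = (dd f u y1 - dd f u x - D (y1 - x)) - (dd f u y0 - dd f u x - D (y0 - x))"
        unfolding k'_def y1_def[symmetric] y0_def[symmetric]
        by (simp add: linear_cmul[OF linD] algebra_simps)
      have "norm (k' s) \<le> e' * norm (y1 - x) + e' * norm (y0 - x)"
        unfolding eq
        by (rule order_trans[OF norm_triangle_ineq4 add_mono[OF D1 D1]]) (use n hK in auto)
      also have "\<dots> \<le> e' * (h * K) + e' * (h * K)"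
        using n e' by (intro add_mono mult_left_mono) auto
      finally show ?thesis by (simp add: mult_ac)
    qed
    have "norm (k h - k 0) \<le> (2 * e' * (h * K)) * norm (h - 0)"
    proof (rule differentiable_bound[of "{0..h}" k "\<lambda>s t. t *\<^sub>R k' s"])
      show "onorm (\<lambda>t. t *\<^sub>R k' s) \<le> 2 * e' * (h * K)" if "s \<in> {0..h}" for s
      proof (rule onorm_le)
        fix t show "norm (t *\<^sub>R k' s) \<le> 2 * e' * (h * K) * norm t"
          using mult_right_mono[OF k'b[OF that], of "norm t"] by (simp only: norm_scaleR mult.commute real_norm_def abs_ge_zero)
      qed
    qed (use kd h in auto)
    also have "\<dots> = h * h * (e / 2)" using h K by (simp add: e'_def field_simps)
    finally have kb: "norm (k h - k 0) \<le> h * h * (e / 2)" .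
    have "(f (x + h *\<^sub>R u + h *\<^sub>R v) - f (x + h *\<^sub>R u) - f (x + h *\<^sub>R v) + f x) /\<^sub>R (h * h) - D v
       = (k h - k 0) /\<^sub>R (h * h)"
      using h unfolding k_def by (simp add: algebra_simps)
    also have "norm \<dots> \<le> e / 2" unfolding norm_scaleR using kb h by (simp add: field_simps del: norm_scaleR)
    finally show ?thesis using e by simp
  qed
  show "\<forall>\<^sub>F h in at_right 0. dist ((f (x + h *\<^sub>R u + h *\<^sub>R v) - f (x + h *\<^sub>R u) - f (x + h *\<^sub>R v) + f x) /\<^sub>R (h * h))
      (dd (dd f u) v x) < e"
    unfolding eventually_at_right_field using d main by (auto simp: dist_norm D_def)
qed

lemma dd_commute:
  assumes "open S" "smooth_on S f" "x \<in> S"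
  shows "dd (dd f u) v x = dd (dd f v) u x"
proof -
  have df: "\<And>y. y \<in> S \<Longrightarrow> f differentiable (at y)" using assms smooth_on_differentiable by auto
  have d2: "\<And>u. dd f u differentiable (at x)"
    using assms(3) smooth_on_dd[OF assms(2)] smooth_on_differentiable by auto
  show ?thesis
    using tendsto_unique[OF _ second_difference_limit[OF assms(1,3) df d2, of u v]]
     second_difference_limit[OF assms(1,3) df d2, of v u]
    by (auto simp: algebra_simps)
qed

subsection \<open>Functions with bounded Cauchy-Riemann defect\<close>

abbreviation hasW :: "(complex \<Rightarrow> complex) \<Rightarrow> complex \<Rightarrow> complex \<Rightarrow> complex \<Rightarrow> bool" where
  "hasW f p q w \<equiv> (f has_derivative (\<lambda>h. p * h + q * cnj h)) (at w)"

text \<open>The mean value inequality with a majorant. The finite exceptional set is there for the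
  radii or parameters at which a circle or a segment meets a zero.\<close>

lemma norm_increment_le:
  fixes \<phi> :: "real \<Rightarrow> 'a::banach" and \<psi> :: "real \<Rightarrow> real"
  assumes "a \<le> b" "finite E" "continuous_on {a..b} \<phi>" "continuous_on {a..b} \<psi>"
    and \<phi>: "\<And>x. x \<in> {a<..<b} - E \<Longrightarrow> (\<phi> has_vector_derivative \<phi>' x) (at x)"
    and \<psi>: "\<And>x. x \<in> {a<..<b} - E \<Longrightarrow> (\<psi> has_vector_derivative \<psi>' x) (at x)"
    and le: "\<And>x. x \<in> {a<..<b} - E \<Longrightarrow> norm (\<phi>' x) \<le> \<psi>' x"
  shows "norm (\<phi> b - \<phi> a) \<le> \<psi> b - \<psi> a"
proof -
  define E' where "E' = E \<union> {a, b}"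
  define \<phi>2 where "\<phi>2 = (\<lambda>x. if x \<in> E' then 0 else \<phi>' x)"
  define \<psi>2 where "\<psi>2 = (\<lambda>x. if x \<in> E' then 0 else \<psi>' x)"
  have E': "finite E'" using assms(2) by (simp add: E'_def)
  have 1: "(\<phi>2 has_integral (\<phi> b - \<phi> a)) {a..b}"
    by (rule fundamental_theorem_of_calculus_interior_strong[OF E' assms(1) _ assms(3)])
      (auto simp: \<phi>2_def E'_def intro: \<phi>)
  have 2: "(\<psi>2 has_integral (\<psi> b - \<psi> a)) {a..b}"
    by (rule fundamental_theorem_of_calculus_interior_strong[OF E' assms(1) _ assms(4)])
      (auto simp: \<psi>2_def E'_def intro: \<psi>)
  have "norm (integral {a..b} \<phi>2) \<le> integral {a..b} \<psi>2"
    by (rule integral_norm_bound_integral)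
      (use 1 2 in \<open>auto simp: \<phi>2_def \<psi>2_def E'_def intro!: le has_integral_integrable\<close>)
  then show ?thesis using 1 2 by (simp add: integral_unique)
qed

text \<open>A segment between distinct points is traversed injectively, so it meets \<open>Z\<close>
  for finitely many parameters, and continuity bridges these. Bounds of derivatives off the zeros
  thereby become Lipschitz constants across them.\<close>

lemma exceptional_lipschitz:
  fixes f :: "complex \<Rightarrow> complex"
  assumes "convex U" "continuous_on U f" "finite Z"
    and W: "\<And>w. w \<in> U - Z \<Longrightarrow> hasW f (p w) (q w) w"
    and L: "\<And>w. w \<in> U - Z \<Longrightarrow> norm (p w) + norm (q w) \<le> L"
    and x: "x \<in> U" "y \<in> U"
  shows "norm (f y - f x) \<le> L * norm (y - x)"
proof (cases "x = y")
  case False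
  define \<gamma> where "\<gamma> = (\<lambda>t::real. x + t *\<^sub>R (y - x))"
  define E where "E = \<gamma> -` Z"
  have inj: "inj \<gamma>" using False by (auto simp: inj_def \<gamma>_def)
  have E: "finite E" unfolding E_def by (rule finite_vimageI[OF assms(3) inj])
  have seg: "\<gamma> t \<in> U" if "t \<in> {0..1}" for t
    using convexD_alt[OF assms(1) x, of t] that by (simp add: \<gamma>_def algebra_simps)
  have \<gamma>': "(\<gamma> has_vector_derivative (y - x)) (at t)" for t
    unfolding \<gamma>_def by (auto intro!: derivative_eq_intros)
  have "norm ((f \<circ> \<gamma>) 1 - (f \<circ> \<gamma>) 0) \<le> L * norm (y - x) * 1 - L * norm (y - x) * 0"
  proof (rule norm_increment_le[of 0 1 E "f \<circ> \<gamma>" "\<lambda>t. L * norm (y - x) * t"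
        "\<lambda>t. p (\<gamma> t) * (y - x) + q (\<gamma> t) * cnj (y - x)" "\<lambda>_. L * norm (y - x)"])
    have "continuous_on {0..1} \<gamma>" unfolding \<gamma>_def by (intro continuous_intros)
    then show "continuous_on {0..1} (f \<circ> \<gamma>)"
      by (rule continuous_on_compose) (auto intro!: continuous_on_subset[OF assms(2)] seg)
    fix t assume t: "t \<in> {0<..<1} - E"
    then have tU: "\<gamma> t \<in> U - Z" using seg[of t] by (auto simp: E_def)
    show "(f \<circ> \<gamma> has_vector_derivative (p (\<gamma> t) * (y - x) + q (\<gamma> t) * cnj (y - x))) (at t)"
      using has_derivative_compose[OF \<gamma>'[of t, unfolded has_vector_derivative_def] W[OF tU]]
      unfolding has_vector_derivative_def o_def
      by (rule has_derivative_eq_rhs) (auto simp: fun_eq_iff scaleR_conv_of_real algebra_simps)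
    show "norm (p (\<gamma> t) * (y - x) + q (\<gamma> t) * cnj (y - x)) \<le> L * norm (y - x)"
    proof -
      have "norm (p (\<gamma> t) * (y - x) + q (\<gamma> t) * cnj (y - x)) \<le> (norm (p (\<gamma> t)) + norm (q (\<gamma> t))) * norm (y - x)"
        using norm_triangle_ineq[of "p (\<gamma> t) * (y - x)" "q (\<gamma> t) * cnj (y - x)"]
        by (simp add: norm_mult distrib_right del: complex_cnj_diff)
      also have "\<dots> \<le> L * norm (y - x)" by (rule mult_right_mono[OF L[OF tU]]) simp
      finally show ?thesis .
    qed
    show "((\<lambda>t. L * norm (y - x) * t) has_vector_derivative L * norm (y - x)) (at t)"
      by (auto intro!: derivative_eq_intros simp: has_real_derivative_iff_has_vector_derivative[symmetric])
  qed (use E in \<open>auto intro!: continuous_intros\<close>)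
  then show ?thesis by (simp add: \<gamma>_def)
qed auto

text \<open>The Fourier coefficient of index \<open>k\<close> on the circle of radius
  \<open>\<rho>\<close> about \<open>c\<close>, without the factor \<open>1 / (2 * pi)\<close> of a
  mean value.\<close>

definition circ :: "(complex \<Rightarrow> complex) \<Rightarrow> complex \<Rightarrow> real \<Rightarrow> real \<Rightarrow> complex" where
  "circ f c k \<rho> = integral {0..2*pi} (\<lambda>\<theta>. f (c + \<rho> * cis \<theta>) * cis (- (k * \<theta>)))"

lemma circ_bound:
  assumes "continuous_on {0..2*pi} (\<lambda>\<theta>. f (c + \<rho> * cis \<theta>))" "\<And>\<theta>. norm (f (c + \<rho> * cis \<theta>)) \<le> B"
  shows "norm (circ f c k \<rho>) \<le> 2 * pi * B"
proof -
  have "norm (circ f c k \<rho>) \<le> B * (2 * pi - 0)"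
    unfolding circ_def
    by (rule integral_bound) (auto intro!: continuous_intros assms simp: norm_mult)
  then show ?thesis by (simp add: mult_ac)
qed

lemma integral_cis_zero:
  assumes "k \<noteq> 0"
  shows "integral {0..2*pi} (\<lambda>\<theta>. cis (- (of_int k * \<theta>))) = 0"
proof -
  define F where "F = (\<lambda>\<theta>. \<i> / of_int k * cis (- (of_int k * \<theta>)))"
  have "((\<lambda>\<theta>. cis (- (of_int k * \<theta>))) has_integral (F (2*pi) - F 0)) {0..2*pi}"
  proof (rule fundamental_theorem_of_calculus)
    show "(F has_vector_derivative cis (- (of_int k * x))) (at x within {0..2*pi})" for x
      unfolding F_def has_vector_derivative_def using assms
      by (auto intro!: derivative_eq_intros simp: scaleR_conv_of_real algebra_simps)
  qed simp
  moreover have "cis (- (of_int k * (2 * pi))) = 1"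
    using cis_multiple_2pi[of "- of_int k"] by (simp add: mult_ac)
  ultimately show ?thesis by (simp add: F_def integral_unique)
qed

lemma circle_dist:
  "dist (c + complex_of_real \<rho> * cis \<theta>) c = \<bar>\<rho>\<bar>" "dist c (c + complex_of_real \<rho> * cis \<theta>) = \<bar>\<rho>\<bar>"
  by (simp_all add: dist_norm norm_mult)

lemma continuous_on_circ:
  assumes "continuous_on (cball c R) f"
  shows "continuous_on {0..R} (circ f c k)"
  unfolding circ_def cbox_interval[symmetric]
  by (rule integral_continuous_on_param)
    (auto intro!: continuous_intros continuous_on_compose2[OF assms] simp: split_beta circle_dist dist_commute)

text \<open>In polar coordinates the Cauchy-Riemann operator is a combination of the radial and the
  angular derivative; the latter is removed by partial integration.\<close>

lemma circ_has_derivative: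
  assumes Z: "finite Z" and W: "\<And>w. w \<in> ball c R - Z \<Longrightarrow> hasW f (p w) (q w) w"
    and cont: "continuous_on (ball c R - Z) p" "continuous_on (ball c R - Z) q"
    and \<rho>: "0 < \<rho>" "\<rho> < R" "\<rho> \<notin> dist c ` Z"
  shows "(circ f c (of_int k) has_vector_derivative
           (of_int k / \<rho>) * circ f c (of_int k) \<rho> + 2 * circ q c (of_int k + 1) \<rho>) (at \<rho>)"
proof -
  have fcont: "continuous_on (ball c R - Z) f"
    by (rule continuous_at_imp_continuous_on) (use W has_derivative_continuous in blast)
  have "open ({0<..<R} - dist c ` Z)" using Z by (intro open_Diff) (auto intro!: finite_imp_closed)
  then obtain \<eta> where \<eta>: "\<eta> > 0" "ball \<rho> \<eta> \<subseteq> {0<..<R} - dist c ` Z"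
    using openE[of _ \<rho>] \<rho> by (metis DiffI greaterThanLessThan_iff)
  define g where "g = (\<lambda>\<theta>. cis (- (of_int k * \<theta>)))"
  have mem: "c + complex_of_real x * cis t \<in> ball c R - Z" if "x \<in> ball \<rho> \<eta>" for x t
  proof -
    have "x \<in> {0<..<R} - dist c ` Z" using \<eta> that by blast
    moreover have "dist c (c + complex_of_real x * cis t) = \<bar>x\<bar>"
      using circle_dist by (metis dist_commute)
    ultimately show ?thesis by (force simp: image_iff)
  qed
  have mem\<rho>: "c + complex_of_real \<rho> * cis t \<in> ball c R - Z" for t
    using mem \<eta>(1) by simp
  define fx where "fx = (\<lambda>x \<theta>. (p (c + of_real x * cis \<theta>) * cis \<theta> + q (c + of_real x * cis \<theta>) * cis (- \<theta>)) * g \<theta>)"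
  have "((\<lambda>x. integral (cbox 0 (2*pi)) (\<lambda>\<theta>. f (c + of_real x * cis \<theta>) * g \<theta>)) has_vector_derivative
      integral (cbox 0 (2*pi)) (fx \<rho>)) (at \<rho> within ball \<rho> \<eta>)"
  proof (rule leibniz_rule_vector_derivative)
    fix x t assume x: "x \<in> ball \<rho> \<eta>"
    have l: "((\<lambda>x. c + of_real x * cis t) has_derivative (\<lambda>h. of_real h * cis t)) (at x within ball \<rho> \<eta>)"
      by (auto intro!: derivative_eq_intros)
    have "((\<lambda>x. f (c + of_real x * cis t)) has_derivative
       (\<lambda>h. p (c + of_real x * cis t) * (of_real h * cis t) + q (c + of_real x * cis t) * cnj (of_real h * cis t))) (at x within ball \<rho> \<eta>)"
      by (rule has_derivative_compose[OF l W[OF mem[OF x]]])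
    then show "((\<lambda>x. f (c + of_real x * cis t) * g t) has_vector_derivative fx x t) (at x within ball \<rho> \<eta>)"
      unfolding has_vector_derivative_def fx_def
      by (rule has_derivative_eq_rhs[OF has_derivative_mult_left])
        (auto simp: fun_eq_iff scaleR_conv_of_real cis_cnj algebra_simps)
  next
    fix x assume x: "x \<in> ball \<rho> \<eta>"
    show "(\<lambda>\<theta>. f (c + of_real x * cis \<theta>) * g \<theta>) integrable_on cbox 0 (2*pi)"
      unfolding g_def by (intro integrable_continuous continuous_intros continuous_on_compose2[OF fcont])
        (use mem[OF x] in auto)
  next
    show "continuous_on (ball \<rho> \<eta> \<times> cbox 0 (2*pi)) (\<lambda>(x, t). fx x t)"
      unfolding fx_def g_def split_beta
      by (intro continuous_intros continuous_on_compose2[OF cont(1)] continuous_on_compose2[OF cont(2)])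
        (use mem in auto)
  qed (use \<eta> in auto)
  then have D: "(circ f c (of_int k) has_vector_derivative integral {0..2*pi} (fx \<rho>)) (at \<rho>)"
    using at_within_open[of \<rho> "ball \<rho> \<eta>"] \<eta> unfolding circ_def g_def by simp
  define F where "F = (\<lambda>\<theta>. f (c + of_real \<rho> * cis \<theta>) * g \<theta>)"
  define P where "P = (\<lambda>\<theta>. p (c + of_real \<rho> * cis \<theta>) * cis \<theta> * g \<theta>)"
  define Q where "Q = (\<lambda>\<theta>. q (c + of_real \<rho> * cis \<theta>) * cis (- \<theta>) * g \<theta>)"
  have ct: "continuous_on {0..2*pi} F" "continuous_on {0..2*pi} P" "continuous_on {0..2*pi} Q"
    unfolding F_def P_def Q_def g_def
    by (intro continuous_intros continuous_on_compose2[OF cont(1)] continuous_on_compose2[OF cont(2)]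
        continuous_on_compose2[OF fcont]; use mem\<rho> in auto)+
  note int = ct[THEN integrable_continuous_real]
  have FT: "((\<lambda>\<theta>. \<i> * \<rho> * P \<theta> - \<i> * \<rho> * Q \<theta> - \<i> * k * F \<theta>) has_integral (F (2*pi) - F 0)) {0..2*pi}"
  proof (rule fundamental_theorem_of_calculus)
    fix x
    have l: "((\<lambda>x. c + of_real \<rho> * cis x) has_derivative (\<lambda>h. h *\<^sub>R (\<rho> * \<i> * cis x))) (at x within {0..2*pi})"
      by (auto intro!: derivative_eq_intros simp: scaleR_conv_of_real)
    have "(F has_derivative (\<lambda>h. f (c + of_real \<rho> * cis x) * (h *\<^sub>R (- \<i> * k * g x)) +
        (p (c + of_real \<rho> * cis x) * (h *\<^sub>R (\<rho> * \<i> * cis x)) + q (c + of_real \<rho> * cis x) * cnj (h *\<^sub>R (\<rho> * \<i> * cis x))) * g x)) (at x within {0..2*pi})"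
      unfolding F_def
    proof (rule has_derivative_mult[OF has_derivative_compose[OF l W[OF mem\<rho>]]])
      show "(g has_derivative (\<lambda>h. h *\<^sub>R (- \<i> * k * g x))) (at x within {0..2*pi})"
        unfolding g_def by (auto intro!: derivative_eq_intros simp: scaleR_conv_of_real algebra_simps)
    qed
    then show "(F has_vector_derivative \<i> * \<rho> * P x - \<i> * \<rho> * Q x - \<i> * k * F x) (at x within {0..2*pi})"
      unfolding has_vector_derivative_def
      by (rule has_derivative_eq_rhs)
        (auto simp: fun_eq_iff scaleR_conv_of_real cis_cnj F_def P_def Q_def algebra_simps)
  qed simp
  \<comment> \<open>Integrality of \<open>k\<close> makes the integrand periodic; the angular
    derivative then integrates to 0 and ties the integral of \<open>P\<close> to those of
    \<open>Q\<close> and \<open>F\<close>.\<close>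
  have "g (2*pi) = g 0" using cis_multiple_2pi[of "- of_int k"] by (simp add: g_def mult_ac)
  then have "F (2*pi) = F 0" unfolding F_def by simp
  moreover have "((\<lambda>\<theta>. \<i> * \<rho> * P \<theta> - \<i> * \<rho> * Q \<theta> - \<i> * k * F \<theta>) has_integral
      (\<i> * \<rho> * integral {0..2*pi} P - \<i> * \<rho> * integral {0..2*pi} Q - \<i> * k * integral {0..2*pi} F)) {0..2*pi}"
    by (intro has_integral_diff has_integral_mult_right integrable_integral int)
  ultimately have "\<i> * \<rho> * integral {0..2*pi} P - \<i> * \<rho> * integral {0..2*pi} Q - \<i> * k * integral {0..2*pi} F = 0"
    using has_integral_unique[OF FT] by fastforce
  then have "\<i> * (\<rho> * integral {0..2*pi} P) = \<i> * (\<rho> * integral {0..2*pi} Q + k * integral {0..2*pi} F)"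
    by (simp add: algebra_simps)
  then have "\<rho> * integral {0..2*pi} P = \<rho> * integral {0..2*pi} Q + k * integral {0..2*pi} F"
    by simp
  then have P: "integral {0..2*pi} P = integral {0..2*pi} Q + (k / \<rho>) * integral {0..2*pi} F"
    using \<rho>(1) by (simp add: field_simps)
  have "integral {0..2*pi} (fx \<rho>) = integral {0..2*pi} P + integral {0..2*pi} Q"
    using int by (simp add: integral_add[symmetric] fx_def P_def Q_def algebra_simps)
  also have "\<dots> = (of_int k / \<rho>) * circ f c (of_int k) \<rho> + 2 * circ q c (of_int k + 1) \<rho>"
  proof -
    have "integral {0..2*pi} Q = circ q c (of_int k + 1) \<rho>"
      unfolding circ_def Q_def g_def
      by (rule integral_cong) (simp add: cis_mult mult.assoc distrib_right minus_diff_commute)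
    then show ?thesis unfolding P by (simp add: circ_def F_def g_def)
  qed
  finally show ?thesis using D by simp
qed

lemma circle_continuous:
  assumes "continuous_on (ball c R - Z) q" "0 < \<rho>" "\<rho> < R" "\<rho> \<notin> dist c ` Z"
  shows "continuous_on T (\<lambda>\<theta>. q (c + of_real \<rho> * cis \<theta>))"
proof (rule continuous_on_compose2[OF assms(1)])
  have "dist c (c + complex_of_real \<rho> * cis t) = \<rho>" for t
    using circle_dist assms(2) by (simp add: dist_commute)
  then show "(\<lambda>\<theta>. c + complex_of_real \<rho> * cis \<theta>) ` T \<subseteq> ball c R - Z"
    using assms by (force simp: image_iff)
qed (intro continuous_intros)

text \<open>A mean value property with defect: at radius 0 the coefficient of index 0 is
  \<open>2 * pi * f c\<close>, and its radial derivative \<open>2 * circ q c 1\<close> has norm at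
  most \<open>4 * pi * C\<close>, which is integrated up to \<open>R\<close>.\<close>

lemma center_bound:
  assumes Z: "finite Z" and R: "R > 0" and fc: "continuous_on (cball c R) f"
    and W: "\<And>w. w \<in> ball c R - Z \<Longrightarrow> hasW f (p w) (q w) w"
    and cont: "continuous_on (ball c R - Z) p" "continuous_on (ball c R - Z) q"
    and q: "\<And>w. w \<in> ball c R - Z \<Longrightarrow> norm (q w) \<le> C"
    and S: "\<And>w. w \<in> sphere c R \<Longrightarrow> norm (f w) \<le> S"
  shows "norm (f c) \<le> S + 2 * R * C"
proof -
  have "norm (circ f c 0 R - circ f c 0 0) \<le> 4 * pi * C * R - 4 * pi * C * 0"
  proof (rule norm_increment_le[of 0 R "dist c ` Z" "circ f c 0" "\<lambda>\<rho>. 4 * pi * C * \<rho>" "\<lambda>\<rho>. 2 * circ q c 1 \<rho>" "\<lambda>_. 4 * pi * C"])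
    fix \<rho> assume "\<rho> \<in> {0<..<R} - dist c ` Z"
    then have \<rho>: "0 < \<rho>" "\<rho> < R" "\<rho> \<notin> dist c ` Z" by auto
    show "(circ f c 0 has_vector_derivative 2 * circ q c 1 \<rho>) (at \<rho>)"
      using circ_has_derivative[OF Z W cont \<rho>, of 0] by simp
    have "norm (q (c + of_real \<rho> * cis \<theta>)) \<le> C" for \<theta>
      using \<rho> circle_dist[of c \<rho> \<theta>] by (intro q) (force simp: dist_commute image_iff)
    then have "norm (circ q c 1 \<rho>) \<le> 2 * pi * C"
      by (intro circ_bound circle_continuous[OF cont(2) \<rho>])
    then show "norm (2 * circ q c 1 \<rho>) \<le> 4 * pi * C" by (simp add: norm_mult mult_ac)
    show "((\<lambda>\<rho>. 4 * pi * C * \<rho>) has_vector_derivative 4 * pi * C) (at \<rho>)"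
      by (auto intro!: derivative_eq_intros simp: has_real_derivative_iff_has_vector_derivative[symmetric])
  qed (use Z R fc in \<open>auto intro!: continuous_intros continuous_on_circ\<close>)
  moreover have "circ f c 0 0 = 2 * pi * f c" by (simp add: circ_def scaleR_conv_of_real)
  moreover have "norm (circ f c 0 R) \<le> 2 * pi * S"
  proof (rule circ_bound)
    show "continuous_on {0..2*pi} (\<lambda>\<theta>. f (c + of_real R * cis \<theta>))"
      using R by (intro continuous_on_compose2[OF fc] continuous_intros) (auto simp: dist_norm norm_mult)
  qed (use R in \<open>auto intro!: S simp: dist_norm norm_mult\<close>)
  ultimately have "norm (2 * pi * f c) \<le> 4 * pi * C * R + 2 * pi * S"
    using norm_triangle_sub[of "circ f c 0 0" "circ f c 0 R"] by (simp add: norm_minus_commute)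
  then have "2 * pi * norm (f c) \<le> 2 * pi * (S + 2 * R * C)"
    by (simp add: norm_mult algebra_simps)
  then show ?thesis by (rule mult_left_le_imp_le) simp
qed

text \<open>If the maximum is attained at a point \<open>x\<close> within \<open>r / 4\<close> of
  \<open>c\<close>, the circle of radius \<open>r / 2\<close> about \<open>x\<close> lies in the
  annulus, and the defect in \<open>center_bound\<close> costs at most \<open>r * C <= 1/2\<close>
  times the maximum itself, which is absorbed.\<close>

lemma annulus_maximum:
  assumes Z: "finite Z" and r: "r > 0" and fc: "continuous_on (cball c r) f"
    and W: "\<And>w. w \<in> ball c r - Z \<Longrightarrow> hasW f (p w) (q w) w"
    and cont: "continuous_on (ball c r - Z) p" "continuous_on (ball c r - Z) q"
    and q: "\<And>w. w \<in> ball c r - Z \<Longrightarrow> norm (q w) \<le> C * norm (f w)"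
    and C: "0 \<le> C" "r * C \<le> 1/2"
    and S: "\<And>w. r / 4 \<le> dist c w \<Longrightarrow> dist c w \<le> r \<Longrightarrow> norm (f w) \<le> S"
    and w: "w \<in> cball c r"
  shows "norm (f w) \<le> 2 * S"
proof -
  have "\<exists>x\<in>cball c r. \<forall>y\<in>cball c r. norm (f y) \<le> norm (f x)"
    by (rule continuous_attains_sup) (use r fc in \<open>auto intro!: continuous_intros\<close>)
  then obtain x where x: "x \<in> cball c r" and max: "\<And>y. y \<in> cball c r \<Longrightarrow> norm (f y) \<le> norm (f x)"
    by blast
  have "norm (f x) \<le> 2 * S"
  proof (cases "r / 4 \<le> dist c x")
    case True
    then have "norm (f x) \<le> S" using S[of x] x by (simp add: mem_cball)
    then show ?thesis using norm_ge_zero[of "f x"] by linarith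
  next
    case False
    have sub: "cball x (r / 2) \<subseteq> cball c r" "ball x (r/2) \<subseteq> ball c r"
      using False by (auto simp: cball_subset_cball_iff ball_subset_ball_iff dist_commute)
    have "norm (f x) \<le> S + 2 * (r / 2) * (C * norm (f x))"
    proof (rule center_bound[OF Z, where f=f and c=x and p=p and q=q])
      fix w assume "w \<in> ball x (r / 2) - Z"
      then have w: "w \<in> ball c r - Z" using sub by auto
      then have "w \<in> cball c r" by auto
      then show "norm (q w) \<le> C * norm (f x)"
        using q[OF w] mult_left_mono[OF max C(1)] by fastforce
    next
      fix w assume "w \<in> sphere x (r / 2)"
      then have d: "dist x w = r / 2" by simp
      have "dist x w \<le> dist c x + dist c w" by (metis dist_commute dist_triangle)
      moreover have "dist c w \<le> dist c x + dist x w" by (rule dist_triangle)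
      ultimately show "norm (f w) \<le> S" using False d by (intro S) auto
    qed (use r sub W in \<open>auto intro: continuous_on_subset[OF fc] continuous_on_subset[OF cont(1)] continuous_on_subset[OF cont(2)]\<close>)
    also have "2 * (r / 2) * (C * norm (f x)) = (r * C) * norm (f x)" by simp
    also have "\<dots> \<le> 1/2 * norm (f x)" by (rule mult_right_mono) (use C in auto)
    finally show ?thesis by simp
  qed
  then show ?thesis using max[OF w] by simp
qed

text \<open>The coefficient of index 1 divided by the radius tends to \<open>2 * pi * p c\<close> at
  the centre, and the division cancels the term \<open>k / \<rho>\<close> of
  \<open>circ_has_derivative\<close>. There remains \<open>2 / \<rho>\<close> times the second
  coefficient of \<open>q\<close>. A mere bound of \<open>q\<close> would make this non-integrable
  at 0, so an integrable majorant with primitive \<open>\<psi>\<close> is left to the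
  caller.\<close>

lemma center_derivative_bound:
  assumes Z: "finite Z" "c \<notin> Z" and R: "R > 0" and fc: "continuous_on (cball c R) f"
    and W: "\<And>w. w \<in> ball c R - Z \<Longrightarrow> hasW f (p w) (q w) w"
    and cont: "continuous_on (ball c R - Z) p" "continuous_on (ball c R - Z) q"
    and \<psi>: "continuous_on {0..R} \<psi>" "\<psi> 0 = 0"
    and \<psi>': "\<And>\<rho>. \<rho> \<in> {0<..<R} - dist c ` Z \<Longrightarrow> (\<psi> has_vector_derivative \<psi>' \<rho>) (at \<rho>)"
    and q: "\<And>\<rho>. \<rho> \<in> {0<..<R} - dist c ` Z \<Longrightarrow> 2 / \<rho> * norm (circ q c 2 \<rho>) \<le> \<psi>' \<rho>"
    and S: "\<And>w. w \<in> sphere c R \<Longrightarrow> norm (f w) \<le> S"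
  shows "2 * pi * norm (p c) \<le> 2 * pi * S / R + \<psi> R"
proof -
  define \<phi> where "\<phi> = (\<lambda>\<rho>. circ f c 1 \<rho> / of_real \<rho>)"
  have inc: "norm (\<phi> R - \<phi> \<rho>0) \<le> \<psi> R - \<psi> \<rho>0" if \<rho>0: "0 < \<rho>0" "\<rho>0 < R" for \<rho>0
  proof (rule norm_increment_le[of \<rho>0 R "dist c ` Z" \<phi> \<psi> "\<lambda>\<rho>. 2 / \<rho> * circ q c 2 \<rho>" \<psi>'])
    fix \<rho> assume r: "\<rho> \<in> {\<rho>0<..<R} - dist c ` Z"
    then have \<rho>: "0 < \<rho>" "\<rho> < R" "\<rho> \<notin> dist c ` Z" using \<rho>0 by auto
    have D: "(circ f c 1 has_vector_derivative (1 / \<rho>) * circ f c 1 \<rho> + 2 * circ q c 2 \<rho>) (at \<rho>)"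
      using circ_has_derivative[OF Z(1) W cont \<rho>, of 1] by simp
    have D2: "((\<lambda>\<rho>. inverse (complex_of_real \<rho>)) has_vector_derivative (- 1 / (of_real \<rho>)\<^sup>2)) (at \<rho>)"
      unfolding has_vector_derivative_def using \<rho>
      by (auto intro!: derivative_eq_intros simp: scaleR_conv_of_real fun_eq_iff power2_eq_square field_simps)
    show "(\<phi> has_vector_derivative 2 / \<rho> * circ q c 2 \<rho>) (at \<rho>)"
      unfolding \<phi>_def divide_inverse
      using has_vector_derivative_mult[OF D D2] \<rho>
      by (simp add: power2_eq_square field_simps)
    show "norm (2 / \<rho> * circ q c 2 \<rho>) \<le> \<psi>' \<rho>"
      using q[of \<rho>] \<rho> by (simp add: norm_mult norm_divide)
    show "(\<psi> has_vector_derivative \<psi>' \<rho>) (at \<rho>)" using \<rho> by (intro \<psi>') auto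
  next
    have "continuous_on {\<rho>0..R} (circ f c 1)"
      by (rule continuous_on_subset[OF continuous_on_circ[OF fc]]) (use \<rho>0 in auto)
    then show "continuous_on {\<rho>0..R} \<phi>" unfolding \<phi>_def
      by (intro continuous_intros) (use \<rho>0 in auto)
  qed (use Z \<rho>0 in \<open>auto intro!: continuous_on_subset[OF \<psi>(1)]\<close>)
  \<comment> \<open>Near \<open>c\<close> the function is real affine up to the small remainder
    \<open>u\<close>; the constant and the conjugate linear part have no coefficient of index 1, so
    only \<open>p c\<close> survives.\<close>
  have lim: "(\<phi> \<longlongrightarrow> 2 * pi * p c) (at_right 0)"
  proof (rule tendstoI)
    fix e :: real assume e: "e > 0"
    define e' where "e' = e / (4 * pi)"
    have e': "e' > 0" using e by (simp add: e'_def)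
    have "hasW f (p c) (q c) c" using W Z R by auto
    then obtain d where d: "d > 0" and D: "\<And>y. norm (y - c) < d \<Longrightarrow> norm (f y - f c - (p c * (y - c) + q c * cnj (y - c))) \<le> e' * norm (y - c)"
      unfolding has_derivative_at_alt using e' by blast
    have "dist (\<phi> \<rho>) (2 * pi * p c) < e" if \<rho>: "0 < \<rho>" "\<rho> < min d R" for \<rho>
    proof -
      define u where "u = (\<lambda>y. f y - f c - (p c * (y - c) + q c * cnj (y - c)))"
      have fco: "continuous_on {0..2*pi} (\<lambda>\<theta>. f (c + of_real \<rho> * cis \<theta>))"
        using \<rho> by (intro continuous_on_compose2[OF fc] continuous_intros) (auto simp: dist_norm norm_mult)
      have uc: "continuous_on {0..2*pi} (\<lambda>\<theta>. u (c + of_real \<rho> * cis \<theta>))"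
        unfolding u_def by (intro continuous_intros fco)
      have ub: "norm (circ u c 1 \<rho>) \<le> 2 * pi * (e' * \<rho>)"
        by (rule circ_bound[OF uc]) (use D[of "c + of_real \<rho> * cis _"] \<rho> in \<open>auto simp: u_def norm_mult\<close>)
      have "circ u c 1 \<rho> = integral {0..2*pi} (\<lambda>\<theta>. f (c + of_real \<rho> * cis \<theta>) * cis (- (1 * \<theta>))
          - f c * cis (- (of_int 1 * \<theta>)) - p c * \<rho> - q c * \<rho> * cis (- (of_int 2 * \<theta>)))"
        unfolding circ_def
      proof (rule integral_cong)
        fix \<theta> :: real
        have "cis \<theta> * cis (- \<theta>) = 1" "cis (-\<theta>) * cis (- \<theta>) = cis (- (of_int 2 * \<theta>))"
          by (simp_all add: cis_mult)
        then show "u (c + of_real \<rho> * cis \<theta>) * cis (- (1 * \<theta>)) = f (c + of_real \<rho> * cis \<theta>) * cis (- (1 * \<theta>))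
          - f c * cis (- (of_int 1 * \<theta>)) - p c * \<rho> - q c * \<rho> * cis (- (of_int 2 * \<theta>))"
          unfolding u_def by (simp add: cis_cnj left_diff_distrib distrib_right mult.assoc)
      qed
      also have "\<dots> = circ f c 1 \<rho> - f c * integral {0..2*pi} (\<lambda>\<theta>. cis (- (of_int 1 * \<theta>)))
          - integral {0..2*pi} (\<lambda>\<theta>. p c * \<rho>) - q c * \<rho> * integral {0..2*pi} (\<lambda>\<theta>. cis (- (of_int 2 * \<theta>)))"
        unfolding circ_def integral_mult_right[symmetric]
        by (subst integral_diff integral_diff, intro integrable_continuous_real continuous_intros fco,
            intro integrable_continuous_real continuous_intros)+ (rule refl)
      also have "\<dots> = circ f c 1 \<rho> - 2 * pi * p c * \<rho>"
        unfolding integral_cis_zero[of 1, simplified] integral_cis_zero[of 2, simplified]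
        using integral_cis_zero[of 1] integral_cis_zero[of 2] by (simp add: scaleR_conv_of_real mult_ac)
      finally have "circ u c 1 \<rho> = circ f c 1 \<rho> - 2 * pi * p c * \<rho>" .
      then have "\<phi> \<rho> - 2 * pi * p c = circ u c 1 \<rho> / \<rho>" using \<rho> by (simp add: \<phi>_def field_simps)
      then have "norm (\<phi> \<rho> - 2 * pi * p c) \<le> 2 * pi * e'"
        using ub \<rho> by (simp only: norm_divide) (simp add: divide_le_eq mult_ac)
      also have "\<dots> < e" using e by (simp add: e'_def)
      finally show ?thesis by (simp add: dist_norm)
    qed
    then show "\<forall>\<^sub>F \<rho> in at_right 0. dist (\<phi> \<rho>) (2 * pi * p c) < e"
      unfolding eventually_at_right_field using d R by (intro exI[of _ "min d R"]) auto
  qed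
  have \<psi>0: "(\<psi> \<longlongrightarrow> 0) (at_right 0)"
  proof -
    have "(\<psi> \<longlongrightarrow> \<psi> 0) (at 0 within {0..R})" using \<psi>(1) R by (auto simp: continuous_on_def)
    then have "(\<psi> \<longlongrightarrow> \<psi> 0) (at 0 within {0..R})" .
    then show ?thesis using at_within_Icc_at_right[of 0 R] R \<psi>(2) by simp
  qed
  have "norm (\<phi> R - 2 * pi * p c) \<le> \<psi> R - 0"
  proof (rule tendsto_le[of "at_right 0"])
    show "((\<lambda>\<rho>. norm (\<phi> R - \<phi> \<rho>)) \<longlongrightarrow> norm (\<phi> R - 2 * pi * p c)) (at_right 0)" by (intro tendsto_intros lim)
    show "((\<lambda>\<rho>. \<psi> R - \<psi> \<rho>) \<longlongrightarrow> \<psi> R - 0) (at_right 0)" by (intro tendsto_intros \<psi>0)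
    show "\<forall>\<^sub>F x in at_right 0. norm (\<phi> R - \<phi> x) \<le> \<psi> R - \<psi> x"
      unfolding eventually_at_right_field using R inc by auto
  qed auto
  moreover have "norm (\<phi> R) \<le> 2 * pi * S / R"
  proof -
    have "norm (circ f c 1 R) \<le> 2 * pi * S"
    proof (rule circ_bound)
      show "continuous_on {0..2*pi} (\<lambda>\<theta>. f (c + of_real R * cis \<theta>))"
        using R by (intro continuous_on_compose2[OF fc] continuous_intros) (auto simp: dist_norm norm_mult)
    qed (use R in \<open>auto intro!: S simp: dist_norm norm_mult\<close>)
    then show ?thesis using R by (simp add: \<phi>_def norm_divide divide_right_mono)
  qed
  ultimately have "norm (2 * pi * p c) \<le> 2 * pi * S / R + \<psi> R"
    using norm_triangle_sub[of "2 * pi * p c" "\<phi> R"] by (simp add: norm_minus_commute)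
  then show ?thesis by (simp add: norm_mult)
qed

text \<open>This is \<open>cnj P / P\<close> for the polynomial \<open>P\<close> with zeros
  \<open>Z\<close> and multiplicities \<open>n\<close>. At the zeros themselves division by zero
  still gives a value of norm at most 1.\<close>

definition unimod :: "complex set \<Rightarrow> (complex \<Rightarrow> nat) \<Rightarrow> complex \<Rightarrow> complex" where
  "unimod Z n w = (\<Prod>\<zeta>\<in>Z. (cnj (w - \<zeta>) / (w - \<zeta>)) ^ n \<zeta>)"

lemma norm_unimod_le: "norm (unimod Z n w) \<le> 1"
proof -
  have "norm (cnj (w - \<zeta>) / (w - \<zeta>)) \<le> 1" for \<zeta>
    by (cases "w = \<zeta>") (auto simp: norm_divide simp del: complex_cnj_diff)
  then show ?thesis unfolding unimod_def prod_norm[symmetric] norm_power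
    by (intro prod_le_1) (auto intro: power_le_one)
qed

lemma continuous_on_unimod: "finite Z \<Longrightarrow> continuous_on (- Z) (unimod Z n)"
  unfolding unimod_def by (intro continuous_intros) auto

lemma prod_cis_powers:
  "finite Z \<Longrightarrow> (\<Prod>\<zeta>\<in>Z. (a \<zeta> * cis (- (real (e \<zeta>) * 2 * \<theta>))) ^ n \<zeta>) =
     (\<Prod>\<zeta>\<in>Z. a \<zeta> ^ n \<zeta>) * cis (- (2 * real (\<Sum>\<zeta>\<in>Z. n \<zeta> * e \<zeta>) * \<theta>))"
proof (induction Z rule: finite_induct)
  case (insert x F)
  have "(a x * cis (- (real (e x) * 2 * \<theta>))) ^ n x = a x ^ n x * cis (- (2 * real (n x * e x) * \<theta>))"
    unfolding power_mult_distrib Complex.DeMoivre by (simp add: mult.assoc mult.left_commute)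
  moreover have "cis (- (2 * real (n x * e x) * \<theta>)) * cis (- (2 * real (\<Sum>\<zeta>\<in>F. n \<zeta> * e \<zeta>) * \<theta>))
     = cis (- (2 * real (\<Sum>\<zeta>\<in>insert x F. n \<zeta> * e \<zeta>) * \<theta>))"
    using insert by (simp add: cis_mult algebra_simps)
  ultimately show ?case using insert by (simp add: mult_ac)
qed simp

text \<open>For \<open>s\<close> much smaller than the circle the factor is close to its value for
  \<open>s = 0\<close>, for \<open>s\<close> much larger it is close to a constant, and for
  comparable radii the trivial bound 2 is enough. The error is symmetric in \<open>\<rho>\<close>
  and \<open>cmod s\<close> because, divided by \<open>\<rho>\<close>, it is then a multiple of the
  derivative of \<open>arctan (\<rho> / cmod s)\<close>.\<close>

lemma unimod_factor_approx:
  fixes s w :: complex and \<rho> :: real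
  assumes \<rho>: "0 < \<rho>" and s: "s \<noteq> 0" "cmod s \<noteq> \<rho>" and w: "w = \<rho> * cis \<theta>"
  shows "norm (cnj (w - s) / (w - s) - (if cmod s < \<rho> then cis (- (2 * \<theta>)) else cnj s / s))
      \<le> 8 * (\<rho> * cmod s / (\<rho>\<^sup>2 + (cmod s)\<^sup>2))" (is "?L \<le> 8 * (\<rho> * ?t / _)")
proof -
  have nw: "cmod w = \<rho>" using w \<rho> by (simp add: norm_mult)
  then have ws: "w \<noteq> s" "w \<noteq> 0" using s \<rho> by auto
  have t: "?t > 0" using s by simp
  have den: "\<rho>\<^sup>2 + ?t\<^sup>2 > 0" using \<rho> by (auto intro: add_pos_nonneg)
  have cw: "cnj w / w = cis (- (2 * \<theta>))"
  proof -
    have "cnj w = \<rho> * cis (- \<theta>)" by (simp add: w cis_cnj)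
    also have "\<dots> = cis (- (2 * \<theta>)) * w" by (simp add: w cis_mult)
    finally show ?thesis using ws by simp
  qed
  have triv: "?L \<le> 2"
  proof -
    have "norm (cnj (w - s) / (w - s)) = 1" using ws by (simp add: norm_divide del: complex_cnj_diff)
    moreover have "norm (if cmod s < \<rho> then cis (- (2 * \<theta>)) else cnj s / s) = 1"
      using s by (simp add: norm_divide)
    ultimately show ?thesis using norm_triangle_ineq4[of "cnj (w - s) / (w - s)"] by (metis one_add_one)
  qed
  \<comment> \<open>The phase \<open>cnj x / x\<close> is the same for \<open>x\<close> and
    \<open>- x\<close>, so one estimate compares \<open>w - s\<close> both with \<open>w\<close> and
    with \<open>s\<close>, the other number being the perturbation \<open>y\<close>.\<close>
  have gen: "norm (cnj (w - s) / (w - s) - cnj x / x) \<le> 2 * cmod y / cmod (w - s)"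
    if "x \<noteq> 0" "w - s = x - y \<or> w - s = y - x" for x y
  proof -
    have "cnj (w - s) / (w - s) - cnj x / x = (cnj (w - s) * x - cnj x * (w - s)) / ((w - s) * x)"
      using ws that(1) by (simp add: divide_simps)
    also have "norm \<dots> = norm (cnj (w - s) * x - cnj x * (w - s)) / (cmod (w - s) * cmod x)"
      by (simp add: norm_divide norm_mult)
    also have "norm (cnj (w - s) * x - cnj x * (w - s)) = norm (cnj x * y - cnj y * x)"
    proof -
      from that(2) show ?thesis
      proof
        assume e: "w - s = x - y"
        show ?thesis unfolding e by (simp add: algebra_simps norm_minus_commute)
      next
        assume e: "w - s = y - x"
        show ?thesis unfolding e by (simp add: algebra_simps norm_minus_commute)
      qed
    qed
    also have "norm (cnj x * y - cnj y * x) \<le> 2 * cmod y * cmod x"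
      using norm_triangle_ineq4[of "cnj x * y" "cnj y * x"] by (simp add: norm_mult mult_ac)
    finally show ?thesis using that(1) ws by (simp add: divide_right_mono)
  qed
  consider "?t \<le> \<rho> / 2" | "\<rho> / 2 < ?t" "?t < 2 * \<rho>" | "2 * \<rho> \<le> ?t" by linarith
  then show ?thesis
  proof cases
    case 1
    have "\<rho> / 2 \<le> cmod (w - s)" using norm_triangle_ineq2[of w s] nw 1 by simp
    then have "2 * ?t / cmod (w - s) \<le> 2 * ?t / (\<rho> / 2)"
      by (intro divide_left_mono) (use \<rho> ws in auto)
    also have "\<dots> = 4 * ?t / \<rho>" by simp
    also have "\<dots> \<le> 8 * (\<rho> * ?t / (\<rho>\<^sup>2 + ?t\<^sup>2))"
    proof -
      have "?t * ?t \<le> \<rho> * \<rho>" using 1 t \<rho> by (intro mult_mono) auto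
      then have "4 * ?t * (\<rho>\<^sup>2 + ?t\<^sup>2) \<le> 4 * ?t * (2 * (\<rho> * \<rho>))"
        by (intro mult_left_mono) (simp_all add: power2_eq_square)
      then show ?thesis using \<rho> den by (simp add: divide_simps power2_eq_square algebra_simps)
    qed
    finally show ?thesis using gen[of w s] ws 1 \<rho> cw by auto
  next
    case 2
    \<comment> \<open>The radii are within a factor 2 of each other, so
      \<open>\<rho> * ?t / (\<rho>^2 + ?t^2)\<close> is at least 2/5 and the right-hand side exceeds
      2.\<close>
    have "(?t - \<rho> / 2) * (2 * \<rho> - ?t) \<ge> 0" using 2 by (intro mult_nonneg_nonneg) auto
    then have "2 * (\<rho>\<^sup>2 + ?t\<^sup>2) \<le> 5 * (\<rho> * ?t)" by (simp add: power2_eq_square algebra_simps)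
    moreover have "\<rho> * ?t > 0" using \<rho> t by simp
    ultimately have "2 * (\<rho>\<^sup>2 + ?t\<^sup>2) \<le> 8 * (\<rho> * ?t)" by linarith
    then have "2 \<le> 8 * (\<rho> * ?t / (\<rho>\<^sup>2 + ?t\<^sup>2))" using den by (simp add: divide_simps)
    then show ?thesis using triv by linarith
  next
    case 3
    have "?t / 2 \<le> cmod (w - s)" using norm_triangle_ineq2[of s w] nw 3 by (simp add: norm_minus_commute)
    then have "2 * cmod w / cmod (w - s) \<le> 2 * cmod w / (?t / 2)"
      by (intro divide_left_mono) (use \<rho> ws t in auto)
    also have "\<dots> = 4 * \<rho> / ?t" using nw by simp
    also have "\<dots> \<le> 8 * (\<rho> * ?t / (\<rho>\<^sup>2 + ?t\<^sup>2))"
    proof -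
      have "\<rho> * \<rho> \<le> ?t * ?t" using 3 \<rho> by (intro mult_mono) auto
      then have "4 * \<rho> * (\<rho>\<^sup>2 + ?t\<^sup>2) \<le> 4 * \<rho> * (2 * (?t * ?t))"
        by (intro mult_left_mono) (use \<rho> in \<open>simp_all add: power2_eq_square\<close>)
      then show ?thesis using t den by (simp add: divide_simps power2_eq_square algebra_simps)
    qed
    finally show ?thesis using gen[of s w] s 3 \<rho> by auto
  qed
qed

text \<open>On a circle each factor is close either to its value at the centre or to its value for a
  zero at the centre; the product of these approximations has no Fourier coefficient of order 2.\<close>

lemma circ_unimod_bound:
  assumes Z: "finite Z" "c \<notin> Z" and \<rho>: "0 < \<rho>" "\<rho> \<notin> dist c ` Z"
  shows "norm (circ (unimod Z n) c 2 \<rho>) \<le> 16 * pi * (\<Sum>\<zeta>\<in>Z. n \<zeta> * (\<rho> * dist c \<zeta> / (\<rho>\<^sup>2 + (dist c \<zeta>)\<^sup>2)))"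
proof -
  \<comment> \<open>\<open>a\<close> and \<open>e\<close> encode both approximations of a factor at
    once: the pure frequency -2 (\<open>e = 1\<close>) for a zero inside the circle, a constant of
    norm 1 (\<open>e = 0\<close>) for one outside. \<open>m\<close> counts the zeros inside with
    multiplicity.\<close>
  define a where "a = (\<lambda>\<zeta>. if cmod (\<zeta> - c) < \<rho> then 1 else cnj (\<zeta> - c) / (\<zeta> - c))"
  define e where "e = (\<lambda>\<zeta>. if cmod (\<zeta> - c) < \<rho> then 1 else 0 :: nat)"
  define v where "v = (\<lambda>\<theta> \<zeta>. a \<zeta> * cis (- (real (e \<zeta>) * 2 * \<theta>)))"
  define m where "m = (\<Sum>\<zeta>\<in>Z. n \<zeta> * e \<zeta>)"
  define A where "A = (\<Prod>\<zeta>\<in>Z. a \<zeta> ^ n \<zeta>)"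
  have v: "(\<Prod>\<zeta>\<in>Z. v \<theta> \<zeta> ^ n \<zeta>) = A * cis (- (2 * real m * \<theta>))" for \<theta>
    unfolding v_def A_def m_def by (rule prod_cis_powers[OF Z(1)])
  have d: "cmod (\<zeta> - c) = dist c \<zeta>" for \<zeta> by (simp add: dist_norm norm_minus_commute)
  have off: "c + of_real \<rho> * cis \<theta> \<notin> Z" for \<theta>
    using \<rho> circle_dist(2)[of c \<rho> \<theta>] by (auto simp: image_iff)
  have diff: "norm (unimod Z n (c + of_real \<rho> * cis \<theta>) - A * cis (- (2 * real m * \<theta>)))
      \<le> (\<Sum>\<zeta>\<in>Z. n \<zeta> * (8 * (\<rho> * dist c \<zeta> / (\<rho>\<^sup>2 + (dist c \<zeta>)\<^sup>2))))" for \<theta>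
  proof -
    define w where "w = of_real \<rho> * cis \<theta>"
    have u1: "norm (cnj (c + w - \<zeta>) / (c + w - \<zeta>)) \<le> 1" for \<zeta>
      by (cases "c + w = \<zeta>") (auto simp: norm_divide simp del: complex_cnj_diff)
    have v1: "norm (v \<theta> \<zeta>) \<le> 1" if "\<zeta> \<in> Z" for \<zeta>
      using that Z by (auto simp: v_def a_def norm_mult norm_divide simp del: complex_cnj_diff)
    have "norm (unimod Z n (c + w) - (\<Prod>\<zeta>\<in>Z. v \<theta> \<zeta> ^ n \<zeta>))
      \<le> (\<Sum>\<zeta>\<in>Z. norm ((cnj (c + w - \<zeta>) / (c + w - \<zeta>)) ^ n \<zeta> - v \<theta> \<zeta> ^ n \<zeta>))"
      unfolding unimod_def
      by (rule norm_prod_diff) (use u1 v1 in \<open>auto simp: norm_power intro!: power_le_one\<close>)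
    also have "\<dots> \<le> (\<Sum>\<zeta>\<in>Z. n \<zeta> * norm (cnj (c + w - \<zeta>) / (c + w - \<zeta>) - v \<theta> \<zeta>))"
      by (intro sum_mono norm_power_diff u1 v1)
    also have "\<dots> \<le> (\<Sum>\<zeta>\<in>Z. n \<zeta> * (8 * (\<rho> * dist c \<zeta> / (\<rho>\<^sup>2 + (dist c \<zeta>)\<^sup>2))))"
    proof (intro sum_mono mult_left_mono)
      fix \<zeta> assume \<zeta>: "\<zeta> \<in> Z"
      have "v \<theta> \<zeta> = (if cmod (\<zeta> - c) < \<rho> then cis (- (2 * \<theta>)) else cnj (\<zeta> - c) / (\<zeta> - c))"
        by (simp add: v_def a_def e_def)
      moreover have "c + w - \<zeta> = w - (\<zeta> - c)" by simp
      moreover have "\<zeta> - c \<noteq> 0" "cmod (\<zeta> - c) \<noteq> \<rho>" using \<rho> \<zeta> Z d by auto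
      ultimately show "norm (cnj (c + w - \<zeta>) / (c + w - \<zeta>) - v \<theta> \<zeta>) \<le> 8 * (\<rho> * dist c \<zeta> / (\<rho>\<^sup>2 + (dist c \<zeta>)\<^sup>2))"
        using unimod_factor_approx[OF \<rho>(1) _ _ w_def, of "\<zeta> - c"] unfolding d by (simp only: not_False_eq_True simp_thms)
    qed auto
    finally show ?thesis unfolding v w_def .
  qed
  define g where "g = (\<lambda>\<theta>. unimod Z n (c + of_real \<rho> * cis \<theta>) - A * cis (- (2 * real m * \<theta>)))"
  have uc: "continuous_on {0..2*pi} (\<lambda>\<theta>. unimod Z n (c + of_real \<rho> * cis \<theta>))"
    by (rule continuous_on_compose2[OF continuous_on_unimod[OF Z(1)]]) (use off in \<open>auto intro!: continuous_intros\<close>)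
  have gb: "norm (g \<theta>) \<le> (\<Sum>\<zeta>\<in>Z. n \<zeta> * (8 * (\<rho> * dist c \<zeta> / (\<rho>\<^sup>2 + (dist c \<zeta>)\<^sup>2))))" for \<theta>
    unfolding g_def by (rule diff)
  have gc: "continuous_on {0..2*pi} g" unfolding g_def by (intro continuous_intros uc)
  \<comment> \<open>The approximating product has frequency \<open>- 2 m\<close>; the factor of the
    second coefficient makes it \<open>- (2 m + 2)\<close>, which is never 0 because
    \<open>m\<close> is a number of zeros.\<close>
  have "circ (unimod Z n) c 2 \<rho> = integral {0..2*pi} (\<lambda>\<theta>. g \<theta> * cis (- (2 * \<theta>)) + A * cis (- (of_int (2 * int m + 2) * \<theta>)))"
    unfolding circ_def
  proof (rule integral_cong)
    fix \<theta> :: real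
    have "cis (- (2 * real m * \<theta>)) * cis (- (2 * \<theta>)) = cis (- (of_int (2 * int m + 2) * \<theta>))"
      by (simp add: cis_mult algebra_simps)
    then show "unimod Z n (c + of_real \<rho> * cis \<theta>) * cis (- (2 * \<theta>)) = g \<theta> * cis (- (2 * \<theta>)) + A * cis (- (of_int (2 * int m + 2) * \<theta>))"
      unfolding g_def by (simp only: left_diff_distrib mult.assoc) simp
  qed
  also have "\<dots> = integral {0..2*pi} (\<lambda>\<theta>. g \<theta> * cis (- (2 * \<theta>))) + A * integral {0..2*pi} (\<lambda>\<theta>. cis (- (of_int (2 * int m + 2) * \<theta>)))"
    unfolding integral_mult_right[symmetric]
    by (rule integral_add) (intro integrable_continuous_real continuous_intros gc)+
  also have "\<dots> = integral {0..2*pi} (\<lambda>\<theta>. g \<theta> * cis (- (2 * \<theta>)))"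
    by (subst integral_cis_zero) auto
  also have "norm \<dots> \<le> (\<Sum>\<zeta>\<in>Z. n \<zeta> * (8 * (\<rho> * dist c \<zeta> / (\<rho>\<^sup>2 + (dist c \<zeta>)\<^sup>2)))) * (2 * pi - 0)"
    by (rule integral_bound) (use gb in \<open>auto intro!: continuous_intros gc simp: norm_mult\<close>)
  also have "\<dots> = 16 * pi * (\<Sum>\<zeta>\<in>Z. n \<zeta> * (\<rho> * dist c \<zeta> / (\<rho>\<^sup>2 + (dist c \<zeta>)\<^sup>2)))"
    by (simp add: sum_distrib_left sum_distrib_right mult_ac)
  finally show ?thesis .
qed

text \<open>The right-hand side is frozen at \<open>c\<close>: the constant \<open>F1 c\<close> has
  no second coefficient, \<open>F2 c * unimod Z n\<close> is handled by
  \<open>circ_unimod_bound\<close>, and the variation is of order \<open>sqrt \<rho>\<close>,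
  integrable against \<open>1 / \<rho>\<close>. The zeros enter the result through their total
  multiplicity only.\<close>

lemma unimod_derivative_bound:
  assumes Z: "finite Z" "c \<notin> Z" and R: "R > 0" and fc: "continuous_on (cball c R) f"
    and W: "\<And>w. w \<in> ball c R - Z \<Longrightarrow> hasW f (p w) (q w) w"
    and cont: "continuous_on (ball c R - Z) p" "continuous_on (ball c R - Z) q"
    and q: "\<And>w. w \<in> ball c R - Z \<Longrightarrow> q w = F1 w + F2 w * unimod Z n w"
    and F1: "\<And>w. w \<in> ball c R - Z \<Longrightarrow> norm (F1 w - F1 c) \<le> T * sqrt (dist c w)"
    and F2: "\<And>w. w \<in> ball c R - Z \<Longrightarrow> norm (F2 w - F2 c) \<le> T * sqrt (dist c w)"
    and M: "norm (F2 c) \<le> M"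
    and S: "\<And>w. w \<in> sphere c R \<Longrightarrow> norm (f w) \<le> S"
  shows "norm (p c) \<le> S / R + 8 * T * sqrt R + 8 * pi * M * (\<Sum>\<zeta>\<in>Z. n \<zeta>)"
proof -
  have M0: "M \<ge> 0" using M norm_ge_zero order_trans by blast
  have dpos: "dist c \<zeta> > 0" if "\<zeta> \<in> Z" for \<zeta> using that Z by auto
  \<comment> \<open>The first term integrates the square-root variation, the second one the errors
    at the zeros; every arctangent stays below \<open>pi / 2\<close>, wherever the zero is.\<close>
  define \<psi> where "\<psi> = (\<lambda>\<rho>. 16 * pi * T * sqrt \<rho> + 32 * pi * M * (\<Sum>\<zeta>\<in>Z. n \<zeta> * arctan (\<rho> / dist c \<zeta>)))"
  define \<psi>' where "\<psi>' = (\<lambda>\<rho>. 8 * pi * T / sqrt \<rho> + 32 * pi * M * (\<Sum>\<zeta>\<in>Z. n \<zeta> * (dist c \<zeta> / (\<rho>\<^sup>2 + (dist c \<zeta>)\<^sup>2))))"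
  have "2 * pi * norm (p c) \<le> 2 * pi * S / R + \<psi> R"
  proof (rule center_derivative_bound[OF Z R fc W cont, where \<psi>'=\<psi>'])
    show "continuous_on {0..R} \<psi>" unfolding \<psi>_def by (intro continuous_intros) (use dpos in force)
    show "\<psi> 0 = 0" by (simp add: \<psi>_def)
    fix \<rho> assume "\<rho> \<in> {0<..<R} - dist c ` Z"
    then have \<rho>: "0 < \<rho>" "\<rho> < R" "\<rho> \<notin> dist c ` Z" by auto
    have at: "((\<lambda>\<rho>. arctan (\<rho> / dist c \<zeta>)) has_real_derivative (dist c \<zeta> / (\<rho>\<^sup>2 + (dist c \<zeta>)\<^sup>2))) (at \<rho>)"
      if "\<zeta> \<in> Z" for \<zeta>
    proof -
      have "1 + (\<rho> / dist c \<zeta>)\<^sup>2 \<noteq> 0" by (metis add_pos_nonneg less_irrefl zero_le_power2 zero_less_one)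
      then have "inverse (1 + (\<rho> / dist c \<zeta>)\<^sup>2) * (1 / dist c \<zeta>) = dist c \<zeta> / (\<rho>\<^sup>2 + (dist c \<zeta>)\<^sup>2)"
        using dpos[OF that] \<rho>(1) by (simp add: field_simps power2_eq_square add_pos_pos less_imp_neq)
      moreover have "((\<lambda>\<rho>. arctan (\<rho> / dist c \<zeta>)) has_real_derivative inverse (1 + (\<rho> / dist c \<zeta>)\<^sup>2) * (1 / dist c \<zeta>)) (at \<rho>)"
        using dpos[OF that] by (auto intro!: derivative_eq_intros)
      ultimately show ?thesis by simp
    qed
    have sq: "(sqrt has_real_derivative (1 / (2 * sqrt \<rho>))) (at \<rho>)"
      using \<rho> by (auto intro!: derivative_eq_intros simp: field_simps)
    have "(\<psi> has_real_derivative 16 * pi * T * (1 / (2 * sqrt \<rho>)) + 32 * pi * M * (\<Sum>\<zeta>\<in>Z. n \<zeta> * (dist c \<zeta> / (\<rho>\<^sup>2 + (dist c \<zeta>)\<^sup>2)))) (at \<rho>)"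
      unfolding \<psi>_def
      by (intro DERIV_add DERIV_cmult DERIV_sum at sq)
    then show "(\<psi> has_vector_derivative \<psi>' \<rho>) (at \<rho>)"
      unfolding \<psi>'_def has_real_derivative_iff_has_vector_derivative by (simp add: mult_ac)
    define g where "g = (\<lambda>w. q w - F1 c - F2 c * unimod Z n w)"
    have off: "c + of_real \<rho> * cis \<theta> \<in> ball c R - Z" for \<theta>
      using \<rho> circle_dist(2)[of c \<rho> \<theta>] by (auto simp: image_iff)
    have uc: "continuous_on {0..2*pi} (\<lambda>\<theta>. unimod Z n (c + of_real \<rho> * cis \<theta>))"
      by (rule continuous_on_compose2[OF continuous_on_unimod[OF Z(1)]]) (use off in \<open>auto intro!: continuous_intros\<close>)
    have qc: "continuous_on {0..2*pi} (\<lambda>\<theta>. q (c + of_real \<rho> * cis \<theta>))"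
      by (rule circle_continuous[OF cont(2) \<rho>])
    have gc: "continuous_on {0..2*pi} (\<lambda>\<theta>. g (c + of_real \<rho> * cis \<theta>))"
      unfolding g_def by (intro continuous_intros uc qc)
    have gb: "norm (circ g c 2 \<rho>) \<le> 2 * pi * (2 * T * sqrt \<rho>)"
    proof (rule circ_bound[OF gc])
      fix \<theta>
      define w where "w = c + of_real \<rho> * cis \<theta>"
      have w: "w \<in> ball c R - Z" "dist c w = \<rho>" unfolding w_def using off circle_dist \<rho> by auto
      have "g w = (F1 w - F1 c) + (F2 w - F2 c) * unimod Z n w"
        unfolding g_def q[OF w(1)] by (simp add: algebra_simps)
      also have "norm \<dots> \<le> norm (F1 w - F1 c) + norm (F2 w - F2 c) * 1"
        by (rule order_trans[OF norm_triangle_ineq]) (auto simp: norm_mult norm_unimod_le intro!: mult_left_le)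
      also have "\<dots> \<le> 2 * T * sqrt \<rho>" using F1[OF w(1)] F2[OF w(1)] w(2) by simp
      finally show "norm (g (c + of_real \<rho> * cis \<theta>)) \<le> 2 * T * sqrt \<rho>" unfolding w_def .
    qed
    have "circ q c 2 \<rho> = integral {0..2*pi} (\<lambda>\<theta>. g (c + of_real \<rho> * cis \<theta>) * cis (- (2 * \<theta>))
        + (F1 c * cis (- (of_int 2 * \<theta>)) + F2 c * (unimod Z n (c + of_real \<rho> * cis \<theta>) * cis (- (2 * \<theta>)))))"
      unfolding circ_def by (rule integral_cong) (simp add: g_def algebra_simps)
    also have "\<dots> = circ g c 2 \<rho> + (F1 c * integral {0..2*pi} (\<lambda>\<theta>. cis (- (of_int 2 * \<theta>))) + F2 c * circ (unimod Z n) c 2 \<rho>)"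
    proof -
      have i1: "(\<lambda>\<theta>. g (c + of_real \<rho> * cis \<theta>) * cis (- (2 * \<theta>))) integrable_on {0..2*pi}"
        and i2: "(\<lambda>\<theta>. F1 c * cis (- (of_int 2 * \<theta>))) integrable_on {0..2*pi}"
        and i3: "(\<lambda>\<theta>. F2 c * (unimod Z n (c + of_real \<rho> * cis \<theta>) * cis (- (2 * \<theta>)))) integrable_on {0..2*pi}"
        by (intro integrable_continuous_real continuous_intros gc uc)+
      show ?thesis by (simp only: circ_def integral_mult_right integral_add[OF i1 integrable_add[OF i2 i3]] integral_add[OF i2 i3])
    qed
    also have "\<dots> = circ g c 2 \<rho> + F2 c * circ (unimod Z n) c 2 \<rho>"
      by (subst integral_cis_zero) auto
    finally have "norm (circ q c 2 \<rho>) \<le> 2 * pi * (2 * T * sqrt \<rho>)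
        + M * (16 * pi * (\<Sum>\<zeta>\<in>Z. n \<zeta> * (\<rho> * dist c \<zeta> / (\<rho>\<^sup>2 + (dist c \<zeta>)\<^sup>2))))"
      using gb M circ_unimod_bound[OF Z \<rho>(1) \<rho>(3), of n] M0
      by (auto simp only: norm_mult intro!: order_trans[OF norm_triangle_ineq] add_mono mult_mono norm_ge_zero)
    then have "2 / \<rho> * norm (circ q c 2 \<rho>) \<le> 2 / \<rho> * (2 * pi * (2 * T * sqrt \<rho>)
        + M * (16 * pi * (\<Sum>\<zeta>\<in>Z. n \<zeta> * (\<rho> * dist c \<zeta> / (\<rho>\<^sup>2 + (dist c \<zeta>)\<^sup>2)))))"
      using \<rho> by (intro mult_left_mono) auto
    also have "\<dots> = 8 * pi * T * (sqrt \<rho> / \<rho>) + 32 * pi * M * ((1 / \<rho>) * (\<Sum>\<zeta>\<in>Z. n \<zeta> * (\<rho> * dist c \<zeta> / (\<rho>\<^sup>2 + (dist c \<zeta>)\<^sup>2))))"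
      by (simp add: algebra_simps)
    also have "sqrt \<rho> / \<rho> = 1 / sqrt \<rho>" using \<rho> by (simp add: field_simps)
    also have "(1 / \<rho>) * (\<Sum>\<zeta>\<in>Z. n \<zeta> * (\<rho> * dist c \<zeta> / (\<rho>\<^sup>2 + (dist c \<zeta>)\<^sup>2))) = (\<Sum>\<zeta>\<in>Z. n \<zeta> * (dist c \<zeta> / (\<rho>\<^sup>2 + (dist c \<zeta>)\<^sup>2)))"
      using \<rho> by (simp add: sum_distrib_left)
    finally show "2 / \<rho> * norm (circ q c 2 \<rho>) \<le> \<psi>' \<rho>" by (simp add: \<psi>'_def)
  qed (use S in auto)
  also have "\<psi> R \<le> 16 * pi * T * sqrt R + 32 * pi * M * (\<Sum>\<zeta>\<in>Z. n \<zeta> * (pi / 2))"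
    unfolding \<psi>_def
    by (intro add_left_mono mult_left_mono sum_mono less_imp_le[OF arctan_ubound]) (use M0 in auto)
  also have "32 * pi * M * (\<Sum>\<zeta>\<in>Z. n \<zeta> * (pi / 2)) = 16 * pi * M * pi * (\<Sum>\<zeta>\<in>Z. n \<zeta>)"
    by (simp add: sum_distrib_right[symmetric] flip: sum_divide_distrib)
  finally have "2 * pi * norm (p c) \<le> 2 * pi * (S / R + 8 * T * sqrt R + 8 * pi * M * (\<Sum>\<zeta>\<in>Z. n \<zeta>))"
    by (simp add: algebra_simps)
  then show ?thesis by (rule mult_left_le_imp_le) simp
qed

subsection \<open>Vanishing order\<close>

text \<open>The Wirtinger derivatives with respect to the variable and to its conjugate.\<close>

definition wd :: "(complex \<Rightarrow> complex) \<Rightarrow> complex \<Rightarrow> complex" where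
  "wd f w = (dd f 1 w - \<i> * dd f \<i> w) / 2"

definition wb :: "(complex \<Rightarrow> complex) \<Rightarrow> complex \<Rightarrow> complex" where
  "wb f w = (dd f 1 w + \<i> * dd f \<i> w) / 2"

lemma frechet_derivative_wirtinger:
  assumes "f differentiable (at w)"
  shows "frechet_derivative f (at w) v = wd f w * v + wb f w * cnj v"
proof -
  have l: "linear (frechet_derivative f (at w))" by (rule linear_frechet_derivative[OF assms])
  have "v = Re v *\<^sub>R 1 + Im v *\<^sub>R \<i>" by (simp add: complex_eq_iff)
  then have "frechet_derivative f (at w) v = Re v *\<^sub>R dd f 1 w + Im v *\<^sub>R dd f \<i> w"
    using linear_add[OF l] linear_cmul[OF l] by metis
  then show ?thesis
    unfolding wd_def wb_def scaleR_conv_of_real complex_eq_iff by (simp add: field_simps)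
qed

lemma hasW_wirtinger:
  assumes "f differentiable (at w)"
  shows "hasW f (wd f w) (wb f w) w"
  by (rule has_derivative_eq_rhs[OF assms[unfolded frechet_derivative_works]])
    (simp add: fun_eq_iff frechet_derivative_wirtinger[OF assms])

lemma hasW_unique:
  assumes "hasW f p q w"
  shows "wd f w = p" "wb f w = q"
  unfolding wd_def wb_def frechet_derivative_at[OF assms, symmetric]
  by (simp_all add: algebra_simps)

lemma hasW_divide:
  assumes "hasW f p q w" "(P has_field_derivative P') (at w)" "P w \<noteq> 0"
  shows "hasW (\<lambda>w. f w / P w) (p / P w - f w * P' / (P w)\<^sup>2) (q / P w) w"
  by (rule has_derivative_eq_rhs[OF has_derivative_divide[OF assms(1) assms(2)[unfolded has_field_derivative_def] assms(3)]])
    (use assms(3) in \<open>auto simp: fun_eq_iff divide_simps power2_eq_square algebra_simps\<close>)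

context
  fixes S :: "complex set" and c :: complex
  assumes S: "open S"
begin

lemma smooth_wd: "smooth_on S f \<Longrightarrow> smooth_on S (wd f)"
  unfolding wd_def divide_inverse
  by (intro smooth_on_mult smooth_on_diff smooth_on_const smooth_on_dd S)

lemma smooth_wb: "smooth_on S f \<Longrightarrow> smooth_on S (wb f)"
  unfolding wb_def divide_inverse
  by (intro smooth_on_mult smooth_on_add smooth_on_const smooth_on_dd S)

lemma dd_cong:
  assumes "\<And>w. w \<in> S \<Longrightarrow> f w = g w" "w \<in> S" "smooth_on S f"
  shows "dd f v w = dd g v w"
  using frechet_derivative_transform_within_open[OF smooth_on_differentiable[OF assms(3,2)] S assms(2), of g] assms(1)
  by simp

lemma wd_cong:
  assumes "\<And>w. w \<in> S \<Longrightarrow> f w = g w" "w \<in> S" "smooth_on S f"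
  shows "wd f w = wd g w" "wb f w = wb g w"
  using dd_cong[OF assms] unfolding wd_def wb_def by auto

lemma wd_wb_commute:
  assumes f: "smooth_on S f" and w: "w \<in> S"
  shows "wd (wb f) w = wb (wd f) w"
proof -
  have d: "dd f v differentiable (at w)" for v
    using smooth_on_differentiable[OF smooth_on_dd[OF f] w] .
  have h: "((\<lambda>x. (dd f 1 x + e * (\<i> * dd f \<i> x)) / 2) has_derivative
     (\<lambda>u. (dd (dd f 1) u w + e * (\<i> * dd (dd f \<i>) u w)) / 2)) (at w)" for e
    using d[unfolded frechet_derivative_works]
    by (auto intro!: derivative_eq_intros)
  have 1: "dd (wb f) u w = (dd (dd f 1) u w + \<i> * dd (dd f \<i>) u w) / 2" for u
    using frechet_derivative_at[OF h[of 1]] unfolding wb_def by (simp add: fun_eq_iff)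
  have 2: "dd (wd f) u w = (dd (dd f 1) u w - \<i> * dd (dd f \<i>) u w) / 2" for u
    using frechet_derivative_at[OF h[of "-1"]] unfolding wd_def by (simp add: fun_eq_iff)
  show ?thesis
    unfolding wd_def[of "wb f"] wb_def[of "wd f"] 1 2 dd_commute[OF S f w, of \<i> 1]
    by (simp add: field_simps)
qed

end

text \<open>Vanishing of all iterated derivatives of order below \<open>n\<close>. Real directional
  derivatives are used because the functions are not holomorphic, and because sums, products and
  conjugates then inherit the property by induction.\<close>

primrec vo :: "nat \<Rightarrow> (complex \<Rightarrow> complex) \<Rightarrow> complex \<Rightarrow> bool" where
  "vo 0 f c = True"
| "vo (Suc n) f c = (f c = 0 \<and> (\<forall>v. vo n (dd f v) c))"

context
  fixes S :: "complex set" and c :: complex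
  assumes S: "open S" and c: "c \<in> S"
begin

lemma vo_cong:
  assumes "\<And>w. w \<in> S \<Longrightarrow> f w = g w" "smooth_on S f" "vo n f c"
  shows "vo n g c"
  using assms
proof (induction n arbitrary: f g)
  case (Suc n)
  have "vo n (dd g v) c" for v
    by (rule Suc.IH[of "dd f v"])
      (use Suc.prems dd_cong[OF S, of f g] in \<open>auto intro: smooth_on_dd\<close>)
  then show ?case using Suc.prems c by auto
qed auto

lemma vo_Suc_imp: "vo (Suc n) f c \<Longrightarrow> vo n f c"
  by (induction n arbitrary: f) auto

lemma vo_add:
  assumes "smooth_on S f" "smooth_on S g" "vo n f c" "vo n g c"
  shows "vo n (\<lambda>w. f w + g w) c"
  using assms
proof (induction n arbitrary: f g)
  case (Suc n)
  have "vo n (dd (\<lambda>w. f w + g w) v) c" for v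
  proof (rule vo_cong)
    show "vo n (\<lambda>w. dd f v w + dd g v w) c" using Suc by (auto intro: smooth_on_dd)
    show "smooth_on S (\<lambda>w. dd f v w + dd g v w)" using Suc.prems S by (auto intro: smooth_on_dd smooth_on_add)
    show "dd f v w + dd g v w = dd (\<lambda>w. f w + g w) v w" if "w \<in> S" for w
      using frechet_derivative_at[OF has_derivative_add[OF smooth_on_has_derivative smooth_on_has_derivative, OF Suc.prems(1) that Suc.prems(2) that]]
      by (simp add: fun_eq_iff)
  qed
  then show ?case using Suc.prems by auto
qed auto

lemma vo_mult:
  assumes "smooth_on S f" "smooth_on S g" "vo n f c"
  shows "vo n (\<lambda>w. f w * g w) c"
  using assms
proof (induction n arbitrary: f g)
  case (Suc n)
  have "vo n (dd (\<lambda>w. f w * g w) v) c" for v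
  proof (rule vo_cong)
    have 1: "vo n (\<lambda>w. f w * dd g v w) c"
      using vo_Suc_imp[OF Suc.prems(3)] Suc.IH Suc.prems smooth_on_dd by blast
    have 2: "vo n (\<lambda>w. dd f v w * g w) c"
      using Suc.IH[of "dd f v" g] Suc.prems smooth_on_dd by auto
    show "vo n (\<lambda>w. f w * dd g v w + dd f v w * g w) c"
      by (rule vo_add[OF _ _ 1 2]) (intro smooth_on_mult S smooth_on_dd Suc.prems)+
    show "smooth_on S (\<lambda>w. f w * dd g v w + dd f v w * g w)"
      by (intro smooth_on_mult smooth_on_add S smooth_on_dd Suc.prems)
    show "f w * dd g v w + dd f v w * g w = dd (\<lambda>w. f w * g w) v w" if "w \<in> S" for w
      using frechet_derivative_at[OF has_derivative_mult[OF smooth_on_has_derivative smooth_on_has_derivative, OF Suc.prems(1) that Suc.prems(2) that]]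
      by (simp add: fun_eq_iff)
  qed
  then show ?case using Suc.prems by auto
qed auto

lemma vo_cmult: "smooth_on S f \<Longrightarrow> vo n f c \<Longrightarrow> vo n (\<lambda>w. k * f w) c"
  using vo_mult[OF _ smooth_on_const[OF S, of k], of f n] by (simp add: mult.commute)

lemma vo_cnj:
  assumes "smooth_on S f" "vo n f c"
  shows "vo n (\<lambda>w. cnj (f w)) c"
  using assms
proof (induction n arbitrary: f)
  case (Suc n)
  have "vo n (dd (\<lambda>w. cnj (f w)) v) c" for v
  proof (rule vo_cong)
    show "vo n (\<lambda>w. cnj (dd f v w)) c" using Suc by (auto intro: smooth_on_dd)
    show "smooth_on S (\<lambda>w. cnj (dd f v w))"
      using smooth_on_linear[OF bounded_linear_cnj S] smooth_on_dd[OF Suc.prems(1)] by blast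
    show "cnj (dd f v w) = dd (\<lambda>w. cnj (f w)) v w" if "w \<in> S" for w
      using frechet_derivative_at[OF bounded_linear.has_derivative[OF bounded_linear_cnj smooth_on_has_derivative[OF Suc.prems(1) that]]]
      by (simp add: fun_eq_iff)
  qed
  then show ?case using Suc.prems by auto
qed auto

lemma vo_wirtinger:
  assumes "smooth_on S f" "vo (Suc n) f c"
  shows "vo n (wd f) c" "vo n (wb f) c"
proof -
  have d: "vo n (dd f v) c" for v using assms by auto
  have 1: "vo n (\<lambda>w. 1/2 * dd f 1 w + (- \<i>/2) * dd f \<i> w) c" "vo n (\<lambda>w. 1/2 * dd f 1 w + (\<i>/2) * dd f \<i> w) c"
    by (rule vo_add; intro vo_cmult d smooth_on_mult smooth_on_dd assms smooth_on_const S)+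
  have "wd f = (\<lambda>w. 1/2 * dd f 1 w + (- \<i>/2) * dd f \<i> w)" "wb f = (\<lambda>w. 1/2 * dd f 1 w + (\<i>/2) * dd f \<i> w)"
    unfolding wd_def wb_def by (auto simp: fun_eq_iff field_simps)
  with 1 show "vo n (wd f) c" "vo n (wb f) c" by simp_all
qed

lemma vo_SucI:
  assumes f: "smooth_on S f" and "f c = 0" "vo n (wd f) c" "vo n (wb f) c"
  shows "vo (Suc n) f c"
proof -
  have "vo n (dd f v) c" for v
  proof (rule vo_cong)
    show "vo n (\<lambda>w. v * wd f w + cnj v * wb f w) c"
      by (rule vo_add; intro vo_cmult assms smooth_on_mult smooth_on_const smooth_wd smooth_wb S)
    show "smooth_on S (\<lambda>w. v * wd f w + cnj v * wb f w)"
      by (intro smooth_on_add assms smooth_on_mult smooth_on_const smooth_wd smooth_wb S)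
    show "v * wd f w + cnj v * wb f w = dd f v w" if "w \<in> S" for w
      using frechet_derivative_wirtinger[OF smooth_on_differentiable[OF f that]] by (simp add: mult.commute)
  qed
  then show ?thesis using assms by simp
qed

text \<open>A derivative of order \<open>n\<close> that contains a conjugate derivative vanishes, as
  \<open>wb f\<close> vanishes to order \<open>n\<close> and the Wirtinger operators commute; the
  pure power of \<open>wd\<close> is the only one left to test.\<close>

lemma vo_step:
  assumes "smooth_on S f" "vo n f c" "vo n (wb f) c" "(wd ^^ n) f c = 0"
  shows "vo (Suc n) f c"
  using assms
proof (induction n arbitrary: f)
  case (Suc n)
  note f = Suc.prems(1)
  have "vo (Suc n) (wd f) c"
  proof (rule Suc.IH)
    show "smooth_on S (wd f)" by (rule smooth_wd[OF S f])
    show "vo n (wd f) c" by (rule vo_wirtinger(1)[OF f Suc.prems(2)])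
    show "vo n (wb (wd f)) c"
      by (rule vo_cong[OF wd_wb_commute[OF S f] _ vo_wirtinger(1)[OF smooth_wb[OF S f] Suc.prems(3)]])
        (auto intro!: smooth_wd[OF S] smooth_wb[OF S] f)
    show "(wd ^^ n) (wd f) c = 0" using Suc.prems(4) by (simp add: funpow_swap1)
  qed
  then show ?case by (intro vo_SucI[OF f]) (use Suc.prems in auto)
qed auto

text \<open>Both Wirtinger derivatives are of size \<open>dist c w ^ n\<close> by induction, and the
  Lipschitz estimate on the disc \<open>cball c (dist c w)\<close> gains one more power.\<close>

lemma vo_growth:
  assumes "smooth_on S f" "vo n f c"
  shows "\<exists>K r. r > 0 \<and> K \<ge> 0 \<and> ball c r \<subseteq> S \<and> (\<forall>w\<in>ball c r. norm (f w) \<le> K * dist c w ^ n)"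
  using assms
proof (induction n arbitrary: f)
  case 0
  have "isCont f c" by (rule smooth_on_isCont[OF 0(1) c])
  then obtain d where d: "d > 0" "\<And>w. dist w c < d \<Longrightarrow> dist (f w) (f c) < 1"
    unfolding continuous_at_eps_delta by (metis zero_less_one)
  obtain r where r: "r > 0" "ball c r \<subseteq> S" using openE[OF S c] by blast
  have "norm (f w) \<le> norm (f c) + 1" if "w \<in> ball c (min d r)" for w
    using d(2)[of w] that norm_triangle_sub[of "f w" "f c"] by (auto simp: dist_norm norm_minus_commute)
  then show ?case using d r by (intro exI[of _ "norm (f c) + 1"] exI[of _ "min d r"]) auto
next
  case (Suc n)
  have "\<exists>K r. r > 0 \<and> K \<ge> 0 \<and> ball c r \<subseteq> S \<and> (\<forall>w\<in>ball c r. norm (g w) \<le> K * dist c w ^ n)"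
    if "g = wd f \<or> g = wb f" for g
    using that vo_wirtinger[OF Suc.prems] Suc.IH smooth_wd[OF S Suc.prems(1)] smooth_wb[OF S Suc.prems(1)] by metis
  then obtain K1 r1 K2 r2 where
    1: "r1 > 0" "K1 \<ge> 0" "ball c r1 \<subseteq> S" "\<And>w. w\<in>ball c r1 \<Longrightarrow> norm (wd f w) \<le> K1 * dist c w ^ n" and
    2: "r2 > 0" "K2 \<ge> 0" "ball c r2 \<subseteq> S" "\<And>w. w\<in>ball c r2 \<Longrightarrow> norm (wb f w) \<le> K2 * dist c w ^ n"
    by metis
  define r where "r = min r1 r2"
  have B: "ball c r \<subseteq> S" using 1(3) subset_ball[of r r1 c] by (auto simp: r_def)
  have "norm (f w) \<le> (K1 + K2) * dist c w ^ Suc n" if w: "w \<in> ball c r" for w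
  proof -
    have U: "cball c (dist c w) \<subseteq> ball c r" using w by auto
    have "norm (f w - f c) \<le> ((K1 + K2) * dist c w ^ n) * norm (w - c)"
    proof (rule exceptional_lipschitz[where Z="{}" and U="cball c (dist c w)" and p="wd f" and q="wb f"])
      show "continuous_on (cball c (dist c w)) f"
        using continuous_on_subset[OF smooth_on_continuous_on[OF Suc.prems(1)] order_trans[OF U B]] .
      fix x assume "x \<in> cball c (dist c w) - {}"
      then have x: "x \<in> ball c r" "dist c x \<le> dist c w" using U by auto
      then have "x \<in> S" using 1(3) by (auto simp: r_def)
      then show "hasW f (wd f x) (wb f x) x" using smooth_on_differentiable[OF Suc.prems(1)] hasW_wirtinger by blast
      have "norm (wd f x) + norm (wb f x) \<le> K1 * dist c x ^ n + K2 * dist c x ^ n"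
        using x 1 2 by (intro add_mono) (auto simp: r_def)
      also have "\<dots> \<le> K1 * dist c w ^ n + K2 * dist c w ^ n"
        using x 1 2 by (intro add_mono mult_left_mono power_mono) auto
      finally show "norm (wd f x) + norm (wb f x) \<le> (K1 + K2) * dist c w ^ n" by (simp add: distrib_right)
    qed auto
    then show ?thesis using Suc.prems(2) by (simp add: dist_norm norm_minus_commute mult_ac)
  qed
  then show ?case using 1 2 by (intro exI[of _ "K1 + K2"] exI[of _ r]) (auto simp: r_def)
qed

end

section \<open>Monomials, flat functions and leading terms\<close>

lemma mono_derivs:
  fixes c \<alpha> :: complex
  shows "dd (\<lambda>w. \<alpha> * (w - c) ^ Suc n) v = (\<lambda>w. (of_nat (Suc n) * \<alpha> * v) * (w - c) ^ n)"
    "wd (\<lambda>w. \<alpha> * (w - c) ^ m) = (\<lambda>w. (of_nat m * \<alpha>) * (w - c) ^ (m - 1))"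
    "wb (\<lambda>w. \<alpha> * (w - c) ^ m) = (\<lambda>w. 0)"
proof -
  have d: "((\<lambda>w. \<alpha> * (w - c) ^ m) has_derivative (\<lambda>h. (of_nat m * \<alpha>) * (w - c) ^ (m - 1) * h)) (at w)" for w m
    by (auto intro!: derivative_eq_intros simp: fun_eq_iff)
  show "dd (\<lambda>w. \<alpha> * (w - c) ^ Suc n) v = (\<lambda>w. (of_nat (Suc n) * \<alpha> * v) * (w - c) ^ n)"
    using frechet_derivative_at[OF d[of "Suc n"], symmetric] by (simp add: fun_eq_iff)
  have "hasW (\<lambda>w. \<alpha> * (w - c) ^ m) ((of_nat m * \<alpha>) * (w - c) ^ (m - 1)) 0 w" for w
    using d[of m w] by simp
  from hasW_unique[OF this]
  show "wd (\<lambda>w. \<alpha> * (w - c) ^ m) = (\<lambda>w. (of_nat m * \<alpha>) * (w - c) ^ (m - 1))"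
    "wb (\<lambda>w. \<alpha> * (w - c) ^ m) = (\<lambda>w. 0)" by auto
qed

lemma smooth_mono: "open S \<Longrightarrow> smooth_on S (\<lambda>w. \<alpha> * (w - c) ^ n :: complex)"
proof -
  assume S: "open S"
  have "smooth_on S (\<lambda>w. (w - c) ^ n)"
    by (induction n) (auto intro!: smooth_on_mult smooth_on_const smooth_on_diff smooth_on_id S)
  then show ?thesis by (intro smooth_on_mult smooth_on_const S)
qed

lemma vo_mono: "vo n (\<lambda>w. \<alpha> * (w - c) ^ n) c"
proof (induction n arbitrary: \<alpha>)
  case (Suc n)
  show ?case unfolding vo.simps mono_derivs using Suc by simp
qed simp

lemma wd_funpow_mono: "(wd ^^ n) (\<lambda>w. \<alpha> * (w - c) ^ n) c = fact n * \<alpha>"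
proof (induction n arbitrary: \<alpha>)
  case (Suc n)
  have "(wd ^^ Suc n) (\<lambda>w. \<alpha> * (w - c) ^ Suc n) = (wd ^^ n) (wd (\<lambda>w. \<alpha> * (w - c) ^ Suc n))"
    by (simp add: funpow_swap1)
  then have "(wd ^^ Suc n) (\<lambda>w. \<alpha> * (w - c) ^ Suc n) c = fact n * (of_nat (Suc n) * \<alpha>)"
    unfolding mono_derivs diff_Suc_1 using Suc[of "of_nat (Suc n) * \<alpha>"] by (simp only:)
  then show ?case by (simp only: fact_Suc) (simp add: algebra_simps)
qed simp

lemma wd_funpow_diff:
  assumes S: "open S" "smooth_on S f" "smooth_on S g" "w \<in> S"
  shows "(wd ^^ n) (\<lambda>w. f w - g w) w = (wd ^^ n) f w - (wd ^^ n) g w"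
    and "wb (\<lambda>w. f w - g w) w = wb f w - wb g w"
proof -
  have d: "dd (\<lambda>w. f w - g w) v w = dd f v w - dd g v w" if "w \<in> S" "smooth_on S f" "smooth_on S g" for w v f g
    using frechet_derivative_at[OF has_derivative_diff[OF smooth_on_has_derivative smooth_on_has_derivative, OF that(2,1) that(3,1)]]
    by (simp add: fun_eq_iff)
  show "wb (\<lambda>w. f w - g w) w = wb f w - wb g w"
    unfolding wb_def d[OF S(4,2,3)] by (simp add: field_simps)
  have sm: "smooth_on S ((wd ^^ n) f)" if "smooth_on S f" for n f
    by (induction n) (auto intro: that smooth_wd[OF S(1)])
  have "\<forall>w\<in>S. (wd ^^ n) (\<lambda>w. f w - g w) w = (wd ^^ n) f w - (wd ^^ n) g w"
  proof (induction n)
    case (Suc n)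
    show ?case
    proof
      fix w assume w: "w \<in> S"
      have "wd ((wd ^^ n) (\<lambda>w. f w - g w)) w = wd (\<lambda>w. (wd ^^ n) f w - (wd ^^ n) g w) w"
        by (rule wd_cong(1)[OF S(1) _ w sm[OF smooth_on_diff[OF S(1,2,3)]]]) (use Suc in blast)
      also have "\<dots> = wd ((wd ^^ n) f) w - wd ((wd ^^ n) g) w"
        unfolding wd_def[of "\<lambda>w. (wd ^^ n) f w - (wd ^^ n) g w"] wd_def[of "(wd ^^ n) f"] wd_def[of "(wd ^^ n) g"]
          d[OF w sm[OF S(2)] sm[OF S(3)]]
        by (simp add: field_simps)
      finally show "(wd ^^ Suc n) (\<lambda>w. f w - g w) w = (wd ^^ Suc n) f w - (wd ^^ Suc n) g w" by simp
    qed
  qed auto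
  then show "(wd ^^ n) (\<lambda>w. f w - g w) w = (wd ^^ n) f w - (wd ^^ n) g w" using S by auto
qed

text \<open>Unique continuation: dividing by a high power keeps the inequality, and the maximum
  on an annulus then controls the function near the centre.\<close>

lemma flat_imp_zero:
  assumes S: "open S" "c \<in> S" and a: "smooth_on S a" and C: "0 \<le> C"
    and wb: "\<And>w. w \<in> S \<Longrightarrow> norm (wb a w) \<le> C * norm (a w)"
    and flat: "\<And>n. vo n a c"
  shows "\<exists>r>0. \<forall>w\<in>ball c r. a w = 0"
proof -
  obtain r0 where r0: "r0 > 0" "cball c r0 \<subseteq> S" using open_contains_cball S by blast
  define r where "r = min r0 (1 / (2 * C + 2))"
  have r: "r > 0" using r0 C by (simp add: r_def)
  have rS: "cball c r \<subseteq> S" using r0(2) by (auto simp: r_def)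
  have "r * C \<le> 1 / (2 * C + 2) * C" using C by (intro mult_right_mono) (auto simp: r_def)
  also have "\<dots> \<le> 1/2" using C by (simp add: field_simps)
  finally have rC: "r * C \<le> 1/2" .
  have acont: "continuous_on (cball c r) a"
    by (rule continuous_on_subset[OF smooth_on_continuous_on[OF a] rS])
  have "\<exists>x\<in>cball c r. \<forall>y\<in>cball c r. norm (a y) \<le> norm (a x)"
    by (rule continuous_attains_sup) (use r acont in \<open>auto intro!: continuous_intros\<close>)
  then obtain M where M: "\<And>y. y \<in> cball c r \<Longrightarrow> norm (a y) \<le> M" by blast
  have M0: "M \<ge> 0" using M[of c] r norm_ge_zero[of "a c"] by (simp del: norm_ge_zero)
  have bound: "norm (a w) \<le> 2 * M * (1/2) ^ N" if w: "w \<in> ball c (r/8)" "w \<noteq> c" for w N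
  proof -
    define f where "f = (\<lambda>w. a w / (w - c) ^ N)"
    \<comment> \<open>One order more than the division consumes: the quotient tends to 0 at
      \<open>c\<close>, which for \<open>N > 0\<close> is also the value that division by zero
      assigns there.\<close>
    have vN: "vo (Suc N) a c" by (rule flat)
    obtain K \<delta> where K: "\<delta> > 0" "K \<ge> 0" "\<And>w. w \<in> ball c \<delta> \<Longrightarrow> norm (a w) \<le> K * dist c w ^ Suc N"
      using vo_growth[OF S a vN] by blast
    have fc0: "a c = 0" using vN by simp
    have "isCont f c"
    proof (cases "N = 0")
      case True
      then show ?thesis using smooth_on_isCont[OF a S(2)] by (simp add: f_def)
    next
      case False
      have "(f \<longlongrightarrow> 0) (at c)"
      proof (rule Lim_null_comparison)
        show "((\<lambda>w. K * dist c w) \<longlongrightarrow> 0) (at c)" by (auto intro!: tendsto_eq_intros)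
        have "norm (f w) \<le> K * dist c w" if "dist w c < \<delta>" "w \<noteq> c" for w
        proof -
          have "norm (f w) = norm (a w) / dist c w ^ N"
            by (simp add: f_def norm_divide norm_power dist_norm norm_minus_commute)
          also have "\<dots> \<le> K * dist c w ^ Suc N / dist c w ^ N"
            using K(3)[of w] that by (intro divide_right_mono) (auto simp: dist_commute)
          also have "\<dots> = K * dist c w" using that by (simp add: dist_commute)
          finally show ?thesis .
        qed
        then show "\<forall>\<^sub>F w in at c. norm (f w) \<le> K * dist c w"
          unfolding eventually_at using K(1) by auto
      qed
      then show ?thesis using False by (simp add: isCont_def f_def fc0)
    qed
    then have fcont: "continuous_on (cball c r) f"
    proof -
      assume *: "isCont f c"
      have "isCont f x" if "x \<in> S" for x
      proof (cases "x = c")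
        case False
        then show ?thesis unfolding f_def using smooth_on_isCont[OF a that] by (intro continuous_intros) auto
      qed (use * in simp)
      then show ?thesis using rS by (auto intro!: continuous_at_imp_continuous_on)
    qed
    have pw: "((\<lambda>w. (w - c) ^ N) has_field_derivative (of_nat N * (w - c) ^ (N - 1))) (at w)" for w
      by (auto intro!: derivative_eq_intros)
    have bS: "ball c r - {c} \<subseteq> S" using order_trans[OF ball_subset_cball rS] by blast
    have "norm (f w) \<le> 2 * (M * (4 / r) ^ N)"
    proof (rule annulus_maximum[OF _ r fcont, of "{c}" _ _ C])
      fix x assume "x \<in> ball c r - {c}"
      then have x: "x \<in> S" "x \<noteq> c" using bS by auto
      show "hasW f (wd a x / (x - c) ^ N - a x * (of_nat N * (x - c) ^ (N - 1)) / ((x - c) ^ N)\<^sup>2) (wb a x / (x - c) ^ N) x"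
        unfolding f_def by (rule hasW_divide[OF hasW_wirtinger[OF smooth_on_differentiable[OF a x(1)]] pw]) (use x in auto)
      show "norm (wb a x / (x - c) ^ N) \<le> C * norm (f x)"
        using wb[OF x(1)] x(2) by (simp add: f_def norm_divide divide_right_mono)
    next
      show "continuous_on (ball c r - {c}) (\<lambda>x. wd a x / (x - c) ^ N - a x * (of_nat N * (x - c) ^ (N - 1)) / ((x - c) ^ N)\<^sup>2)"
        "continuous_on (ball c r - {c}) (\<lambda>x. wb a x / (x - c) ^ N)"
        by (intro continuous_intros continuous_on_subset[OF smooth_on_continuous_on bS] smooth_wd smooth_wb a S; simp)+
      fix x assume x: "r / 4 \<le> dist c x" "dist c x \<le> r"
      have "norm (f x) = norm (a x) / dist c x ^ N"
        by (simp add: f_def norm_divide norm_power dist_norm norm_minus_commute)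
      also have "\<dots> \<le> M / (r / 4) ^ N"
        using M[of x] x r M0 by (intro frac_le power_mono) auto
      finally show "norm (f x) \<le> M * (4 / r) ^ N" by (simp add: power_divide)
    qed (use C rC r w in auto)
    have "norm (a w) = norm (f w) * dist c w ^ N"
      using w by (simp add: f_def norm_divide norm_power dist_norm norm_minus_commute)
    \<comment> \<open>On the annulus the division costs a factor \<open>(4 / r) ^ N\<close>;
      multiplying back within the radius \<open>r / 8\<close> gains \<open>(r / 8) ^ N\<close>,
      altogether \<open>(1 / 2) ^ N\<close>.\<close>
    also have "\<dots> \<le> 2 * (M * (4 / r) ^ N) * (r / 8) ^ N"
      using \<open>norm (f w) \<le> _\<close> w M0 r by (intro mult_mono power_mono) auto
    also have "\<dots> = 2 * M * ((4 / r) * (r / 8)) ^ N" by (simp only: power_mult_distrib mult.assoc)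
    also have "(4 / r) * (r / 8) = 1/2" using r by simp
    finally show ?thesis .
  qed
  have "a w = 0" if w: "w \<in> ball c (r/8)" for w
  proof (cases "w = c")
    case True
    then show ?thesis using flat[of 1] by simp
  next
    case False
    have "(\<lambda>N. 2 * M * (1/2) ^ N) \<longlonglongrightarrow> 2 * M * 0"
      by (intro tendsto_mult tendsto_const LIMSEQ_power_zero) simp
    then have "norm (a w) \<le> 2 * M * 0"
      by (rule LIMSEQ_le_const) (use bound[OF w False] in auto)
    then show ?thesis by simp
  qed
  then show ?thesis using r by (intro exI[of _ "r/8"]) auto
qed

text \<open>The expression in the second clause is the \<open>wd\<close> derivative of
  \<open>f / (w - c) ^ n\<close>. The limit alone gives a continuous quotient; the bound supplies
  the finite, if uncontrolled, value from which derivatives are later absorbed.\<close>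

definition lead :: "(complex \<Rightarrow> complex) \<Rightarrow> complex \<Rightarrow> nat \<Rightarrow> complex \<Rightarrow> bool" where
  "lead f c n \<alpha> \<longleftrightarrow> ((\<lambda>w. f w / (w - c) ^ n) \<longlongrightarrow> \<alpha>) (at c) \<and>
     (\<exists>K. \<forall>\<^sub>F w in at c. norm (wd f w / (w - c) ^ n - of_nat n * f w / (w - c) ^ Suc n) \<le> K)"

text \<open>The monomial is annihilated by \<open>wb\<close>, so subtracting it keeps the hypothesis
  on \<open>wb f\<close> and removes the pure \<open>wd\<close> derivative of order
  \<open>n\<close>, the one obstruction in \<open>vo_step\<close>.\<close>

lemma vo_remainder:
  assumes S: "open S" "c \<in> S" and f: "smooth_on S f" "vo n f c" "vo n (wb f) c"
  shows "vo (Suc n) (\<lambda>w. f w - (wd ^^ n) f c / fact n * (w - c) ^ n) c"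
proof (rule vo_step[OF S])
  define \<alpha> where "\<alpha> = (wd ^^ n) f c / fact n"
  define g where "g = (\<lambda>w. \<alpha> * (w - c) ^ n)"
  have g: "smooth_on S g" unfolding g_def by (rule smooth_mono[OF S(1)])
  show "smooth_on S (\<lambda>w. f w - (wd ^^ n) f c / fact n * (w - c) ^ n)"
    by (intro smooth_on_diff S f smooth_mono)
  have "vo n (\<lambda>w. f w + (- \<alpha>) * (w - c) ^ n) c"
    by (rule vo_add[OF S f(1) smooth_mono f(2) vo_mono]) (rule S)
  then show "vo n (\<lambda>w. f w - (wd ^^ n) f c / fact n * (w - c) ^ n) c" by (simp add: \<alpha>_def)
  show "vo n (wb (\<lambda>w. f w - (wd ^^ n) f c / fact n * (w - c) ^ n)) c"
  proof (rule vo_cong[OF S _ _ f(3)])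
    show "wb f w = wb (\<lambda>w. f w - (wd ^^ n) f c / fact n * (w - c) ^ n) w" if "w \<in> S" for w
      using wd_funpow_diff(2)[OF S(1) f(1) g that] unfolding g_def mono_derivs \<alpha>_def by simp
  qed (rule smooth_wb[OF S(1) f(1)])
  show "(wd ^^ n) (\<lambda>w. f w - (wd ^^ n) f c / fact n * (w - c) ^ n) c = 0"
    using wd_funpow_diff(1)[OF S(1) f(1) g S(2), of n] unfolding g_def wd_funpow_mono by (simp add: \<alpha>_def)
qed

text \<open>Expresses the derivative of \<open>f / x ^ n\<close> through the remainder after the
  leading monomial. The factor \<open>of_nat n\<close> makes the truncated exponent
  \<open>n - 1\<close> harmless at \<open>n = 0\<close>.\<close>

lemma quotient_identity:
  fixes x :: complex
  assumes "x \<noteq> 0"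
  shows "D / x ^ n - of_nat n * F / x ^ Suc n
    = (D - of_nat n * \<alpha> * x ^ (n - 1)) / x ^ n - of_nat n * ((F - \<alpha> * x ^ n) / x ^ Suc n)"
  using assms by (cases n) (simp_all add: field_simps)

lemma vo_remainder_lead:
  assumes S: "open S" "c \<in> S" and f: "smooth_on S f" "vo (Suc n) (\<lambda>w. f w - \<alpha> * (w - c) ^ n) c"
  shows "lead f c n \<alpha>"
proof -
  define g where "g = (\<lambda>w. f w - \<alpha> * (w - c) ^ n)"
  have g: "smooth_on S g" unfolding g_def by (intro smooth_on_diff S f smooth_mono)
  have vg: "vo (Suc n) g c" using f by (simp add: g_def)
  obtain K1 r1 where 1: "r1 > 0" "K1 \<ge> 0" "ball c r1 \<subseteq> S" "\<And>w. w \<in> ball c r1 \<Longrightarrow> norm (g w) \<le> K1 * dist c w ^ Suc n"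
    using vo_growth[OF S g vg] by blast
  obtain K2 r2 where 2: "r2 > 0" "K2 \<ge> 0" "ball c r2 \<subseteq> S" "\<And>w. w \<in> ball c r2 \<Longrightarrow> norm (wd g w) \<le> K2 * dist c w ^ n"
    using vo_growth[OF S smooth_wd[OF S(1) g] vo_wirtinger(1)[OF S g vg]] by blast
  have G: "norm (f w / (w - c) ^ n - \<alpha>) \<le> K1 * dist c w"
    and D: "norm (wd f w / (w - c) ^ n - of_nat n * f w / (w - c) ^ Suc n) \<le> K2 + n * K1"
    if w: "dist w c < min r1 r2" "w \<noteq> c" for w
  proof -
    have wb: "w \<in> ball c r1" "w \<in> ball c r2" "w \<in> S" using w 1 by (auto simp: dist_commute)
    have d: "dist c w > 0" using w by (simp add: dist_commute)
    have nn: "norm ((w - c) ^ m) = dist c w ^ m" for m by (simp add: norm_power dist_norm norm_minus_commute)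
    have g1: "norm (g w / (w - c) ^ Suc n) \<le> K1"
      unfolding norm_divide nn using 1(4)[OF wb(1)] d by (simp add: pos_divide_le_eq)
    have g2: "norm (wd g w / (w - c) ^ n) \<le> K2"
      unfolding norm_divide nn using 2(4)[OF wb(2)] d by (simp add: pos_divide_le_eq)
    have "f w / (w - c) ^ n - \<alpha> = (g w / (w - c) ^ Suc n) * (w - c)"
      using w(2) by (simp add: g_def field_simps)
    also have "norm \<dots> \<le> K1 * dist c w"
      unfolding norm_mult using g1 by (simp add: dist_norm norm_minus_commute mult_right_mono)
    finally show "norm (f w / (w - c) ^ n - \<alpha>) \<le> K1 * dist c w" .
    have wdg: "wd g w = wd f w - of_nat n * \<alpha> * (w - c) ^ (n - 1)"
      using wd_funpow_diff(1)[OF S(1) f(1) smooth_mono[OF S(1), of \<alpha> c n] wb(3), of 1] unfolding g_def by (simp add: mono_derivs)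
    have "wd f w / (w - c) ^ n - of_nat n * f w / (w - c) ^ Suc n
        = wd g w / (w - c) ^ n - of_nat n * (g w / (w - c) ^ Suc n)"
      unfolding wdg unfolding g_def by (rule quotient_identity) (use w(2) in simp)
    also have "norm \<dots> \<le> K2 + n * K1"
      by (rule order_trans[OF norm_triangle_ineq4]) (use g1 g2 in \<open>auto simp only: norm_mult norm_of_nat intro!: add_mono mult_left_mono\<close>)
    finally show "norm (wd f w / (w - c) ^ n - of_nat n * f w / (w - c) ^ Suc n) \<le> K2 + n * K1" .
  qed
  have ev: "\<forall>\<^sub>F w in at c. dist w c < min r1 r2 \<and> w \<noteq> c"
    unfolding eventually_at using 1(1) 2(1) by (intro exI[of _ "min r1 r2"]) auto
  have "((\<lambda>w. f w / (w - c) ^ n - \<alpha>) \<longlongrightarrow> 0) (at c)"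
  proof (rule Lim_null_comparison)
    show "((\<lambda>w. K1 * dist c w) \<longlongrightarrow> 0) (at c)" by (auto intro!: tendsto_eq_intros)
    show "\<forall>\<^sub>F w in at c. norm (f w / (w - c) ^ n - \<alpha>) \<le> K1 * dist c w"
      using ev by eventually_elim (use G in auto)
  qed
  then have "((\<lambda>w. f w / (w - c) ^ n) \<longlongrightarrow> \<alpha>) (at c)" by (simp add: LIM_zero_iff)
  moreover have "\<forall>\<^sub>F w in at c. norm (wd f w / (w - c) ^ n - of_nat n * f w / (w - c) ^ Suc n) \<le> K2 + n * K1"
    using ev by eventually_elim (use D in auto)
  ultimately show ?thesis unfolding lead_def by blast
qed

text \<open>The order of \<open>a\<close> is finite, since a flat \<open>a\<close> would vanish near
  \<open>c\<close> by \<open>flat_imp_zero\<close>. Whenever \<open>a\<close> vanishes to some order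
  so does \<open>b\<close>: a nonzero monomial of \<open>b\<close> below that order would violate
  \<open>norm b <= norm a\<close>. Hence both have a leading term with the same exponent, that of
  \<open>b\<close> possibly with coefficient 0.\<close>

lemma pair_order:
  assumes S: "open S" "c \<in> S" and sm: "smooth_on S a" "smooth_on S b" "smooth_on S A" "smooth_on S B"
    and eqa: "\<And>w. w \<in> S \<Longrightarrow> wb a w = A w * a w + B w * cnj (b w)"
    and eqb: "\<And>w. w \<in> S \<Longrightarrow> wb b w = A w * b w + B w * cnj (a w)"
    and le: "\<And>w. w \<in> S \<Longrightarrow> norm (b w) \<le> norm (a w)"
    and nz: "\<not> (\<exists>r>0. \<forall>w\<in>ball c r. a w = 0)"
  shows "\<exists>n \<alpha> \<beta>. \<alpha> \<noteq> 0 \<and> lead a c n \<alpha> \<and> lead b c n \<beta>"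
proof -
  have wb: "vo n (wb a) c \<and> vo n (wb b) c" if "vo n a c" "vo n b c" for n
  proof
    have p: "vo n (\<lambda>w. A w * a w + B w * cnj (b w)) c" "smooth_on S (\<lambda>w. A w * a w + B w * cnj (b w))"
      if "vo n a c" "vo n b c" "smooth_on S a" "smooth_on S b" for a b
    proof -
      have cb: "smooth_on S (\<lambda>w. cnj (b w))" using smooth_on_linear[OF bounded_linear_cnj S(1) that(4)] .
      have "vo n (\<lambda>w. a w * A w + cnj (b w) * B w) c"
        by (rule vo_add[OF S]) (intro vo_mult[OF S] vo_cnj[OF S] that sm smooth_on_mult S cb)+
      then show "vo n (\<lambda>w. A w * a w + B w * cnj (b w)) c" by (simp add: mult.commute)
      show "smooth_on S (\<lambda>w. A w * a w + B w * cnj (b w))" by (intro smooth_on_add smooth_on_mult S that sm cb)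
    qed
    show "vo n (wb a) c" by (rule vo_cong[OF S _ p(2,1)[OF that sm(1,2)]]) (simp add: eqa)
    show "vo n (wb b) c" by (rule vo_cong[OF S _ p(2,1)[OF that(2,1) sm(2,1)]]) (simp add: eqb)
  qed
  have vb: "vo n b c" if "vo n a c" for n
    using that
  proof (induction n)
    case (Suc n)
    have b: "vo n b c" using Suc vo_Suc_imp[OF S Suc.prems] by simp
    have a: "vo n a c" using vo_Suc_imp[OF S Suc.prems] .
    define \<beta> where "\<beta> = (wd ^^ n) b c / fact n"
    have rem: "vo (Suc n) (\<lambda>w. b w - \<beta> * (w - c) ^ n) c"
      unfolding \<beta>_def using vo_remainder[OF S sm(2) b] wb[OF a b] by blast
    obtain K1 r1 where 1: "r1 > 0" "K1 \<ge> 0" "ball c r1 \<subseteq> S" "\<And>w. w \<in> ball c r1 \<Longrightarrow> norm (a w) \<le> K1 * dist c w ^ Suc n"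
      using vo_growth[OF S sm(1) Suc.prems] by blast
    obtain K2 r2 where 2: "r2 > 0" "K2 \<ge> 0" "ball c r2 \<subseteq> S" "\<And>w. w \<in> ball c r2 \<Longrightarrow> norm (b w - \<beta> * (w - c) ^ n) \<le> K2 * dist c w ^ Suc n"
      using vo_growth[OF S smooth_on_diff[OF S(1) sm(2) smooth_mono[OF S(1)]] rem] by blast
    have le2: "norm \<beta> \<le> (K1 + K2) * t" if t: "0 < t" "t < min r1 r2" for t
    proof -
      define w where "w = c + of_real t"
      have d: "dist c w = t" using t by (simp add: w_def dist_norm)
      have wB: "w \<in> ball c r1" "w \<in> ball c r2" "w \<in> S" using d t 1(3) by auto
      have "norm \<beta> * t ^ n = norm (\<beta> * (w - c) ^ n)" using t by (simp add: w_def norm_mult norm_power)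
      also have "\<dots> \<le> norm (b w) + norm (b w - \<beta> * (w - c) ^ n)"
        using norm_triangle_ineq4[of "b w" "b w - \<beta> * (w - c) ^ n"] by simp
      also have "\<dots> \<le> K1 * t ^ Suc n + K2 * t ^ Suc n"
        using 1(4)[OF wB(1)] 2(4)[OF wB(2)] le[OF wB(3)] d by simp
      also have "\<dots> = ((K1 + K2) * t) * t ^ n" by (simp add: algebra_simps)
      finally show ?thesis using t by simp
    qed
    have "norm \<beta> \<le> (K1 + K2) * 0"
    proof (rule tendsto_le[of "at_right 0"])
      show "((\<lambda>t. (K1 + K2) * t) \<longlongrightarrow> (K1 + K2) * 0) (at_right 0)" by (intro tendsto_intros)
      show "\<forall>\<^sub>F t in at_right 0. norm \<beta> \<le> (K1 + K2) * t"
        unfolding eventually_at_right_field using 1(1) 2(1) le2 by (intro exI[of _ "min r1 r2"]) auto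
    qed auto
    then have "\<beta> = 0" by simp
    then show ?case using rem by simp
  qed simp
  have "\<not> (\<forall>n. vo n a c)"
  proof
    assume flat: "\<forall>n. vo n a c"
    obtain K1 r1 where 1: "r1 > 0" "K1 \<ge> 0" "ball c r1 \<subseteq> S" "\<And>w. w \<in> ball c r1 \<Longrightarrow> norm (A w) \<le> K1"
      using vo_growth[OF S sm(3), of 0] by auto
    obtain K2 r2 where 2: "r2 > 0" "K2 \<ge> 0" "ball c r2 \<subseteq> S" "\<And>w. w \<in> ball c r2 \<Longrightarrow> norm (B w) \<le> K2"
      using vo_growth[OF S sm(4), of 0] by auto
    have "\<exists>r>0. \<forall>w\<in>ball c r. a w = 0"
    proof (rule flat_imp_zero[of "ball c r1 \<inter> ball c r2" c a "K1 + K2"])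
      fix w assume w: "w \<in> ball c r1 \<inter> ball c r2"
      then have wS: "w \<in> S" using 1 by auto
      have "norm (wb a w) \<le> norm (A w) * norm (a w) + norm (B w) * norm (b w)"
        unfolding eqa[OF wS] using norm_triangle_ineq[of "A w * a w" "B w * cnj (b w)"] by (simp add: norm_mult)
      also have "\<dots> \<le> K1 * norm (a w) + K2 * norm (a w)"
        using 1 2 w le[OF wS] by (intro add_mono mult_mono) auto
      finally show "norm (wb a w) \<le> (K1 + K2) * norm (a w)" by (simp add: distrib_right)
    qed (use 1 2 flat in \<open>auto intro!: smooth_on_subset[OF sm(1)]\<close>)
    then show False using nz by simp
  qed
  then obtain n where n: "vo n a c" "\<not> vo (Suc n) a c"
  proof -
    assume *: "\<And>n. vo n a c \<Longrightarrow> \<not> vo (Suc n) a c \<Longrightarrow> thesis"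
    assume "\<not> (\<forall>n. vo n a c)"
    moreover have "vo n a c" if "\<forall>n. vo n a c \<longrightarrow> vo (Suc n) a c" for n
      using that by (induction n) (rule vo.simps(1)[THEN iffD2, OF TrueI], blast)
    ultimately show thesis using * by blast
  qed
  note nb = vb[OF n(1)]
  define \<alpha> where "\<alpha> = (wd ^^ n) a c / fact n"
  have "\<alpha> \<noteq> 0" using vo_step[OF S sm(1) n(1)] wb[OF n(1) nb] n(2) by (auto simp: \<alpha>_def)
  moreover have "lead a c n \<alpha>"
    unfolding \<alpha>_def by (rule vo_remainder_lead[OF S sm(1) vo_remainder[OF S sm(1) n(1)]]) (use wb[OF n(1) nb] in blast)
  moreover have "lead b c n ((wd ^^ n) b c / fact n)"
    by (rule vo_remainder_lead[OF S sm(2) vo_remainder[OF S sm(2) nb]]) (use wb[OF n(1) nb] in blast)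
  ultimately show ?thesis by blast
qed

text \<open>If a combination \<open>a \<zeta> + b (cnj \<zeta>)\<close> vanished to higher order than \<open>a\<close>, its quotient by
  \<open>\<zeta> a\<close> would take values in the left half plane.\<close>

lemma pair_dichotomy:
  assumes S: "open S" "c \<in> S" and sm: "smooth_on S a" "smooth_on S b" "smooth_on S A" "smooth_on S B"
    and eqa: "\<And>w. w \<in> S \<Longrightarrow> wb a w = A w * a w + B w * cnj (b w)"
    and eqb: "\<And>w. w \<in> S \<Longrightarrow> wb b w = A w * b w + B w * cnj (a w)"
    and le: "\<And>w. w \<in> S \<Longrightarrow> norm (b w) \<le> norm (a w)"
    and nz: "\<not> (\<exists>r>0. \<forall>w\<in>ball c r. norm (a w) = norm (b w))"
  shows "\<exists>n \<alpha> \<beta>. norm \<beta> < norm \<alpha> \<and> lead a c n \<alpha> \<and> lead b c n \<beta>"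
proof -
  obtain r0 where r0: "r0 > 0" "ball c r0 \<subseteq> S" using openE[OF S] by blast
  have "\<not> (\<exists>r>0. \<forall>w\<in>ball c r. a w = 0)"
  proof
    assume "\<exists>r>0. \<forall>w\<in>ball c r. a w = 0"
    then obtain r where r: "r > 0" "\<And>w. w \<in> ball c r \<Longrightarrow> a w = 0" by blast
    have "norm (a w) = norm (b w)" if "w \<in> ball c (min r r0)" for w
    proof -
      have "w \<in> S" "a w = 0" using that r r0 by auto
      then show ?thesis using le[of w] by simp
    qed
    then show False using nz r r0 by (metis min_less_iff_conj)
  qed
  from pair_order[OF S sm eqa eqb le this]
  obtain n \<alpha> \<beta> where \<alpha>: "\<alpha> \<noteq> 0" and la: "lead a c n \<alpha>" and lb: "lead b c n \<beta>" by blast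
  have ta: "((\<lambda>w. a w / (w - c) ^ n) \<longlongrightarrow> \<alpha>) (at c)" and tb: "((\<lambda>w. b w / (w - c) ^ n) \<longlongrightarrow> \<beta>) (at c)"
    using la lb by (auto simp: lead_def)
  have evS: "\<forall>\<^sub>F w in at c. w \<in> S \<and> w \<noteq> c"
    using S by (auto simp: eventually_at_topological)
  have \<beta>le: "norm \<beta> \<le> norm \<alpha>"
  proof (rule tendsto_le[OF _ tendsto_norm[OF ta] tendsto_norm[OF tb]])
    show "\<forall>\<^sub>F w in at c. norm (b w / (w - c) ^ n) \<le> norm (a w / (w - c) ^ n)"
      using evS by eventually_elim (auto simp: norm_divide intro!: divide_right_mono le)
  qed auto
  have ne: "\<alpha> * \<zeta> + \<beta> * cnj \<zeta> \<noteq> 0" if \<zeta>: "\<zeta> \<noteq> 0" for \<zeta>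
  proof
    assume z: "\<alpha> * \<zeta> + \<beta> * cnj \<zeta> = 0"
    \<comment> \<open>With \<open>\<zeta>\<close> constant, \<open>\<xi>\<close> solves
      \<open>wb \<xi> = A \<xi> + B cnj \<xi>\<close>, so it forms with itself a pair to which
      \<open>pair_order\<close> applies.\<close>
    define \<xi> where "\<xi> = (\<lambda>w. a w * \<zeta> + b w * cnj \<zeta>)"
    have s\<xi>: "smooth_on S \<xi>" unfolding \<xi>_def by (intro smooth_on_add smooth_on_mult smooth_on_const S sm)
    have w\<xi>: "wb \<xi> w = A w * \<xi> w + B w * cnj (\<xi> w)" if w: "w \<in> S" for w
    proof -
      have "hasW \<xi> (wd a w * \<zeta> + wd b w * cnj \<zeta>) (wb a w * \<zeta> + wb b w * cnj \<zeta>) w"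
        unfolding \<xi>_def
        by (rule has_derivative_eq_rhs[OF has_derivative_add[OF
            has_derivative_mult_left[OF hasW_wirtinger[OF smooth_on_differentiable[OF sm(1) w]]]
            has_derivative_mult_left[OF hasW_wirtinger[OF smooth_on_differentiable[OF sm(2) w]]]]])
          (simp add: fun_eq_iff algebra_simps)
      from hasW_unique(2)[OF this] show ?thesis
        unfolding eqa[OF w] eqb[OF w] by (simp add: \<xi>_def algebra_simps)
    qed
    have "\<not> (\<exists>r>0. \<forall>w\<in>ball c r. \<xi> w = 0)"
    proof
      assume "\<exists>r>0. \<forall>w\<in>ball c r. \<xi> w = 0"
      then obtain r where r: "r > 0" "\<And>w. w \<in> ball c r \<Longrightarrow> \<xi> w = 0" by blast
      have "norm (a w) = norm (b w)" if w: "w \<in> ball c r" for w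
      proof -
        have "a w * \<zeta> = - (b w * cnj \<zeta>)" using r(2)[OF w] by (simp add: \<xi>_def eq_neg_iff_add_eq_0)
        then have "norm (a w * \<zeta>) = norm (b w * cnj \<zeta>)" by (simp only: norm_minus_cancel)
        then show ?thesis using \<zeta> by (simp add: norm_mult)
      qed
      then show False using nz r(1) by blast
    qed
    from pair_order[OF S s\<xi> s\<xi> sm(3,4) w\<xi> w\<xi> order_refl this]
    obtain m \<gamma> where \<gamma>: "\<gamma> \<noteq> 0" and "lead \<xi> c m \<gamma>" by blast
    then have t\<xi>: "((\<lambda>w. \<xi> w / (w - c) ^ m) \<longlongrightarrow> \<gamma>) (at c)" by (simp add: lead_def)
    have "((\<lambda>w. a w / (w - c) ^ n * \<zeta> + b w / (w - c) ^ n * cnj \<zeta>) \<longlongrightarrow> \<alpha> * \<zeta> + \<beta> * cnj \<zeta>) (at c)"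
      by (intro tendsto_intros ta tb)
    then have t0: "((\<lambda>w. \<xi> w / (w - c) ^ n) \<longlongrightarrow> 0) (at c)" unfolding z \<xi>_def by (simp add: add_divide_distrib)
    have mn: "n < m"
    proof (rule ccontr)
      assume "\<not> n < m"
      then obtain k where k: "n = m + k" using le_Suc_ex not_le by blast
      have "((\<lambda>w. \<xi> w / (w - c) ^ n * (w - c) ^ k) \<longlongrightarrow> 0 * (c - c) ^ k) (at c)"
        by (intro tendsto_intros t0)
      moreover have "\<forall>\<^sub>F w in at c. \<xi> w / (w - c) ^ n * (w - c) ^ k = \<xi> w / (w - c) ^ m"
        using evS by eventually_elim (auto simp: k power_add)
      ultimately have "((\<lambda>w. \<xi> w / (w - c) ^ m) \<longlongrightarrow> 0) (at c)"
        using tendsto_cong by fastforce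
      then show False using tendsto_unique[OF _ t\<xi>] \<gamma> by auto
    qed
    define k where "k = m - n"
    have k: "k > 0" "m = n + k" using mn by (auto simp: k_def)
    define \<kappa> where "\<kappa> = \<gamma> / (\<alpha> * \<zeta>)"
    have \<kappa>: "\<kappa> \<noteq> 0" using \<gamma> \<alpha> \<zeta> by (simp add: \<kappa>_def)
    have "((\<lambda>w. (\<xi> w / (w - c) ^ m) / (a w / (w - c) ^ n * \<zeta>)) \<longlongrightarrow> \<kappa>) (at c)"
      unfolding \<kappa>_def by (intro tendsto_intros t\<xi> ta) (use \<alpha> \<zeta> in auto)
    moreover have "\<forall>\<^sub>F w in at c. (\<xi> w / (w - c) ^ m) / (a w / (w - c) ^ n * \<zeta>) = \<xi> w / (a w * \<zeta>) / (w - c) ^ k"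
      using evS by eventually_elim (auto simp: k(2) power_add)
    ultimately have tk: "((\<lambda>w. \<xi> w / (a w * \<zeta>) / (w - c) ^ k) \<longlongrightarrow> \<kappa>) (at c)"
      using tendsto_cong by fastforce
    \<comment> \<open>A root chosen so that \<open>\<kappa> * u ^ k = - 1\<close>: on the ray in the
      direction \<open>u\<close> the quotient \<open>\<xi> / (a \<zeta>)\<close> behaves like
      \<open>- t ^ k\<close>, whereas \<open>norm b <= norm a\<close> keeps its real part
      nonnegative.\<close>
    define u where "u = exp (Ln (- 1 / \<kappa>) / of_nat k)"
    have uk: "u ^ k = - 1 / \<kappa>" unfolding u_def using k(1) \<kappa> by (simp add: exp_of_nat_mult[symmetric])
    have u0: "u \<noteq> 0" by (simp add: u_def)
    have lim: "filterlim (\<lambda>t. c + of_real t * u) (at c) (at_right 0)"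
    proof (rule filterlim_atI)
      have "((\<lambda>t. c + of_real t * u) \<longlongrightarrow> c + of_real 0 * u) (at_right 0)" by (intro tendsto_intros)
      then show "((\<lambda>t. c + of_real t * u) \<longlongrightarrow> c) (at_right 0)" by simp
      show "\<forall>\<^sub>F t in at_right 0. c + of_real t * u \<noteq> c"
        unfolding eventually_at_right_field using u0 by (intro exI[of _ 1]) auto
    qed
    have "((\<lambda>t. \<xi> (c + of_real t * u) / (a (c + of_real t * u) * \<zeta>) / (of_real t * u) ^ k * u ^ k) \<longlongrightarrow> \<kappa> * u ^ k) (at_right 0)"
      using tendsto_mult_right[OF filterlim_compose[OF tk lim], of "u ^ k"] by simp
    then have "((\<lambda>t. Re (\<xi> (c + of_real t * u) / (a (c + of_real t * u) * \<zeta>) / (of_real t * u) ^ k * u ^ k)) \<longlongrightarrow> Re (\<kappa> * u ^ k)) (at_right 0)"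
      by (rule tendsto_Re)
    moreover have "\<forall>\<^sub>F t in at_right 0. 0 \<le> Re (\<xi> (c + of_real t * u) / (a (c + of_real t * u) * \<zeta>) / (of_real t * u) ^ k * u ^ k)"
    proof -
      have "\<forall>\<^sub>F t in at_right 0. c + of_real t * u \<in> S \<and> c + of_real t * u \<noteq> c"
        using filterlim_iff[THEN iffD1, OF lim] evS by blast
      moreover have "\<forall>\<^sub>F t::real in at_right 0. t > 0" by (simp add: eventually_at_right_less)
      ultimately show ?thesis
      proof eventually_elim
        case (elim t)
        define w where "w = c + of_real t * u"
        have "Re (b w * cnj \<zeta> * cnj (a w * \<zeta>)) \<ge> - (norm (a w) * norm (a w) * norm \<zeta> ^ 2)"
        proof -
          have "norm (b w * cnj \<zeta> * cnj (a w * \<zeta>)) \<le> norm (a w) * norm (a w) * norm \<zeta> ^ 2"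
            using le[of w] elim mult_right_mono[of "norm (b w)" "norm (a w)" "norm (a w) * norm \<zeta> ^ 2"]
            by (simp add: norm_mult w_def power2_eq_square mult_ac)
          then show ?thesis using abs_Re_le_cmod[of "b w * cnj \<zeta> * cnj (a w * \<zeta>)"] by linarith
        qed
        moreover have "a w * \<zeta> * cnj (a w * \<zeta>) = of_real (norm (a w) * norm (a w) * norm \<zeta> ^ 2)"
          unfolding complex_norm_square[of "a w * \<zeta>", symmetric] by (simp add: norm_mult power2_eq_square mult_ac)
        ultimately have "Re (\<xi> w * cnj (a w * \<zeta>)) \<ge> 0"
          by (simp add: \<xi>_def distrib_right del: complex_cnj_mult)
        then have "Re (\<xi> w / (a w * \<zeta>)) \<ge> 0"
          unfolding complex_div_cnj[of "\<xi> w"] by (simp add: Re_divide_of_real flip: of_real_power)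
        moreover have "\<xi> w / (a w * \<zeta>) / (of_real t * u) ^ k * u ^ k = \<xi> w / (a w * \<zeta>) / of_real (t ^ k)"
          using u0 elim by (simp add: power_mult_distrib)
        ultimately show ?case
          using elim unfolding w_def by (simp only: Re_divide_of_real) (simp add: divide_nonneg_pos)
      qed
    qed
    ultimately have "0 \<le> Re (\<kappa> * u ^ k)"
      by (rule tendsto_lowerbound) auto
    then show False using uk \<kappa> by simp
  qed
  have "norm \<beta> \<noteq> norm \<alpha>"
  proof
    assume eq: "norm \<beta> = norm \<alpha>"
    \<comment> \<open>If the norms agreed, this \<open>\<zeta>\<close> of norm 1 would satisfy
      \<open>\<alpha> * \<zeta> + \<beta> * cnj \<zeta> = 0\<close>, against
      \<open>ne\<close>.\<close>
    define \<zeta> where "\<zeta> = csqrt (- \<beta> / \<alpha>)"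
    have n1: "norm (- \<beta> / \<alpha>) = 1" using eq \<alpha> by (simp add: norm_divide)
    have z2: "\<zeta> * \<zeta> = - \<beta> / \<alpha>" unfolding \<zeta>_def power2_eq_square[symmetric] by simp
    have nz: "norm \<zeta> * norm \<zeta> = 1" using n1 z2 by (metis norm_mult)
    then have z0: "\<zeta> \<noteq> 0" by auto
    have "\<zeta> * cnj \<zeta> = 1" using nz unfolding complex_norm_square[symmetric] by (simp add: power2_eq_square flip: of_real_mult)
    then have "\<alpha> * \<zeta> + \<beta> * cnj \<zeta> = \<alpha> * (\<zeta> * \<zeta>) * cnj \<zeta> + \<beta> * cnj \<zeta>" by (simp add: mult.assoc)
    also have "\<dots> = 0" unfolding z2 using \<alpha> by simp
    finally show False using ne[OF z0] by simp
  qed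
  then show ?thesis using \<beta>le la lb by (metis order_le_less)
qed

subsection \<open>Dividing out the zeros\<close>

definition zprod :: "complex set \<Rightarrow> (complex \<Rightarrow> nat) \<Rightarrow> complex \<Rightarrow> complex" where
  "zprod Z n w = (\<Prod>\<zeta>\<in>Z. (w - \<zeta>) ^ n \<zeta>)"

text \<open>\<open>\<phi> w\<close> stands for the leading coefficient of \<open>f\<close> at the
  zero \<open>w\<close>, so that the first branch extends \<open>f / zprod Z n\<close> continuously
  to the zeros.\<close>

definition zquot :: "complex set \<Rightarrow> (complex \<Rightarrow> nat) \<Rightarrow> (complex \<Rightarrow> complex) \<Rightarrow> (complex \<Rightarrow> complex) \<Rightarrow> complex \<Rightarrow> complex" where
  "zquot Z n \<phi> f w = (if w \<in> Z then \<phi> w / zprod (Z - {w}) n w else f w / zprod Z n w)"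

definition zlogd :: "complex set \<Rightarrow> (complex \<Rightarrow> nat) \<Rightarrow> complex \<Rightarrow> complex" where
  "zlogd Z n w = (\<Sum>\<zeta>\<in>Z. of_nat (n \<zeta>) / (w - \<zeta>))"

text \<open>Off \<open>Z\<close> this is the \<open>wd\<close> derivative of
  \<open>f / zprod Z n\<close>, with \<open>zlogd\<close> the logarithmic derivative of the
  product.\<close>

definition zquotd :: "complex set \<Rightarrow> (complex \<Rightarrow> nat) \<Rightarrow> (complex \<Rightarrow> complex) \<Rightarrow> complex \<Rightarrow> complex" where
  "zquotd Z n f w = wd f w / zprod Z n w - f w / zprod Z n w * zlogd Z n w"

lemma zprod_nonzero: "finite Z \<Longrightarrow> w \<notin> Z \<Longrightarrow> zprod Z n w \<noteq> 0"
  by (auto simp: zprod_def)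

lemma zprod_split: "finite Z \<Longrightarrow> \<zeta> \<in> Z \<Longrightarrow> zprod Z n w = (w - \<zeta>) ^ n \<zeta> * zprod (Z - {\<zeta>}) n w"
  unfolding zprod_def by (rule prod.remove)

lemma continuous_on_zprod: "continuous_on T (zprod Z n)"
  unfolding zprod_def by (intro continuous_intros)

lemma continuous_on_zlogd: "finite Z \<Longrightarrow> continuous_on (- Z) (zlogd Z n)"
  unfolding zlogd_def by (intro continuous_intros) auto

lemma zprod_derivative:
  assumes "finite Z" "w \<notin> Z"
  shows "(zprod Z n has_field_derivative zprod Z n w * zlogd Z n w) (at w)"
  using assms
proof (induction Z rule: finite_induct)
  case empty
  then show ?case by (simp add: zprod_def[abs_def] zlogd_def)
next
  case (insert x F)
  have e: "zprod (insert x F) n = (\<lambda>w. (w - x) ^ n x * zprod F n w)"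
    using insert by (auto simp: zprod_def)
  have d: "((\<lambda>w. (w - x) ^ n x) has_field_derivative (w - x) ^ n x * (of_nat (n x) / (w - x))) (at w)"
  proof -
    have "((\<lambda>w. (w - x) ^ n x) has_field_derivative (of_nat (n x) * (w - x) ^ (n x - 1))) (at w)"
      by (auto intro!: derivative_eq_intros)
    moreover have "of_nat (n x) * (w - x) ^ (n x - 1) = (w - x) ^ n x * (of_nat (n x) / (w - x))"
      using insert by (cases "n x") (auto simp: field_simps)
    ultimately show ?thesis by simp
  qed
  show ?case unfolding e
    by (rule DERIV_cong[OF DERIV_mult[OF d insert.IH]]) (use insert in \<open>auto simp: zlogd_def algebra_simps\<close>)
qed

lemma zprod_bounds:
  assumes "finite Z"
  shows "(\<And>\<zeta>. \<zeta> \<in> Z \<Longrightarrow> norm (w - \<zeta>) \<le> D) \<Longrightarrow> norm (zprod Z n w) \<le> D ^ (\<Sum>\<zeta>\<in>Z. n \<zeta>)"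
    and "0 \<le> d \<Longrightarrow> (\<And>\<zeta>. \<zeta> \<in> Z \<Longrightarrow> d \<le> norm (w - \<zeta>)) \<Longrightarrow> d ^ (\<Sum>\<zeta>\<in>Z. n \<zeta>) \<le> norm (zprod Z n w)"
  unfolding zprod_def prod_norm[symmetric] norm_power power_sum
  by (auto intro!: prod_mono power_mono)

text \<open>Origin of the unimodular factor: in the equations for the quotients the conjugated
  unknown is divided by \<open>P\<close> and not by \<open>cnj P\<close>.\<close>

lemma cnj_zprod: "finite Z \<Longrightarrow> w \<notin> Z \<Longrightarrow> cnj (x / zprod Z n w) * unimod Z n w = cnj x / zprod Z n w"
  using zprod_nonzero[of Z w n]
  by (simp add: unimod_def zprod_def power_divide prod_dividef)

lemma zquot_hasW:
  assumes "finite Z" "w \<notin> Z" "f differentiable (at w)"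
  shows "hasW (zquot Z n \<phi> f) (zquotd Z n f w) (wb f w / zprod Z n w) w"
proof -
  have e: "zquotd Z n f w = wd f w / zprod Z n w - f w * (zprod Z n w * zlogd Z n w) / (zprod Z n w)\<^sup>2"
    using zprod_nonzero[OF assms(1,2), of n] by (simp add: zquotd_def power2_eq_square)
  have "hasW (\<lambda>w. f w / zprod Z n w) (zquotd Z n f w) (wb f w / zprod Z n w) w"
    unfolding e
    by (rule hasW_divide[OF hasW_wirtinger[OF assms(3)] zprod_derivative[OF assms(1,2)] zprod_nonzero[OF assms(1,2)]])
  then show ?thesis
    by (rule has_derivative_transform_within_open[OF _ open_Compl[OF finite_imp_closed[OF assms(1)]]])
      (use assms in \<open>auto simp: zquot_def\<close>)
qed

lemma eventually_notin_finite:
  fixes w :: complex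
  assumes "finite Z"
  shows "\<forall>\<^sub>F x in at w. x \<notin> Z - {w}"
proof -
  have "open (- (Z - {w}))" by (rule open_Compl[OF finite_imp_closed]) (use assms in simp)
  then show ?thesis unfolding eventually_at_topological by (intro exI[of _ "- (Z - {w})"]) auto
qed

lemma zquot_isCont:
  assumes "finite Z" and "w \<in> Z \<Longrightarrow> lead f w (n w) (\<phi> w)" and "f differentiable (at w)"
  shows "isCont (zquot Z n \<phi> f) w"
proof (cases "w \<in> Z")
  case False
  then show ?thesis
    using has_derivative_continuous[OF zquot_hasW[OF assms(1) False assms(3)]] by blast
next
  case True
  have t: "((\<lambda>x. f x / (x - w) ^ n w) \<longlongrightarrow> \<phi> w) (at w)" using assms(2)[OF True] by (simp add: lead_def)
  have nz: "zprod (Z - {w}) n w \<noteq> 0" using assms(1) by (intro zprod_nonzero) auto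
  have "isCont (zprod (Z - {w}) n) w"
    using continuous_on_zprod[of UNIV "Z - {w}" n] by (simp add: continuous_on_eq_continuous_at)
  then have "((\<lambda>x. (f x / (x - w) ^ n w) / zprod (Z - {w}) n x) \<longlongrightarrow> \<phi> w / zprod (Z - {w}) n w) (at w)"
    using nz by (intro tendsto_divide t) (auto simp: isCont_def)
  moreover have "\<forall>\<^sub>F x in at w. (f x / (x - w) ^ n w) / zprod (Z - {w}) n x = zquot Z n \<phi> f x"
  proof -
    have "\<forall>\<^sub>F x in at w. x \<notin> Z - {w}"
      by (rule eventually_notin_finite[OF assms(1)])
    moreover have "\<forall>\<^sub>F x in at w. x \<noteq> w" by (simp add: eventually_neq_at_within)
    ultimately show ?thesis
      by eventually_elim (auto simp: zquot_def zprod_split[OF assms(1) True])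
  qed
  ultimately have "(zquot Z n \<phi> f \<longlongrightarrow> \<phi> w / zprod (Z - {w}) n w) (at w)"
    using tendsto_cong by fastforce
  then show ?thesis using True by (simp add: isCont_def zquot_def)
qed

lemma tendsto_eventually_norm_le: "(f \<longlongrightarrow> l) F \<Longrightarrow> \<forall>\<^sub>F x in F. norm (f x) \<le> norm l + 1"
  using order_tendstoD(2)[OF tendsto_norm, of f l F "norm l + 1"]
  by (auto elim: eventually_mono)

text \<open>At a zero the two terms are singular separately, and the second clause of
  \<open>lead\<close> bounds their combination. The bound is not uniform in any parameter, but it
  makes the supremum finite that is absorbed in \<open>hol_quotient\<close>.\<close>

lemma zquotd_locally_bounded:
  assumes "finite Z" and "w \<in> Z \<Longrightarrow> lead f w (n w) (\<phi> w)" and f: "open S" "smooth_on S f" "w \<in> S"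
  shows "\<exists>K. \<forall>\<^sub>F x in at w. norm (zquotd Z n f x) \<le> K"
proof (cases "w \<in> Z")
  case False
  have "open (S - Z)" using f(1) assms(1) by (intro open_Diff finite_imp_closed)
  moreover have "continuous_on (S - Z) (zquotd Z n f)"
    unfolding zquotd_def
    by (intro continuous_intros continuous_on_zprod continuous_on_subset[OF smooth_on_continuous_on[OF smooth_wd[OF f(1,2)]]]
        continuous_on_subset[OF smooth_on_continuous_on[OF f(2)]] continuous_on_subset[OF continuous_on_zlogd[OF assms(1)]])
      (use zprod_nonzero[OF assms(1)] in auto)
  ultimately have "isCont (zquotd Z n f) w" using False f(3) by (simp add: continuous_on_eq_continuous_at)
  then show ?thesis using tendsto_eventually_norm_le unfolding isCont_def by blast
next
  case True
  define Q where "Q = zprod (Z - {w}) n"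
  have t: "((\<lambda>x. f x / (x - w) ^ n w) \<longlongrightarrow> \<phi> w) (at w)" using assms(2)[OF True] by (simp add: lead_def)
  obtain K where K: "\<forall>\<^sub>F x in at w. norm (wd f x / (x - w) ^ n w - of_nat (n w) * f x / (x - w) ^ Suc (n w)) \<le> K"
    using assms(2)[OF True] by (auto simp: lead_def)
  have nz: "Q w \<noteq> 0" unfolding Q_def using assms(1) by (intro zprod_nonzero) auto
  have Qc: "(Q \<longlongrightarrow> Q w) (at w)"
    using continuous_on_zprod[of UNIV "Z - {w}" n] by (simp add: continuous_on_eq_continuous_at isCont_def Q_def)
  have "continuous_on (- (Z - {w})) (zlogd (Z - {w}) n)" by (rule continuous_on_zlogd) (use assms in auto)
  then have "isCont (zlogd (Z - {w}) n) w"
    using continuous_on_eq_continuous_at[OF open_Compl[OF finite_imp_closed[of "Z - {w}"]]] assms(1) by blast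
  then have Lc: "(zlogd (Z - {w}) n \<longlongrightarrow> zlogd (Z - {w}) n w) (at w)" by (simp add: isCont_def)
  obtain K1 where K1: "\<forall>\<^sub>F x in at w. norm (1 / Q x) \<le> K1"
    using tendsto_eventually_norm_le[OF tendsto_divide[OF tendsto_const Qc nz]] by blast
  obtain K2 where K2: "\<forall>\<^sub>F x in at w. norm (f x / (x - w) ^ n w / Q x * zlogd (Z - {w}) n x) \<le> K2"
    using tendsto_eventually_norm_le[OF tendsto_mult[OF tendsto_divide[OF t Qc nz] Lc]] by blast
  have off: "\<forall>\<^sub>F x in at w. x \<notin> Z - {w}"
    by (rule eventually_notin_finite[OF assms(1)])
  have ne: "\<forall>\<^sub>F x in at w. x \<noteq> w" by (simp add: eventually_neq_at_within)
  have "\<forall>\<^sub>F x in at w. norm (zquotd Z n f x) \<le> K * K1 + K2"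
    using K K1 K2 off ne
  proof eventually_elim
    case (elim x)
    have Qx: "Q x \<noteq> 0" unfolding Q_def using assms(1) elim by (intro zprod_nonzero) auto
    have P: "zprod Z n x = (x - w) ^ n w * Q x" unfolding Q_def by (rule zprod_split[OF assms(1) True])
    have L: "zlogd Z n x = of_nat (n w) / (x - w) + zlogd (Z - {w}) n x"
      unfolding zlogd_def by (rule sum.remove[OF assms(1) True])
    have "zquotd Z n f x = (wd f x / (x - w) ^ n w - of_nat (n w) * f x / (x - w) ^ Suc (n w)) * (1 / Q x)
        - f x / (x - w) ^ n w / Q x * zlogd (Z - {w}) n x"
      unfolding zquotd_def P L using elim Qx by (simp add: field_simps)
    also have "norm \<dots> \<le> K * K1 + K2"
    proof (rule order_trans[OF norm_triangle_ineq4 add_mono])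
      have "K \<ge> 0" using elim(1) norm_ge_zero order_trans by blast
      then show "norm ((wd f x / (x - w) ^ n w - of_nat (n w) * f x / (x - w) ^ Suc (n w)) * (1 / Q x)) \<le> K * K1"
        unfolding norm_mult using elim by (intro mult_mono) auto
    qed (use elim in auto)
    finally show ?case .
  qed
  then show ?thesis by blast
qed

lemma locally_bounded_imp_bounded:
  fixes f :: "complex \<Rightarrow> real"
  assumes "compact X" "\<And>x. x \<in> X \<Longrightarrow> \<exists>K. \<forall>\<^sub>F y in at x. f y \<le> K"
  shows "\<exists>K. \<forall>y\<in>X. f y \<le> K"
proof -
  have "\<exists>U K. open U \<and> x \<in> U \<and> (\<forall>y\<in>U. f y \<le> K)" if x: "x \<in> X" for x
  proof -
    obtain K where "\<forall>\<^sub>F y in at x. f y \<le> K" using assms(2)[OF x] by blast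
    then obtain U where "open U" "x \<in> U" "\<And>y. y \<in> U \<Longrightarrow> y \<noteq> x \<Longrightarrow> f y \<le> K"
      unfolding eventually_at_topological by blast
    then have "\<forall>y\<in>U. f y \<le> max K (f x)" by force
    then show ?thesis using \<open>open U\<close> \<open>x \<in> U\<close> by blast
  qed
  then obtain U K where UK: "\<And>x. x \<in> X \<Longrightarrow> open (U x) \<and> x \<in> U x \<and> (\<forall>y\<in>U x. f y \<le> K x)" by metis
  obtain D where D: "D \<subseteq> X" "finite D" "X \<subseteq> (\<Union>x\<in>D. U x)"
    using compactE_image[OF assms(1), of X U] UK by blast
  have "f y \<le> Max (K ` D)" if y: "y \<in> X" for y
  proof -
    obtain x where x: "x \<in> D" "y \<in> U x" using D y by blast
    then have "f y \<le> K x" using UK D by blast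
    also have "\<dots> \<le> Max (K ` D)" using x D by (intro Max_ge) auto
    finally show ?thesis .
  qed
  then show ?thesis by blast
qed

text \<open>One slice, with \<open>z\<close> fixed. The numbers \<open>r\<close>, \<open>C\<close>,
  \<open>c0\<close>, \<open>M\<close>, \<open>Nm\<close> are common to all nearby slices, so
  estimates in terms of them are uniform in \<open>z\<close>. By \<open>ann\<close> all zeros lie
  within \<open>r / 64\<close> of \<open>x0\<close>, and \<open>2 * r <= 1\<close> makes the
  polynomial of the zeros at most 1 in norm on the disc.\<close>

locale slice =
  fixes a b A B :: "complex \<Rightarrow> complex" and S :: "complex set" and x0 :: complex
    and r C c0 M :: real and Nm :: nat
  assumes S: "open S" "cball x0 r \<subseteq> S" and r: "0 < r" "2 * r \<le> 1"
    and C: "0 \<le> C" "r * (2 * C) \<le> 1/2" and c0: "0 < c0" and Nm: "2 * M / c0 < 2 ^ Nm"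
    and sm: "smooth_on S a" "smooth_on S b"
    and eqa: "\<And>w. w \<in> S \<Longrightarrow> wb a w = A w * a w + B w * cnj (b w)"
    and eqb: "\<And>w. w \<in> S \<Longrightarrow> wb b w = A w * b w + B w * cnj (a w)"
    and le: "\<And>w. w \<in> S \<Longrightarrow> norm (b w) \<le> norm (a w)"
    and AB: "\<And>w. w \<in> cball x0 r \<Longrightarrow> norm (A w) \<le> C" "\<And>w. w \<in> cball x0 r \<Longrightarrow> norm (B w) \<le> C"
    and ABL: "\<And>w w'. w \<in> cball x0 r \<Longrightarrow> w' \<in> cball x0 r \<Longrightarrow> norm (A w - A w') \<le> C * norm (w - w')"
      "\<And>w w'. w \<in> cball x0 r \<Longrightarrow> w' \<in> cball x0 r \<Longrightarrow> norm (B w - B w') \<le> C * norm (w - w')"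
    and M: "\<And>w. w \<in> cball x0 r \<Longrightarrow> norm (a w) \<le> M"
      "\<And>w. w \<in> cball x0 r \<Longrightarrow> norm (wd a w) \<le> M" "\<And>w. w \<in> cball x0 r \<Longrightarrow> norm (wd b w) \<le> M"
    and ann: "\<And>w. r / 64 \<le> dist x0 w \<Longrightarrow> dist x0 w \<le> r \<Longrightarrow> c0 \<le> norm (a w)"
    and leads: "\<And>c. c \<in> cball x0 r \<Longrightarrow> \<exists>n \<alpha> \<beta>. norm \<beta> < norm \<alpha> \<and> lead a c n \<alpha> \<and> lead b c n \<beta>"
begin

definition Z where "Z = {w \<in> cball x0 r. a w = 0}"

lemma eventually_nonzero:
  assumes "c \<in> cball x0 r"
  shows "\<forall>\<^sub>F w in at c. a w \<noteq> 0"
proof -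
  obtain n \<alpha> where "\<alpha> \<noteq> 0" "((\<lambda>w. a w / (w - c) ^ n) \<longlongrightarrow> \<alpha>) (at c)"
    using leads[OF assms] unfolding lead_def by (metis norm_zero not_less norm_ge_zero)
  then have "\<forall>\<^sub>F w in at c. a w / (w - c) ^ n \<noteq> 0" using tendsto_imp_eventually_ne by blast
  then show ?thesis by eventually_elim auto
qed

lemma finite_Z: "finite Z"
proof (rule ccontr)
  assume "infinite Z"
  moreover have "compact (cball x0 r)" "Z \<subseteq> cball x0 r" by (auto simp: Z_def)
  ultimately obtain x where x: "x \<in> cball x0 r" "x islimpt Z"
    unfolding compact_eq_Bolzano_Weierstrass by blast
  have "\<forall>\<^sub>F w in at x. w \<notin> Z" using eventually_nonzero[OF x(1)] by eventually_elim (auto simp: Z_def)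
  then show False using x(2) by (simp add: islimpt_iff_eventually)
qed

lemma Z_small: "\<zeta> \<in> Z \<Longrightarrow> dist x0 \<zeta> < r / 64"
  using ann[of \<zeta>] c0 by (force simp: Z_def)

lemma wb_le:
  assumes "w \<in> cball x0 r"
  shows "norm (wb a w) \<le> 2 * C * norm (a w)" "norm (wb b w) \<le> 2 * C * norm (a w)"
proof -
  have wS: "w \<in> S" using S assms by blast
  have l: "norm (b w) \<le> norm (a w)" using le wS .
  have "norm (wb a w) \<le> norm (A w) * norm (a w) + norm (B w) * norm (b w)"
    unfolding eqa[OF wS] using norm_triangle_ineq[of "A w * a w" "B w * cnj (b w)"] by (simp add: norm_mult)
  also have "\<dots> \<le> C * norm (a w) + C * norm (a w)"
    using AB assms l by (intro add_mono mult_mono) (auto simp: C)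
  finally show "norm (wb a w) \<le> 2 * C * norm (a w)" by simp
  have "norm (wb b w) \<le> norm (A w) * norm (b w) + norm (B w) * norm (a w)"
    unfolding eqb[OF wS] using norm_triangle_ineq[of "A w * b w" "B w * cnj (a w)"] by (simp add: norm_mult)
  also have "\<dots> \<le> C * norm (a w) + C * norm (a w)"
    using AB assms l by (intro add_mono mult_mono) (auto simp: C)
  finally show "norm (wb b w) \<le> 2 * C * norm (a w)" by simp
qed

text \<open>\<open>15 * r / 64 = r / 4 - r / 64\<close> bounds from below the distance of a zero
  from a point at distance at least \<open>r / 4\<close> from the centre; \<open>\<sigma>\<close> is
  its inverse. \<open>M1\<close> bounds the quotients by \<open>P\<close>, and \<open>Lw\<close> is
  twice the part of the estimate of their derivatives that is free of the unknown bound
  \<open>L\<close>, hence the bound after absorption.\<close>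

definition "\<sigma> = 64 / (15 * r)"
definition "M1 = 2 * (M * \<sigma> ^ Nm)"
definition "K0 = M * \<sigma> ^ Nm + M1 * (Nm * \<sigma>) + 4 * M1 / r + 8 * pi * (C * M1) * Nm"
definition "Lw = 2 * (K0 + 64 * C\<^sup>2 * M1 + (2 * C * M1 + M1) / 2)"
definition "Lip = 4 * Lw / c0 + 4 * C"

lemma M_pos: "0 < M"
proof -
  have "r / 64 \<le> dist x0 (x0 + of_real r)" "dist x0 (x0 + of_real r) \<le> r" using r by (auto simp: dist_norm)
  then show ?thesis using ann[of "x0 + of_real r"] M(1)[of "x0 + of_real r"] c0 by simp
qed

lemma \<sigma>: "1 \<le> \<sigma>" using r by (simp add: \<sigma>_def)

lemma nonneg: "0 \<le> M1" "0 \<le> K0" "0 \<le> Lw" "0 \<le> Lip"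
proof -
  show 1: "0 \<le> M1" using M_pos \<sigma> by (simp add: M1_def)
  then show 2: "0 \<le> K0" using M_pos \<sigma> r C by (auto simp: K0_def intro!: add_nonneg_nonneg mult_nonneg_nonneg)
  then show 3: "0 \<le> Lw" using 1 C by (auto simp: Lw_def intro!: add_nonneg_nonneg mult_nonneg_nonneg)
  show "0 \<le> Lip" using 3 C c0 by (simp add: Lip_def)
qed

text \<open>The function is \<open>be / al\<close>, with \<open>al\<close> and \<open>be\<close> the
  quotients of \<open>a\<close> and \<open>b\<close> by the polynomial \<open>P\<close> of the
  zeros: \<open>al\<close> stays away from 0, so derivative bounds of \<open>al\<close> and
  \<open>be\<close> pass to their quotient. The last clause serves the comparison of slices: in
  every disc of radius \<open>\<delta>\<close> some value of \<open>a\<close> is at least of order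
  \<open>\<delta> ^ Nm\<close>.\<close>

lemma hol_quotient:
  "\<exists>q. continuous_on (cball x0 r) q \<and> (\<forall>w\<in>cball x0 r. a w \<noteq> 0 \<longrightarrow> q w = b w / a w) \<and>
     (\<forall>w\<in>cball x0 r. norm (q w) < 1) \<and>
     (\<forall>w\<in>cball x0 r. \<forall>w'\<in>cball x0 r. norm (q w - q w') \<le> Lip * norm (w - w')) \<and>
     (\<forall>w\<in>cball x0 (r/2). \<forall>\<delta>. 0 < \<delta> \<and> \<delta> \<le> r / 2 \<longrightarrow>
        (\<exists>w'\<in>cball w \<delta>. c0 / 2 * (\<delta> / (2 * (Nm + 1))) ^ Nm \<le> norm (a w')))"
proof -
  have "\<forall>\<zeta>. \<exists>n \<alpha> \<beta>. \<zeta> \<in> Z \<longrightarrow> norm \<beta> < norm \<alpha> \<and> lead a \<zeta> n \<alpha> \<and> lead b \<zeta> n \<beta>"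
    using leads unfolding Z_def by blast
  then obtain n \<alpha> \<beta> where lead: "\<And>\<zeta>. \<zeta> \<in> Z \<Longrightarrow> norm (\<beta> \<zeta>) < norm (\<alpha> \<zeta>) \<and> lead a \<zeta> (n \<zeta>) (\<alpha> \<zeta>) \<and> lead b \<zeta> (n \<zeta>) (\<beta> \<zeta>)"
    by metis
  define N where "N = (\<Sum>\<zeta>\<in>Z. n \<zeta>)"
  define P where "P = zprod Z n"
  define al where "al = zquot Z n \<alpha> a"
  define be where "be = zquot Z n \<beta> b"
  define p1 where "p1 = zquotd Z n a"
  define p2 where "p2 = zquotd Z n b"
  define q1 where "q1 = (\<lambda>w. wb a w / P w)"
  define q2 where "q2 = (\<lambda>w. wb b w / P w)"
  have cS: "w \<in> S" if "w \<in> cball x0 r" for w using that S by blast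
  have da: "a differentiable (at w)" "b differentiable (at w)" if "w \<in> cball x0 r" for w
    using smooth_on_differentiable[OF _ cS[OF that]] sm by auto
  have Pnz: "P w \<noteq> 0" if "w \<notin> Z" for w unfolding P_def by (rule zprod_nonzero[OF finite_Z that])
  have Wal: "hasW al (p1 w) (q1 w) w" and Wbe: "hasW be (p2 w) (q2 w) w" if "w \<in> cball x0 r - Z" for w
    unfolding al_def p1_def q1_def be_def p2_def q2_def P_def using that
    by (intro zquot_hasW[OF finite_Z _ da(1)] zquot_hasW[OF finite_Z _ da(2)]; simp)+
  have alP: "al w = a w / P w" "be w = b w / P w" if "w \<notin> Z" for w
    using that by (auto simp: al_def be_def zquot_def P_def)
  have alc: "continuous_on (cball x0 r) al" "continuous_on (cball x0 r) be"
    unfolding al_def be_def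
    by (intro continuous_at_imp_continuous_on ballI zquot_isCont finite_Z; use lead da in blast)+
  have pqc: "continuous_on (S - Z) p1" "continuous_on (S - Z) p2" "continuous_on (S - Z) q1" "continuous_on (S - Z) q2"
  proof -
    have c: "continuous_on (S - Z) f" if "smooth_on S f" for f :: "complex \<Rightarrow> complex"
      using continuous_on_subset[OF smooth_on_continuous_on[OF that], of "S - Z"] by blast
    have l: "continuous_on (S - Z) (zlogd Z n)"
      by (rule continuous_on_subset[OF continuous_on_zlogd[OF finite_Z]]) auto
    note c' = c[OF sm(1)] c[OF sm(2)] c[OF smooth_wd[OF S(1) sm(1)]] c[OF smooth_wd[OF S(1) sm(2)]]
      c[OF smooth_wb[OF S(1) sm(1)]] c[OF smooth_wb[OF S(1) sm(2)]]
    show "continuous_on (S - Z) p1" "continuous_on (S - Z) p2" "continuous_on (S - Z) q1" "continuous_on (S - Z) q2"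
      unfolding p1_def p2_def q1_def q2_def zquotd_def P_def
      by (intro continuous_intros continuous_on_zprod l c'; use zprod_nonzero[OF finite_Z] in auto)+
  qed
  note pqc' = pqc[THEN continuous_on_subset]
  have bS: "ball x0 r - Z \<subseteq> S - Z" using S by auto
  have alnz: "al w \<noteq> 0" if "w \<in> cball x0 r" for w
  proof (cases "w \<in> Z")
    case True
    then have "\<alpha> w \<noteq> 0" using lead[OF True] by auto
    then show ?thesis using True zprod_nonzero[of "Z - {w}" w n] finite_Z by (simp add: al_def zquot_def)
  next
    case False
    then have "a w \<noteq> 0" using that by (simp add: Z_def)
    then show ?thesis using False Pnz alP by simp
  qed
  have beal: "norm (be w) \<le> norm (al w)" if "w \<in> cball x0 r" for w
  proof (cases "w \<in> Z")
    case True
    then show ?thesis using lead[OF True] by (simp add: al_def be_def zquot_def norm_divide divide_right_mono)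
  next
    case False
    then show ?thesis using le[OF cS[OF that]] by (simp add: alP norm_divide divide_right_mono)
  qed
  have qal: "norm (q1 w) \<le> 2 * C * norm (al w)" "norm (q2 w) \<le> 2 * C * norm (al w)" if "w \<in> cball x0 r - Z" for w
    using that wb_le[of w] by (auto simp: q1_def q2_def alP norm_divide divide_right_mono)
  have dZ: "15 * r / 64 \<le> norm (w - \<zeta>)" if "r / 4 \<le> dist x0 w" "\<zeta> \<in> Z" for w \<zeta>
    using dist_triangle[of x0 w \<zeta>] Z_small[OF that(2)] that(1) by (simp add: dist_norm norm_minus_commute)
  have \<sigma>r: "15 * r / 64 = inverse \<sigma>" by (simp add: \<sigma>_def)
  have Plow: "1 \<le> \<sigma> ^ N * norm (P w)" if "r / 4 \<le> dist x0 w" for w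
  proof -
    have "(15 * r / 64) ^ N \<le> norm (P w)"
      unfolding P_def N_def using r by (intro zprod_bounds finite_Z dZ[OF that]) auto
    then have "\<sigma> ^ N * (15 * r / 64) ^ N \<le> \<sigma> ^ N * norm (P w)" using \<sigma> by (intro mult_left_mono) auto
    then show ?thesis unfolding \<sigma>r using \<sigma> by (simp add: power_inverse)
  qed
  have notZ: "w \<notin> Z" if "r / 4 \<le> dist x0 w" for w using Z_small[of w] that r by fastforce
  have quotP: "norm (x / P w) \<le> norm x * \<sigma> ^ N" if "r / 4 \<le> dist x0 w" for x w
  proof -
    have "norm (x / P w) = norm x * (1 / norm (P w))" by (simp add: norm_divide)
    also have "\<dots> \<le> norm x * \<sigma> ^ N"
      using Plow[OF that] Pnz[OF notZ[OF that]] by (intro mult_left_mono) (auto simp: divide_le_eq)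
    finally show ?thesis .
  qed
  \<comment> \<open>Division by \<open>P\<close> is harmless on the annulus, where the zeros are at
    distance at least \<open>1 / \<sigma>\<close>; the maximum principle carries the bound across
    the zeros.\<close>
  have al_le': "norm (al w) \<le> 2 * (M * \<sigma> ^ N)" if "w \<in> cball x0 r" for w
  proof (rule annulus_maximum[OF finite_Z r(1) alc(1) Wal pqc'(1)[OF bS] pqc'(3)[OF bS] qal(1) _ C(2) _ that])
    show "norm (al w) \<le> M * \<sigma> ^ N" if "r / 4 \<le> dist x0 w" "dist x0 w \<le> r" for w
      unfolding alP(1)[OF notZ[OF that(1)]]
      by (rule order_trans[OF quotP[OF that(1)]]) (use M(1)[of w] \<sigma> that in \<open>auto intro!: mult_right_mono\<close>)
  qed (use C in auto)
  \<comment> \<open>The reciprocal of \<open>al\<close> satisfies the same differential inequality,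
    so the maximum principle also bounds \<open>al\<close> from below; on the annulus
    \<open>norm (P w) <= 1\<close> gives the bound.\<close>
  have inv_le: "norm (1 / al w) \<le> 2 * (1 / c0)" if "w \<in> cball x0 r" for w
  proof (rule annulus_maximum[OF finite_Z r(1) _ _ _ _ _ _ C(2) _ that])
    show "continuous_on (cball x0 r) (\<lambda>w. 1 / al w)" using alnz by (intro continuous_intros alc) auto
    have sub: "ball x0 r - Z \<subseteq> cball x0 r" by auto
    show "hasW (\<lambda>w. 1 / al w) (- p1 w / (al w)\<^sup>2) (- q1 w / (al w)\<^sup>2) w" if "w \<in> ball x0 r - Z" for w
    proof -
      have w: "w \<in> cball x0 r - Z" using that by auto
      have nz: "al w \<noteq> 0" using alnz w by auto
      show ?thesis
        by (rule has_derivative_eq_rhs[OF has_derivative_divide[OF has_derivative_const Wal[OF w] nz]])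
          (use nz in \<open>auto simp: fun_eq_iff divide_simps power2_eq_square algebra_simps\<close>)
    qed
    show "continuous_on (ball x0 r - Z) (\<lambda>w. - p1 w / (al w)\<^sup>2)" "continuous_on (ball x0 r - Z) (\<lambda>w. - q1 w / (al w)\<^sup>2)"
      using alnz by (intro continuous_intros pqc'(1)[OF bS] pqc'(3)[OF bS] continuous_on_subset[OF alc(1) sub]; auto)+
    show "norm (- q1 w / (al w)\<^sup>2) \<le> 2 * C * norm (1 / al w)" if "w \<in> ball x0 r - Z" for w
    proof -
      have w: "w \<in> cball x0 r - Z" using that by auto
      have "norm (- q1 w / (al w)\<^sup>2) \<le> 2 * C * norm (al w) / (norm (al w))\<^sup>2"
        using qal(1)[OF w] by (simp add: norm_divide norm_power divide_right_mono)
      also have "\<dots> = 2 * C * norm (1 / al w)" using alnz w by (simp add: norm_divide power2_eq_square)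
      finally show ?thesis .
    qed
    show "norm (1 / al w) \<le> 1 / c0" if w: "r / 4 \<le> dist x0 w" "dist x0 w \<le> r" for w
    proof -
      have "norm (P w) \<le> 1 ^ (\<Sum>\<zeta>\<in>Z. n \<zeta>)" unfolding P_def
      proof (rule zprod_bounds(1)[OF finite_Z])
        fix \<zeta> assume "\<zeta> \<in> Z"
        then have "dist x0 \<zeta> \<le> r" by (simp add: Z_def)
        then show "norm (w - \<zeta>) \<le> 1"
          using dist_triangle[of w \<zeta> x0] w(2) r by (simp add: dist_norm norm_minus_commute)
      qed
      then have "norm (P w) \<le> 1" by simp
      moreover have "c0 \<le> norm (a w)" using w r by (intro ann) auto
      ultimately have "norm (P w) / norm (a w) \<le> 1 / c0" using c0 by (intro frac_le) auto
      then show ?thesis by (simp add: alP[OF notZ[OF w(1)]] norm_divide)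
    qed
  qed (use C in auto)
  have al_ge: "c0 / 2 \<le> norm (al w)" if "w \<in> cball x0 r" for w
    using inv_le[OF that] alnz[OF that] c0 by (simp add: norm_divide field_simps)
  \<comment> \<open>Tested at radius \<open>r / 64\<close>, where every factor of \<open>P\<close>
    is at most \<open>r / 32\<close>: each zero multiplies the bound of \<open>a\<close> by at most
    \<open>\<sigma> * (r / 32) = 2 / 15 < 1 / 2\<close>, while \<open>a\<close> stays above
    \<open>c0\<close> there.\<close>
  have N: "N \<le> Nm"
  proof (rule ccontr)
    assume "\<not> N \<le> Nm"
    define w where "w = x0 + of_real (r / 64)"
    have d: "dist x0 w = r / 64" using r by (simp add: w_def dist_norm)
    have wc: "w \<in> cball x0 r" using d r by simp
    have wZ: "w \<notin> Z" using Z_small[of w] d by auto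
    have Pw: "norm (P w) \<le> (r / 32) ^ N" unfolding P_def N_def
    proof (rule zprod_bounds(1)[OF finite_Z])
      fix \<zeta> assume "\<zeta> \<in> Z"
      then show "norm (w - \<zeta>) \<le> r / 32"
        using Z_small[of \<zeta>] dist_triangle[of w \<zeta> x0] d by (simp add: dist_norm norm_minus_commute)
    qed
    have "c0 \<le> norm (a w)" using ann[of w] d r by simp
    also have "norm (a w) = norm (al w) * norm (P w)" using Pnz[OF wZ] by (simp add: alP[OF wZ] norm_divide)
    also have "\<dots> \<le> 2 * (M * \<sigma> ^ N) * (r / 32) ^ N"
      using al_le'[OF wc] Pw M_pos \<sigma> by (intro mult_mono) auto
    also have "\<dots> = 2 * M * (\<sigma> * (r / 32)) ^ N" by (simp only: power_mult_distrib mult.assoc)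
    also have "\<sigma> * (r / 32) = 2 / 15" using r by (simp add: \<sigma>_def)
    also have "2 * M * (2 / 15) ^ N \<le> 2 * M * (1 / 2) ^ N" using M_pos by (intro mult_left_mono power_mono) auto
    finally have "c0 * 2 ^ N \<le> 2 * M" by (simp add: power_divide field_simps)
    moreover have "2 ^ Nm \<le> (2::real) ^ N" using \<open>\<not> N \<le> Nm\<close> by (intro power_increasing) auto
    ultimately have "c0 * 2 ^ Nm \<le> 2 * M" using c0 by (meson mult_left_mono less_imp_le order_trans)
    then show False using Nm c0 by (simp add: field_simps)
  qed
  have \<sigma>N: "\<sigma> ^ N \<le> \<sigma> ^ Nm" using \<sigma> N by (intro power_increasing) auto
  have al_le: "norm (al w) \<le> M1" if "w \<in> cball x0 r" for w
  proof -
    have "M * \<sigma> ^ N \<le> M * \<sigma> ^ Nm" using \<sigma>N M_pos by (intro mult_left_mono) auto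
    then show ?thesis using al_le'[OF that] unfolding M1_def by linarith
  qed
  have be_le: "norm (be w) \<le> M1" if "w \<in> cball x0 r" for w
    using al_le[OF that] beal[OF that] by simp
  have qM: "norm (q1 w) \<le> 2 * C * M1" "norm (q2 w) \<le> 2 * C * M1" if "w \<in> cball x0 r - Z" for w
    using qal[OF that] mult_left_mono[OF al_le, of w "2 * C"] that C by auto
  \<comment> \<open>Self-improvement of a bound \<open>L\<close> of the derivatives. At distance at
    least \<open>r / 4\<close> from \<open>x0\<close> the formula for the derivative of a quotient
    is estimated directly; elsewhere \<open>unimod_derivative_bound\<close> is applied on the disc
    of radius \<open>r / 4\<close> about \<open>c\<close>.\<close>
  have step: "norm (p1 c) \<le> K0 + 64 * C\<^sup>2 * M1 + (2 * C * M1 + M1) / 2 + L / 2 \<and> norm (p2 c) \<le> K0 + 64 * C\<^sup>2 * M1 + (2 * C * M1 + M1) / 2 + L / 2"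
    if L: "\<And>w. w \<in> cball x0 r - Z \<Longrightarrow> norm (p1 w) \<le> L \<and> norm (p2 w) \<le> L" and c: "c \<in> cball x0 r - Z" for L c
  proof (cases "r / 4 \<le> dist x0 c")
    case True
    have L0: "0 \<le> L" using L[OF c] norm_ge_zero order_trans by blast
    have zl: "norm (zlogd Z n c) \<le> Nm * \<sigma>"
    proof -
      have "norm (zlogd Z n c) \<le> (\<Sum>\<zeta>\<in>Z. n \<zeta> * \<sigma>)"
        unfolding zlogd_def
      proof (rule order_trans[OF norm_sum sum_mono])
        fix \<zeta> assume \<zeta>: "\<zeta> \<in> Z"
        have "n \<zeta> * (1 / norm (c - \<zeta>)) \<le> n \<zeta> * (1 / (15 * r / 64))"
          using dZ[OF True \<zeta>] r less_le_trans[of 0 "15 * r / 64" "norm (c - \<zeta>)"]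
          by (intro mult_left_mono divide_left_mono mult_pos_pos) auto
        then show "norm (of_nat (n \<zeta>) / (c - \<zeta>)) \<le> n \<zeta> * \<sigma>" by (simp add: norm_divide \<sigma>_def)
      qed
      also have "\<dots> = N * \<sigma>" by (simp add: N_def sum_distrib_right)
      also have "\<dots> \<le> Nm * \<sigma>" using N \<sigma> by (intro mult_right_mono) auto
      finally show ?thesis .
    qed
    have "norm (zquotd Z n f c) \<le> K0" if f: "norm (wd f c) \<le> M" "norm (f c / P c) \<le> M1" for f
    proof -
      have "norm (wd f c / P c) \<le> M * \<sigma> ^ Nm"
        by (rule order_trans[OF quotP[OF True]]) (use f \<sigma>N \<sigma> M_pos in \<open>auto intro!: mult_mono\<close>)
      moreover have "norm (f c / P c * zlogd Z n c) \<le> M1 * (Nm * \<sigma>)"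
        unfolding norm_mult using f(2) zl nonneg(1) by (intro mult_mono) auto
      ultimately have "norm (zquotd Z n f c) \<le> M * \<sigma> ^ Nm + M1 * (Nm * \<sigma>)"
        unfolding zquotd_def P_def[symmetric] by (intro order_trans[OF norm_triangle_ineq4 add_mono])
      then show ?thesis using nonneg r C by (simp add: K0_def add_increasing2)
    qed
    then have "norm (p1 c) \<le> K0" "norm (p2 c) \<le> K0"
      unfolding p1_def p2_def using c M al_le[of c] be_le[of c] by (auto simp: alP)
    moreover have "0 \<le> 64 * C\<^sup>2 * M1 + (2 * C * M1 + M1) / 2 + L / 2"
      using nonneg C L0 by auto
    ultimately show ?thesis by linarith
  next
    case False
    have L0: "0 \<le> L" using L[OF c] norm_ge_zero order_trans by blast
    have sub: "cball c (r / 4) \<subseteq> cball x0 r" "ball c (r / 4) - Z \<subseteq> cball x0 r - Z" "ball c (r / 4) - Z \<subseteq> S - Z"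
    proof -
      show s: "cball c (r / 4) \<subseteq> cball x0 r" using False by (auto simp: cball_subset_cball_iff dist_commute)
      show "ball c (r / 4) - Z \<subseteq> cball x0 r - Z" using s by auto
      then show "ball c (r / 4) - Z \<subseteq> S - Z" using S by blast
    qed
    have cc: "c \<in> cball x0 r" "c \<notin> Z" using c by auto
    \<comment> \<open>The variation of a product of coefficient and quotient is at most
      \<open>E * dist c w\<close> and also at most \<open>2 * C * M1\<close>. The geometric mean of
      the two bounds has a constant \<open>T\<close> in which \<open>L\<close> occurs under a square
      root.\<close>
    define E where "E = C * (L + 2 * C * M1 + M1)"
    define T where "T = sqrt (2 * C * M1 * E)"
    have E0: "0 \<le> E" using C L0 nonneg by (simp add: E_def)
    have var: "norm (D w * F w - D c * F c) \<le> T * sqrt (dist c w)"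
      if D: "\<And>w. w \<in> cball x0 r \<Longrightarrow> norm (D w) \<le> C"
        "\<And>w w'. w \<in> cball x0 r \<Longrightarrow> w' \<in> cball x0 r \<Longrightarrow> norm (D w - D w') \<le> C * norm (w - w')"
        and F: "\<And>w. w \<in> cball x0 r \<Longrightarrow> norm (F w) \<le> M1"
        "\<And>w w'. w \<in> cball x0 r \<Longrightarrow> w' \<in> cball x0 r \<Longrightarrow> norm (F w - F w') \<le> (L + 2 * C * M1) * norm (w - w')"
        and w: "w \<in> cball x0 r" for D F :: "complex \<Rightarrow> complex" and w
    proof -
      define d where "d = norm (D w * F w - D c * F c)"
      have dd: "norm (w - c) = dist c w" by (simp add: dist_norm norm_minus_commute)
      have eq: "D w * F w - D c * F c = D w * (F w - F c) + (D w - D c) * F c" by (simp add: algebra_simps)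
      have "d \<le> norm (D w) * norm (F w - F c) + norm (D w - D c) * norm (F c)"
        unfolding d_def eq using norm_triangle_ineq by (metis norm_mult)
      also have "\<dots> \<le> C * ((L + 2 * C * M1) * dist c w) + (C * dist c w) * M1"
        using D(1)[OF w] D(2)[OF w cc(1)] F(1)[OF cc(1)] F(2)[OF w cc(1)] C nonneg(1)
        unfolding dd by (intro add_mono mult_mono) auto
      finally have 1: "d \<le> E * dist c w" by (simp add: E_def algebra_simps)
      have "d \<le> norm (D w) * norm (F w) + norm (D c) * norm (F c)"
        unfolding d_def using norm_triangle_ineq4 by (metis norm_mult)
      also have "\<dots> \<le> C * M1 + C * M1"
        using D(1)[OF w] D(1)[OF cc(1)] F(1)[OF cc(1)] F(1)[OF w] C by (intro add_mono mult_mono) auto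
      finally have 2: "d \<le> 2 * C * M1" by simp
      have "d\<^sup>2 \<le> (2 * C * M1) * (E * dist c w)"
        unfolding power2_eq_square by (intro mult_mono 1 2) (use C nonneg in \<open>auto simp: d_def\<close>)
      then have "d \<le> sqrt ((2 * C * M1) * (E * dist c w))" by (rule real_le_rsqrt)
      also have "\<dots> = T * sqrt (dist c w)" unfolding T_def real_sqrt_mult[symmetric] by (simp only: mult.assoc)
      finally show ?thesis unfolding d_def .
    qed
    have main: "norm (p c) \<le> K0 + 64 * C\<^sup>2 * M1 + (2 * C * M1 + M1) / 2 + L / 2"
      if F: "continuous_on (cball x0 r) F" "\<And>w. w \<in> cball x0 r - Z \<Longrightarrow> hasW F (p w) (q w) w"
        "continuous_on (S - Z) p" "continuous_on (S - Z) q"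
        and q: "\<And>w. w \<in> cball x0 r - Z \<Longrightarrow> q w = A w * F w + B w * cnj (G w) * unimod Z n w"
        and Fb: "\<And>w. w \<in> cball x0 r \<Longrightarrow> norm (F w) \<le> M1"
        "\<And>w w'. w \<in> cball x0 r \<Longrightarrow> w' \<in> cball x0 r \<Longrightarrow> norm (F w - F w') \<le> (L + 2 * C * M1) * norm (w - w')"
        and Gb: "\<And>w. w \<in> cball x0 r \<Longrightarrow> norm (G w) \<le> M1"
        "\<And>w w'. w \<in> cball x0 r \<Longrightarrow> w' \<in> cball x0 r \<Longrightarrow> norm (G w - G w') \<le> (L + 2 * C * M1) * norm (w - w')"
      for F G p q
    proof -
      have Gb': "norm (cnj (G w)) \<le> M1" "norm (cnj (G w) - cnj (G w')) \<le> (L + 2 * C * M1) * norm (w - w')"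
        if "w \<in> cball x0 r" "w' \<in> cball x0 r" for w w'
        using Gb(1)[OF that(1)] Gb(2)[OF that] by (simp_all flip: complex_cnj_diff)
      have sub1: "w \<in> cball x0 r" if "w \<in> ball c (r / 4) - Z" for w using that sub(2) by blast
      have sub2: "w \<in> cball x0 r - Z" if "w \<in> ball c (r / 4) - Z" for w using that sub(2) by blast
      have "norm (p c) \<le> M1 / (r / 4) + 8 * T * sqrt (r / 4) + 8 * pi * (C * M1) * (\<Sum>\<zeta>\<in>Z. n \<zeta>)"
      proof (rule unimod_derivative_bound[OF finite_Z cc(2) _ continuous_on_subset[OF F(1) sub(1)] F(2)[OF sub2]
            continuous_on_subset[OF F(3) sub(3)] continuous_on_subset[OF F(4) sub(3)] q[OF sub2]])
        show "norm (A w * F w - A c * F c) \<le> T * sqrt (dist c w)" if "w \<in> ball c (r/4) - Z" for w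
          by (rule var[OF AB(1) ABL(1) Fb sub1[OF that]])
        show "norm (B w * cnj (G w) - B c * cnj (G c)) \<le> T * sqrt (dist c w)" if "w \<in> ball c (r/4) - Z" for w
          by (rule var[OF AB(2) ABL(2) Gb' sub1[OF that]])
        show "norm (B c * cnj (G c)) \<le> C * M1"
          unfolding norm_mult using AB(2)[OF cc(1)] Gb(1)[OF cc(1)] C by (intro mult_mono) auto
        show "norm (F w) \<le> M1" if "w \<in> sphere c (r / 4)" for w
          using that sub(1) by (intro Fb) auto
      qed (use r in auto)
      also have "\<dots> \<le> 4 * M1 / r + 8 * T + 8 * pi * (C * M1) * Nm"
      proof (intro add_mono mult_left_mono)
        have "sqrt (r / 4) \<le> 1" using r by simp
        moreover have "0 \<le> T" using C E0 nonneg by (simp add: T_def)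
        ultimately show "8 * T * sqrt (r / 4) \<le> 8 * T" using mult_left_le[of "sqrt (r/4)" "8 * T"] by simp
        show "real (\<Sum>\<zeta>\<in>Z. n \<zeta>) \<le> real Nm" using N unfolding N_def by (simp del: of_nat_sum)
      qed (use C nonneg in \<open>auto simp: mult.commute\<close>)
      \<comment> \<open>The inequality \<open>16 sqrt x sqrt y <= 64 x + y\<close> trades the square
        root of \<open>L\<close> for \<open>L / 2\<close>.\<close>
      also have "8 * T \<le> 64 * C\<^sup>2 * M1 + (L + 2 * C * M1 + M1) / 2"
      proof -
        define x where "x = 2 * C\<^sup>2 * M1"
        define y where "y = L + 2 * C * M1 + M1"
        have xy: "0 \<le> x" "0 \<le> y" using C nonneg L0 by (auto simp: x_def y_def)
        have "T = sqrt x * sqrt y"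
          unfolding T_def real_sqrt_mult[symmetric] x_def y_def E_def by (simp add: power2_eq_square mult_ac)
        moreover have "0 \<le> (8 * sqrt x - sqrt y)\<^sup>2" by simp
        then have "16 * (sqrt x * sqrt y) \<le> 64 * x + y"
          using xy by (simp add: power2_diff power_mult_distrib)
        ultimately have "8 * T \<le> 32 * x + y / 2" by simp
        also have "\<dots> = 64 * C\<^sup>2 * M1 + (L + 2 * C * M1 + M1) / 2" by (simp add: x_def y_def)
        finally show ?thesis .
      qed
      finally have "norm (p c) \<le> 4 * M1 / r + (64 * C\<^sup>2 * M1 + (L + 2 * C * M1 + M1) / 2) + 8 * pi * (C * M1) * Nm" by simp
      moreover have "0 \<le> M * \<sigma> ^ Nm" "0 \<le> M1 * (Nm * \<sigma>)" using M_pos \<sigma> nonneg by auto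
      ultimately show ?thesis unfolding K0_def by (simp add: add_divide_distrib)
    qed
    have alL: "norm (al w - al w') \<le> (L + 2 * C * M1) * norm (w - w')" if "w \<in> cball x0 r" "w' \<in> cball x0 r" for w w'
      by (rule exceptional_lipschitz[OF convex_cball alc(1) finite_Z Wal _ that(2,1)]) (use L qM in \<open>auto intro!: add_mono\<close>)
    have beL: "norm (be w - be w') \<le> (L + 2 * C * M1) * norm (w - w')" if "w \<in> cball x0 r" "w' \<in> cball x0 r" for w w'
      by (rule exceptional_lipschitz[OF convex_cball alc(2) finite_Z Wbe _ that(2,1)]) (use L qM in \<open>auto intro!: add_mono\<close>)
    have qeq: "q1 w = A w * al w + B w * cnj (be w) * unimod Z n w" "q2 w = A w * be w + B w * cnj (al w) * unimod Z n w"
      if "w \<in> cball x0 r - Z" for w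
    proof -
      have w: "w \<in> S" "w \<notin> Z" using that cS by auto
      show "q1 w = A w * al w + B w * cnj (be w) * unimod Z n w" "q2 w = A w * be w + B w * cnj (al w) * unimod Z n w"
        unfolding q1_def q2_def eqa[OF w(1)] eqb[OF w(1)] alP[OF w(2)] mult.assoc P_def cnj_zprod[OF finite_Z w(2)]
        by (simp_all add: add_divide_distrib)
    qed
    show ?thesis
      using main[OF alc(1) Wal pqc(1,3) qeq(1) al_le alL be_le beL]
        main[OF alc(2) Wbe pqc(2,4) qeq(2) be_le beL al_le alL] by blast
  qed
  have bounded: "\<exists>L. \<forall>w\<in>cball x0 r - Z. norm (p1 w) \<le> L \<and> norm (p2 w) \<le> L"
  proof -
    have "\<exists>K. \<forall>w\<in>cball x0 r. norm (p1 w) \<le> K"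
      unfolding p1_def by (rule locally_bounded_imp_bounded[OF compact_cball zquotd_locally_bounded[OF finite_Z _ S(1) sm(1) cS]]) (use lead in blast)
    moreover have "\<exists>K. \<forall>w\<in>cball x0 r. norm (p2 w) \<le> K"
      unfolding p2_def by (rule locally_bounded_imp_bounded[OF compact_cball zquotd_locally_bounded[OF finite_Z _ S(1) sm(2) cS]]) (use lead in blast)
    ultimately obtain K1 K2 where K: "\<forall>w\<in>cball x0 r. norm (p1 w) \<le> K1" "\<forall>w\<in>cball x0 r. norm (p2 w) \<le> K2" by blast
    show ?thesis using K by (intro exI[of _ "max K1 K2"]) (auto simp: le_max_iff_disj)
  qed
  have Lb: "norm (p1 w) \<le> Lw" "norm (p2 w) \<le> Lw" if w: "w \<in> cball x0 r - Z" for w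
  proof -
    \<comment> \<open>The supremum of the derivatives is finite by \<open>bounded\<close>; put in
      place of \<open>L\<close> in \<open>step\<close>, it can be absorbed.\<close>
    define X where "X = (norm \<circ> p1) ` (cball x0 r - Z) \<union> (norm \<circ> p2) ` (cball x0 r - Z)"
    have bdd: "bdd_above X" using bounded by (auto simp: X_def bdd_above_def)
    have ne: "X \<noteq> {}" using w by (auto simp: X_def)
    have up: "norm (p1 w) \<le> Sup X \<and> norm (p2 w) \<le> Sup X" if "w \<in> cball x0 r - Z" for w
      using that by (intro conjI cSup_upper[OF _ bdd]) (auto simp: X_def)
    have "Sup X \<le> K0 + 64 * C\<^sup>2 * M1 + (2 * C * M1 + M1) / 2 + Sup X / 2"
      by (rule cSup_least[OF ne]) (use step[OF up] in \<open>auto simp: X_def\<close>)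
    moreover have "x \<le> 2 * y" if "x \<le> y + x / 2" for x y :: real using that by simp
    ultimately have "Sup X \<le> Lw" unfolding Lw_def by blast
    then show "norm (p1 w) \<le> Lw" "norm (p2 w) \<le> Lw" using up[OF w] by auto
  qed
  define q where "q = (\<lambda>w. be w / al w)"
  have qc: "continuous_on (cball x0 r) q" unfolding q_def using alnz by (intro continuous_intros alc) auto
  have qba: "q w = b w / a w" if "w \<in> cball x0 r" "a w \<noteq> 0" for w
  proof -
    have "w \<notin> Z" using that by (simp add: Z_def)
    then show ?thesis unfolding q_def using Pnz by (simp add: alP)
  qed
  have qL: "norm (q w - q w') \<le> Lip * norm (w - w')" if "w \<in> cball x0 r" "w' \<in> cball x0 r" for w w'
  proof (rule exceptional_lipschitz[OF convex_cball qc finite_Z _ _ that(2,1)])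
    fix w assume w: "w \<in> cball x0 r - Z"
    have nz: "al w \<noteq> 0" using alnz w by auto
    show "hasW q ((p2 w * al w - be w * p1 w) / (al w)\<^sup>2) ((q2 w * al w - be w * q1 w) / (al w)\<^sup>2) w"
      unfolding q_def
      by (rule has_derivative_eq_rhs[OF has_derivative_divide[OF Wbe[OF w] Wal[OF w] nz]])
        (use nz in \<open>auto simp: fun_eq_iff divide_simps power2_eq_square algebra_simps\<close>)
    have gen: "norm ((x * al w - be w * y) / (al w)\<^sup>2) \<le> 2 * D / norm (al w)"
      if "norm x \<le> D" "norm y \<le> D" for x y D
    proof -
      have "norm (x * al w - be w * y) \<le> norm x * norm (al w) + norm (be w) * norm y"
        using norm_triangle_ineq4[of "x * al w" "be w * y"] by (simp add: norm_mult)
      also have "\<dots> \<le> D * norm (al w) + norm (al w) * D"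
        using that beal[of w] w order_trans[OF norm_ge_zero that(1)] by (intro add_mono mult_mono) auto
      finally have "norm (x * al w - be w * y) / (norm (al w))\<^sup>2 \<le> (2 * D * norm (al w)) / (norm (al w))\<^sup>2"
        by (intro divide_right_mono) auto
      also have "\<dots> = 2 * D / norm (al w)" using nz by (simp add: power2_eq_square)
      finally show ?thesis by (simp add: norm_divide norm_power)
    qed
    have "norm ((p2 w * al w - be w * p1 w) / (al w)\<^sup>2) \<le> 2 * Lw / norm (al w)" by (rule gen[OF Lb(2)[OF w] Lb(1)[OF w]])
    also have "\<dots> \<le> 2 * Lw / (c0 / 2)"
      using al_ge[of w] w c0 nonneg nz by (intro divide_left_mono mult_pos_pos) auto
    finally have 1: "norm ((p2 w * al w - be w * p1 w) / (al w)\<^sup>2) \<le> 4 * Lw / c0" by simp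
    have "norm ((q2 w * al w - be w * q1 w) / (al w)\<^sup>2) \<le> 2 * (2 * C * norm (al w)) / norm (al w)" by (rule gen[OF qal(2)[OF w] qal(1)[OF w]])
    also have "\<dots> = 4 * C" using nz by simp
    finally show "norm ((p2 w * al w - be w * p1 w) / (al w)\<^sup>2) + norm ((q2 w * al w - be w * q1 w) / (al w)\<^sup>2) \<le> Lip"
      using 1 by (simp add: Lip_def)
  qed
  have avoid: "\<exists>w'\<in>cball w \<delta>. c0 / 2 * (\<delta> / (2 * (Nm + 1))) ^ Nm \<le> norm (a w')"
    if w: "w \<in> cball x0 (r/2)" and \<delta>: "0 < \<delta>" "\<delta> \<le> r / 2" for w \<delta>
  proof -
    define s where "s = \<delta> / (Nm + 1)"
    have s: "0 < s" "s \<le> 1"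
    proof -
      show "0 < s" using \<delta> by (simp add: s_def)
      have "s \<le> \<delta> / 1" unfolding s_def using \<delta> by (intro divide_left_mono) auto
      then show "s \<le> 1" using \<delta> r by simp
    qed
    define x where "x = (\<lambda>k::nat. w + of_real (k * s))"
    have xd: "dist w (x k) \<le> \<delta>" if "k \<le> Nm" for k
    proof -
      have "dist w (x k) = k * s" using s by (simp add: x_def dist_norm norm_mult)
      also have "\<dots> \<le> (Nm + 1) * s" using that s by (intro mult_right_mono) auto
      also have "\<dots> = \<delta>" by (simp add: s_def)
      finally show ?thesis .
    qed
    have xc: "x k \<in> cball x0 r" if "k \<le> Nm" for k
      using dist_triangle[of x0 "x k" w] xd[OF that] w \<delta> by simp
    \<comment> \<open>Dropping points with exponent 0 leaves \<open>P\<close> unchanged and makes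
      the number of points at most the degree \<open>N\<close>.\<close>
    define Z' where "Z' = {\<zeta> \<in> Z. n \<zeta> > 0}"
    have Z': "finite Z'" "Z' \<subseteq> Z" using finite_Z by (auto simp: Z'_def)
    have "card Z' \<le> N"
    proof -
      have "card Z' = (\<Sum>\<zeta>\<in>Z'. 1)" by simp
      also have "\<dots> \<le> (\<Sum>\<zeta>\<in>Z'. n \<zeta>)" by (intro sum_mono) (auto simp: Z'_def)
      also have "\<dots> \<le> N" unfolding N_def by (intro sum_mono2 finite_Z Z') auto
      finally show ?thesis .
    qed
    \<comment> \<open>Pigeonhole: the \<open>Nm + 1\<close> points \<open>x k\<close> are at mutual
      distance at least \<open>s\<close>, so each of the at most \<open>Nm\<close> zeros is closer
      than \<open>s / 2\<close> to at most one of them.\<close>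
    have "\<exists>k\<le>Nm. \<forall>\<zeta>\<in>Z'. s / 2 \<le> norm (x k - \<zeta>)"
    proof (rule ccontr)
      assume "\<not> ?thesis"
      then obtain g where g: "\<And>k. k \<le> Nm \<Longrightarrow> g k \<in> Z' \<and> norm (x k - g k) < s / 2"
        by (metis not_le)
      have "inj_on g {..Nm}"
      proof (rule inj_onI)
        fix k l assume kl: "k \<in> {..Nm}" "l \<in> {..Nm}" "g k = g l"
        have "norm (x k - x l) < s / 2 + s / 2"
          using norm_triangle_ineq4[of "x k - g k" "x l - g l"] g[of k] g[of l] kl by simp
        moreover have "x k - x l = of_real ((real k - real l) * s)" by (simp add: x_def algebra_simps)
        ultimately have "\<bar>real k - real l\<bar> * s < 1 * s" using s by (simp add: abs_mult del: of_real_mult of_real_diff)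
        then have "\<bar>real k - real l\<bar> < 1" using s by (simp only: mult_less_cancel_right_pos)
        then show "k = l" by linarith
      qed
      then have "card {..Nm} \<le> card Z'" using g Z' by (intro card_inj_on_le[of g]) auto
      then show False using \<open>card Z' \<le> N\<close> N by simp
    qed
    then obtain k where k: "k \<le> Nm" "\<And>\<zeta>. \<zeta> \<in> Z' \<Longrightarrow> s / 2 \<le> norm (x k - \<zeta>)" by blast
    have "(s / 2) ^ (\<Sum>\<zeta>\<in>Z'. n \<zeta>) \<le> norm (zprod Z' n (x k))"
      by (rule zprod_bounds(2)[OF Z'(1)]) (use s k in auto)
    moreover have "zprod Z' n (x k) = P (x k)"
      unfolding zprod_def P_def by (rule prod.mono_neutral_left[OF finite_Z Z'(2)]) (auto simp: Z'_def)
    moreover have "(\<Sum>\<zeta>\<in>Z'. n \<zeta>) = N"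
      unfolding N_def by (rule sum.mono_neutral_left[OF finite_Z Z'(2)]) (auto simp: Z'_def)
    ultimately have "(s / 2) ^ N \<le> norm (P (x k))" by simp
    moreover have "(s / 2) ^ Nm \<le> (s / 2) ^ N" using N s by (intro power_decreasing) auto
    ultimately have Plb: "(s / 2) ^ Nm \<le> norm (P (x k))" by linarith
    have "c0 / 2 * (s / 2) ^ Nm \<le> norm (a (x k))"
    proof (cases "x k \<in> Z")
      case True
      then have "x k \<in> Z'"
      proof -
        have "a (x k) = 0" using True by (simp add: Z_def)
        have "n (x k) \<noteq> 0"
        proof
          assume "n (x k) = 0"
          then have "((\<lambda>w. a w) \<longlongrightarrow> \<alpha> (x k)) (at (x k))" using lead[OF True] by (simp add: lead_def)
          moreover have "((\<lambda>w. a w) \<longlongrightarrow> a (x k)) (at (x k))"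
            using smooth_on_isCont[OF sm(1) cS[OF xc[OF k(1)]]] by (simp add: isCont_def)
          ultimately have "\<alpha> (x k) = 0" using \<open>a (x k) = 0\<close> tendsto_unique[OF trivial_limit_at] by metis
          then show False using lead[OF True] by auto
        qed
        then show ?thesis using True by (simp add: Z'_def)
      qed
      then show ?thesis using k(2)[of "x k"] s by simp
    next
      case False
      then have "norm (a (x k)) = norm (al (x k)) * norm (P (x k))"
        using Pnz by (simp add: alP norm_divide)
      moreover have "c0 / 2 * (s / 2) ^ Nm \<le> norm (al (x k)) * norm (P (x k))"
        using al_ge[OF xc[OF k(1)]] Plb c0 s by (intro mult_mono) auto
      ultimately show ?thesis by simp
    qed
    moreover have "s / 2 = \<delta> / (2 * (Nm + 1))" by (simp add: s_def)
    ultimately show ?thesis using xd[OF k(1)] by (intro bexI[of _ "x k"]) auto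
  qed
  have q1: "norm (q w) < 1" if w: "w \<in> cball x0 r" for w
  proof (cases "w \<in> Z")
    case True
    have "norm (\<beta> w) < norm (\<alpha> w)" using lead[OF True] by blast
    moreover have "q w = \<beta> w / \<alpha> w"
      using True zprod_nonzero[of "Z - {w}" w n] finite_Z by (simp add: q_def al_def be_def zquot_def)
    ultimately show ?thesis by (simp add: norm_divide divide_less_eq)
  next
    case False
    then have nz: "a w \<noteq> 0" using w by (simp add: Z_def)
    \<comment> \<open>Off the zeros, too, \<open>norm b <= norm a\<close> has to be made strict: a
      leading pair at \<open>w\<close> identifies \<open>b w / a w\<close> with
      \<open>\<beta>' / \<alpha>'\<close>.\<close>
    obtain n' \<alpha>' \<beta>' where l: "norm \<beta>' < norm \<alpha>'" "lead a w n' \<alpha>'" "lead b w n' \<beta>'" using leads[OF w] by blast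
    have "((\<lambda>x. (b x / (x - w) ^ n') / (a x / (x - w) ^ n')) \<longlongrightarrow> \<beta>' / \<alpha>') (at w)"
    proof (rule tendsto_divide)
      show "\<alpha>' \<noteq> 0" using l(1) by auto
    qed (use l in \<open>simp_all add: lead_def\<close>)
    moreover have "\<forall>\<^sub>F x in at w. x \<noteq> w" by (simp add: eventually_neq_at_within)
    then have "\<forall>\<^sub>F x in at w. (b x / (x - w) ^ n') / (a x / (x - w) ^ n') = b x / a x"
      by eventually_elim simp
    ultimately have 1: "((\<lambda>x. b x / a x) \<longlongrightarrow> \<beta>' / \<alpha>') (at w)" by (rule Lim_transform_eventually)
    have 2: "((\<lambda>x. b x / a x) \<longlongrightarrow> b w / a w) (at w)"
      by (rule tendsto_divide[OF smooth_on_isCont[OF sm(2) cS[OF w], unfolded isCont_def]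
          smooth_on_isCont[OF sm(1) cS[OF w], unfolded isCont_def] nz])
    have "b w / a w = \<beta>' / \<alpha>'" by (rule tendsto_unique[OF trivial_limit_at 2 1])
    then have "q w = \<beta>' / \<alpha>'" using qba[OF w nz] by simp
    then show ?thesis using l(1) by (simp add: norm_divide divide_less_eq)
  qed
  show ?thesis
    by (rule exI[of _ q], intro conjI ballI allI impI) (rule qc qba q1 qL avoid; (elim conjE)?; assumption)+
qed

end

subsection \<open>Adapted frames\<close>

lemma blinfun_compose_idD:
  assumes "A o\<^sub>L B = id_blinfun"
  shows "A (B u) = u"
  using arg_cong[OF assms, of "\<lambda>T. blinfun_apply T u"] by simp

lemma blinfun_square_minus_idD:
  assumes "J o\<^sub>L J = - id_blinfun"
  shows "J (J u) = - u"
  using arg_cong[OF assms, of "\<lambda>T. blinfun_apply T u"] by (simp add: uminus_blinfun.rep_eq)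

text \<open>From \<open>Fi y - Fi x = - Fi y (F y - F x) Fi x\<close>. This needs a bound of
  \<open>Fi y\<close> near \<open>x\<close>, which the same identity yields once
  \<open>norm (F y - F x) * norm (Fi x) < 1/2\<close>.\<close>

lemma blinfun_inverse_continuous:
  fixes F :: "'x::real_normed_vector \<Rightarrow> 'a::real_normed_vector \<Rightarrow>\<^sub>L 'b::real_normed_vector"
  assumes N: "open N" "x \<in> N" and F: "isCont F x"
    and inv: "\<And>y. y \<in> N \<Longrightarrow> F y o\<^sub>L Fi y = id_blinfun" "\<And>y. y \<in> N \<Longrightarrow> Fi y o\<^sub>L F y = id_blinfun"
  shows "isCont Fi x"
proof -
  define m where "m = norm (Fi x)"
  have eq: "Fi y - Fi x = - (Fi y o\<^sub>L (F y - F x) o\<^sub>L Fi x)" if "y \<in> N" for y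
  proof (rule blinfun_eqI)
    fix v
    have 1: "Fi y (F y u) = u" for u by (rule blinfun_compose_idD[OF inv(2)[OF that]])
    have 2: "F x (Fi x v) = v" by (rule blinfun_compose_idD[OF inv(1)[OF N(2)]])
    show "(Fi y - Fi x) v = (- (Fi y o\<^sub>L (F y - F x) o\<^sub>L Fi x)) v"
      by (simp add: blinfun.bilinear_simps 1 2)
  qed
  have b: "norm (Fi y - Fi x) \<le> norm (Fi y) * norm (F y - F x) * m" if "y \<in> N" for y
    unfolding eq[OF that] norm_minus_cancel m_def
    by (rule order_trans[OF norm_blinfun_compose mult_right_mono[OF norm_blinfun_compose]]) simp
  have evN: "\<forall>\<^sub>F y in at x. y \<in> N" using N by (auto simp: eventually_at_topological)
  have Fl: "((\<lambda>y. norm (F y - F x) * m) \<longlongrightarrow> 0) (at x)"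
  proof -
    have "((\<lambda>y. norm (F y - F x) * m) \<longlongrightarrow> norm (F x - F x) * m) (at x)"
      by (rule tendsto_mult[OF tendsto_norm[OF tendsto_diff[OF F[unfolded isCont_def] tendsto_const]] tendsto_const])
    then show ?thesis by simp
  qed
  have "\<forall>\<^sub>F y in at x. norm (F y - F x) * m < 1/2" by (rule order_tendstoD(2)[OF Fl]) simp
  with evN have le: "\<forall>\<^sub>F y in at x. norm (Fi y - Fi x) \<le> 2 * m * (norm (F y - F x) * m)"
  proof eventually_elim
    case (elim y)
    have "norm (Fi y) \<le> m + norm (Fi y - Fi x)" unfolding m_def using norm_triangle_sub[of "Fi y" "Fi x"] by simp
    also have "\<dots> \<le> m + norm (Fi y) * (norm (F y - F x) * m)" using b[OF elim(1)] by (simp add: mult.assoc)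
    also have "\<dots> \<le> m + norm (Fi y) * (1/2)" using elim(2) by (intro add_left_mono mult_left_mono) auto
    finally have "norm (Fi y) \<le> 2 * m" by simp
    then have "norm (Fi y) * (norm (F y - F x) * m) \<le> 2 * m * (norm (F y - F x) * m)"
      by (intro mult_right_mono) (auto simp: m_def)
    then show ?case using b[OF elim(1)] by (simp add: mult.assoc)
  qed
  have "((\<lambda>y. 2 * m * (norm (F y - F x) * m)) \<longlongrightarrow> 2 * m * 0) (at x)"
    by (rule tendsto_mult[OF tendsto_const Fl])
  then have "((\<lambda>y. 2 * m * (norm (F y - F x) * m)) \<longlongrightarrow> 0) (at x)" by (simp only: mult_zero_right)
  with le have "((\<lambda>y. Fi y - Fi x) \<longlongrightarrow> 0) (at x)" by (rule Lim_null_comparison)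
  then show ?thesis unfolding isCont_def by (rule LIM_zero_cancel)
qed

lemma blinfun_inverse_derivative:
  fixes F :: "'x::real_normed_vector \<Rightarrow> 'a::real_normed_vector \<Rightarrow>\<^sub>L 'b::real_normed_vector"
  assumes N: "open N" "x \<in> N" and F: "(F has_derivative D) (at x)"
    and inv: "\<And>y. y \<in> N \<Longrightarrow> F y o\<^sub>L Fi y = id_blinfun" "\<And>y. y \<in> N \<Longrightarrow> Fi y o\<^sub>L F y = id_blinfun"
  shows "(Fi has_derivative (\<lambda>h. - (Fi x o\<^sub>L D h o\<^sub>L Fi x))) (at x)"
proof -
  have bD: "bounded_linear D" using F has_derivative_bounded_linear by blast
  then obtain K where K: "\<And>h. norm (D h) \<le> norm h * K" using bounded_linear.bounded by blast
  define m where "m = norm (Fi x)"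
  define R where "R = (\<lambda>y. F y - F x - D (y - x))"
  have Rl: "((\<lambda>y. norm (R y) / norm (y - x)) \<longlongrightarrow> 0) (at x)"
    using F unfolding has_derivative_iff_norm R_def by simp
  have Fil: "(Fi \<longlongrightarrow> Fi x) (at x)"
    using blinfun_inverse_continuous[OF N has_derivative_continuous[OF F] inv] by (simp add: isCont_def)
  have bl: "bounded_linear (\<lambda>h. - (Fi x o\<^sub>L D h o\<^sub>L Fi x))"
    by (intro bounded_linear_minus bounded_linear_compose[OF bounded_bilinear.bounded_linear_left[OF bounded_bilinear_blinfun_compose]]
        bounded_linear_compose[OF bounded_bilinear.bounded_linear_right[OF bounded_bilinear_blinfun_compose]] bD)
  have evN: "\<forall>\<^sub>F y in at x. y \<in> N" using N by (auto simp: eventually_at_topological)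
  moreover have "\<forall>\<^sub>F y in at x. y \<noteq> x" by (simp add: eventually_neq_at_within)
  ultimately have le: "\<forall>\<^sub>F y in at x. norm (norm (Fi y - Fi x - - (Fi x o\<^sub>L D (y - x) o\<^sub>L Fi x)) / norm (y - x))
      \<le> norm (Fi y) * (norm (R y) / norm (y - x)) * m + norm (Fi y - Fi x) * K * m"
  proof eventually_elim
    case (elim y)
    have "Fi y - Fi x - - (Fi x o\<^sub>L D (y - x) o\<^sub>L Fi x) = - (Fi y o\<^sub>L R y o\<^sub>L Fi x) - ((Fi y - Fi x) o\<^sub>L D (y - x) o\<^sub>L Fi x)"
    proof (rule blinfun_eqI)
      fix v
      have 1: "Fi y (F y u) = u" for u by (rule blinfun_compose_idD[OF inv(2)[OF elim(1)]])
      have 2: "F x (Fi x v) = v" by (rule blinfun_compose_idD[OF inv(1)[OF N(2)]])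
      show "(Fi y - Fi x - - (Fi x o\<^sub>L D (y - x) o\<^sub>L Fi x)) v = (- (Fi y o\<^sub>L R y o\<^sub>L Fi x) - ((Fi y - Fi x) o\<^sub>L D (y - x) o\<^sub>L Fi x)) v"
        by (simp add: blinfun.bilinear_simps 1 2 R_def)
    qed
    also have "norm \<dots> \<le> norm (Fi y) * norm (R y) * m + norm (Fi y - Fi x) * norm (D (y - x)) * m"
    proof (rule order_trans[OF norm_triangle_ineq4 add_mono])
      show "norm (- (Fi y o\<^sub>L R y o\<^sub>L Fi x)) \<le> norm (Fi y) * norm (R y) * m"
        unfolding norm_minus_cancel m_def
        by (rule order_trans[OF norm_blinfun_compose mult_right_mono[OF norm_blinfun_compose]]) simp
      show "norm ((Fi y - Fi x) o\<^sub>L D (y - x) o\<^sub>L Fi x) \<le> norm (Fi y - Fi x) * norm (D (y - x)) * m"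
        unfolding m_def by (rule order_trans[OF norm_blinfun_compose mult_right_mono[OF norm_blinfun_compose]]) simp
    qed
    also have "\<dots> \<le> norm (Fi y) * norm (R y) * m + norm (Fi y - Fi x) * (norm (y - x) * K) * m"
      by (intro add_left_mono mult_right_mono mult_left_mono K) (auto simp: m_def)
    finally have "norm (Fi y - Fi x - - (Fi x o\<^sub>L D (y - x) o\<^sub>L Fi x)) / norm (y - x)
      \<le> (norm (Fi y) * norm (R y) * m + norm (Fi y - Fi x) * (norm (y - x) * K) * m) / norm (y - x)"
      by (rule divide_right_mono) simp
    also have "\<dots> = norm (Fi y) * (norm (R y) / norm (y - x)) * m + norm (Fi y - Fi x) * K * m"
      using elim(2) by (simp add: add_divide_distrib)
    finally show ?case by simp
  qed
  have "((\<lambda>y. norm (Fi y) * (norm (R y) / norm (y - x)) * m + norm (Fi y - Fi x) * K * m)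
      \<longlongrightarrow> norm (Fi x) * 0 * m + norm (Fi x - Fi x) * K * m) (at x)"
    by (rule tendsto_add[OF tendsto_mult[OF tendsto_mult[OF tendsto_norm[OF Fil] Rl] tendsto_const]
        tendsto_mult[OF tendsto_mult[OF tendsto_norm[OF tendsto_diff[OF Fil tendsto_const]] tendsto_const] tendsto_const]])
  then have "((\<lambda>y. norm (Fi y) * (norm (R y) / norm (y - x)) * m + norm (Fi y - Fi x) * K * m) \<longlongrightarrow> 0) (at x)"
    by simp
  with le have "((\<lambda>y. norm (Fi y - Fi x - - (Fi x o\<^sub>L D (y - x) o\<^sub>L Fi x)) / norm (y - x)) \<longlongrightarrow> 0) (at x)"
    by (rule Lim_null_comparison)
  then show ?thesis unfolding has_derivative_iff_norm using bl by blast
qed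

lemma smooth_on_blinfun_inverse:
  fixes F :: "'x::real_normed_vector \<Rightarrow> 'a::real_normed_vector \<Rightarrow>\<^sub>L 'b::real_normed_vector"
  assumes N: "open N" and F: "smooth_on N F"
    and inv: "\<And>y. y \<in> N \<Longrightarrow> F y o\<^sub>L Fi y = id_blinfun" "\<And>y. y \<in> N \<Longrightarrow> Fi y o\<^sub>L F y = id_blinfun"
  shows "smooth_on N Fi"
proof -
  have f: "\<And>n. ck n N F" using F smooth_on_iff_ck by auto
  note d = blinfun_inverse_derivative[OF N _ smooth_on_has_derivative[OF F] inv]
  have "ck n N Fi" for n
  proof (induction n rule: less_induct)
    case (less n)
    show ?case
    proof (rule ckI[OF N d])
      fix m v assume n: "n = Suc m"
      note IH = less.IH[of m, unfolded n, OF lessI]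
      have "ck m N (\<lambda>x. Fi x o\<^sub>L dd F v x o\<^sub>L Fi x)"
        by (rule ck_bilinear[OF bounded_bilinear_blinfun_compose N
            ck_bilinear[OF bounded_bilinear_blinfun_compose N IH ck_SucD(2)[OF f]] IH])
      then show "ck m N (\<lambda>x. - (Fi x o\<^sub>L dd F v x o\<^sub>L Fi x))"
        by (rule ck_linear[OF bounded_linear_minus[OF bounded_linear_ident] N])
    qed
  qed
  then show ?thesis by (simp add: smooth_on_iff_ck)
qed

lemma inj_blinfun_inverse:
  fixes F :: "'a::euclidean_space \<Rightarrow>\<^sub>L 'a"
  assumes "inj (blinfun_apply F)"
  shows "\<exists>G. F o\<^sub>L G = id_blinfun \<and> G o\<^sub>L F = id_blinfun"
proof -
  obtain g where g: "linear g" "\<And>x. g (F x) = x" "\<And>x. F (g x) = x"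
    using linear_injective_isomorphism[OF _ assms] bounded_linear.linear[OF blinfun.bounded_linear_right] by metis
  then have "blinfun_apply (Blinfun g) = g" by (simp add: bounded_linear_Blinfun_apply linear_conv_bounded_linear)
  then show ?thesis using g by (intro exI[of _ "Blinfun g"]) (auto intro!: blinfun_eqI)
qed

section \<open>Complex frames of a tangent space\<close>

definition rank1 :: "cc \<Rightarrow> cc \<Rightarrow> (cc \<Rightarrow>\<^sub>L cc)" where
  "rank1 u v = blinfun_scaleR_left v o\<^sub>L blinfun_inner_left u"

lemma rank1_apply: "rank1 u v x = (x \<bullet> u) *\<^sub>R v"
  by (simp add: rank1_def blinfun_inner_left.rep_eq)

lemma bounded_linear_rank1: "bounded_linear (rank1 u)"
  unfolding rank1_def
  by (rule bounded_linear_compose[OF bounded_bilinear.bounded_linear_left[OF bounded_bilinear_blinfun_compose] bounded_linear_blinfun_scaleR_left])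

text \<open>\<open>cframe\<close> as a bounded operator, assembled from rank one operators so that
  its smooth dependence on the point can be stated and follows from that of \<open>J\<close> and
  \<open>v\<close>. Multiplication by \<open>\<i>\<close> on the coordinates corresponds to
  \<open>J\<close> (\<open>framemap_i\<close>).\<close>

definition framemap :: "(cc \<Rightarrow>\<^sub>L cc) \<Rightarrow> cc \<Rightarrow> cc \<Rightarrow> (cc \<Rightarrow>\<^sub>L cc)" where
  "framemap J v u = rank1 (1, 0) v + rank1 (\<i>, 0) (J v) + rank1 (0, 1) u + rank1 (0, \<i>) (J u)"

lemma framemap_apply: "framemap J v u (s, t) = Re s *\<^sub>R v + Im s *\<^sub>R J v + Re t *\<^sub>R u + Im t *\<^sub>R J u"
  by (simp add: framemap_def rank1_apply blinfun.bilinear_simps inner_complex_def)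

lemma framemap_cframe: "blinfun_apply (framemap J v u) = cframe J v u"
  by (rule ext) (simp add: cframe_def framemap_apply split: prod.splits)

lemma framemap_i:
  assumes "J o\<^sub>L J = - id_blinfun"
  shows "framemap J v u (\<i> * s, \<i> * t) = J (framemap J v u (s, t))"
proof -
  have JJ: "J (J x) = - x" for x
    by (rule blinfun_square_minus_idD[OF assms])
  show ?thesis by (simp add: framemap_apply blinfun.bilinear_simps JJ)
qed

text \<open>Any \<open>u\<close> outside the real span of \<open>v\<close> and \<open>J v\<close>
  works; the span has dimension at most 2 in a space of dimension 4. If a kernel element had a
  nonzero second coordinate, complex multiplication by its inverse would turn that coordinate into 1
  and put \<open>u\<close> into the span.\<close>

lemma exists_frame:
  fixes J :: "cc \<Rightarrow>\<^sub>L cc"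
  assumes J: "J o\<^sub>L J = - id_blinfun" and v: "v \<noteq> 0"
  shows "\<exists>u. inj (blinfun_apply (framemap J v u))"
proof -
  have JJ: "J (J x) = - x" for x
    by (rule blinfun_square_minus_idD[OF J])
  have "span {v, J v} \<noteq> UNIV"
  proof
    assume "span {v, J v} = UNIV"
    then have "dim (UNIV :: cc set) \<le> card {v, J v}" by (intro dim_le_card) auto
    also have "\<dots> \<le> 2" by (simp add: card_insert_if)
    finally show False by simp
  qed
  then obtain u where u: "u \<notin> span {v, J v}" by blast
  have sp: "Re s *\<^sub>R v + Im s *\<^sub>R J v \<in> span {v, J v}" for s
    by (intro span_add span_scale span_base) auto
  have ind: "s = 0" if "Re s *\<^sub>R v + Im s *\<^sub>R J v = 0" for s
  proof -
    have "Re s *\<^sub>R J v - Im s *\<^sub>R v = J (Re s *\<^sub>R v + Im s *\<^sub>R J v)" by (simp add: blinfun.bilinear_simps JJ)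
    then have e: "Re s *\<^sub>R J v - Im s *\<^sub>R v = 0" using that by (simp add: blinfun.bilinear_simps)
    have "(Re s * Re s + Im s * Im s) *\<^sub>R v = Re s *\<^sub>R (Re s *\<^sub>R v + Im s *\<^sub>R J v) - Im s *\<^sub>R (Re s *\<^sub>R J v - Im s *\<^sub>R v)"
      by (simp add: algebra_simps)
    then have "Re s * Re s + Im s * Im s = 0" using that e v by simp
    then show ?thesis by (simp add: complex_eq_iff)
  qed
  have "inj (blinfun_apply (framemap J v u))"
  proof (rule linear_injective_0[THEN iffD2, rule_format])
    show "linear (blinfun_apply (framemap J v u))" by (rule bounded_linear.linear[OF blinfun.bounded_linear_right])
    show "x = 0" if x: "framemap J v u x = 0" for x
    proof -
      obtain s t where st: "x = (s, t)" by (cases x)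
      have t: "t = 0"
      proof (rule ccontr)
        assume t: "t \<noteq> 0"
        define k where "k = inverse t"
        have J0: "framemap J v u (\<i> * s, \<i> * t) = 0" unfolding framemap_i[OF J] using x st by (simp add: blinfun.bilinear_simps)
        have "framemap J v u (k * s, k * t) = Re k *\<^sub>R framemap J v u (s, t) + Im k *\<^sub>R framemap J v u (\<i> * s, \<i> * t)"
          unfolding framemap_apply by (simp add: algebra_simps)
        then have "framemap J v u (k * s, 1) = 0" using x st J0 t by (simp add: k_def)
        then have "u = - (Re (k * s) *\<^sub>R v + Im (k * s) *\<^sub>R J v)"
          unfolding framemap_apply by (simp add: eq_neg_iff_add_eq_0 algebra_simps)
        then have "u \<in> span {v, J v}" using span_neg[OF sp[of "k * s"]] by (simp only:)
        then show False using u by blast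
      qed
      then have "s = 0" using x st by (intro ind) (simp add: framemap_apply)
      then show "x = 0" using t st by (simp add: zero_prod_def)
    qed
  qed
  then show ?thesis by blast
qed

lemma smooth_on_framemap:
  fixes J :: "'x::real_normed_vector \<Rightarrow> cc \<Rightarrow>\<^sub>L cc"
  assumes "open N" "smooth_on N J" "smooth_on N v"
  shows "smooth_on N (\<lambda>x. framemap (J x) (v x) u)"
  unfolding framemap_def
  by (intro smooth_on_add assms smooth_on_linear[OF bounded_linear_rank1] smooth_on_const
      smooth_on_bilinear[OF bounded_bilinear_blinfun_apply])

text \<open>If \<open>norm (F x - F x0) * norm G0 < 1\<close>, with \<open>G0\<close> the inverse at
  \<open>x0\<close>, then \<open>F x\<close> is injective, hence invertible by finite
  dimension.\<close>

lemma frame_inverse_nearby: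
  fixes F :: "cc \<Rightarrow> cc \<Rightarrow>\<^sub>L cc"
  assumes N: "open N" "x0 \<in> N" and F: "smooth_on N F" and inj: "inj (blinfun_apply (F x0))"
  shows "\<exists>N' Fi. open N' \<and> x0 \<in> N' \<and> N' \<subseteq> N \<and> smooth_on N' Fi \<and>
    (\<forall>x\<in>N'. F x o\<^sub>L Fi x = id_blinfun \<and> Fi x o\<^sub>L F x = id_blinfun)"
proof -
  obtain G0 where G0: "F x0 o\<^sub>L G0 = id_blinfun" "G0 o\<^sub>L F x0 = id_blinfun" using inj_blinfun_inverse[OF inj] by blast
  define N' where "N' = N \<inter> (\<lambda>x. norm (F x - F x0) * norm G0) -` {..<1}"
  have N': "open N'" unfolding N'_def
    by (rule continuous_open_preimage[OF _ N(1)]) (intro continuous_intros smooth_on_continuous_on F, simp)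
  have x0: "x0 \<in> N'" "N' \<subseteq> N" using N by (auto simp: N'_def)
  have "inj (blinfun_apply (F x))" if x: "x \<in> N'" for x
  proof (rule linear_injective_0[THEN iffD2, rule_format])
    show "linear (blinfun_apply (F x))" by (rule bounded_linear.linear[OF blinfun.bounded_linear_right])
    fix v assume v: "F x v = 0"
    have "v = G0 (F x0 v)" by (rule blinfun_compose_idD[OF G0(2), symmetric])
    also have "\<dots> = - (G0 ((F x - F x0) v))" by (simp add: blinfun.bilinear_simps v)
    also have "norm \<dots> \<le> norm G0 * (norm (F x - F x0) * norm v)"
      unfolding norm_minus_cancel by (rule order_trans[OF norm_blinfun mult_left_mono[OF norm_blinfun]]) simp
    finally have "norm v \<le> norm (F x - F x0) * norm G0 * norm v" by (simp add: mult_ac)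
    moreover have "norm (F x - F x0) * norm G0 < 1" using x by (simp add: N'_def)
    ultimately show "v = 0" by (metis mult_less_cancel_right_disj mult_1 not_less norm_ge_zero norm_le_zero_iff)
  qed
  then have "\<forall>x\<in>N'. \<exists>G. F x o\<^sub>L G = id_blinfun \<and> G o\<^sub>L F x = id_blinfun" using inj_blinfun_inverse by blast
  then obtain Fi where Fi: "\<And>x. x \<in> N' \<Longrightarrow> F x o\<^sub>L Fi x = id_blinfun \<and> Fi x o\<^sub>L F x = id_blinfun" by metis
  have "smooth_on N' Fi"
    by (rule smooth_on_blinfun_inverse[OF N' smooth_on_subset[OF F x0(2)]]) (use Fi in auto)
  then show ?thesis using N' x0 Fi by blast
qed

text \<open>A family of holomorphic immersed discs read in coordinates: \<open>G\<close> is the map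
  in a chart with image in \<open>Y\<close>, and \<open>Jl\<close> the structure in that chart. It
  is also instantiated with holomorphic coordinates, where \<open>Jl\<close> is constant.\<close>

locale curves =
  fixes N :: "cc set" and G :: "cc \<Rightarrow> cc" and Y :: "cc set" and Jl :: "cc \<Rightarrow> cc \<Rightarrow>\<^sub>L cc"
  assumes N: "open N" and G: "smooth_on N G" and GY: "G ` N \<subseteq> Y"
    and Y: "open Y" and Jl: "smooth_on Y Jl"
    and Jl2: "\<And>y. y \<in> Y \<Longrightarrow> Jl y o\<^sub>L Jl y = - id_blinfun"
    and holo: "\<And>x t. x \<in> N \<Longrightarrow> dd G (0, \<i> * t) x = Jl (G x) (dd G (0, t) x)"
    and imm: "\<And>x. x \<in> N \<Longrightarrow> dd G (0, 1) x \<noteq> 0"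
begin

definition "JJ x = Jl (G x)"
definition "ee x = dd G (0, 1) x"

lemma GinY: "x \<in> N \<Longrightarrow> G x \<in> Y" using GY by blast

lemma JJ2: "x \<in> N \<Longrightarrow> JJ x o\<^sub>L JJ x = - id_blinfun" unfolding JJ_def by (rule Jl2[OF GinY])

lemma JJJJ: "x \<in> N \<Longrightarrow> JJ x (JJ x v) = - v"
  by (rule blinfun_square_minus_idD[OF JJ2])

lemma smooth_JJ: "smooth_on N JJ"
  using smooth_on_compose[OF N Y GY G Jl] unfolding JJ_def[abs_def] .

lemma smooth_ee: "smooth_on N ee"
  unfolding ee_def[abs_def] by (rule smooth_on_dd[OF G])

lemma Di_G: "x \<in> N \<Longrightarrow> dd G (0, \<i>) x = JJ x (ee x)"
  using holo[of x 1] by (simp add: JJ_def ee_def)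

lemma JJ_derivative:
  assumes "x \<in> N"
  shows "(JJ has_derivative (\<lambda>u. frechet_derivative Jl (at (G x)) (dd G u x))) (at x)"
  unfolding JJ_def[abs_def]
  using has_derivative_compose[OF smooth_on_has_derivative[OF G assms] smooth_on_has_derivative[OF Jl GinY[OF assms]]] .

text \<open>\<open>Di_G\<close> is differentiated along \<open>u\<close> and the derivatives are
  exchanged. Besides the directions \<open>u\<close> transversal to the discs, \<open>(0, 1)\<close>
  and \<open>(0, \<i>)\<close> matter: for them the equation describes the frame vectors
  \<open>ee\<close> and \<open>JJ ee\<close>.\<close>

lemma variation:
  assumes x: "x \<in> N"
  shows "dd (dd G u) (0, \<i>) x = JJ x (dd (dd G u) (0, 1) x) + frechet_derivative Jl (at (G x)) (dd G u x) (ee x)"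
proof -
  have "dd (dd G u) (0, \<i>) x = dd (dd G (0, \<i>)) u x" by (rule dd_commute[OF N G x])
  also have "\<dots> = dd (\<lambda>x. JJ x (ee x)) u x"
    using frechet_derivative_transform_within_open[OF smooth_on_differentiable[OF smooth_on_dd[OF G] x] N x, of "(0, \<i>)" "\<lambda>x. JJ x (ee x)"] Di_G
    by simp
  also have "\<dots> = JJ x (dd ee u x) + frechet_derivative Jl (at (G x)) (dd G u x) (ee x)"
    using fun_cong[OF frechet_derivative_at[OF bounded_bilinear.FDERIV[OF bounded_bilinear_blinfun_apply JJ_derivative[OF x] smooth_on_has_derivative[OF smooth_ee x]], symmetric], of u]
    by simp
  also have "dd ee u x = dd (dd G u) (0, 1) x"
    unfolding ee_def[abs_def] by (rule dd_commute[OF N G x])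
  finally show ?thesis .
qed

text \<open>Modulo the tangent line of the disc the derivatives of the first coordinate of
  \<open>dG\<close> drop out of the linearised equation \<open>variation\<close>, so the second
  coordinate satisfies a closed system of order one.\<close>

lemma local_coords:
  assumes x0: "x0 \<in> N"
  shows "\<exists>N' v0 s s' a b A B. open N' \<and> x0 \<in> N' \<and> N' \<subseteq> N \<and>
    smooth_on N' s \<and> smooth_on N' s' \<and> smooth_on N' a \<and> smooth_on N' b \<and> smooth_on N' A \<and> smooth_on N' B \<and>
    (\<forall>x\<in>N'. bij (blinfun_apply (framemap (JJ x) (ee x) v0))) \<and>
    (\<forall>x\<in>N'. \<forall>\<zeta> \<omega>. dd G (\<zeta>, \<omega>) x =
        framemap (JJ x) (ee x) v0 (s x * \<zeta> + s' x * cnj \<zeta> + \<omega>, a x * \<zeta> + b x * cnj \<zeta>)) \<and>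
    (\<forall>x\<in>N'. (dd a (0, 1) x + \<i> * dd a (0, \<i>) x) / 2 = A x * a x + B x * cnj (b x)) \<and>
    (\<forall>x\<in>N'. (dd b (0, 1) x + \<i> * dd b (0, \<i>) x) / 2 = A x * b x + B x * cnj (a x)) \<and>
    ((\<exists>J0. \<forall>y\<in>Y. Jl y = J0) \<longrightarrow> (\<forall>x\<in>N'. A x = 0 \<and> B x = 0))"
proof -
  have "ee x0 \<noteq> 0" using imm[OF x0] by (simp add: ee_def)
  then obtain v0 where v0: "inj (blinfun_apply (framemap (JJ x0) (ee x0) v0))"
    using exists_frame[OF JJ2[OF x0]] by blast
  define F where "F = (\<lambda>x. framemap (JJ x) (ee x) v0)"
  have sF: "smooth_on N F" unfolding F_def by (rule smooth_on_framemap[OF N smooth_JJ smooth_ee])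
  obtain N' Fi where N': "open N'" "x0 \<in> N'" "N' \<subseteq> N" and sFi: "smooth_on N' Fi"
    and inv: "\<And>x. x \<in> N' \<Longrightarrow> F x o\<^sub>L Fi x = id_blinfun" "\<And>x. x \<in> N' \<Longrightarrow> Fi x o\<^sub>L F x = id_blinfun"
    using frame_inverse_nearby[OF N x0 sF] v0 unfolding F_def by blast
  note FFi = blinfun_compose_idD[OF inv(1)] and FiF = blinfun_compose_idD[OF inv(2)]
  have inN: "x \<in> N" if "x \<in> N'" for x using that N' by blast
  note sJJ = smooth_on_subset[OF smooth_JJ N'(3)] and see = smooth_on_subset[OF smooth_ee N'(3)]
    and sG = smooth_on_subset[OF G N'(3)]
  define p where "p = (\<lambda>x. JJ x (ee x))"
  define k where "k = (\<lambda>x. JJ x v0)"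
  have sp: "smooth_on N' p" unfolding p_def by (rule smooth_on_bilinear[OF bounded_bilinear_blinfun_apply N'(1) sJJ see])
  have sk: "smooth_on N' k" unfolding k_def by (rule smooth_on_bilinear[OF bounded_bilinear_blinfun_apply N'(1) sJJ smooth_on_const[OF N'(1)]])
  define V where "V = (\<lambda>u x. Fi x (dd G u x))"
  have sV: "smooth_on N' (V u)" for u
    unfolding V_def by (rule smooth_on_bilinear[OF bounded_bilinear_blinfun_apply N'(1) sFi smooth_on_dd[OF sG]])
  define S where "S = (\<lambda>u x. fst (V u x))"
  define X where "X = (\<lambda>u x. snd (V u x))"
  have sS: "smooth_on N' (S u)" for u unfolding S_def by (rule smooth_on_linear[OF bounded_linear_fst N'(1) sV])
  have sX: "smooth_on N' (X u)" for u unfolding X_def by (rule smooth_on_linear[OF bounded_linear_snd N'(1) sV])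
  define T where "T = (\<lambda>x v. frechet_derivative Jl (at (G x)) v)"
  have linT: "linear (T x)" if "x \<in> N'" for x
    unfolding T_def by (rule linear_frechet_derivative[OF smooth_on_differentiable[OF Jl GinY[OF inN[OF that]]]])
  have sT: "smooth_on N' (\<lambda>x. T x (v x))" if v: "smooth_on N' v" for v
  proof (rule smooth_on_cong[OF N'(1)])
    have "G ` N' \<subseteq> Y" using GY N'(3) by blast
    then have "smooth_on N' (\<lambda>x. dd Jl c (G x))" for c
      by (rule smooth_on_compose[OF N'(1) Y _ sG smooth_on_dd[OF Jl]])
    then show "smooth_on N' (\<lambda>x. \<Sum>c\<in>Basis. (v x \<bullet> c) *\<^sub>R dd Jl c (G x))"
      by (intro smooth_on_sum N'(1) smooth_on_scaleR smooth_on_linear[OF bounded_linear_inner_left] v)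
    show "(\<Sum>c\<in>Basis. (v x \<bullet> c) *\<^sub>R dd Jl c (G x)) = T x (v x)" if "x \<in> N'" for x
      unfolding T_def by (rule frechet_derivative_expand[OF smooth_on_differentiable[OF Jl GinY[OF inN[OF that]]], symmetric])
  qed
  \<comment> \<open>\<open>l1\<close> and \<open>l2\<close> are the defects of the frame vectors
    \<open>v0\<close> and \<open>k\<close> as solutions of the linearised equation, read modulo the
    tangent line; the derivatives of \<open>v0\<close> are 0.\<close>
  define l1 where "l1 = (\<lambda>x. - snd (Fi x (T x v0 (ee x))))"
  define l2 where "l2 = (\<lambda>x. snd (Fi x (dd k (0, \<i>) x - JJ x (dd k (0, 1) x) - T x (k x) (ee x))))"
  have sl: "smooth_on N' l1" "smooth_on N' l2"
    unfolding l1_def l2_def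
    by (intro smooth_on_minus smooth_on_linear[OF bounded_linear_snd] smooth_on_bilinear[OF bounded_bilinear_blinfun_apply]
      smooth_on_diff N'(1) sFi see sT smooth_on_const sk sJJ smooth_on_dd)+
  \<comment> \<open>The real-linear map sending \<open>X\<close> to
    \<open>- \<i> / 2 * (Re X * l1 + Im X * l2)\<close>, written in terms of \<open>X\<close> and
    \<open>cnj X\<close>.\<close>
  define A where "A = (\<lambda>x. - \<i> / 4 * (l1 x - \<i> * l2 x))"
  define B where "B = (\<lambda>x. - \<i> / 4 * (l1 x + \<i> * l2 x))"
  have sAB: "smooth_on N' A" "smooth_on N' B"
    unfolding A_def B_def by (intro smooth_on_mult smooth_on_diff smooth_on_add smooth_on_const N'(1) sl)+
  have basis: "Fi x (ee x) = (1, 0)" "Fi x (p x) = (\<i>, 0)" "Fi x v0 = (0, 1)" "Fi x (k x) = (0, \<i>)" if x: "x \<in> N'" for x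
    using FiF[OF x, of "(1, 0)"] FiF[OF x, of "(\<i>, 0)"] FiF[OF x, of "(0, 1)"] FiF[OF x, of "(0, \<i>)"]
    by (simp_all add: F_def framemap_apply p_def k_def)
  have Vexp: "dd G u x = Re (S u x) *\<^sub>R ee x + Im (S u x) *\<^sub>R p x + Re (X u x) *\<^sub>R v0 + Im (X u x) *\<^sub>R k x"
    if x: "x \<in> N'" for x u
  proof -
    have "dd G u x = F x (S u x, X u x)" using FFi[OF x, of "dd G u x"] by (simp add: S_def X_def V_def)
    then show ?thesis by (simp add: F_def framemap_apply p_def k_def)
  qed
  \<comment> \<open>The frame vectors \<open>ee\<close> and \<open>p\<close> are themselves
    variations of the discs, so they solve the linearised equation and contribute nothing to the
    system.\<close>
  have Ve: "dd ee (0, \<i>) x = JJ x (dd ee (0, 1) x) + T x (ee x) (ee x)" if x: "x \<in> N'" for x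
    using variation[OF inN[OF x], of "(0, 1)"] by (simp add: ee_def[abs_def] T_def)
  have Vp: "dd p (0, \<i>) x = JJ x (dd p (0, 1) x) + T x (p x) (ee x)" if x: "x \<in> N'" for x
  proof -
    have "frechet_derivative (dd G (0, \<i>)) (at x) = frechet_derivative p (at x)"
      by (rule frechet_derivative_transform_within_open[OF smooth_on_differentiable[OF smooth_on_dd[OF G] inN[OF x]] N inN[OF x]])
        (simp add: Di_G p_def)
    then show ?thesis using variation[OF inN[OF x], of "(0, \<i>)"] Di_G[OF inN[OF x]] by (simp add: p_def T_def)
  qed
  have pde: "dd (X u) (0, 1) x + \<i> * dd (X u) (0, \<i>) x = 2 * (A x * X u x + B x * cnj (X u x))" if x: "x \<in> N'" for x u
  proof -
    define S' where "S' = frechet_derivative (S u) (at x)"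
    define X' where "X' = frechet_derivative (X u) (at x)"
    have dS: "(S u has_derivative S') (at x)" unfolding S'_def by (rule smooth_on_has_derivative[OF sS x])
    have dX: "(X u has_derivative X') (at x)" unfolding X'_def by (rule smooth_on_has_derivative[OF sX x])
    note d = smooth_on_has_derivative[OF see x] smooth_on_has_derivative[OF sp x] smooth_on_has_derivative[OF sk x]
    have "((\<lambda>x. Re (S u x) *\<^sub>R ee x + Im (S u x) *\<^sub>R p x + Re (X u x) *\<^sub>R v0 + Im (X u x) *\<^sub>R k x) has_derivative
        (\<lambda>h. (Re (S u x) *\<^sub>R dd ee h x + Re (S' h) *\<^sub>R ee x) + (Im (S u x) *\<^sub>R dd p h x + Im (S' h) *\<^sub>R p x)
          + Re (X' h) *\<^sub>R v0 + (Im (X u x) *\<^sub>R dd k h x + Im (X' h) *\<^sub>R k x))) (at x)"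
      by (intro has_derivative_add has_derivative_scaleR has_derivative_scaleR_left has_derivative_Re has_derivative_Im dS dX d)
    note D = has_derivative_transform_within_open[OF this N'(1) x Vexp[symmetric]]
    have dV: "dd (dd G u) h x = (Re (S u x) *\<^sub>R dd ee h x + Re (S' h) *\<^sub>R ee x) + (Im (S u x) *\<^sub>R dd p h x + Im (S' h) *\<^sub>R p x)
          + Re (X' h) *\<^sub>R v0 + (Im (X u x) *\<^sub>R dd k h x + Im (X' h) *\<^sub>R k x)" for h
      using fun_cong[OF frechet_derivative_at[OF D, symmetric], of h] .
    have TV: "T x (dd G u x) = Re (S u x) *\<^sub>R T x (ee x) + Im (S u x) *\<^sub>R T x (p x) + Re (X u x) *\<^sub>R T x v0 + Im (X u x) *\<^sub>R T x (k x)"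
      unfolding Vexp[OF x] by (simp only: linear_add[OF linT[OF x]] linear_cmul[OF linT[OF x]])
    have Jp: "JJ x (p x) = - ee x" "JJ x (k x) = - v0" "JJ x (ee x) = p x" "JJ x v0 = k x"
      using JJJJ[OF inN[OF x]] by (simp_all add: p_def k_def)
    have "dd (dd G u) (0, \<i>) x = JJ x (dd (dd G u) (0, 1) x) + T x (dd G u x) (ee x)"
      using variation[OF inN[OF x], of u] by (simp add: T_def)
    then have "Re (S' (0, \<i>)) *\<^sub>R ee x + Im (S' (0, \<i>)) *\<^sub>R p x + Re (X' (0, \<i>)) *\<^sub>R v0
        + Im (X u x) *\<^sub>R dd k (0, \<i>) x + Im (X' (0, \<i>)) *\<^sub>R k x =
      Re (S' (0, 1)) *\<^sub>R p x - Im (S' (0, 1)) *\<^sub>R ee x + Re (X' (0, 1)) *\<^sub>R k x - Im (X' (0, 1)) *\<^sub>R v0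
        + Im (X u x) *\<^sub>R JJ x (dd k (0, 1) x) + Re (X u x) *\<^sub>R T x v0 (ee x) + Im (X u x) *\<^sub>R T x (k x) (ee x)"
      unfolding dV TV blinfun.bilinear_simps Jp Ve[OF x] Vp[OF x] by (simp add: algebra_simps)
    \<comment> \<open>The second coordinate in the frame kills \<open>ee\<close> and
      \<open>p\<close>, and with them all derivatives of \<open>S\<close>.\<close>
    from arg_cong[OF this, of "\<lambda>v. snd (Fi x v)"]
    have "of_real (Re (X' (0, \<i>))) + Im (X u x) *\<^sub>R snd (Fi x (dd k (0, \<i>) x)) + Im (X' (0, \<i>)) *\<^sub>R \<i> =
       Re (X' (0, 1)) *\<^sub>R \<i> - of_real (Im (X' (0, 1))) + Im (X u x) *\<^sub>R snd (Fi x (JJ x (dd k (0, 1) x)))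
        + Re (X u x) *\<^sub>R snd (Fi x (T x v0 (ee x))) + Im (X u x) *\<^sub>R snd (Fi x (T x (k x) (ee x)))"
      by (simp add: blinfun.bilinear_simps basis[OF x] scaleR_conv_of_real)
    then have eq: "X' (0, \<i>) = \<i> * X' (0, 1) - Re (X u x) *\<^sub>R l1 x - Im (X u x) *\<^sub>R l2 x"
      unfolding l1_def l2_def complex_eq_iff by (simp add: blinfun.bilinear_simps algebra_simps)
    have "X' (0, 1) + \<i> * X' (0, \<i>) = - \<i> * (Re (X u x) * l1 x + Im (X u x) * l2 x)"
      unfolding eq by (simp add: scaleR_conv_of_real algebra_simps)
    also have "\<dots> = 2 * (A x * X u x + B x * cnj (X u x))"
    proof -
      have "X u x + cnj (X u x) = 2 * Re (X u x)" "X u x - cnj (X u x) = 2 * \<i> * Im (X u x)"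
        by (simp_all add: complex_eq_iff)
      then have r: "complex_of_real (Re (X u x)) = (X u x + cnj (X u x)) / 2" "complex_of_real (Im (X u x)) = - \<i> * (X u x - cnj (X u x)) / 2"
        by (simp_all add: mult.assoc[symmetric])
      show ?thesis unfolding r A_def B_def by (simp add: field_simps)
    qed
    finally show ?thesis unfolding X'_def .
  qed
  define s where "s = (\<lambda>x. (S (1, 0) x - \<i> * S (\<i>, 0) x) / 2)"
  define s' where "s' = (\<lambda>x. (S (1, 0) x + \<i> * S (\<i>, 0) x) / 2)"
  define a where "a = (\<lambda>x. (X (1, 0) x - \<i> * X (\<i>, 0) x) / 2)"
  define b where "b = (\<lambda>x. (X (1, 0) x + \<i> * X (\<i>, 0) x) / 2)"
  have sm: "smooth_on N' s" "smooth_on N' s'" "smooth_on N' a" "smooth_on N' b"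
    unfolding s_def s'_def a_def b_def divide_inverse
    by (intro smooth_on_mult smooth_on_diff smooth_on_add smooth_on_const N'(1) sS sX)+
  have rel: "dd G (\<zeta>, \<omega>) x = framemap (JJ x) (ee x) v0 (s x * \<zeta> + s' x * cnj \<zeta> + \<omega>, a x * \<zeta> + b x * cnj \<zeta>)"
    if x: "x \<in> N'" for x \<zeta> \<omega>
  proof -
    have l: "linear (frechet_derivative G (at x))" by (rule linear_frechet_derivative[OF smooth_on_differentiable[OF sG x]])
    have u: "(\<zeta>, \<omega>) = Re \<zeta> *\<^sub>R (1, 0) + Im \<zeta> *\<^sub>R (\<i>, 0) + Re \<omega> *\<^sub>R (0, 1) + Im \<omega> *\<^sub>R (0, \<i>)"
      by (simp add: complex_eq_iff)
    have "dd G (\<zeta>, \<omega>) x = Re \<zeta> *\<^sub>R dd G (1, 0) x + Im \<zeta> *\<^sub>R dd G (\<i>, 0) x + Re \<omega> *\<^sub>R ee x + Im \<omega> *\<^sub>R p x"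
      unfolding u linear_add[OF l] linear_cmul[OF l] using Di_G[OF inN[OF x]] by (simp add: ee_def p_def)
    then have "Fi x (dd G (\<zeta>, \<omega>) x) = Re \<zeta> *\<^sub>R V (1, 0) x + Im \<zeta> *\<^sub>R V (\<i>, 0) x + (\<omega>, 0)"
      by (simp add: blinfun.bilinear_simps basis[OF x] V_def complex_eq_iff)
    also have "\<dots> = (s x * \<zeta> + s' x * cnj \<zeta> + \<omega>, a x * \<zeta> + b x * cnj \<zeta>)"
    proof -
      have c: "(P - \<i> * Q) / 2 * \<zeta> + (P + \<i> * Q) / 2 * cnj \<zeta> = Re \<zeta> *\<^sub>R P + Im \<zeta> *\<^sub>R Q" for P Q
        by (simp add: complex_eq_iff field_simps)
      show ?thesis unfolding s_def s'_def a_def b_def c by (simp add: S_def X_def prod_eq_iff)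
    qed
    finally have "F x (Fi x (dd G (\<zeta>, \<omega>) x)) = F x (s x * \<zeta> + s' x * cnj \<zeta> + \<omega>, a x * \<zeta> + b x * cnj \<zeta>)" by simp
    then show ?thesis unfolding FFi[OF x] by (simp add: F_def)
  qed
  have bijF: "bij (blinfun_apply (framemap (JJ x) (ee x) v0))" if x: "x \<in> N'" for x
    by (rule o_bij[of "blinfun_apply (Fi x)"]) (use FFi[OF x] FiF[OF x] in \<open>auto simp: fun_eq_iff F_def\<close>)
  have dab: "dd a h x = (dd (X (1, 0)) h x - \<i> * dd (X (\<i>, 0)) h x) / 2"
    "dd b h x = (dd (X (1, 0)) h x + \<i> * dd (X (\<i>, 0)) h x) / 2" if x: "x \<in> N'" for x h
  proof -
    note d = smooth_on_has_derivative[OF sX[of "(1, 0)"] x] smooth_on_has_derivative[OF sX[of "(\<i>, 0)"] x]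
    have "(a has_derivative (\<lambda>h. (dd (X (1, 0)) h x - \<i> * dd (X (\<i>, 0)) h x) / 2)) (at x)"
      unfolding a_def divide_inverse by (intro has_derivative_mult_left has_derivative_diff has_derivative_mult_right d)
    from fun_cong[OF frechet_derivative_at[OF this, symmetric], of h] show "dd a h x = (dd (X (1, 0)) h x - \<i> * dd (X (\<i>, 0)) h x) / 2" .
    have "(b has_derivative (\<lambda>h. (dd (X (1, 0)) h x + \<i> * dd (X (\<i>, 0)) h x) / 2)) (at x)"
      unfolding b_def divide_inverse by (intro has_derivative_mult_left has_derivative_add has_derivative_mult_right d)
    from fun_cong[OF frechet_derivative_at[OF this, symmetric], of h] show "dd b h x = (dd (X (1, 0)) h x + \<i> * dd (X (\<i>, 0)) h x) / 2" .
  qed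
  \<comment> \<open>Conjugation exchanges the complex linear and the conjugate linear combination;
    this is why \<open>cnj b\<close> appears in the equation of \<open>a\<close> and
    \<open>cnj a\<close> in that of \<open>b\<close>.\<close>
  have comb: "((P1 - \<i> * Q1) / 2 + \<i> * ((P2 - \<i> * Q2) / 2)) / 2 = A x * ((p0 - \<i> * q0) / 2) + B x * cnj ((p0 + \<i> * q0) / 2)"
    "((P1 + \<i> * Q1) / 2 + \<i> * ((P2 + \<i> * Q2) / 2)) / 2 = A x * ((p0 + \<i> * q0) / 2) + B x * cnj ((p0 - \<i> * q0) / 2)"
    if "P1 + \<i> * P2 = 2 * (A x * p0 + B x * cnj p0)" "Q1 + \<i> * Q2 = 2 * (A x * q0 + B x * cnj q0)"
    for x P1 P2 Q1 Q2 p0 q0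
  proof -
    have 1: "((P1 - \<i> * Q1) / 2 + \<i> * ((P2 - \<i> * Q2) / 2)) / 2 = ((P1 + \<i> * P2) - \<i> * (Q1 + \<i> * Q2)) / 4"
      and 2: "((P1 + \<i> * Q1) / 2 + \<i> * ((P2 + \<i> * Q2) / 2)) / 2 = ((P1 + \<i> * P2) + \<i> * (Q1 + \<i> * Q2)) / 4"
      by (simp_all add: field_simps)
    show "((P1 - \<i> * Q1) / 2 + \<i> * ((P2 - \<i> * Q2) / 2)) / 2 = A x * ((p0 - \<i> * q0) / 2) + B x * cnj ((p0 + \<i> * q0) / 2)"
      "((P1 + \<i> * Q1) / 2 + \<i> * ((P2 + \<i> * Q2) / 2)) / 2 = A x * ((p0 + \<i> * q0) / 2) + B x * cnj ((p0 - \<i> * q0) / 2)"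
      unfolding 1 2 that by (simp_all add: field_simps)
  qed
  have eqs: "(dd a (0, 1) x + \<i> * dd a (0, \<i>) x) / 2 = A x * a x + B x * cnj (b x)"
    "(dd b (0, 1) x + \<i> * dd b (0, \<i>) x) / 2 = A x * b x + B x * cnj (a x)" if x: "x \<in> N'" for x
  proof -
    have ab: "a x = (X (1, 0) x - \<i> * X (\<i>, 0) x) / 2" "b x = (X (1, 0) x + \<i> * X (\<i>, 0) x) / 2"
      by (simp_all add: a_def b_def)
    show "(dd a (0, 1) x + \<i> * dd a (0, \<i>) x) / 2 = A x * a x + B x * cnj (b x)"
      "(dd b (0, 1) x + \<i> * dd b (0, \<i>) x) / 2 = A x * b x + B x * cnj (a x)"
      unfolding dab[OF x] ab by (rule comb[OF pde[OF x] pde[OF x]])+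
  qed
  \<comment> \<open>A structure that is constant in the chart has \<open>T = 0\<close> and makes
    \<open>k\<close> constant, so both defects vanish.\<close>
  have const: "A x = 0 \<and> B x = 0" if J0: "\<forall>y\<in>Y. Jl y = J0" and x: "x \<in> N'" for J0 x
  proof -
    have "(Jl has_derivative (\<lambda>_. 0)) (at (G x))"
      by (rule has_derivative_transform_within_open[OF has_derivative_const[of J0] Y GinY[OF inN[OF x]]]) (use J0 in simp)
    from fun_cong[OF frechet_derivative_at[OF this, symmetric]] have T0: "T x v = 0" for v unfolding T_def .
    have "(k has_derivative (\<lambda>_. 0)) (at x)"
    proof (rule has_derivative_transform_within_open[OF has_derivative_const[of "J0 v0"] N'(1) x])
      show "J0 v0 = k y" if "y \<in> N'" for y using J0 GinY[OF inN[OF that]] by (simp add: k_def JJ_def)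
    qed
    from fun_cong[OF frechet_derivative_at[OF this, symmetric]] have k0: "dd k h x = 0" for h .
    show ?thesis by (simp add: A_def B_def l1_def l2_def T0 k0 blinfun.bilinear_simps)
  qed
  show ?thesis
  proof (rule exI[of _ N'], rule exI[of _ v0], rule exI[of _ s], rule exI[of _ s'], rule exI[of _ a], rule exI[of _ b],
        rule exI[of _ A], rule exI[of _ B], intro conjI)
    show "(\<exists>J0. \<forall>y\<in>Y. Jl y = J0) \<longrightarrow> (\<forall>x\<in>N'. A x = 0 \<and> B x = 0)"
    proof (intro impI ballI)
      fix x assume "\<exists>J0. \<forall>y\<in>Y. Jl y = J0" and x: "x \<in> N'"
      then obtain J0 where "\<forall>y\<in>Y. Jl y = J0" by blast
      from const[OF this x] show "A x = 0 \<and> B x = 0" .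
    qed
    show "\<forall>x\<in>N'. bij (blinfun_apply (framemap (JJ x) (ee x) v0))" by (rule ballI) (rule bijF)
    show "\<forall>x\<in>N'. \<forall>\<zeta> \<omega>. dd G (\<zeta>, \<omega>) x =
        framemap (JJ x) (ee x) v0 (s x * \<zeta> + s' x * cnj \<zeta> + \<omega>, a x * \<zeta> + b x * cnj \<zeta>)"
      by (intro ballI allI) (rule rel)
    show "\<forall>x\<in>N'. (dd a (0, 1) x + \<i> * dd a (0, \<i>) x) / 2 = A x * a x + B x * cnj (b x)" by (rule ballI) (rule eqs)
    show "\<forall>x\<in>N'. (dd b (0, 1) x + \<i> * dd b (0, \<i>) x) / 2 = A x * b x + B x * cnj (a x)" by (rule ballI) (rule eqs)
  qed (fact N' sm sAB)+
qed

end

subsection \<open>Bounds and parameter integrals of smooth maps\<close>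

lemma smooth_bounds:
  fixes f :: "'a::euclidean_space \<Rightarrow> 'b::real_normed_vector"
  assumes U: "open U" and f: "smooth_on U f" and K: "compact K" "convex K" "K \<subseteq> U"
  shows "\<exists>L\<ge>0. (\<forall>x\<in>K. norm (f x) \<le> L) \<and> (\<forall>x\<in>K. \<forall>u. norm (dd f u x) \<le> L * norm u) \<and>
    (\<forall>x\<in>K. \<forall>y\<in>K. norm (f x - f y) \<le> L * norm (x - y))"
proof -
  have bd: "\<exists>L. \<forall>x\<in>K. norm (g x) \<le> L" if "smooth_on U g" for g :: "'a \<Rightarrow> 'b"
  proof -
    have "compact (g ` K)"
      by (rule compact_continuous_image[OF continuous_on_subset[OF smooth_on_continuous_on[OF that] K(3)] K(1)])
    then show ?thesis using compact_imp_bounded bounded_iff by (metis image_eqI)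
  qed
  obtain L0 where L0: "\<And>x. x \<in> K \<Longrightarrow> norm (f x) \<le> L0" using bd[OF f] by blast
  obtain l where l: "\<And>b x. x \<in> K \<Longrightarrow> norm (dd f b x) \<le> l b" using bd[OF smooth_on_dd[OF f]] by metis
  define L where "L = max 0 L0 + (\<Sum>b\<in>Basis. \<bar>l b\<bar>)"
  have S0: "0 \<le> (\<Sum>b\<in>Basis. \<bar>l b\<bar>)" by (rule sum_nonneg) simp
  have D: "norm (dd f u x) \<le> L * norm u" if x: "x \<in> K" for x u
  proof -
    have "norm (dd f u x) = norm (\<Sum>b\<in>Basis. (u \<bullet> b) *\<^sub>R dd f b x)"
      using frechet_derivative_expand[OF smooth_on_differentiable[OF f], of x u] x K by auto
    also have "\<dots> \<le> (\<Sum>b\<in>Basis. norm u * \<bar>l b\<bar>)"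
      unfolding norm_scaleR[symmetric]
    proof (rule order_trans[OF norm_sum sum_mono])
      fix b :: 'a assume b: "b \<in> Basis"
      have "norm (dd f b x) \<le> \<bar>l b\<bar>" using l[OF x, of b] by linarith
      then show "norm ((u \<bullet> b) *\<^sub>R dd f b x) \<le> norm u * \<bar>l b\<bar>"
        unfolding norm_scaleR using Basis_le_norm[OF b, of u] by (intro mult_mono) auto
    qed
    also have "\<dots> = (\<Sum>b\<in>Basis. \<bar>l b\<bar>) * norm u" by (simp add: sum_distrib_left mult.commute)
    also have "\<dots> \<le> L * norm u" by (intro mult_right_mono) (auto simp: L_def)
    finally show ?thesis .
  qed
  have "norm (f x - f y) \<le> L * norm (x - y)" if "x \<in> K" "y \<in> K" for x y
  proof (rule differentiable_bound[OF K(2) _ _ that(1,2)])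
    fix z assume z: "z \<in> K"
    show "(f has_derivative frechet_derivative f (at z)) (at z within K)"
      using smooth_on_has_derivative[OF f] z K(3) has_derivative_at_withinI by blast
    show "onorm (frechet_derivative f (at z)) \<le> L" by (rule onorm_le) (rule D[OF z])
  qed
  moreover have "norm (f x) \<le> L" if "x \<in> K" for x using L0[OF that] S0 unfolding L_def by linarith
  moreover have "L \<ge> 0" using S0 by (simp add: L_def)
  ultimately show ?thesis using D by blast
qed

lemma smooth_on_fst: "open S \<Longrightarrow> smooth_on S f \<Longrightarrow> smooth_on S (\<lambda>x. fst (f x))"
  by (rule smooth_on_linear[OF bounded_linear_fst])

lemma smooth_on_snd: "open S \<Longrightarrow> smooth_on S f \<Longrightarrow> smooth_on S (\<lambda>x. snd (f x))"
  by (rule smooth_on_linear[OF bounded_linear_snd])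

lemma smooth_on_cnj: "open S \<Longrightarrow> smooth_on S f \<Longrightarrow> smooth_on S (\<lambda>x. cnj (f x))"
  by (rule smooth_on_linear[OF bounded_linear_cnj])

lemma bounded_linear_inl: "bounded_linear (\<lambda>x. (x, 0))"
  and bounded_linear_inr: "bounded_linear (\<lambda>x. (0, x))"
  by (auto intro!: bounded_linear_Pair bounded_linear_zero bounded_linear_ident)

lemma smooth_on_Pair:
  assumes "open S" "smooth_on S f" "smooth_on S g"
  shows "smooth_on S (\<lambda>x. (f x, g x))"
  using smooth_on_add[OF assms(1) smooth_on_linear[OF bounded_linear_inl assms(1,2)] smooth_on_linear[OF bounded_linear_inr assms(1,3)]]
  by simp

lemma ck_integral:
  fixes \<Phi> :: "'a::euclidean_space \<times> real \<Rightarrow> complex"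
  assumes U: "open U" and \<Phi>: "smooth_on (U \<times> UNIV) \<Phi>"
  shows "ck n U (\<lambda>x. integral {a..b} (\<lambda>t. \<Phi> (x, t)))"
  using \<Phi>
proof (induction n arbitrary: \<Phi> rule: less_induct)
  case (less n)
  note \<Phi> = less.prems
  have UU: "open (U \<times> (UNIV :: real set))" by (intro open_Times U open_UNIV)
  have dd_cont: "continuous_on (U \<times> UNIV) (dd \<Phi> v)" for v
    by (rule smooth_on_continuous_on[OF smooth_on_dd[OF \<Phi>]])
  have int: "(\<lambda>t. \<Phi>' (x, t)) integrable_on {a..b}" if "x \<in> U" "continuous_on (U \<times> UNIV) \<Phi>'" for x and \<Phi>' :: "'a \<times> real \<Rightarrow> complex"
    by (intro integrable_continuous_real continuous_on_compose2[OF that(2)] continuous_intros) (use that in auto)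
  have D: "((\<lambda>x. integral {a..b} (\<lambda>t. \<Phi> (x, t))) has_derivative (\<lambda>v. integral {a..b} (\<lambda>t. dd \<Phi> (v, 0) (x, t)))) (at x)"
    if x: "x \<in> U" for x
  proof -
    obtain r where r: "r > 0" "ball x r \<subseteq> U" using openE[OF U x] by blast
    \<comment> \<open>Differentiation under the integral takes the derivative as an operator
      depending continuously on the parameters; it is assembled from the partial derivatives along
      the basis.\<close>
    define fx where "fx = (\<lambda>y t. \<Sum>c\<in>Basis. blinfun_scaleR_left (dd \<Phi> (c, 0) (y, t)) o\<^sub>L blinfun_inner_left (c::'a))"
    have fxa: "blinfun_apply (fx y t) v = dd \<Phi> (v, 0) (y, t)" if "y \<in> U" for y v and t :: real
    proof -
      have l: "linear (frechet_derivative \<Phi> (at (y, t)))"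
        by (rule linear_frechet_derivative[OF smooth_on_differentiable[OF \<Phi>]]) (use that in auto)
      have "(v, 0 :: real) = (\<Sum>c\<in>Basis. (v \<bullet> c) *\<^sub>R (c, 0))"
        by (simp add: euclidean_representation prod_eq_iff fst_sum snd_sum)
      then have "dd \<Phi> (v, 0) (y, t) = (\<Sum>c\<in>Basis. (v \<bullet> c) *\<^sub>R dd \<Phi> (c, 0) (y, t))"
        by (simp only: linear_sum[OF l] linear_cmul[OF l])
      also have "\<dots> = blinfun_apply (fx y t) v"
        by (simp add: fx_def blinfun.sum_left blinfun_inner_left.rep_eq)
      finally show ?thesis by simp
    qed
    have "((\<lambda>x. integral (cbox a b) (\<lambda>t. \<Phi> (x, t))) has_derivative blinfun_apply (integral (cbox a b) (fx x))) (at x within ball x r)"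
    proof (rule leibniz_rule)
      fix y and t :: real assume y: "y \<in> ball x r"
      then have yU: "y \<in> U" using r by blast
      have l: "((\<lambda>y. (y, t)) has_derivative (\<lambda>v. (v, 0))) (at y within ball x r)"
        by (auto intro!: derivative_eq_intros)
      have "((\<lambda>y. \<Phi> (y, t)) has_derivative (\<lambda>v. dd \<Phi> (v, 0) (y, t))) (at y within ball x r)"
        by (rule has_derivative_compose[OF l smooth_on_has_derivative[OF \<Phi>]]) (use yU in auto)
      then show "((\<lambda>y. \<Phi> (y, t)) has_derivative blinfun_apply (fx y t)) (at y within ball x r)"
        by (rule has_derivative_eq_rhs) (simp add: fun_eq_iff fxa[OF yU])
    next
      show "(\<lambda>t. \<Phi> (y, t)) integrable_on cbox a b" if "y \<in> ball x r" for y
        using int[of y \<Phi>] that r smooth_on_continuous_on[OF \<Phi>] by auto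
      have "continuous_on (ball x r \<times> cbox a b) (\<lambda>p. blinfun_scaleR_left (dd \<Phi> (c, 0) p) o\<^sub>L blinfun_inner_left c)" for c :: 'a
      proof -
        have "bounded_linear (\<lambda>v::complex. blinfun_scaleR_left v o\<^sub>L blinfun_inner_left c)"
          by (rule bounded_linear_compose[OF bounded_bilinear.bounded_linear_left[OF bounded_bilinear_blinfun_compose] bounded_linear_blinfun_scaleR_left])
        moreover have "ball x r \<times> cbox a b \<subseteq> U \<times> UNIV" using r by auto
        ultimately show ?thesis
          by (intro bounded_linear.continuous_on[of "\<lambda>v::complex. blinfun_scaleR_left v o\<^sub>L blinfun_inner_left c"]
              continuous_on_subset[OF dd_cont])
      qed
      then show "continuous_on (ball x r \<times> cbox a b) (\<lambda>(y, t). fx y t)"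
        unfolding fx_def split_beta by (intro continuous_on_sum) simp
    qed (use r in auto)
    then have "((\<lambda>x. integral {a..b} (\<lambda>t. \<Phi> (x, t))) has_derivative blinfun_apply (integral {a..b} (fx x))) (at x)"
      using at_within_open[of x "ball x r"] r by simp
    moreover have "blinfun_apply (integral {a..b} (fx x)) v = integral {a..b} (\<lambda>t. dd \<Phi> (v, 0) (x, t))" for v
    proof -
      have "continuous_on {a..b} (\<lambda>t. blinfun_scaleR_left (dd \<Phi> (c, 0) (x, t)) o\<^sub>L blinfun_inner_left c)" for c :: 'a
      proof -
        have "bounded_linear (\<lambda>v::complex. blinfun_scaleR_left v o\<^sub>L blinfun_inner_left c)"
          by (rule bounded_linear_compose[OF bounded_bilinear.bounded_linear_left[OF bounded_bilinear_blinfun_compose] bounded_linear_blinfun_scaleR_left])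
        moreover have "continuous_on {a..b} (\<lambda>t. dd \<Phi> (c, 0) (x, t))"
          by (rule continuous_on_compose2[OF dd_cont]) (use x in \<open>auto intro!: continuous_intros\<close>)
        ultimately show ?thesis
          by (rule bounded_linear.continuous_on[of "\<lambda>v::complex. blinfun_scaleR_left v o\<^sub>L blinfun_inner_left c"])
      qed
      then have "fx x integrable_on {a..b}"
        unfolding fx_def by (intro integrable_continuous_real continuous_on_sum) simp
      from integral_linear[OF this, of "\<lambda>T. blinfun_apply T v"]
      show ?thesis using fxa[OF x] by (simp add: o_def blinfun.bounded_linear_left)
    qed
    then have "blinfun_apply (integral {a..b} (fx x)) = (\<lambda>v. integral {a..b} (\<lambda>t. dd \<Phi> (v, 0) (x, t)))" by (rule ext)
    ultimately show ?thesis by (rule has_derivative_eq_rhs)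
  qed
  show ?case
  proof (rule ckI[OF U D])
    fix m v assume "n = Suc m"
    then show "ck m U (\<lambda>x. integral {a..b} (\<lambda>t. dd \<Phi> (v, 0) (x, t)))"
      by (intro less.IH smooth_on_dd \<Phi>) simp
  qed
qed

lemma smooth_on_integral:
  fixes \<Phi> :: "'a::euclidean_space \<times> real \<Rightarrow> complex"
  assumes "open U" "smooth_on (U \<times> UNIV) \<Phi>"
  shows "smooth_on U (\<lambda>x. integral {a..b} (\<lambda>t. \<Phi> (x, t)))"
  unfolding smooth_on_iff_ck by (intro allI ck_integral assms)

lemma smooth_on_cis: "smooth_on UNIV cis"
proof -
  have d: "(cis has_derivative (\<lambda>h. h *\<^sub>R (\<i> * cis t))) (at t)" for t
    by (auto intro!: derivative_eq_intros)
  have "ck n UNIV cis" for n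
  proof (induction n rule: less_induct)
    case (less n)
    show ?case
    proof (rule ckI[OF open_UNIV d])
      fix m :: nat and v :: real assume "n = Suc m"
      then have "ck m UNIV cis" using less.IH by simp
      then show "ck m UNIV (\<lambda>t. v *\<^sub>R (\<i> * cis t))"
        by (rule ck_linear[OF bounded_linear_compose[OF bounded_linear_scaleR_right bounded_linear_mult_right] open_UNIV])
    qed
  qed
  then show ?thesis by (simp add: smooth_on_iff_ck)
qed

subsection \<open>The structure determined by the Beltrami coefficient\<close>

text \<open>The structure that makes \<open>(\<zeta>, \<omega>) \<mapsto> (s \<zeta> + s' cnj \<zeta> + \<omega>, \<zeta> + q cnj \<zeta>)\<close> complex linear, for \<open>|q| < 1\<close>; on
  \<open>|q| = 1\<close> its entries are divisions by zero.\<close>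

definition JQ :: "complex \<times> complex \<times> complex \<Rightarrow> (cc \<Rightarrow>\<^sub>L cc)" where
  "JQ = (\<lambda>(q, s, s'). let \<mu> = \<i> * (1 + q * cnj q) / (1 - q * cnj q); \<nu> = 2 * \<i> * q / (1 - q * cnj q);
      \<sigma> = \<i> * s - s * \<mu> - s' * cnj \<nu>; \<tau> = \<i> * s' - s * \<nu> - s' * cnj \<mu>
    in rank1 (1, 0) (\<mu> + \<nu>, \<sigma> + \<tau>) + rank1 (\<i>, 0) (\<i> * (\<mu> - \<nu>), \<i> * (\<sigma> - \<tau>)) + rank1 (0, 1) (0, \<i>) + rank1 (0, \<i>) (0, - 1))"

lemma cnj_mult_less_1: "norm q < 1 \<Longrightarrow> 1 - q * cnj q \<noteq> 0"
proof
  assume q: "norm q < 1" "1 - q * cnj q = 0"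
  then have "q * cnj q = 1" by simp
  then have "(norm q)\<^sup>2 = 1" unfolding complex_norm_square[symmetric] by (metis of_real_eq_1_iff)
  then have "norm q = 1 \<or> norm q = - 1" by (simp add: power2_eq_1_iff)
  then show False using q(1) norm_ge_zero[of q] by (elim disjE) linarith+
qed

lemma smooth_on_JQ: "smooth_on (ball 0 1 \<times> UNIV \<times> UNIV) JQ"
proof -
  let ?S = "ball 0 1 \<times> UNIV \<times> UNIV :: (complex \<times> complex \<times> complex) set"
  have S: "open ?S" by (intro open_Times open_ball open_UNIV)
  note intros = smooth_on_add smooth_on_diff smooth_on_mult smooth_on_divide smooth_on_const smooth_on_id smooth_on_fst
    smooth_on_snd smooth_on_cnj smooth_on_Pair smooth_on_linear[OF bounded_linear_rank1] S
  have "smooth_on ?S (\<lambda>x. let q = fst x; s = fst (snd x); s' = snd (snd x);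
      \<mu> = \<i> * (1 + q * cnj q) / (1 - q * cnj q); \<nu> = 2 * \<i> * q / (1 - q * cnj q);
      \<sigma> = \<i> * s - s * \<mu> - s' * cnj \<nu>; \<tau> = \<i> * s' - s * \<nu> - s' * cnj \<mu>
    in rank1 (1, 0) (\<mu> + \<nu>, \<sigma> + \<tau>) + rank1 (\<i>, 0) (\<i> * (\<mu> - \<nu>), \<i> * (\<sigma> - \<tau>)) + rank1 (0, 1) (0, \<i>) + rank1 (0, \<i>) (0, - 1))"
    unfolding Let_def by (intro intros) (use cnj_mult_less_1 in auto)
  then show ?thesis unfolding JQ_def case_prod_unfold Let_def .
qed

lemma JQ_intertwines:
  fixes q s s' a :: complex
  assumes "norm q < 1" "JQ (q, s, s') (\<zeta>, \<omega>) = (\<zeta>', \<omega>')"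
  shows "s * \<zeta>' + s' * cnj \<zeta>' + \<omega>' = \<i> * (s * \<zeta> + s' * cnj \<zeta> + \<omega>)" "\<zeta>' + q * cnj \<zeta>' = \<i> * (\<zeta> + q * cnj \<zeta>)"
proof -
  define \<mu> where "\<mu> = \<i> * (1 + q * cnj q) / (1 - q * cnj q)"
  define \<nu> where "\<nu> = 2 * \<i> * q / (1 - q * cnj q)"
  define \<sigma> where "\<sigma> = \<i> * s - s * \<mu> - s' * cnj \<nu>"
  define \<tau> where "\<tau> = \<i> * s' - s * \<nu> - s' * cnj \<mu>"
  have exp: "Re \<zeta> *\<^sub>R (x + y) + Im \<zeta> *\<^sub>R (\<i> * (x - y)) = x * \<zeta> + y * cnj \<zeta>" for x y
    by (simp add: complex_eq_iff algebra_simps)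
  have om: "Re \<omega> *\<^sub>R \<i> - complex_of_real (Im \<omega>) = \<i> * \<omega>" by (simp add: complex_eq_iff)
  have J: "JQ (q, s, s') = rank1 (1, 0) (\<mu> + \<nu>, \<sigma> + \<tau>) + rank1 (\<i>, 0) (\<i> * (\<mu> - \<nu>), \<i> * (\<sigma> - \<tau>)) + rank1 (0, 1) (0, \<i>) + rank1 (0, \<i>) (0, - 1)"
    unfolding JQ_def \<mu>_def \<nu>_def \<sigma>_def \<tau>_def Let_def split_conv by (rule refl)
  have "JQ (q, s, s') (\<zeta>, \<omega>) = (\<mu> * \<zeta> + \<nu> * cnj \<zeta>, (\<sigma> * \<zeta> + \<tau> * cnj \<zeta>) + \<i> * \<omega>)"
    unfolding exp[symmetric] om[symmetric] J
    by (simp add: blinfun.bilinear_simps rank1_apply inner_complex_def scaleR_conv_of_real)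
  then have z: "\<zeta>' = \<mu> * \<zeta> + \<nu> * cnj \<zeta>" and w: "\<omega>' = \<sigma> * \<zeta> + \<tau> * cnj \<zeta> + \<i> * \<omega>" using assms(2) by auto
  show "s * \<zeta>' + s' * cnj \<zeta>' + \<omega>' = \<i> * (s * \<zeta> + s' * cnj \<zeta> + \<omega>)"
    unfolding z w \<sigma>_def \<tau>_def by (simp add: algebra_simps)
  have nz: "1 - q * cnj q \<noteq> 0" "1 - cnj q * q \<noteq> 0" using cnj_mult_less_1[OF assms(1)] by (simp_all add: mult.commute)
  have 1: "\<mu> + q * cnj \<nu> = \<i>" "\<nu> + q * cnj \<mu> = \<i> * q"
    unfolding \<mu>_def \<nu>_def using nz by (simp_all add: divide_simps) (simp_all add: algebra_simps)
  have "\<zeta>' + q * cnj \<zeta>' = (\<mu> + q * cnj \<nu>) * \<zeta> + (\<nu> + q * cnj \<mu>) * cnj \<zeta>"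
    unfolding z by (simp add: algebra_simps)
  then show "\<zeta>' + q * cnj \<zeta>' = \<i> * (\<zeta> + q * cnj \<zeta>)" unfolding 1 by (simp add: algebra_simps)
qed

section \<open>Injectivity and orientation of real-linear maps of the plane\<close>

lemma beltrami_inj:
  fixes a b :: complex
  assumes "norm a \<noteq> norm b" "a * \<zeta> + b * cnj \<zeta> = 0"
  shows "\<zeta> = 0"
proof (rule ccontr)
  assume "\<zeta> \<noteq> 0"
  have "norm (a * \<zeta>) = norm (b * cnj \<zeta>)" using assms(2) by (metis add_eq_0_iff norm_minus_cancel)
  then show False using \<open>\<zeta> \<noteq> 0\<close> assms(1) by (simp add: norm_mult)
qed

lemma beltrami_not_inj:
  fixes a b :: complex
  assumes "norm a = norm b"
  shows "\<exists>\<zeta>. \<zeta> \<noteq> 0 \<and> a * \<zeta> + b * cnj \<zeta> = 0"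
proof (cases "b = 0")
  case True
  then show ?thesis using assms by (intro exI[of _ 1]) auto
next
  case False
  then have a: "a \<noteq> 0" using assms by auto
  define \<zeta> where "\<zeta> = csqrt (- b / a)"
  have z2: "\<zeta> * \<zeta> = - b / a" unfolding \<zeta>_def power2_eq_square[symmetric] by simp
  then have "norm \<zeta> * norm \<zeta> = 1" using assms a by (metis norm_mult norm_divide norm_minus_cancel divide_self norm_eq_zero)
  then have "\<zeta> * cnj \<zeta> = 1" unfolding complex_norm_square[symmetric] by (simp add: power2_eq_square flip: of_real_mult)
  then have "a * \<zeta> + b * cnj \<zeta> = a * (\<zeta> * \<zeta>) * cnj \<zeta> + b * cnj \<zeta>" by (simp add: mult.assoc)
  also have "\<dots> = 0" unfolding z2 using a by simp
  finally show ?thesis using \<open>\<zeta> * cnj \<zeta> = 1\<close> by (intro exI[of _ \<zeta>]) auto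
qed

text \<open>The relation gives \<open>norm a * norm (j - \<i>) = norm b * norm (j + \<i>)\<close>,
  and \<open>j\<close> is in the upper half plane exactly when it is closer to \<open>\<i>\<close>
  than to \<open>- \<i>\<close>.\<close>

lemma beltrami_orientation:
  fixes a b j :: complex
  assumes "norm a \<noteq> norm b" "a * j + b * cnj j = \<i> * (a + b)"
  shows "Im j > 0 \<longleftrightarrow> norm b < norm a"
proof -
  have "a * (j - \<i>) = - (b * (cnj j - \<i>))" using assms(2) by (simp add: algebra_simps eq_neg_iff_add_eq_0)
  then have "norm a * norm (j - \<i>) = norm b * norm (cnj j - \<i>)" by (metis norm_minus_cancel norm_mult)
  also have "norm (cnj j - \<i>) = norm (j + \<i>)"
  proof -
    have "cnj j - \<i> = cnj (j + \<i>)" by simp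
    then show ?thesis by (simp only: complex_mod_cnj)
  qed
  finally have eq: "norm a * norm (j - \<i>) = norm b * norm (j + \<i>)" .
  have lt: "norm (j - \<i>) < norm (j + \<i>) \<longleftrightarrow> Im j > 0"
  proof -
    have "norm (j - \<i>) < norm (j + \<i>) \<longleftrightarrow> (norm (j - \<i>))\<^sup>2 < (norm (j + \<i>))\<^sup>2"
      unfolding not_le[symmetric] by (subst power_mono_iff) auto
    also have "\<dots> \<longleftrightarrow> Im j > 0" by (simp add: cmod_power2) (simp add: power2_eq_square algebra_simps)
    finally show ?thesis .
  qed
  have nb: "norm (j - \<i>) + norm (j + \<i>) > 0"
  proof (rule ccontr)
    assume "\<not> ?thesis"
    then have "norm (j - \<i>) = 0" "norm (j + \<i>) = 0" using norm_ge_zero[of "j - \<i>"] norm_ge_zero[of "j + \<i>"] by linarith+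
    then have "j = \<i>" "j + \<i> = 0" by auto
    then show False by (simp add: complex_eq_iff)
  qed
  show ?thesis
  proof
    assume "Im j > 0"
    then have l: "norm (j - \<i>) < norm (j + \<i>)" using lt by simp
    show "norm b < norm a"
    proof (rule ccontr)
      assume "\<not> norm b < norm a"
      then have "norm a < norm b" using assms(1) by simp
      then have "norm a * norm (j - \<i>) \<le> norm a * norm (j + \<i>)" "norm a * norm (j + \<i>) < norm b * norm (j + \<i>)"
        using l by (auto intro!: mult_left_mono mult_strict_right_mono le_less_trans[OF norm_ge_zero l])
      then show False using eq by linarith
    qed
  next
    assume ab: "norm b < norm a"
    have "norm (j - \<i>) < norm (j + \<i>)"
    proof (rule ccontr)
      assume "\<not> ?thesis"
      then have g: "norm (j + \<i>) \<le> norm (j - \<i>)" by simp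
      then have "0 < norm (j - \<i>)" using nb by linarith
      then have "norm b * norm (j + \<i>) \<le> norm b * norm (j - \<i>)" "norm b * norm (j - \<i>) < norm a * norm (j - \<i>)"
        using g ab by (auto intro!: mult_left_mono mult_strict_right_mono simp del: zero_less_norm_iff)
      then show False using eq by linarith
    qed
    then show "Im j > 0" using lt by simp
  qed
qed

subsection \<open>Local extension\<close>

lemma slice_wirtinger:
  fixes f :: "cc \<Rightarrow> complex"
  assumes N: "open N" and f: "smooth_on N f"
  shows "open {w. (z, w) \<in> N}" "smooth_on {w. (z, w) \<in> N} (\<lambda>w. f (z, w))"
    and "(z, w) \<in> N \<Longrightarrow> wb (\<lambda>w. f (z, w)) w = (dd f (0, 1) (z, w) + \<i> * dd f (0, \<i>) (z, w)) / 2"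
    and "(z, w) \<in> N \<Longrightarrow> wd (\<lambda>w. f (z, w)) w = (dd f (0, 1) (z, w) - \<i> * dd f (0, \<i>) (z, w)) / 2"
proof -
  have eq: "{w. (z, w) \<in> N} = (\<lambda>w. (z, w)) -` N" by auto
  show o: "open {w. (z, w) \<in> N}" unfolding eq by (rule open_vimage[OF N]) (intro continuous_intros)
  show "smooth_on {w. (z, w) \<in> N} (\<lambda>w. f (z, w))"
    by (rule smooth_on_compose[OF o N _ _ f]) (auto intro!: smooth_on_Pair smooth_on_const smooth_on_id o)
  assume w: "(z, w) \<in> N"
  have l: "((\<lambda>w. (z, w)) has_derivative (\<lambda>h. (0, h))) (at w)" by (auto intro!: derivative_eq_intros)
  have d: "dd (\<lambda>w. f (z, w)) v w = dd f (0, v) (z, w)" for v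
    using fun_cong[OF frechet_derivative_at[OF has_derivative_compose[OF l smooth_on_has_derivative[OF f w]], symmetric], of v] .
  show "wb (\<lambda>w. f (z, w)) w = (dd f (0, 1) (z, w) + \<i> * dd f (0, \<i>) (z, w)) / 2"
    "wd (\<lambda>w. f (z, w)) w = (dd f (0, 1) (z, w) - \<i> * dd f (0, \<i>) (z, w)) / 2"
    unfolding wb_def wd_def d by simp_all
qed

text \<open>\<open>J0\<close> is the pulled back structure. Orientation enters through the sign of
  \<open>Im (fst (J0 x (1, 0)))\<close>, which mentions no chart on the target; hence the locale can
  be instantiated with holomorphic coordinates outside the atlas as well.\<close>

locale extension = curves N G Y Jl for N G Y Jl +
  fixes J0 :: "cc \<Rightarrow> cc \<Rightarrow> cc"
  assumes J0: "\<And>x v. x \<in> N \<Longrightarrow> bij (frechet_derivative G (at x)) \<Longrightarrow> dd G (J0 x v) x = Jl (G x) (dd G v x)"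
    and J0_pos: "\<And>x. x \<in> N \<Longrightarrow> bij (frechet_derivative G (at x)) \<Longrightarrow> Im (fst (J0 x (1, 0))) > 0"
begin

definition regular :: "cc \<Rightarrow> bool" where
  "regular x \<longleftrightarrow> bij (frechet_derivative G (at x))"

text \<open>The frame is eliminated and scalar functions remain. Bijectivity of \<open>dG\<close>
  amounts to \<open>norm a\<close> and \<open>norm b\<close> being different, and
  \<open>J0_pos\<close> decides which is larger by \<open>beltrami_orientation\<close>; at the other
  points they agree, so \<open>norm b <= norm a\<close> throughout.\<close>

lemma coords:
  assumes x0: "x0 \<in> N"
  shows "\<exists>N' s s' a b A B. open N' \<and> x0 \<in> N' \<and> N' \<subseteq> N \<and>
    smooth_on N' s \<and> smooth_on N' s' \<and> smooth_on N' a \<and> smooth_on N' b \<and> smooth_on N' A \<and> smooth_on N' B \<and>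
    (\<forall>z w. (z, w) \<in> N' \<longrightarrow> wb (\<lambda>w. a (z, w)) w = A (z, w) * a (z, w) + B (z, w) * cnj (b (z, w))) \<and>
    (\<forall>z w. (z, w) \<in> N' \<longrightarrow> wb (\<lambda>w. b (z, w)) w = A (z, w) * b (z, w) + B (z, w) * cnj (a (z, w))) \<and>
    ((\<exists>J0. \<forall>y\<in>Y. Jl y = J0) \<longrightarrow> (\<forall>x\<in>N'. A x = 0 \<and> B x = 0)) \<and>
    (\<forall>x\<in>N'. norm (b x) \<le> norm (a x)) \<and> (\<forall>x\<in>N'. regular x \<longleftrightarrow> norm (b x) < norm (a x)) \<and>
    (\<forall>x\<in>N'. regular x \<longrightarrow> blinfun_apply (JQ (b x / a x, s x, s' x)) = J0 x)"
proof -
  obtain N' v0 s s' a b A B where N': "open N'" "x0 \<in> N'" "N' \<subseteq> N"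
    and sm: "smooth_on N' s" "smooth_on N' s'" "smooth_on N' a" "smooth_on N' b" "smooth_on N' A" "smooth_on N' B"
    and bijF: "\<forall>x\<in>N'. bij (blinfun_apply (framemap (JJ x) (ee x) v0))"
    and rel: "\<forall>x\<in>N'. \<forall>\<zeta> \<omega>. dd G (\<zeta>, \<omega>) x =
        framemap (JJ x) (ee x) v0 (s x * \<zeta> + s' x * cnj \<zeta> + \<omega>, a x * \<zeta> + b x * cnj \<zeta>)"
    and eqs: "\<forall>x\<in>N'. (dd a (0, 1) x + \<i> * dd a (0, \<i>) x) / 2 = A x * a x + B x * cnj (b x)"
      "\<forall>x\<in>N'. (dd b (0, 1) x + \<i> * dd b (0, \<i>) x) / 2 = A x * b x + B x * cnj (a x)"
    and const: "(\<exists>J0. \<forall>y\<in>Y. Jl y = J0) \<longrightarrow> (\<forall>x\<in>N'. A x = 0 \<and> B x = 0)"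
    using local_coords[OF x0] by (elim exE conjE) (rule that; assumption)
  define F where "F = (\<lambda>x. blinfun_apply (framemap (JJ x) (ee x) v0))"
  define M where "M = (\<lambda>x (\<zeta>, \<omega>). (s x * \<zeta> + s' x * cnj \<zeta> + \<omega>, a x * \<zeta> + b x * cnj \<zeta>))"
  have dG: "frechet_derivative G (at x) u = F x (M x u)" if "x \<in> N'" for x u
    using rel that by (cases u) (simp add: F_def M_def)
  have injF: "F x u = F x v \<longleftrightarrow> u = v" if "x \<in> N'" for x u v
    using bijF that unfolding F_def bij_def inj_def by blast
  have inN: "x \<in> N" if "x \<in> N'" for x using that N' by blast
  have lin: "linear (frechet_derivative G (at x))" if "x \<in> N'" for x
    by (rule linear_frechet_derivative[OF smooth_on_differentiable[OF G inN[OF that]]])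
  have reg: "regular x \<longleftrightarrow> norm (a x) \<noteq> norm (b x)" if x: "x \<in> N'" for x
  proof
    assume r: "regular x"
    show "norm (a x) \<noteq> norm (b x)"
    proof
      assume "norm (a x) = norm (b x)"
      then obtain \<zeta> where \<zeta>: "\<zeta> \<noteq> 0" "a x * \<zeta> + b x * cnj \<zeta> = 0" using beltrami_not_inj by blast
      have "M x (\<zeta>, - (s x * \<zeta> + s' x * cnj \<zeta>)) = M x (0, 0)" using \<zeta> by (simp add: M_def)
      then have "frechet_derivative G (at x) (\<zeta>, - (s x * \<zeta> + s' x * cnj \<zeta>)) = frechet_derivative G (at x) (0, 0)"
        by (simp add: dG[OF x])
      then show False using r \<zeta>(1) unfolding regular_def bij_def inj_def by blast
    qed
  next
    assume ne: "norm (a x) \<noteq> norm (b x)"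
    have "inj (frechet_derivative G (at x))"
    proof (rule linear_injective_0[THEN iffD2, OF lin[OF x], rule_format])
      fix u assume "frechet_derivative G (at x) u = 0"
      moreover have "F x (0, 0) = 0" by (simp add: F_def framemap_apply)
      ultimately have "M x u = (0, 0)" using dG[OF x, of u] injF[OF x, of "M x u" "(0, 0)"] by simp
      then obtain \<zeta> \<omega> where u: "u = (\<zeta>, \<omega>)" and e: "s x * \<zeta> + s' x * cnj \<zeta> + \<omega> = 0" "a x * \<zeta> + b x * cnj \<zeta> = 0"
        by (cases u) (auto simp: M_def)
      have "\<zeta> = 0" by (rule beltrami_inj[OF ne e(2)])
      then show "u = 0" using e(1) u by (simp add: zero_prod_def)
    qed
    then show "regular x" unfolding regular_def bij_def using linear_injective_imp_surjective[OF lin[OF x]] by blast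
  qed
  have Fi: "F x (\<i> * u, \<i> * v) = JJ x (F x (u, v))" if "x \<in> N'" for x u v
    unfolding F_def by (rule framemap_i[OF JJ2[OF inN[OF that]]])
  have MJ0: "M x (J0 x v) = (\<i> * fst (M x v), \<i> * snd (M x v))" if x: "x \<in> N'" and r: "regular x" for x v
  proof -
    have "F x (M x (J0 x v)) = JJ x (F x (M x v))"
      using J0[OF inN[OF x] r[unfolded regular_def], of v] by (simp add: dG[OF x] JJ_def)
    also have "\<dots> = F x (\<i> * fst (M x v), \<i> * snd (M x v))" using Fi[OF x, of "fst (M x v)" "snd (M x v)"] by simp
    finally show ?thesis using injF[OF x] by simp
  qed
  have lt: "norm (b x) < norm (a x)" if x: "x \<in> N'" and r: "regular x" for x
  proof -
    have ne: "norm (a x) \<noteq> norm (b x)" using reg[OF x] r by simp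
    obtain j k where jk: "J0 x (1, 0) = (j, k)" by (cases "J0 x (1, 0)")
    have "a x * j + b x * cnj j = \<i> * (a x + b x)"
      using MJ0[OF x r, of "(1, 0)"] by (simp add: jk M_def)
    from beltrami_orientation[OF ne this] show ?thesis
      using J0_pos[OF inN[OF x] r[unfolded regular_def]] by (simp add: jk)
  qed
  have le: "norm (b x) \<le> norm (a x)" if "x \<in> N'" for x
    using lt[OF that] reg[OF that] by fastforce
  have JQ: "blinfun_apply (JQ (b x / a x, s x, s' x)) = J0 x" if x: "x \<in> N'" and r: "regular x" for x
  proof
    fix v :: cc
    obtain \<zeta> \<omega> where v: "v = (\<zeta>, \<omega>)" by (cases v)
    obtain \<zeta>' \<omega>' where v': "JQ (b x / a x, s x, s' x) (\<zeta>, \<omega>) = (\<zeta>', \<omega>')" by (cases "JQ (b x / a x, s x, s' x) (\<zeta>, \<omega>)")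
    have a0: "a x \<noteq> 0" using lt[OF x r] by auto
    have "norm (b x / a x) < 1" using lt[OF x r] a0 by (simp add: norm_divide divide_less_eq)
    from JQ_intertwines[OF this v']
    have i: "s x * \<zeta>' + s' x * cnj \<zeta>' + \<omega>' = \<i> * (s x * \<zeta> + s' x * cnj \<zeta> + \<omega>)"
      "\<zeta>' + b x / a x * cnj \<zeta>' = \<i> * (\<zeta> + b x / a x * cnj \<zeta>)" by auto
    have "a x * (\<zeta>' + b x / a x * cnj \<zeta>') = a x * (\<i> * (\<zeta> + b x / a x * cnj \<zeta>))" using i(2) by simp
    then have "a x * \<zeta>' + b x * cnj \<zeta>' = \<i> * (a x * \<zeta> + b x * cnj \<zeta>)" using a0 by (simp add: algebra_simps)
    then have "M x (\<zeta>', \<omega>') = M x (J0 x v)" using i(1) MJ0[OF x r, of v] by (simp add: M_def v)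
    then have "frechet_derivative G (at x) (\<zeta>', \<omega>') = frechet_derivative G (at x) (J0 x v)" by (simp add: dG[OF x])
    then have "(\<zeta>', \<omega>') = J0 x v" using r unfolding regular_def bij_def inj_def by blast
    then show "JQ (b x / a x, s x, s' x) v = J0 x v" using v' v by simp
  qed
  have w1: "wb (\<lambda>w. a (z, w)) w = A (z, w) * a (z, w) + B (z, w) * cnj (b (z, w))"
    "wb (\<lambda>w. b (z, w)) w = A (z, w) * b (z, w) + B (z, w) * cnj (a (z, w))" if "(z, w) \<in> N'" for z w
    using slice_wirtinger(3)[OF N'(1) sm(3) that] slice_wirtinger(3)[OF N'(1) sm(4) that] eqs that by auto
  have r2: "regular x \<longleftrightarrow> norm (b x) < norm (a x)" if "x \<in> N'" for x using lt[OF that] reg[OF that] by fastforce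
  show ?thesis
  proof (rule exI[of _ N'], rule exI[of _ s], rule exI[of _ s'], rule exI[of _ a], rule exI[of _ b],
        rule exI[of _ A], rule exI[of _ B], intro conjI)
    show "\<forall>z w. (z, w) \<in> N' \<longrightarrow> wb (\<lambda>w. a (z, w)) w = A (z, w) * a (z, w) + B (z, w) * cnj (b (z, w))"
      "\<forall>z w. (z, w) \<in> N' \<longrightarrow> wb (\<lambda>w. b (z, w)) w = A (z, w) * b (z, w) + B (z, w) * cnj (a (z, w))"
      by (intro allI impI w1; assumption)+
    show "\<forall>x\<in>N'. norm (b x) \<le> norm (a x)" by (intro ballI le)
    show "\<forall>x\<in>N'. regular x \<longleftrightarrow> norm (b x) < norm (a x)" by (intro ballI r2)
    show "\<forall>x\<in>N'. regular x \<longrightarrow> blinfun_apply (JQ (b x / a x, s x, s' x)) = J0 x" by (intro ballI impI JQ)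
  qed (fact N' sm const)+
qed

text \<open>If \<open>norm a = norm b\<close> near the point of the slice, all points there are
  critical; otherwise the leading coefficients with \<open>norm \<beta> < norm \<alpha>\<close>
  force \<open>norm b < norm a\<close> on a punctured disc.\<close>

lemma slice_dichotomy:
  assumes x0: "(z, w) \<in> N"
  shows "(\<exists>r>0. \<forall>u\<in>ball w r. (z, u) \<in> N \<and> \<not> regular (z, u)) \<or>
    (\<exists>r>0. \<forall>u\<in>ball w r - {w}. (z, u) \<in> N \<and> regular (z, u))"
proof -
  obtain N' s s' a b A B where N': "open N'" "(z, w) \<in> N'" "N' \<subseteq> N"
    and sm: "smooth_on N' s" "smooth_on N' s'" "smooth_on N' a" "smooth_on N' b" "smooth_on N' A" "smooth_on N' B"
    and eqs: "\<forall>z w. (z, w) \<in> N' \<longrightarrow> wb (\<lambda>w. a (z, w)) w = A (z, w) * a (z, w) + B (z, w) * cnj (b (z, w))"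
      "\<forall>z w. (z, w) \<in> N' \<longrightarrow> wb (\<lambda>w. b (z, w)) w = A (z, w) * b (z, w) + B (z, w) * cnj (a (z, w))"
    and "(\<exists>J0. \<forall>y\<in>Y. Jl y = J0) \<longrightarrow> (\<forall>x\<in>N'. A x = 0 \<and> B x = 0)"
    and le: "\<forall>x\<in>N'. norm (b x) \<le> norm (a x)" and reg: "\<forall>x\<in>N'. regular x \<longleftrightarrow> norm (b x) < norm (a x)"
    and "\<forall>x\<in>N'. regular x \<longrightarrow> blinfun_apply (JQ (b x / a x, s x, s' x)) = J0 x"
    using coords[OF x0] by (elim exE conjE) (rule that; assumption)
  define S where "S = {u. (z, u) \<in> N'}"
  have S: "open S" "w \<in> S" unfolding S_def using slice_wirtinger(1)[OF N'(1) sm(1)] N' by auto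
  obtain r0 where r0: "r0 > 0" "ball w r0 \<subseteq> S" using openE[OF S] by blast
  show ?thesis
  proof (cases "\<exists>r>0. \<forall>u\<in>ball w r. norm (a (z, u)) = norm (b (z, u))")
    case True
    then obtain r where r: "r > 0" "\<And>u. u \<in> ball w r \<Longrightarrow> norm (a (z, u)) = norm (b (z, u))" by blast
    have "(z, u) \<in> N \<and> \<not> regular (z, u)" if "u \<in> ball w (min r r0)" for u
    proof -
      have "u \<in> ball w r0" "u \<in> ball w r" using that by auto
      then have "(z, u) \<in> N'" using r0(2) by (auto simp: S_def)
      then show ?thesis using r(2)[OF \<open>u \<in> ball w r\<close>] reg N'(3) by auto
    qed
    then show ?thesis using r(1) r0(1) by (metis min_less_iff_conj)
  next
    case False
    have "\<exists>n \<alpha> \<beta>. norm \<beta> < norm \<alpha> \<and> lead (\<lambda>u. a (z, u)) w n \<alpha> \<and> lead (\<lambda>u. b (z, u)) w n \<beta>"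
      by (rule pair_dichotomy[OF S, where A="\<lambda>u. A (z, u)" and B="\<lambda>u. B (z, u)"])
        (use False slice_wirtinger(2)[OF N'(1)] sm eqs le in \<open>auto simp: S_def\<close>)
    then obtain n \<alpha> \<beta> where l: "norm \<beta> < norm \<alpha>"
      "((\<lambda>u. a (z, u) / (u - w) ^ n) \<longlongrightarrow> \<alpha>) (at w)" "((\<lambda>u. b (z, u) / (u - w) ^ n) \<longlongrightarrow> \<beta>) (at w)"
      unfolding lead_def by blast
    have "((\<lambda>u. norm (a (z, u) / (u - w) ^ n) - norm (b (z, u) / (u - w) ^ n)) \<longlongrightarrow> norm \<alpha> - norm \<beta>) (at w)"
      by (rule tendsto_diff[OF tendsto_norm[OF l(2)] tendsto_norm[OF l(3)]])
    from order_tendstoD(1)[OF this, of 0] l(1)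
    have "\<forall>\<^sub>F u in at w. 0 < norm (a (z, u) / (u - w) ^ n) - norm (b (z, u) / (u - w) ^ n)" by simp
    then obtain d where d: "d > 0" "\<And>u. u \<noteq> w \<Longrightarrow> dist u w < d \<Longrightarrow> 0 < norm (a (z, u) / (u - w) ^ n) - norm (b (z, u) / (u - w) ^ n)"
      unfolding eventually_at by blast
    have "(z, u) \<in> N \<and> regular (z, u)" if u: "u \<in> ball w (min d r0) - {w}" for u
    proof -
      have uS: "(z, u) \<in> N'" using u r0(2) by (auto simp: S_def)
      have "norm (b (z, u)) / norm ((u - w) ^ n) < norm (a (z, u)) / norm ((u - w) ^ n)"
        using d(2)[of u] u by (auto simp: norm_divide dist_commute)
      then have "norm (b (z, u)) < norm (a (z, u))" using u by (simp add: divide_less_cancel)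
      then show ?thesis using uS reg N'(3) by auto
    qed
    then show ?thesis using d(1) r0(1) by (metis min_less_iff_conj)
  qed
qed

end

lemma JQ_square:
  assumes "norm q < 1"
  shows "JQ (q, s, s') o\<^sub>L JQ (q, s, s') = - id_blinfun"
proof (rule blinfun_eqI)
  fix v :: cc
  obtain \<zeta> \<omega> where v: "v = (\<zeta>, \<omega>)" by (cases v)
  obtain \<zeta>1 \<omega>1 where 1: "JQ (q, s, s') (\<zeta>, \<omega>) = (\<zeta>1, \<omega>1)" by (cases "JQ (q, s, s') (\<zeta>, \<omega>)")
  obtain \<zeta>2 \<omega>2 where 2: "JQ (q, s, s') (\<zeta>1, \<omega>1) = (\<zeta>2, \<omega>2)" by (cases "JQ (q, s, s') (\<zeta>1, \<omega>1)")
  note i1 = JQ_intertwines[OF assms 1] and i2 = JQ_intertwines[OF assms 2]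
  have "\<zeta>2 + q * cnj \<zeta>2 = - (\<zeta> + q * cnj \<zeta>)" unfolding i2(2) i1(2) by (simp add: algebra_simps)
  then have e: "1 * (\<zeta>2 + \<zeta>) + q * cnj (\<zeta>2 + \<zeta>) = 0" by (simp add: algebra_simps eq_neg_iff_add_eq_0)
  have "\<zeta>2 + \<zeta> = 0" by (rule beltrami_inj[OF _ e]) (use assms in simp)
  then have z: "\<zeta>2 = - \<zeta>" by (simp add: eq_neg_iff_add_eq_0)
  have "s * \<zeta>2 + s' * cnj \<zeta>2 + \<omega>2 = - (s * \<zeta> + s' * cnj \<zeta> + \<omega>)" unfolding i2(1) i1(1) by (simp add: algebra_simps)
  then have "\<omega>2 = - \<omega>" unfolding z by (simp add: algebra_simps)
  then show "(JQ (q, s, s') o\<^sub>L JQ (q, s, s')) v = (- id_blinfun) v"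
    using 1 2 v z by (simp add: uminus_blinfun.rep_eq)
qed

text \<open>To compare two slices one moves away from the zeros of \<open>a\<close> by \<open>\<delta>\<close>, a power of the distance
  of the slices, where the quotients can be compared directly.\<close>

lemma hoelder_compare:
  fixes a b a' b' q q' :: "complex \<Rightarrow> complex"
  assumes r: "0 < r" and g0: "0 < g" and L: "0 \<le> L" and Lp: "0 \<le> Lp" and d: "0 < d" "d \<le> 1"
    and q: "\<And>w. w \<in> cball x0 r \<Longrightarrow> a w \<noteq> 0 \<Longrightarrow> q w = b w / a w"
    and q': "\<And>w. w \<in> cball x0 r \<Longrightarrow> a' w \<noteq> 0 \<Longrightarrow> q' w = b' w / a' w"
    and q1: "\<And>w. w \<in> cball x0 r \<Longrightarrow> norm (q w) < 1" "\<And>w. w \<in> cball x0 r \<Longrightarrow> norm (q' w) < 1"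
    and Lip: "\<And>w w'. w \<in> cball x0 r \<Longrightarrow> w' \<in> cball x0 r \<Longrightarrow> norm (q w - q w') \<le> Lp * norm (w - w')"
      "\<And>w w'. w \<in> cball x0 r \<Longrightarrow> w' \<in> cball x0 r \<Longrightarrow> norm (q' w - q' w') \<le> Lp * norm (w - w')"
    and avoid: "\<And>w \<delta>. w \<in> cball x0 (r/2) \<Longrightarrow> 0 < \<delta> \<Longrightarrow> \<delta> \<le> r / 2 \<Longrightarrow>
      \<exists>w'\<in>cball w \<delta>. c * (\<delta> / k) ^ Nm \<le> norm (a w')"
    and g: "g = c * (r / 2 / k) ^ Nm"
    and cmp: "\<And>w. w \<in> cball x0 r \<Longrightarrow> norm (a w - a' w) \<le> L * d" "\<And>w. w \<in> cball x0 r \<Longrightarrow> norm (b w - b' w) \<le> L * d"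
    and le: "\<And>w. w \<in> cball x0 r \<Longrightarrow> norm (b' w) \<le> norm (a' w)"
    and \<alpha>: "\<alpha> = 1 / (real Nm + 2)" and w: "w \<in> cball x0 (r/2)"
  shows "norm (q w - q' w) \<le> (Lp * r + 2 * L / g) * d powr \<alpha>"
proof -
  \<comment> \<open>By the choice of \<open>\<alpha>\<close>, \<open>d = t ^ (Nm + 2)\<close>. Where
    \<open>norm a\<close> is at least \<open>g * t ^ Nm\<close>, a change of size \<open>d\<close>
    alters the quotient by order \<open>t^2\<close>, while moving there, by a multiple of
    \<open>t\<close>, costs order \<open>t\<close>.\<close>
  define t where "t = d powr \<alpha>"
  have t: "0 < t" "t \<le> 1" using d \<alpha> by (auto simp: t_def intro!: powr_le1)
  have td: "t ^ Nm * (t * t) = d"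
  proof -
    have "t ^ Nm * (t * t) = t ^ (Nm + 2)" by (simp add: power_add power2_eq_square)
    also have "\<dots> = d powr (\<alpha> * real (Nm + 2))" using d unfolding t_def by (subst powr_power) (simp_all add: mult.commute)
    also have "\<alpha> * real (Nm + 2) = 1" by (simp add: \<alpha>)
    finally show ?thesis using d by simp
  qed
  define \<delta> where "\<delta> = r / 2 * t"
  have \<delta>: "0 < \<delta>" "\<delta> \<le> r / 2" using r t by (auto simp: \<delta>_def mult_left_le)
  obtain w' where w': "w' \<in> cball w \<delta>" and aw: "c * (\<delta> / k) ^ Nm \<le> norm (a w')" using avoid[OF w \<delta>] by blast
  have "\<delta> / k = (r / 2 / k) * t" by (simp add: \<delta>_def)
  then have "c * (\<delta> / k) ^ Nm = g * t ^ Nm" by (simp only: g power_mult_distrib mult.assoc)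
  then have ag: "g * t ^ Nm \<le> norm (a w')" using aw by simp
  have gt: "0 < g * t ^ Nm" using g0 t by simp
  then have a0: "a w' \<noteq> 0" using ag by auto
  have wc: "w \<in> cball x0 r" using w r by simp
  have w'c: "w' \<in> cball x0 r" using dist_triangle[of x0 w' w] w w' \<delta> by simp
  have dw: "norm (w - w') \<le> \<delta>" using w' by (simp add: dist_norm)
  have dw': "norm (w' - w) \<le> \<delta>" using dw by (simp add: norm_minus_commute)
  have mid: "norm (q w' - q' w') \<le> 2 * (L * d) / norm (a w')"
  proof (cases "a' w' = 0")
    case True
    \<comment> \<open>At a zero of \<open>a'\<close> the value of \<open>q'\<close> is not given by
      a quotient; but then \<open>a w'\<close> itself is at most \<open>L * d\<close>, so the
      claimed bound is at least 2.\<close>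
    have "norm (a w') \<le> L * d" using cmp(1)[OF w'c] True by simp
    then have "2 \<le> 2 * (L * d) / norm (a w')" using a0 by (simp add: le_divide_eq)
    moreover have "norm (q w' - q' w') \<le> 2"
      using norm_triangle_ineq4[of "q w'" "q' w'"] q1(1)[OF w'c] q1(2)[OF w'c] by linarith
    ultimately show ?thesis by linarith
  next
    case False
    have "q w' - q' w' = ((b w' - b' w') - q' w' * (a w' - a' w')) / a w'"
      using q[OF w'c a0] q'[OF w'c False] a0 False by (simp add: field_simps)
    also have "norm \<dots> \<le> (L * d + 1 * (L * d)) / norm (a w')"
      unfolding norm_divide
    proof (rule divide_right_mono[OF order_trans[OF norm_triangle_ineq4 add_mono]])
      show "norm (q' w' * (a w' - a' w')) \<le> 1 * (L * d)"
        unfolding norm_mult using q1(2)[OF w'c] cmp(1)[OF w'c] by (intro mult_mono) auto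
    qed (use cmp(2)[OF w'c] in auto)
    finally show ?thesis by simp
  qed
  also have "\<dots> \<le> 2 * (L * d) / (g * t ^ Nm)" using ag gt L d a0 g0 t by (intro divide_left_mono mult_pos_pos) auto
  also have "\<dots> = 2 * L / g * (t * t)" using td t g0 by (simp add: field_simps flip: td)
  also have "\<dots> \<le> 2 * L / g * t" using t L g0 by (intro mult_left_mono mult_left_le) auto
  finally have m: "norm (q w' - q' w') \<le> 2 * L / g * t" .
  have "norm (q w - q' w) \<le> norm (q w - q w') + norm (q w' - q' w') + norm (q' w' - q' w)"
    using norm_triangle_ineq[of "(q w - q w') + (q w' - q' w')" "q' w' - q' w"] norm_triangle_ineq[of "q w - q w'" "q w' - q' w'"] by simp
  also have "\<dots> \<le> Lp * \<delta> + 2 * L / g * t + Lp * \<delta>"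
    using Lip(1)[OF wc w'c] Lip(2)[OF w'c wc] m mult_left_mono[OF dw Lp] mult_left_mono[OF dw' Lp] by linarith
  also have "\<dots> = (Lp * r + 2 * L / g) * t" by (simp add: \<delta>_def algebra_simps)
  finally show ?thesis unfolding t_def .
qed

text \<open>The integrand sees \<open>f\<close> on the circle alone, so \<open>f\<close> may be
  singular inside; the kernel is smooth because \<open>w\<close> stays off the circle.\<close>

lemma smooth_on_circle_integral:
  fixes f :: "cc \<Rightarrow> complex"
  assumes N: "open N" "smooth_on N f" and U: "open U" and r: "r > 0"
    and sub: "\<And>z w. z \<in> U \<Longrightarrow> dist w0 w = r \<Longrightarrow> (z, w) \<in> N"
  shows "smooth_on (U \<times> ball w0 r) (\<lambda>(z, w). integral {0..1} (\<lambda>t.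
    f (z, w0 + of_real r * cis (2 * pi * t)) / (w0 + of_real r * cis (2 * pi * t) - w) * (of_real r * cis (2 * pi * t))))"
proof -
  let ?S = "(U \<times> ball w0 r) \<times> (UNIV :: real set)"
  define c where "c = (\<lambda>t::real. w0 + of_real r * cis (2 * pi * t))"
  have S: "open ?S" "open (U \<times> ball w0 r)" by (auto intro!: open_Times U)
  have sci: "smooth_on ?S (\<lambda>x. cis (2 * pi * snd x))"
    by (rule smooth_on_compose[OF S(1) open_UNIV _ _ smooth_on_cis])
      (auto intro!: smooth_on_mult smooth_on_const smooth_on_snd smooth_on_id S)
  have sc: "smooth_on ?S (\<lambda>x. c (snd x))" unfolding c_def
    by (rule smooth_on_add[OF S(1) smooth_on_const[OF S(1)] smooth_on_mult[OF S(1) smooth_on_const[OF S(1)] sci]])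
  have cd: "dist w0 (c t) = r" for t using r by (simp add: c_def dist_norm norm_mult)
  have sz: "smooth_on ?S (\<lambda>x. fst (fst x))" "smooth_on ?S (\<lambda>x. snd (fst x))"
    by (intro smooth_on_fst smooth_on_snd smooth_on_id S)+
  have sf: "smooth_on ?S (\<lambda>x. f (fst (fst x), c (snd x)))"
    by (rule smooth_on_compose[OF S(1) N(1) _ smooth_on_Pair[OF S(1) sz(1) sc] N(2)]) (use sub cd in auto)
  have sd: "smooth_on ?S (\<lambda>x. c (snd x) - snd (fst x))" by (rule smooth_on_diff[OF S(1) sc sz(2)])
  have ne: "c (snd x) - snd (fst x) \<noteq> 0" if "x \<in> ?S" for x
  proof
    assume "c (snd x) - snd (fst x) = 0"
    then have "snd (fst x) = c (snd x)" by simp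
    then show False using cd[of "snd x"] that by auto
  qed
  have "smooth_on ?S (\<lambda>x. f (fst (fst x), c (snd x)) / (c (snd x) - snd (fst x)) * (of_real r * cis (2 * pi * snd x)))"
    by (rule smooth_on_mult[OF S(1) smooth_on_divide[OF S(1) sf sd ne] smooth_on_mult[OF S(1) smooth_on_const[OF S(1)] sci]])
  from smooth_on_integral[OF S(2) this, of 0 1]
  show ?thesis unfolding c_def by (simp add: case_prod_unfold)
qed

lemma cauchy_integral_cis:
  assumes r: "r > 0" and f: "continuous_on (cball w0 r) f" "f holomorphic_on ball w0 r" and w: "w \<in> ball w0 r"
  shows "integral {0..1} (\<lambda>t. f (w0 + of_real r * cis (2 * pi * t)) / (w0 + of_real r * cis (2 * pi * t) - w) * (of_real r * cis (2 * pi * t))) = f w"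
proof -
  have "((\<lambda>u. f u / (u - w)) has_contour_integral (2 * of_real pi * \<i> * f w)) (circlepath w0 r)"
    by (rule Cauchy_integral_circlepath[OF f]) (use w in \<open>simp add: dist_norm norm_minus_commute\<close>)
  then have "((\<lambda>t. f (circlepath w0 r t) / (circlepath w0 r t - w) * vector_derivative (circlepath w0 r) (at t within {0..1}))
     has_integral (2 * of_real pi * \<i> * f w)) {0..1}"
    unfolding has_contour_integral_def .
  then have "((\<lambda>t. 2 * of_real pi * \<i> * (f (w0 + of_real r * cis (2 * pi * t)) / (w0 + of_real r * cis (2 * pi * t) - w) * (of_real r * cis (2 * pi * t))))
     has_integral (2 * of_real pi * \<i> * f w)) {0..1}"
  proof (rule has_integral_eq[rotated])
    fix t :: real assume t: "t \<in> {0..1}"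
    have vd: "vector_derivative (circlepath w0 r) (at t within {0..1}) = 2 * of_real pi * \<i> * r * exp (2 * of_real pi * \<i> * t)"
      using vector_derivative_circlepath01 t by simp
    have e: "exp (2 * of_real pi * \<i> * complex_of_real t) = cis (2 * pi * t)" by (simp add: cis_conv_exp mult_ac)
    show "f (circlepath w0 r t) / (circlepath w0 r t - w) * vector_derivative (circlepath w0 r) (at t within {0..1}) =
      2 * of_real pi * \<i> * (f (w0 + of_real r * cis (2 * pi * t)) / (w0 + of_real r * cis (2 * pi * t) - w) * (of_real r * cis (2 * pi * t)))"
      unfolding vd unfolding circlepath e by (simp add: mult_ac)
  qed
  from has_integral_mult_right[OF this, of "1 / (2 * of_real pi * \<i>)"] show ?thesis
    by (simp add: integral_unique)
qed

context extension
begin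

text \<open>All constants are fixed on one compact set \<open>K\<close> before \<open>z\<close>
  varies, and \<open>slice.hol_quotient\<close> supplies for each slice a coefficient
  \<open>q z\<close> with common bounds. Isolation of critical points is used at the centre to find
  the annulus, and at every point to exclude the degenerate case of
  \<open>pair_dichotomy\<close>.\<close>

lemma local_extension:
  assumes x0: "(z0, w0) \<in> N"
    and isolated: "\<And>z w. (z, w) \<in> N \<Longrightarrow> \<exists>r>0. \<forall>u\<in>ball w r - {w}. (z, u) \<in> N \<and> regular (z, u)"
  shows "\<exists>\<rho> J \<alpha> C. 0 < \<rho> \<and> ball z0 \<rho> \<times> ball w0 \<rho> \<subseteq> N \<and> 0 < \<alpha> \<and> \<alpha> < 1 \<and> 0 \<le> C \<and>
    (\<forall>x\<in>ball z0 \<rho> \<times> ball w0 \<rho>. J x o\<^sub>L J x = - id_blinfun) \<and>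
    (\<forall>x\<in>ball z0 \<rho> \<times> ball w0 \<rho>. regular x \<longrightarrow> blinfun_apply (J x) = J0 x) \<and>
    (\<forall>z\<in>ball z0 \<rho>. \<forall>z'\<in>ball z0 \<rho>. \<forall>w\<in>ball w0 \<rho>. norm (J (z, w) - J (z', w)) \<le> C * norm (z - z') powr \<alpha>) \<and>
    (\<forall>z\<in>ball z0 \<rho>. \<forall>w\<in>ball w0 \<rho>. \<forall>w'\<in>ball w0 \<rho>. norm (J (z, w) - J (z, w')) \<le> C * norm (w - w')) \<and>
    ((\<exists>J0. \<forall>y\<in>Y. Jl y = J0) \<longrightarrow> smooth_on (ball z0 \<rho> \<times> ball w0 \<rho>) J)"
proof -
  obtain N' s s' a b A B where N': "open N'" "(z0, w0) \<in> N'" "N' \<subseteq> N"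
    and sm: "smooth_on N' s" "smooth_on N' s'" "smooth_on N' a" "smooth_on N' b" "smooth_on N' A" "smooth_on N' B"
    and eqs: "\<forall>z w. (z, w) \<in> N' \<longrightarrow> wb (\<lambda>w. a (z, w)) w = A (z, w) * a (z, w) + B (z, w) * cnj (b (z, w))"
      "\<forall>z w. (z, w) \<in> N' \<longrightarrow> wb (\<lambda>w. b (z, w)) w = A (z, w) * b (z, w) + B (z, w) * cnj (a (z, w))"
    and const: "(\<exists>J0. \<forall>y\<in>Y. Jl y = J0) \<longrightarrow> (\<forall>x\<in>N'. A x = 0 \<and> B x = 0)"
    and le: "\<forall>x\<in>N'. norm (b x) \<le> norm (a x)" and reg: "\<forall>x\<in>N'. regular x \<longleftrightarrow> norm (b x) < norm (a x)"
    and JQ: "\<forall>x\<in>N'. regular x \<longrightarrow> blinfun_apply (JQ (b x / a x, s x, s' x)) = J0 x"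
    using coords[OF x0] by (elim exE conjE) (rule that; assumption)
  obtain U V where UV: "open U" "open V" "(z0, w0) \<in> U \<times> V" "U \<times> V \<subseteq> N'" using open_prod_elim[OF N'(1,2)] by blast
  obtain \<rho>1 where \<rho>1: "\<rho>1 > 0" "cball z0 \<rho>1 \<subseteq> U" using UV(1,3) open_contains_cball by blast
  obtain \<rho>2 where \<rho>2: "\<rho>2 > 0" "cball w0 \<rho>2 \<subseteq> V" using UV(2,3) open_contains_cball by blast
  define K where "K = cball z0 \<rho>1 \<times> cball w0 \<rho>2"
  have K: "compact K" "convex K" "K \<subseteq> N'"
    unfolding K_def using UV(4) \<rho>1 \<rho>2 by (auto intro!: compact_Times convex_Times)
  have sb: "\<exists>L\<ge>0. (\<forall>x\<in>K. norm (f x) \<le> L) \<and> (\<forall>x\<in>K. \<forall>u. norm (dd f u x) \<le> L * norm u) \<and>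
    (\<forall>x\<in>K. \<forall>y\<in>K. norm (f x - f y) \<le> L * norm (x - y))" if "smooth_on N' f" for f :: "cc \<Rightarrow> complex"
    by (rule smooth_bounds[OF N'(1) that K])
  have "\<forall>f::cc \<Rightarrow> complex. \<exists>l. smooth_on N' f \<longrightarrow> l\<ge>0 \<and> (\<forall>x\<in>K. norm (f x) \<le> l) \<and> (\<forall>x\<in>K. \<forall>u. norm (dd f u x) \<le> l * norm u) \<and>
    (\<forall>x\<in>K. \<forall>y\<in>K. norm (f x - f y) \<le> l * norm (x - y))" using sb by blast
  from choice[OF this] obtain L :: "(cc \<Rightarrow> complex) \<Rightarrow> real" where
    L: "\<And>f. smooth_on N' f \<Longrightarrow> L f\<ge>0 \<and> (\<forall>x\<in>K. norm (f x) \<le> L f) \<and> (\<forall>x\<in>K. \<forall>u. norm (dd f u x) \<le> L f * norm u) \<and>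
    (\<forall>x\<in>K. \<forall>y\<in>K. norm (f x - f y) \<le> L f * norm (x - y))" by blast
  have L0: "\<And>f. smooth_on N' f \<Longrightarrow> L f \<ge> 0"
    and L1: "\<And>f x. smooth_on N' f \<Longrightarrow> x \<in> K \<Longrightarrow> norm (f x) \<le> L f"
    and L2: "\<And>f x u. smooth_on N' f \<Longrightarrow> x \<in> K \<Longrightarrow> norm (dd f u x) \<le> L f * norm u"
    and L3: "\<And>f x y. smooth_on N' f \<Longrightarrow> x \<in> K \<Longrightarrow> y \<in> K \<Longrightarrow> norm (f x - f y) \<le> L f * norm (x - y)"
    using L by blast+
  define D where "D = L a + L b + L A + L B + L s + L s'"
  have LD: "L a \<le> D" "L b \<le> D" "L A \<le> D" "L B \<le> D" "L s \<le> D" "L s' \<le> D" and D0: "0 \<le> D"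
    unfolding D_def using L0[OF sm(1)] L0[OF sm(2)] L0[OF sm(3)] L0[OF sm(4)] L0[OF sm(5)] L0[OF sm(6)] by linarith+
  have bnd: "norm (f x) \<le> D" "norm (dd f u x) \<le> D * norm u" "y \<in> K \<Longrightarrow> norm (f x - f y) \<le> D * norm (x - y)"
    if "smooth_on N' f" "L f \<le> D" "x \<in> K" for f x y u
    using L1[OF that(1,3)] L2[OF that(1,3), of u] L3[OF that(1,3), of y] that(2)
      mult_right_mono[OF that(2), of "norm u"] mult_right_mono[OF that(2), of "norm (x - y)"] by auto
  have hn: "norm ((z, w) - (z', w)) = norm (z - z')" "norm ((z, w) - (z, w')) = norm (w - w')" for z z' w w' :: complex
    by (simp_all add: norm_Pair)
  obtain r1 where r1: "r1 > 0" "\<And>u. u \<in> ball w0 r1 - {w0} \<Longrightarrow> regular (z0, u)" using isolated[OF x0] by blast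
  \<comment> \<open>\<open>r < r1\<close> makes the slice \<open>z0\<close> regular on the closed
    disc without its centre; \<open>1 / 2\<close> and \<open>1 / (4 * D + 4)\<close> yield the
    conditions \<open>2 * r <= 1\<close> and \<open>r * (2 * D) <= 1 / 2\<close> of
    \<open>slice\<close>.\<close>
  define r where "r = min (min \<rho>2 (r1 / 2)) (min (1 / 2) (1 / (4 * D + 4)))"
  have rle: "r \<le> min \<rho>2 (r1 / 2)" "r \<le> min (1 / 2) (1 / (4 * D + 4))"
    unfolding r_def by (rule min.cobounded1, rule min.cobounded2)
  note rle = rle[unfolded min.bounded_iff]
  have "0 < r" using \<rho>2 r1 D0 by (simp add: r_def)
  then have r: "0 < r" "r \<le> \<rho>2" "r < r1" "2 * r \<le> 1" using rle r1(1) by auto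
  have rD: "r * (2 * D) \<le> 1 / 2"
  proof -
    have "r * (2 * D) \<le> 1 / (4 * D + 4) * (2 * D)" using D0 rle(2) by (intro mult_right_mono) auto
    also have "\<dots> \<le> 1 / 2" using D0 by (simp add: divide_simps)
    finally show ?thesis .
  qed
  have inK: "(z, w) \<in> K" if "z \<in> cball z0 \<rho>1" "w \<in> cball w0 r" for z w using that r by (auto simp: K_def)
  define An where "An = cball w0 r - ball w0 (r / 64)"
  have An: "compact An" "An \<noteq> {}"
  proof -
    show "compact An" unfolding An_def by (intro compact_diff) auto
    have "w0 + of_real r \<in> An" using r by (simp add: An_def dist_norm)
    then show "An \<noteq> {}" by blast
  qed
  have "continuous_on An (\<lambda>w. norm (a (z0, w)))"
    by (intro continuous_on_norm continuous_on_compose2[OF smooth_on_continuous_on[OF sm(3)]] continuous_intros)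
      (use inK[of z0] \<rho>1 K(3) in \<open>auto simp: An_def\<close>)
  from continuous_attains_inf[OF An this] obtain wm where wm: "wm \<in> An" "\<And>w. w \<in> An \<Longrightarrow> norm (a (z0, wm)) \<le> norm (a (z0, w))" by blast
  \<comment> \<open>Half of the minimum on the annulus in the slice \<open>z0\<close>; the other
    half is spent on moving from \<open>z0\<close> to \<open>z\<close>, which is why
    \<open>D * \<rho>z <= c0\<close> is arranged.\<close>
  define c0 where "c0 = norm (a (z0, wm)) / 2"
  have c0: "0 < c0"
  proof -
    have "wm \<in> ball w0 r1 - {w0}" using wm(1) r by (auto simp: An_def)
    then have "regular (z0, wm)" using r1 by blast
    moreover have "(z0, wm) \<in> N'" using inK[of z0 wm] wm(1) \<rho>1 K(3) by (auto simp: An_def)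
    ultimately have "norm (b (z0, wm)) < norm (a (z0, wm))" using reg by blast
    then show ?thesis unfolding c0_def using norm_ge_zero[of "b (z0, wm)"] by linarith
  qed
  define \<rho>z where "\<rho>z = min \<rho>1 (min (1 / 2) (c0 / (D + 1)))"
  have \<rho>z: "0 < \<rho>z" "\<rho>z \<le> \<rho>1" "\<rho>z \<le> 1 / 2" "D * \<rho>z \<le> c0"
  proof -
    have "\<rho>z \<le> \<rho>1" "\<rho>z \<le> min (1 / 2) (c0 / (D + 1))"
      unfolding \<rho>z_def by (rule min.cobounded1, rule min.cobounded2)
    note le = this[unfolded min.bounded_iff]
    show "\<rho>z \<le> \<rho>1" "\<rho>z \<le> 1 / 2" using le by blast+
    show "0 < \<rho>z" using \<rho>1 c0 D0 by (simp add: \<rho>z_def)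
    have "D * \<rho>z \<le> D * (c0 / (D + 1))" using D0 le by (intro mult_left_mono) auto
    also have "\<dots> \<le> c0" using D0 c0 by (simp add: divide_simps)
    finally show "D * \<rho>z \<le> c0" .
  qed
  have ann: "c0 \<le> norm (a (z, w))" if z: "z \<in> cball z0 \<rho>z" and w: "r / 64 \<le> dist w0 w" "dist w0 w \<le> r" for z w
  proof -
    have "w \<in> An" using w by (simp add: An_def)
    then have "2 * c0 \<le> norm (a (z0, w))" using wm(2) by (simp add: c0_def)
    moreover have "norm (a (z0, w) - a (z, w)) \<le> D * norm ((z0, w) - (z, w))"
      using z w \<rho>z \<rho>1 by (intro bnd(3)[OF sm(3) LD(1)] inK) auto
    moreover have "D * norm ((z0, w) - (z, w)) \<le> D * \<rho>z"
      unfolding hn using z D0 by (intro mult_left_mono) (auto simp: dist_norm)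
    ultimately show ?thesis using \<rho>z(4) norm_triangle_ineq2[of "a (z0, w)" "a (z, w)"] by linarith
  qed
  obtain Nm where Nm: "2 * D / c0 < 2 ^ Nm" using real_arch_pow[of 2 "2 * D / c0"] by auto
  have sl: "slice (\<lambda>w. a (z, w)) (\<lambda>w. b (z, w)) (\<lambda>w. A (z, w)) (\<lambda>w. B (z, w)) {w. (z, w) \<in> N'} w0 r D c0 D Nm"
    if z: "z \<in> cball z0 \<rho>z" for z
  proof
    have zK: "(z, w) \<in> K" if "w \<in> cball w0 r" for w using inK z that \<rho>z by auto
    show "open {w. (z, w) \<in> N'}" by (rule slice_wirtinger(1)[OF N'(1) sm(1)])
    show sub: "cball w0 r \<subseteq> {w. (z, w) \<in> N'}" using zK K(3) by auto
    show "smooth_on {w. (z, w) \<in> N'} (\<lambda>w. a (z, w))" "smooth_on {w. (z, w) \<in> N'} (\<lambda>w. b (z, w))"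
      by (rule slice_wirtinger(2)[OF N'(1)], rule sm)+
    show "wb (\<lambda>w. a (z, w)) w = A (z, w) * a (z, w) + B (z, w) * cnj (b (z, w))"
      "wb (\<lambda>w. b (z, w)) w = A (z, w) * b (z, w) + B (z, w) * cnj (a (z, w))"
      "norm (b (z, w)) \<le> norm (a (z, w))" if "w \<in> {w. (z, w) \<in> N'}" for w using that eqs le by auto
    fix w assume w: "w \<in> cball w0 r"
    show "norm (A (z, w)) \<le> D" "norm (B (z, w)) \<le> D" "norm (a (z, w)) \<le> D"
      by (rule bnd(1)[OF _ _ zK[OF w]]; fact sm LD)+
    show "norm (A (z, w) - A (z, w')) \<le> D * norm (w - w')" "norm (B (z, w) - B (z, w')) \<le> D * norm (w - w')"
      if "w' \<in> cball w0 r" for w'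
      using bnd(3)[OF sm(5) LD(3) zK[OF w] zK[OF that]] bnd(3)[OF sm(6) LD(4) zK[OF w] zK[OF that]] unfolding hn by auto
    have wN: "(z, w) \<in> N'" using zK[OF w] K(3) by blast
    have wdb: "norm (wd (\<lambda>w. f (z, w)) w) \<le> D" if "smooth_on N' f" "L f \<le> D" for f
    proof -
      have "norm (dd f (0, 1) (z, w) - \<i> * dd f (0, \<i>) (z, w)) \<le> norm (dd f (0, 1) (z, w)) + norm (dd f (0, \<i>) (z, w))"
        using norm_triangle_ineq4[of "dd f (0, 1) (z, w)" "\<i> * dd f (0, \<i>) (z, w)"] by (simp add: norm_mult)
      also have "\<dots> \<le> D + D"
        using bnd(2)[OF that zK[OF w], of "(0, 1)"] bnd(2)[OF that zK[OF w], of "(0, \<i>)"] by (simp add: norm_Pair)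
      finally show ?thesis unfolding slice_wirtinger(4)[OF N'(1) that(1) wN] by (simp add: norm_divide)
    qed
    show "norm (wd (\<lambda>w. a (z, w)) w) \<le> D" "norm (wd (\<lambda>w. b (z, w)) w) \<le> D"
      by (rule wdb; fact sm LD)+
    have nz: "\<not> (\<exists>r>0. \<forall>u\<in>ball w r. norm (a (z, u)) = norm (b (z, u)))"
    proof
      assume "\<exists>r>0. \<forall>u\<in>ball w r. norm (a (z, u)) = norm (b (z, u))"
      then obtain d where d: "d > 0" "\<And>u. u \<in> ball w d \<Longrightarrow> norm (a (z, u)) = norm (b (z, u))" by blast
      have "(z, w) \<in> N" using wN N'(3) by blast
      then obtain e where e: "e > 0" "\<And>u. u \<in> ball w e - {w} \<Longrightarrow> regular (z, u)" using isolated by blast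
      have "open {u. (z, u) \<in> N'}" by (rule slice_wirtinger(1)[OF N'(1) sm(1)])
      then obtain k where k: "k > 0" "ball w k \<subseteq> {u. (z, u) \<in> N'}" using openE wN by (metis mem_Collect_eq)
      define u where "u = w + of_real (min d (min e k) / 2)"
      have du: "dist w u = min d (min e k) / 2" using d e k by (simp add: u_def dist_norm)
      have "u \<in> ball w d" "u \<in> ball w e - {w}" "u \<in> ball w k" using du d(1) e(1) k(1) by auto
      then show False using d(2) e(2) k(2) reg by (metis less_irrefl mem_Collect_eq subsetD)
    qed
    show "\<exists>n \<alpha> \<beta>. norm \<beta> < norm \<alpha> \<and> lead (\<lambda>w. a (z, w)) w n \<alpha> \<and> lead (\<lambda>w. b (z, w)) w n \<beta>"
      by (rule pair_dichotomy[OF slice_wirtinger(1)[OF N'(1) sm(1)], where A="\<lambda>w. A (z, w)" and B="\<lambda>w. B (z, w)"])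
        (use nz wN eqs le slice_wirtinger(2)[OF N'(1)] sm in auto)
  next
    show "c0 \<le> norm (a (z, w))" if "r / 64 \<le> dist w0 w" "dist w0 w \<le> r" for w by (rule ann[OF z that])
  qed (use r rD c0 Nm D0 in auto)
  define Lp where "Lp = slice.Lip r D c0 D Nm"
  have Lp: "0 \<le> Lp" unfolding Lp_def by (rule slice.nonneg(4)[OF sl[of z0]]) (use \<rho>z in simp)
  define Q where "Q = (\<lambda>z q. continuous_on (cball w0 r) q \<and> (\<forall>w\<in>cball w0 r. a (z, w) \<noteq> 0 \<longrightarrow> q w = b (z, w) / a (z, w)) \<and>
     (\<forall>w\<in>cball w0 r. norm (q w) < 1) \<and>
     (\<forall>w\<in>cball w0 r. \<forall>w'\<in>cball w0 r. norm (q w - q w') \<le> Lp * norm (w - w')) \<and>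
     (\<forall>w\<in>cball w0 (r/2). \<forall>\<delta>. 0 < \<delta> \<and> \<delta> \<le> r / 2 \<longrightarrow>
        (\<exists>w'\<in>cball w \<delta>. c0 / 2 * (\<delta> / (2 * (Nm + 1))) ^ Nm \<le> norm (a (z, w')))))"
  have "\<forall>z\<in>cball z0 \<rho>z. \<exists>q. Q z q" unfolding Q_def Lp_def by (intro ballI slice.hol_quotient[OF sl])
  then obtain q where q: "\<And>z. z \<in> cball z0 \<rho>z \<Longrightarrow> Q z (q z)" using bchoice by metis
  have qc: "continuous_on (cball w0 r) (q z)"
    and qab: "\<And>w. w \<in> cball w0 r \<Longrightarrow> a (z, w) \<noteq> 0 \<Longrightarrow> q z w = b (z, w) / a (z, w)"
    and q1: "\<And>w. w \<in> cball w0 r \<Longrightarrow> norm (q z w) < 1"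
    and qL: "\<And>w w'. w \<in> cball w0 r \<Longrightarrow> w' \<in> cball w0 r \<Longrightarrow> norm (q z w - q z w') \<le> Lp * norm (w - w')"
    and qav: "\<And>w \<delta>. w \<in> cball w0 (r/2) \<Longrightarrow> 0 < \<delta> \<Longrightarrow> \<delta> \<le> r / 2 \<Longrightarrow>
        \<exists>w'\<in>cball w \<delta>. c0 / 2 * (\<delta> / (2 * (Nm + 1))) ^ Nm \<le> norm (a (z, w'))" if "z \<in> cball z0 \<rho>z" for z
    using q[OF that] unfolding Q_def by blast+
  define \<alpha> where "\<alpha> = 1 / (real Nm + 2)"
  have \<alpha>: "0 < \<alpha>" "\<alpha> < 1" by (auto simp: \<alpha>_def)
  define g where "g = c0 / 2 * (r / 2 / (2 * (Nm + 1))) ^ Nm"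
  have g: "0 < g" using c0 r by (simp add: g_def)
  define C2 where "C2 = Lp * r + 2 * D / g"
  have C2: "0 \<le> C2" using Lp r g D0 by (simp add: C2_def)
  have dz1: "norm (z - z') \<le> 1" if "z \<in> cball z0 \<rho>z" "z' \<in> cball z0 \<rho>z" for z z'
    using dist_triangle[of z z' z0] that \<rho>z(3) by (simp add: dist_norm norm_minus_commute)
  have qH: "norm (q z w - q z' w) \<le> C2 * norm (z - z') powr \<alpha>"
    if z: "z \<in> cball z0 \<rho>z" "z' \<in> cball z0 \<rho>z" and w: "w \<in> cball w0 (r/2)" for z z' w
  proof (cases "z = z'")
    case False
    show ?thesis unfolding C2_def
    proof (rule hoelder_compare[where a="\<lambda>w. a (z, w)" and b="\<lambda>w. b (z, w)" and a'="\<lambda>w. a (z', w)" and b'="\<lambda>w. b (z', w)",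
          OF r(1) g D0 Lp _ _ qab[OF z(1)] qab[OF z(2)] q1[OF z(1)] q1[OF z(2)] qL[OF z(1)] qL[OF z(2)] qav[OF z(1)] g_def _ _ _ \<alpha>_def w])
      show "0 < norm (z - z')" using False by simp
      show "norm (z - z') \<le> 1" by (rule dz1[OF z])
      fix u assume u: "u \<in> cball w0 r"
      have uK: "(z, u) \<in> K" "(z', u) \<in> K" using inK z u \<rho>z by auto
      show "norm (a (z, u) - a (z', u)) \<le> D * norm (z - z')" "norm (b (z, u) - b (z', u)) \<le> D * norm (z - z')"
        using bnd(3)[OF sm(3) LD(1) uK] bnd(3)[OF sm(4) LD(2) uK] unfolding hn by auto
      show "norm (b (z', u)) \<le> norm (a (z', u))" using le uK(2) K(3) by blast
    qed
  qed simp
  have z0c: "z0 \<in> cball z0 \<rho>z" "w0 \<in> cball w0 r" "w0 \<in> cball w0 (r/2)" using \<rho>z r by auto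
  \<comment> \<open>The denominators of \<open>JQ\<close> degenerate as \<open>norm q\<close> tends
    to 1, so the bidisc is shrunk until \<open>norm q\<close> is at most some
    \<open>\<kappa> < 1\<close>; then \<open>JQ\<close> is Lipschitz on a compact set containing all
    values.\<close>
  define \<kappa> where "\<kappa> = (1 + norm (q z0 w0)) / 2"
  have \<kappa>: "norm (q z0 w0) < \<kappa>" "\<kappa> < 1" "0 \<le> \<kappa>" using q1[OF z0c(1,2)] norm_ge_zero[of "q z0 w0"] by (auto simp: \<kappa>_def)
  have "((\<lambda>\<rho>. C2 * \<rho> powr \<alpha> + Lp * \<rho>) \<longlongrightarrow> C2 * 0 powr \<alpha> + Lp * 0) (at_right 0)"
    by (intro tendsto_intros tendsto_powr') (use \<alpha> in \<open>auto simp: eventually_at_right_less intro: eventually_mono[OF eventually_at_right_less]\<close>)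
  then have "((\<lambda>\<rho>. C2 * \<rho> powr \<alpha> + Lp * \<rho>) \<longlongrightarrow> 0) (at_right 0)" by simp
  from order_tendstoD(2)[OF this, of "\<kappa> - norm (q z0 w0)"] \<kappa>
  obtain \<rho>3 where \<rho>3: "\<rho>3 > 0" "\<And>\<rho>. 0 < \<rho> \<Longrightarrow> \<rho> < \<rho>3 \<Longrightarrow> C2 * \<rho> powr \<alpha> + Lp * \<rho> < \<kappa> - norm (q z0 w0)"
    unfolding eventually_at_right_field by auto
  define \<rho> where "\<rho> = min (\<rho>3 / 2) (min \<rho>z (r / 2))"
  have \<rho>: "0 < \<rho>" "\<rho> < \<rho>3" "\<rho> \<le> \<rho>z" "\<rho> \<le> r / 2" using \<rho>3 \<rho>z r by (auto simp: \<rho>_def)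
  define E where "E = ball z0 \<rho> \<times> ball w0 \<rho>"
  have EK: "E \<subseteq> K" using \<rho> \<rho>z r by (auto simp: E_def K_def)
  have zin: "z \<in> cball z0 \<rho>z" if "z \<in> ball z0 \<rho>" for z using that \<rho> by auto
  have win: "w \<in> cball w0 r" "w \<in> cball w0 (r/2)" if "w \<in> ball w0 \<rho>" for w using that \<rho> r by auto
  have q\<kappa>: "norm (q z w) \<le> \<kappa>" if z: "z \<in> ball z0 \<rho>" and w: "w \<in> ball w0 \<rho>" for z w
  proof -
    have "norm (q z w) \<le> norm (q z0 w0) + norm (q z w - q z0 w) + norm (q z0 w - q z0 w0)"
      using norm_triangle_ineq[of "q z0 w0 + (q z w - q z0 w)" "q z0 w - q z0 w0"] norm_triangle_ineq[of "q z0 w0" "q z w - q z0 w"] by simp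
    also have "norm (q z w - q z0 w) \<le> C2 * \<rho> powr \<alpha>"
      by (rule order_trans[OF qH[OF zin[OF z] z0c(1) win(2)[OF w]]])
        (use z C2 \<alpha> in \<open>auto intro!: mult_left_mono powr_mono2 simp: dist_norm norm_minus_commute\<close>)
    also have "norm (q z0 w - q z0 w0) \<le> Lp * \<rho>"
      by (rule order_trans[OF qL[OF z0c(1) win(1)[OF w] z0c(2)]])
        (use w Lp in \<open>auto intro!: mult_left_mono simp: dist_norm norm_minus_commute\<close>)
    finally show ?thesis using \<rho>3(2)[OF \<rho>(1,2)] by linarith
  qed
  define \<Psi> where "\<Psi> = (\<lambda>x. (q (fst x) (snd x), s x, s' x))"
  define J where "J = (\<lambda>x. JQ (\<Psi> x))"
  define K2 where "K2 = cball (0::complex) \<kappa> \<times> cball (0::complex) D \<times> cball (0::complex) D"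
  have "\<exists>L\<ge>0. (\<forall>x\<in>K2. norm (JQ x) \<le> L) \<and> (\<forall>x\<in>K2. \<forall>u. norm (dd JQ u x) \<le> L * norm u) \<and>
    (\<forall>x\<in>K2. \<forall>y\<in>K2. norm (JQ x - JQ y) \<le> L * norm (x - y))"
    by (rule smooth_bounds[OF _ smooth_on_JQ])
      (use \<kappa> in \<open>auto simp: K2_def intro!: open_Times compact_Times convex_Times\<close>)
  then obtain LJ where LJ: "LJ \<ge> 0" "\<And>x y. x \<in> K2 \<Longrightarrow> y \<in> K2 \<Longrightarrow> norm (JQ x - JQ y) \<le> LJ * norm (x - y)" by blast
  have \<Psi>K: "\<Psi> (z, w) \<in> K2" if "z \<in> ball z0 \<rho>" "w \<in> ball w0 \<rho>" for z w
  proof -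
    have "(z, w) \<in> K" using that EK by (auto simp: E_def)
    then show ?thesis using q\<kappa>[OF that] bnd(1)[OF sm(1) LD(5)] bnd(1)[OF sm(2) LD(6)] by (auto simp: \<Psi>_def K2_def)
  qed
  have Jdiff: "norm (J (z, w) - J (z', w')) \<le> LJ * (norm (q z w - q z' w') + 2 * (D * norm ((z, w) - (z', w'))))"
    if "z \<in> ball z0 \<rho>" "w \<in> ball w0 \<rho>" "z' \<in> ball z0 \<rho>" "w' \<in> ball w0 \<rho>" for z w z' w'
  proof -
    have k: "(z, w) \<in> K" "(z', w') \<in> K" using that EK by (auto simp: E_def)
    have "norm (\<Psi> (z, w) - \<Psi> (z', w')) \<le> norm (q z w - q z' w') + (norm (s (z, w) - s (z', w')) + norm (s' (z, w) - s' (z', w')))"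
      unfolding \<Psi>_def by (auto intro!: order_trans[OF norm_Pair_le] add_left_mono)
    also have "\<dots> \<le> norm (q z w - q z' w') + 2 * (D * norm ((z, w) - (z', w')))"
      using bnd(3)[OF sm(1) LD(5) k] bnd(3)[OF sm(2) LD(6) k] by simp
    finally have *: "norm (\<Psi> (z, w) - \<Psi> (z', w')) \<le> norm (q z w - q z' w') + 2 * (D * norm ((z, w) - (z', w')))" .
    show ?thesis unfolding J_def
      by (rule order_trans[OF LJ(2)[OF \<Psi>K[OF that(1,2)] \<Psi>K[OF that(3,4)]] mult_left_mono[OF * LJ(1)]])
  qed
  define C where "C = LJ * (C2 + 2 * D) + LJ * (Lp + 2 * D)"
  have C0: "0 \<le> C" using LJ C2 D0 Lp by (simp add: C_def)
  have JH: "norm (J (z, w) - J (z', w)) \<le> C * norm (z - z') powr \<alpha>"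
    if z: "z \<in> ball z0 \<rho>" "z' \<in> ball z0 \<rho>" and w: "w \<in> ball w0 \<rho>" for z z' w
  proof -
    have d1: "norm (z - z') \<le> 1" by (rule dz1[OF zin[OF z(1)] zin[OF z(2)]])
    have d: "norm (z - z') \<le> norm (z - z') powr \<alpha>"
    proof (cases "z = z'")
      case False
      have "norm (z - z') powr 1 \<le> norm (z - z') powr \<alpha>" using d1 \<alpha> by (intro powr_mono') auto
      then show ?thesis by simp
    qed simp
    have "norm (J (z, w) - J (z', w)) \<le> LJ * (norm (q z w - q z' w) + 2 * (D * norm (z - z')))"
      using Jdiff[OF z(1) w z(2) w] unfolding hn .
    also have "\<dots> \<le> LJ * (C2 * norm (z - z') powr \<alpha> + 2 * (D * norm (z - z') powr \<alpha>))"
      using qH[OF zin[OF z(1)] zin[OF z(2)] win(2)[OF w]] d D0 LJ by (intro mult_left_mono add_mono) auto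
    also have "\<dots> = (LJ * (C2 + 2 * D)) * norm (z - z') powr \<alpha>" by (simp add: algebra_simps)
    also have "\<dots> \<le> C * norm (z - z') powr \<alpha>" using LJ Lp D0 by (intro mult_right_mono) (auto simp: C_def)
    finally show ?thesis .
  qed
  have JL: "norm (J (z, w) - J (z, w')) \<le> C * norm (w - w')"
    if z: "z \<in> ball z0 \<rho>" and w: "w \<in> ball w0 \<rho>" "w' \<in> ball w0 \<rho>" for z w w'
  proof -
    have "norm (J (z, w) - J (z, w')) \<le> LJ * (norm (q z w - q z w') + 2 * (D * norm (w - w')))"
      using Jdiff[OF z w(1) z w(2)] unfolding hn .
    also have "\<dots> \<le> LJ * (Lp * norm (w - w') + 2 * (D * norm (w - w')))"
      using qL[OF zin[OF z] win(1)[OF w(1)] win(1)[OF w(2)]] LJ D0 by (intro mult_left_mono add_mono) auto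
    also have "\<dots> = (LJ * (Lp + 2 * D)) * norm (w - w')" by (simp add: algebra_simps)
    also have "\<dots> \<le> C * norm (w - w')" using LJ C2 D0 by (intro mult_right_mono) (auto simp: C_def)
    finally show ?thesis .
  qed
  have J2: "J x o\<^sub>L J x = - id_blinfun" if x: "x \<in> E" for x
    unfolding J_def \<Psi>_def by (rule JQ_square, rule q1) (use x zin win in \<open>auto simp: E_def\<close>)
  have Jreg: "blinfun_apply (J x) = J0 x" if x: "x \<in> E" and rx: "regular x" for x
  proof -
    obtain z w where zw: "x = (z, w)" by (cases x)
    have xN: "x \<in> N'" using x EK K(3) by blast
    then have "a x \<noteq> 0" using reg rx by force
    then have "q z w = b x / a x" using qab[of z w] x zw zin win by (auto simp: E_def)
    then show ?thesis using JQ xN rx by (simp add: J_def \<Psi>_def zw)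
  qed
  \<comment> \<open>The zeros of \<open>a\<close> are removable singularities of \<open>q z\<close>,
    and the circle of radius \<open>r\<close> belongs to the zero-free annulus of \<open>ann\<close>
    for all \<open>z\<close> at once.\<close>
  have Jsm: "smooth_on E J" if cst: "\<exists>J0. \<forall>y\<in>Y. Jl y = J0"
  proof -
    have AB0: "A x = 0 \<and> B x = 0" if "x \<in> N'" for x using const cst that by blast
    have E: "open E" unfolding E_def by (intro open_Times open_ball)
    define N2 where "N2 = N' \<inter> a -` (- {0})"
    have N2: "open N2" unfolding N2_def
      by (rule continuous_open_preimage[OF smooth_on_continuous_on[OF sm(3)] N'(1)]) auto
    have sba: "smooth_on N2 (\<lambda>x. b x / a x)"
      by (rule smooth_on_divide[OF N2]) (use smooth_on_subset[OF sm(3), of N2] smooth_on_subset[OF sm(4), of N2] in \<open>auto simp: N2_def\<close>)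
    have bd: "(z, w) \<in> N2" if "z \<in> ball z0 \<rho>z" "dist w0 w = r" for z w
    proof -
      have "c0 \<le> norm (a (z, w))" using that r by (intro ann) auto
      then show ?thesis using c0 inK[of z w] that \<rho>z K(3) by (auto simp: N2_def)
    qed
    define I where "I = (\<lambda>(z, w). integral {0..1} (\<lambda>t. b (z, w0 + of_real r * cis (2 * pi * t)) / a (z, w0 + of_real r * cis (2 * pi * t))
       / (w0 + of_real r * cis (2 * pi * t) - w) * (of_real r * cis (2 * pi * t))))"
    have sI: "smooth_on (ball z0 \<rho>z \<times> ball w0 r) I"
      unfolding I_def by (rule smooth_on_circle_integral[OF N2 sba open_ball r(1) bd])
    have Iq: "I (z, w) = q z w" if z: "z \<in> ball z0 \<rho>z" and w: "w \<in> ball w0 r" for z w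
    proof -
      have zc: "z \<in> cball z0 \<rho>z" using z by simp
      define Z where "Z = {w \<in> cball w0 r. a (z, w) = 0}"
      have fZ: "finite Z" using slice.finite_Z[OF sl[OF zc]] unfolding slice.Z_def[OF sl[OF zc]] Z_def .
      have "q z holomorphic_on ball w0 r"
      proof (rule no_isolated_singularity[OF _ _ open_ball fZ])
        show "continuous_on (ball w0 r) (q z)" by (rule continuous_on_subset[OF qc[OF zc]]) auto
        show "q z holomorphic_on ball w0 r - Z"
        proof (rule holomorphic_transform)
          show "b (z, u) / a (z, u) = q z u" if "u \<in> ball w0 r - Z" for u using qab[OF zc, of u] that by (auto simp: Z_def)
          have "\<exists>f'. ((\<lambda>u. f (z, u)) has_field_derivative f') (at u)"
            if u: "u \<in> ball w0 r - Z" and f: "smooth_on N' f" "wb (\<lambda>w. f (z, w)) u = 0" for u f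
          proof -
            have uN: "(z, u) \<in> N'" using inK[of z u] u zc \<rho>z K(3) by auto
            have "(\<lambda>w. f (z, w)) differentiable (at u)"
              by (rule smooth_on_differentiable[OF slice_wirtinger(2)[OF N'(1) f(1)]]) (use uN in simp)
            from hasW_wirtinger[OF this] f(2) show ?thesis
              unfolding has_field_derivative_def by auto
          qed
          note fd = this
          have "\<exists>f'. ((\<lambda>u. b (z, u) / a (z, u)) has_field_derivative f') (at u)" if u: "u \<in> ball w0 r - Z" for u
          proof -
            have uN: "(z, u) \<in> N'" using inK[of z u] u zc \<rho>z K(3) by auto
            have w0: "wb (\<lambda>w. a (z, w)) u = 0" "wb (\<lambda>w. b (z, w)) u = 0" using eqs uN AB0[OF uN] by auto
            obtain a' b' where "((\<lambda>u. a (z, u)) has_field_derivative a') (at u)" "((\<lambda>u. b (z, u)) has_field_derivative b') (at u)"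
              using fd[OF u sm(3) w0(1)] fd[OF u sm(4) w0(2)] by blast
            moreover have "a (z, u) \<noteq> 0" using u by (auto simp: Z_def)
            ultimately show ?thesis using DERIV_divide by blast
          qed
          then show "(\<lambda>u. b (z, u) / a (z, u)) holomorphic_on ball w0 r - Z"
            unfolding holomorphic_on_def field_differentiable_def using has_field_derivative_at_within by blast
        qed
      qed
      from cauchy_integral_cis[OF r(1) qc[OF zc] this w]
      have c: "integral {0..1} (\<lambda>t. q z (w0 + of_real r * cis (2 * pi * t)) / (w0 + of_real r * cis (2 * pi * t) - w) * (of_real r * cis (2 * pi * t))) = q z w" .
      have "I (z, w) = integral {0..1} (\<lambda>t. q z (w0 + of_real r * cis (2 * pi * t)) / (w0 + of_real r * cis (2 * pi * t) - w) * (of_real r * cis (2 * pi * t)))"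
        unfolding I_def split_conv
      proof (rule integral_cong)
        fix t :: real
        define u where "u = w0 + of_real r * cis (2 * pi * t)"
        have "dist w0 u = r" using r by (simp add: u_def dist_norm norm_mult)
        then have "q z u = b (z, u) / a (z, u)" using bd[OF z, of u] by (intro qab[OF zc]) (auto simp: N2_def)
        then show "b (z, w0 + of_real r * cis (2 * pi * t)) / a (z, w0 + of_real r * cis (2 * pi * t)) / (w0 + of_real r * cis (2 * pi * t) - w) * (of_real r * cis (2 * pi * t)) =
          q z (w0 + of_real r * cis (2 * pi * t)) / (w0 + of_real r * cis (2 * pi * t) - w) * (of_real r * cis (2 * pi * t))"
          unfolding u_def by simp
      qed
      then show ?thesis using c by simp
    qed
    have EI: "E \<subseteq> ball z0 \<rho>z \<times> ball w0 r" using \<rho> r by (auto simp: E_def)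
    have sq: "smooth_on E (\<lambda>x. q (fst x) (snd x))"
      by (rule smooth_on_cong[OF E _ smooth_on_subset[OF sI EI]]) (use Iq EI in auto)
    have EN: "E \<subseteq> N'" using EK K(3) by blast
    have s\<Psi>: "smooth_on E \<Psi>"
      unfolding \<Psi>_def by (intro smooth_on_Pair E sq smooth_on_subset[OF sm(1) EN] smooth_on_subset[OF sm(2) EN])
    show ?thesis unfolding J_def
    proof (rule smooth_on_compose[OF E _ _ s\<Psi> smooth_on_JQ])
      show "open (ball 0 1 \<times> UNIV \<times> UNIV :: (complex \<times> complex \<times> complex) set)" by (intro open_Times open_ball open_UNIV)
      show "\<Psi> ` E \<subseteq> ball 0 1 \<times> UNIV \<times> UNIV" using q1 zin win by (auto simp: \<Psi>_def E_def)
    qed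
  qed
  have EN: "E \<subseteq> N" using EK K(3) N'(3) by blast
  show ?thesis
  proof (rule exI[of _ \<rho>], rule exI[of _ J], rule exI[of _ \<alpha>], rule exI[of _ C], unfold E_def[symmetric], intro conjI)
    show "(\<exists>J0. \<forall>y\<in>Y. Jl y = J0) \<longrightarrow> smooth_on E J" by (rule impI) (rule Jsm)
    show "\<forall>x\<in>E. J x o\<^sub>L J x = - id_blinfun" by (intro ballI J2)
    show "\<forall>x\<in>E. regular x \<longrightarrow> blinfun_apply (J x) = J0 x" by (intro ballI impI Jreg)
    show "\<forall>z\<in>ball z0 \<rho>. \<forall>z'\<in>ball z0 \<rho>. \<forall>w\<in>ball w0 \<rho>. norm (J (z, w) - J (z', w)) \<le> C * norm (z - z') powr \<alpha>" by (intro ballI JH)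
    show "\<forall>z\<in>ball z0 \<rho>. \<forall>w\<in>ball w0 \<rho>. \<forall>w'\<in>ball w0 \<rho>. norm (J (z, w) - J (z, w')) \<le> C * norm (w - w')" by (intro ballI JL)
  qed (fact \<rho>(1) EN \<alpha> C0)+
qed

end

subsection \<open>Determinants of linear maps\<close>

text \<open>Conjugation with the enumeration \<open>\<beta>\<close> carries permutations of indices
  to permutations of \<open>Basis\<close> and keeps signs; multiplicativity of the determinant then
  becomes available for \<open>ldet\<close>.\<close>

lemma ldet_eq_det:
  fixes \<beta> :: "'n::finite \<Rightarrow> 'a::euclidean_space"
  assumes \<beta>: "bij_betw \<beta> UNIV Basis"
  shows "ldet L = det (\<chi> i j. L (\<beta> i) \<bullet> \<beta> j)"
proof -
  define \<gamma> where "\<gamma> = inv_into UNIV \<beta>"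
  have \<gamma>\<beta>: "\<gamma> (\<beta> i) = i" for i unfolding \<gamma>_def using \<beta> by (simp add: bij_betw_def)
  have \<beta>\<gamma>: "\<beta> (\<gamma> b) = b" if "b \<in> Basis" for b unfolding \<gamma>_def using \<beta> that by (metis bij_betw_def f_inv_into_f)
  have \<beta>B: "\<beta> i \<in> Basis" for i using \<beta> by (auto simp: bij_betw_def)
  have inj: "\<beta> i = \<beta> j \<longleftrightarrow> i = j" for i j using \<gamma>\<beta> by metis
  define cj where "cj = (\<lambda>p x. if x \<in> Basis then \<beta> (p (\<gamma> x)) else x)"
  define cb where "cb = (\<lambda>q i. \<gamma> (q (\<beta> i)))"
  have cj\<beta>: "cj p (\<beta> i) = \<beta> (p i)" for p i by (simp add: cj_def \<beta>B \<gamma>\<beta>)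
  have cjp: "cj p permutes Basis" if "p permutes UNIV" for p
  proof (rule bij_imp_permutes)
    have bp: "bij p" using that permutes_bij by blast
    show "bij_betw (cj p) Basis Basis"
    proof (rule bij_betw_byWitness[where f'="\<lambda>x. \<beta> (inv p (\<gamma> x))"])
      show "\<forall>a\<in>Basis. \<beta> (inv p (\<gamma> (cj p a))) = a" using bp \<beta>\<gamma> by (simp add: cj_def \<gamma>\<beta> bij_is_inj)
      show "\<forall>a'\<in>Basis. cj p (\<beta> (inv p (\<gamma> a'))) = a'" using bp \<beta>\<gamma> by (simp add: cj\<beta> bij_is_surj surj_f_inv_f)
    qed (auto simp: cj_def \<beta>B)
  qed (simp add: cj_def)
  have cbp: "cb q permutes UNIV" if q: "q permutes Basis" for q
  proof (rule bij_imp_permutes)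
    have qB: "q b \<in> Basis" "inv q b \<in> Basis" if "b \<in> Basis" for b
      using q that permutes_in_image[OF q] permutes_in_image[OF permutes_inv[OF q]] by auto
    show "bij_betw (cb q) UNIV UNIV"
      by (rule bij_betw_byWitness[where f'="\<lambda>i. \<gamma> (inv q (\<beta> i))"])
        (auto simp: cb_def \<beta>\<gamma> qB \<beta>B \<gamma>\<beta> permutes_inverses[OF q])
  qed auto
  have fin: "finite (UNIV :: 'n set)" by simp
  \<comment> \<open>The permutation is built up from transpositions, since conjugation maps the
    transposition of \<open>a\<close> and \<open>b\<close> to that of \<open>\<beta> a\<close> and
    \<open>\<beta> b\<close>.\<close>
  have sgn: "sign (cj p) = sign p \<and> permutation (cj p)" if "p permutes UNIV" for p
    using that fin
  proof (induction rule: permutes_induct)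
    case id
    have "cj id = id" by (auto simp: cj_def \<beta>\<gamma>)
    show ?case unfolding \<open>cj id = id\<close> by (simp only: sign_id permutation_id)
  next
    case (swap a b p)
    have e: "cj (Transposition.transpose a b \<circ> p) = Transposition.transpose (\<beta> a) (\<beta> b) \<circ> cj p"
    proof
      fix x show "cj (Transposition.transpose a b \<circ> p) x = (Transposition.transpose (\<beta> a) (\<beta> b) \<circ> cj p) x"
      proof (cases "x \<in> Basis")
        case True
        then show ?thesis by (auto simp: cj_def Transposition.transpose_def inj)
      next
        case False
        then have "x \<noteq> \<beta> a" "x \<noteq> \<beta> b" using \<beta>B by auto
        then show ?thesis using False by (simp add: cj_def Transposition.transpose_def)
      qed
    qed
    have pp: "permutation p" using swap permutation_permutes fin by blast
    have sp: "permutation (cj p)" "sign (cj p) = sign p" using swap by auto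
    have ab: "\<beta> a \<noteq> \<beta> b" using swap inj by simp
    show ?case unfolding e
      unfolding sign_compose[OF permutation_swap_id sp(1)] sign_compose[OF permutation_swap_id pp] sign_swap_id sp(2)
      by (rule conjI[OF _ permutation_compose[OF permutation_swap_id sp(1)]]) (use swap(3) ab in simp)
  qed
  have cc: "cb (cj p) = p" for p by (rule ext) (simp add: cb_def cj\<beta> \<gamma>\<beta>)
  have cc': "cj (cb q) = q" if q: "q permutes Basis" for q
  proof
    fix x show "cj (cb q) x = q x"
    proof (cases "x \<in> Basis")
      case True
      then have "q x \<in> Basis" using permutes_in_image[OF q] by blast
      then show ?thesis using True by (simp add: cj_def cb_def \<beta>\<gamma>)
    next
      case False
      then show ?thesis using permutes_not_in[OF q] by (simp add: cj_def)
    qed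
  qed
  have "det (\<chi> i j. L (\<beta> i) \<bullet> \<beta> j) = (\<Sum>p | p permutes UNIV. of_int (sign p) * (\<Prod>i\<in>UNIV. L (\<beta> i) \<bullet> \<beta> (p i)))"
    unfolding det_def by simp
  also have "\<dots> = (\<Sum>q | q permutes (Basis :: 'a set). of_int (sign q) * (\<Prod>b\<in>Basis. L b \<bullet> q b))"
  proof (rule sum.reindex_bij_witness[where i=cb and j=cj])
    fix p :: "'n \<Rightarrow> 'n" assume p: "p \<in> {p. p permutes UNIV}"
    have "(\<Prod>b\<in>Basis. L b \<bullet> cj p b) = (\<Prod>i\<in>UNIV. L (\<beta> i) \<bullet> cj p (\<beta> i))"
      by (rule prod.reindex_bij_betw[OF \<beta>, symmetric])
    then show "of_int (sign (cj p)) * (\<Prod>b\<in>Basis. L b \<bullet> cj p b) = of_int (sign p) * (\<Prod>i\<in>UNIV. L (\<beta> i) \<bullet> \<beta> (p i))"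
      using sgn p by (simp add: cj\<beta>)
  qed (use cc cc' cjp cbp in auto)
  finally show ?thesis unfolding ldet_def by simp
qed

lemma exists_basis_enumeration: "\<exists>\<beta> :: 4 \<Rightarrow> cc. bij_betw \<beta> UNIV Basis"
proof -
  have "card (UNIV :: 4 set) = card (Basis :: cc set)" by simp
  then show ?thesis using finite_same_card_bij[of "UNIV :: 4 set" "Basis :: cc set"] by auto
qed

lemma ldet_compose:
  fixes L M :: "cc \<Rightarrow> cc"
  assumes L: "linear L"
  shows "ldet (\<lambda>x. L (M x)) = ldet L * ldet M"
proof -
  obtain \<beta> :: "4 \<Rightarrow> cc" where \<beta>: "bij_betw \<beta> UNIV Basis" using exists_basis_enumeration by blast
  \<comment> \<open>The rows are the images of the basis vectors, the transpose of the usual matrix,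
    so composition becomes the product in reverse order.\<close>
  have "(\<chi> i j. L (M (\<beta> i)) \<bullet> \<beta> j) = (\<chi> i j. M (\<beta> i) \<bullet> \<beta> j) ** (\<chi> i j. L (\<beta> i) \<bullet> \<beta> j)"
  proof -
    have "L (M (\<beta> i)) \<bullet> \<beta> j = (\<Sum>k\<in>UNIV. (M (\<beta> i) \<bullet> \<beta> k) * (L (\<beta> k) \<bullet> \<beta> j))" for i j
    proof -
      have "L (M (\<beta> i)) = L (\<Sum>b\<in>Basis. (M (\<beta> i) \<bullet> b) *\<^sub>R b)" by (simp add: euclidean_representation)
      also have "\<dots> = (\<Sum>b\<in>Basis. (M (\<beta> i) \<bullet> b) *\<^sub>R L b)" by (simp add: linear_sum[OF L] linear_cmul[OF L])
      also have "\<dots> = (\<Sum>k\<in>UNIV. (M (\<beta> i) \<bullet> \<beta> k) *\<^sub>R L (\<beta> k))" by (rule sum.reindex_bij_betw[OF \<beta>, symmetric])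
      finally show ?thesis by (simp add: inner_sum_left)
    qed
    then show ?thesis by (simp add: matrix_matrix_mult_def vec_eq_iff)
  qed
  then show ?thesis unfolding ldet_eq_det[OF \<beta>] by (simp add: det_mul mult.commute)
qed

lemma ldet_id: "ldet (\<lambda>x::cc. x) = 1"
proof -
  obtain \<beta> :: "4 \<Rightarrow> cc" where \<beta>: "bij_betw \<beta> UNIV Basis" using exists_basis_enumeration by blast
  have "\<beta> i \<bullet> \<beta> j = (if i = j then 1 else 0)" for i j
  proof -
    have "\<beta> i \<in> Basis" "\<beta> j \<in> Basis" "\<beta> i = \<beta> j \<longleftrightarrow> i = j"
      using \<beta> by (auto simp: bij_betw_def inj_def)
    then show ?thesis using inner_Basis[of "\<beta> i" "\<beta> j"] by simp
  qed
  then have "(\<chi> i j. \<beta> i \<bullet> \<beta> j) = mat 1" by (simp add: mat_def vec_eq_iff)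
  then show ?thesis unfolding ldet_eq_det[OF \<beta>] by simp
qed

lemma ldet_nonzero:
  fixes L :: "cc \<Rightarrow> cc"
  assumes "linear L" "bij L"
  shows "ldet L \<noteq> 0"
proof
  assume "ldet L = 0"
  then have "ldet (\<lambda>x. L (inv L x)) = 0" using ldet_compose[OF assms(1), of "inv L"] by simp
  moreover have "(\<lambda>x. L (inv L x)) = (\<lambda>x. x)" using assms(2) by (simp add: bij_is_surj surj_f_inv_f)
  ultimately show False using ldet_id by simp
qed

lemma Basis_cc: "(Basis :: cc set) = {(1, 0), (\<i>, 0), (0, 1), (0, \<i>)}"
  by (auto simp: Basis_prod_def Basis_complex_def)

text \<open>In blocks of size 2 the matrix has the identity in the corner of \<open>\<omega>\<close>
  and 0 below it. Exchanging the two block columns is an even permutation, which leaves the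
  determinant of the map \<open>\<zeta>\<close> to
  \<open>a * \<zeta> + b * cnj \<zeta>\<close>.\<close>

lemma ldet_beltrami:
  fixes s s' a b :: complex
  shows "ldet (\<lambda>(\<zeta>, \<omega>). (s * \<zeta> + s' * cnj \<zeta> + \<omega>, a * \<zeta> + b * cnj \<zeta>)) = (norm a)\<^sup>2 - (norm b)\<^sup>2"
proof -
  have f: "finite {(\<i>, 0 :: complex), (0, 1), (0, \<i>)}" "(1, 0) \<notin> {(\<i>, 0 :: complex), (0, 1), (0, \<i>)}"
    "finite {(0 :: complex, 1 :: complex), (0, \<i>)}" "(\<i>, 0) \<notin> {(0 :: complex, 1 :: complex), (0, \<i>)}"
    "finite {(0 :: complex, \<i>)}" "(0, 1) \<notin> {(0 :: complex, \<i>)}"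
    by (auto simp: complex_eq_iff)
  show ?thesis
    unfolding ldet_def Basis_cc cmod_power2
    unfolding sum_over_permutations_insert[OF f(1,2)] sum_over_permutations_insert[OF f(3,4)] sum_over_permutations_insert[OF f(5,6)] permutes_sing
    by (simp add: sign_swap_id permutation_swap_id sign_compose sign_id transpose_def permutation_compose complex_eq_iff inner_complex_def
        power2_eq_square algebra_simps)
qed

subsection \<open>Charts\<close>

lemma open_bidisc: "open bidisc"
  unfolding bidisc_def by (intro open_Times open_ball)

locale family =
  fixes A :: "('m::{t2_space, second_countable_topology} set \<times> ('m \<Rightarrow> cc)) set"
    and Jc :: "('m set \<times> ('m \<Rightarrow> cc)) \<Rightarrow> 'm \<Rightarrow> (cc \<Rightarrow>\<^sub>L cc)"
    and H :: "cc \<Rightarrow> 'm"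
  assumes atlas: "smooth_atlas A"
    and acs: "smooth_almost_complex A Jc"
    and Hsmooth: "smooth_map_bidisc A H"
    and holo_imm: "\<forall>z\<in>ball 0 1. \<forall>w\<in>ball 0 1. \<forall>(U, \<phi>)\<in>A. H (z, w) \<in> U \<longrightarrow>
         frechet_derivative (\<lambda>t. \<phi> (H (z, t))) (at w) \<circ> (\<lambda>t. \<i> * t) =
           blinfun_apply (Jc (U, \<phi>) (H (z, w))) \<circ> frechet_derivative (\<lambda>t. \<phi> (H (z, t))) (at w) \<and>
         inj (frechet_derivative (\<lambda>t. \<phi> (H (z, t))) (at w))"
    and not_contained: "\<forall>z\<in>ball 0 1. \<not> ({z} \<times> ball 0 1 \<subseteq> critical_set A H)"
    and orient: "\<forall>x\<in>bidisc - critical_set A H. \<forall>(U, \<phi>)\<in>A. H x \<in> U \<longrightarrow>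
         (\<forall>v u. ldet (cframe (Jc (U, \<phi>) (H x)) v u) \<noteq> 0 \<longrightarrow>
            ldet (frechet_derivative (\<phi> \<circ> H) (at x)) * ldet (cframe (Jc (U, \<phi>) (H x)) v u) > 0)"
begin

abbreviation "\<Sigma> \<equiv> critical_set A H"

definition dom :: "'m set \<Rightarrow> cc set" where "dom U = bidisc \<inter> H -` U"

definition chart :: "'m \<Rightarrow> 'm set \<times> ('m \<Rightarrow> cc)" where "chart p = (SOME c. c \<in> A \<and> p \<in> fst c)"

text \<open>The pull-back computed in one chosen chart; \<open>J0_chart\<close> shows independence
  of the choice. At critical points \<open>inv\<close> is applied to a map that is not bijective and
  the value has no meaning.\<close>

definition J0 :: "cc \<Rightarrow> cc \<Rightarrow> cc" where
  "J0 x = inv (frechet_derivative (snd (chart (H x)) \<circ> H) (at x)) \<circ> blinfun_apply (Jc (chart (H x)) (H x))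
     \<circ> frechet_derivative (snd (chart (H x)) \<circ> H) (at x)"

lemma chart: "chart p \<in> A" "p \<in> fst (chart p)"
proof -
  have "\<exists>c. c \<in> A \<and> p \<in> fst c" using atlas unfolding smooth_atlas_def by blast
  from someI_ex[OF this] show "chart p \<in> A" "p \<in> fst (chart p)" unfolding chart_def by auto
qed

lemma chart_facts:
  assumes "(U, \<phi>) \<in> A"
  shows "open U" "open (\<phi> ` U)" "inj_on \<phi> U" "continuous_on (\<phi> ` U) (inv_into U \<phi>)"
    "\<And>p. p \<in> U \<Longrightarrow> inv_into U \<phi> (\<phi> p) = p"
    "smooth_on (\<phi> ` U) (Jc (U, \<phi>) \<circ> inv_into U \<phi>)"
    "\<And>p. p \<in> U \<Longrightarrow> Jc (U, \<phi>) p o\<^sub>L Jc (U, \<phi>) p = - id_blinfun"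
    "open (dom U)" "smooth_on (dom U) (\<phi> \<circ> H)"
proof -
  have h: "open U \<and> open (\<phi> ` U) \<and> homeomorphism U (\<phi> ` U) \<phi> (inv_into U \<phi>)"
    using atlas assms unfolding smooth_atlas_def by fast
  then show 1: "open U" "open (\<phi> ` U)" by auto
  show 2: "\<And>p. p \<in> U \<Longrightarrow> inv_into U \<phi> (\<phi> p) = p" using h unfolding homeomorphism_def by blast
  then show "inj_on \<phi> U" by (metis inj_onI)
  show "continuous_on (\<phi> ` U) (inv_into U \<phi>)" using h unfolding homeomorphism_def by blast
  show "smooth_on (\<phi> ` U) (Jc (U, \<phi>) \<circ> inv_into U \<phi>)" using acs assms unfolding smooth_almost_complex_def by fast
  show "\<And>p. p \<in> U \<Longrightarrow> Jc (U, \<phi>) p o\<^sub>L Jc (U, \<phi>) p = - id_blinfun" using acs assms unfolding smooth_almost_complex_def by fastforce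
  have Hc: "continuous_on bidisc H" using Hsmooth unfolding smooth_map_bidisc_def by blast
  show "open (dom U)" unfolding dom_def by (rule continuous_open_preimage[OF Hc open_bidisc 1(1)])
  show "smooth_on (dom U) (\<phi> \<circ> H)" using Hsmooth assms unfolding smooth_map_bidisc_def dom_def by fast
qed

lemma transition:
  assumes c: "(U, \<phi>) \<in> A" "(V, \<psi>) \<in> A" and x: "x \<in> dom U" "x \<in> dom V"
  shows "\<exists>T. frechet_derivative (\<psi> \<circ> H) (at x) = T \<circ> frechet_derivative (\<phi> \<circ> H) (at x) \<and>
    T \<circ> blinfun_apply (Jc (U, \<phi>) (H x)) = blinfun_apply (Jc (V, \<psi>) (H x)) \<circ> T"
proof -
  note f = chart_facts[OF c(1)] and g = chart_facts[OF c(2)]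
  define T where "T = frechet_derivative (\<psi> \<circ> inv_into U \<phi>) (at (\<phi> (H x)))"
  have p: "H x \<in> U \<inter> V" using x by (auto simp: dom_def)
  have "smooth_on (\<phi> ` (U \<inter> V)) (\<psi> \<circ> inv_into U \<phi>)" using atlas c unfolding smooth_atlas_def by fast
  then have dT: "(\<psi> \<circ> inv_into U \<phi> has_derivative T) (at (\<phi> (H x)))"
    unfolding T_def by (rule smooth_on_has_derivative) (use p in blast)
  have dH: "(\<phi> \<circ> H has_derivative frechet_derivative (\<phi> \<circ> H) (at x)) (at x)" by (rule smooth_on_has_derivative[OF f(9) x(1)])
  have "((\<lambda>y. (\<psi> \<circ> inv_into U \<phi>) ((\<phi> \<circ> H) y)) has_derivative (\<lambda>v. T (frechet_derivative (\<phi> \<circ> H) (at x) v))) (at x)"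
    by (rule has_derivative_compose[OF dH]) (use dT in \<open>simp only: o_def\<close>)
  then have "(\<psi> \<circ> H has_derivative (\<lambda>v. T (frechet_derivative (\<phi> \<circ> H) (at x) v))) (at x)"
    by (rule has_derivative_transform_within_open[OF _ open_Int[OF f(8) g(8)]]) (use x f(5) in \<open>auto simp: dom_def\<close>)
  from frechet_derivative_at[OF this] have 1: "frechet_derivative (\<psi> \<circ> H) (at x) = T \<circ> frechet_derivative (\<phi> \<circ> H) (at x)"
    by (simp add: o_def)
  have "T \<circ> blinfun_apply (Jc (U, \<phi>) (H x)) = blinfun_apply (Jc (V, \<psi>) (H x)) \<circ> T"
    unfolding T_def using acs c p unfolding smooth_almost_complex_def by fast
  with 1 show ?thesis by blast
qed

lemma bij_chart:
  assumes c: "(U, \<phi>) \<in> A" "(V, \<psi>) \<in> A" and x: "x \<in> dom U" "x \<in> dom V"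
    and b: "bij (frechet_derivative (\<phi> \<circ> H) (at x))"
  shows "bij (frechet_derivative (\<psi> \<circ> H) (at x))"
proof -
  obtain T' where T': "frechet_derivative (\<phi> \<circ> H) (at x) = T' \<circ> frechet_derivative (\<psi> \<circ> H) (at x)"
    using transition[OF c(2,1) x(2,1)] by blast
  have "inj (frechet_derivative (\<psi> \<circ> H) (at x))"
    using b unfolding T' bij_def using inj_on_imageI2 by blast
  moreover have "linear (frechet_derivative (\<psi> \<circ> H) (at x))"
    by (rule linear_frechet_derivative[OF smooth_on_differentiable[OF chart_facts(9)[OF c(2)] x(2)]])
  ultimately show ?thesis unfolding bij_def using linear_injective_imp_surjective by blast
qed

lemma noncritical_iff:
  assumes c: "(U, \<phi>) \<in> A" and x: "x \<in> dom U"
  shows "x \<notin> \<Sigma> \<longleftrightarrow> bij (frechet_derivative (\<phi> \<circ> H) (at x))"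
proof
  assume "x \<notin> \<Sigma>"
  then show "bij (frechet_derivative (\<phi> \<circ> H) (at x))"
    using c x unfolding critical_set_def dom_def by fast
next
  assume b: "bij (frechet_derivative (\<phi> \<circ> H) (at x))"
  show "x \<notin> \<Sigma>"
  proof
    assume "x \<in> \<Sigma>"
    then obtain V \<psi> where v: "(V, \<psi>) \<in> A" "H x \<in> V" "\<not> bij (frechet_derivative (\<psi> \<circ> H) (at x))"
      unfolding critical_set_def by fast
    have "x \<in> dom V" using v x by (auto simp: dom_def)
    then show False using bij_chart[OF c v(1) x _ b] v(3) by blast
  qed
qed

lemma J0_chart:
  assumes c: "(U, \<phi>) \<in> A" and x: "x \<in> dom U" and nc: "x \<notin> \<Sigma>"
  shows "frechet_derivative (\<phi> \<circ> H) (at x) (J0 x v) = Jc (U, \<phi>) (H x) (frechet_derivative (\<phi> \<circ> H) (at x) v)"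
    and "J0 x = inv (frechet_derivative (\<phi> \<circ> H) (at x)) \<circ> blinfun_apply (Jc (U, \<phi>) (H x)) \<circ> frechet_derivative (\<phi> \<circ> H) (at x)"
proof -
  obtain V \<psi> where V: "chart (H x) = (V, \<psi>)" by (cases "chart (H x)")
  have cV: "(V, \<psi>) \<in> A" "x \<in> dom V" using chart[of "H x"] V x by (auto simp: dom_def)
  define P where "P = frechet_derivative (\<psi> \<circ> H) (at x)"
  define F where "F = frechet_derivative (\<phi> \<circ> H) (at x)"
  have bP: "bij P" and bF: "bij F"
    using noncritical_iff[OF cV] noncritical_iff[OF c x] nc by (auto simp: P_def F_def)
  obtain T where T: "F = T \<circ> P" "T \<circ> blinfun_apply (Jc (V, \<psi>) (H x)) = blinfun_apply (Jc (U, \<phi>) (H x)) \<circ> T"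
    using transition[OF cV(1) c cV(2) x] unfolding F_def P_def by blast
  have J: "J0 x = inv P \<circ> blinfun_apply (Jc (V, \<psi>) (H x)) \<circ> P" unfolding J0_def V P_def by simp
  have PJ: "P (J0 x v) = Jc (V, \<psi>) (H x) (P v)" for v
    unfolding J o_def using bij_is_surj[OF bP] by (simp add: surj_f_inv_f)
  have 1: "F (J0 x v) = Jc (U, \<phi>) (H x) (F v)" for v
    using fun_cong[OF T(2), of "P v"] by (simp add: T(1) PJ)
  then show "frechet_derivative (\<phi> \<circ> H) (at x) (J0 x v) = Jc (U, \<phi>) (H x) (frechet_derivative (\<phi> \<circ> H) (at x) v)"
    unfolding F_def .
  have "J0 x v = inv F (Jc (U, \<phi>) (H x) (F v))" for v
    using 1[of v, symmetric] bij_is_inj[OF bF] by (simp add: inv_f_f)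
  then show "J0 x = inv (frechet_derivative (\<phi> \<circ> H) (at x)) \<circ> blinfun_apply (Jc (U, \<phi>) (H x)) \<circ> frechet_derivative (\<phi> \<circ> H) (at x)"
    unfolding F_def by (simp add: fun_eq_iff)
qed

lemma slice_derivative:
  assumes c: "(U, \<phi>) \<in> A" and x: "(z, w) \<in> dom U"
  shows "frechet_derivative (\<lambda>t. \<phi> (H (z, t))) (at w) h = dd (\<phi> \<circ> H) (0, h) (z, w)"
proof -
  have l: "((\<lambda>t. (z, t)) has_derivative (\<lambda>h. (0, h))) (at w)" by (auto intro!: derivative_eq_intros)
  have "((\<lambda>t. (\<phi> \<circ> H) (z, t)) has_derivative (\<lambda>h. dd (\<phi> \<circ> H) (0, h) (z, w))) (at w)"
    by (rule has_derivative_compose[OF l smooth_on_has_derivative[OF chart_facts(9)[OF c] x]])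
  from fun_cong[OF frechet_derivative_at[OF this, symmetric], of h] show ?thesis by (simp add: o_def)
qed

lemma chart_curves:
  assumes c: "(U, \<phi>) \<in> A"
  shows "curves (dom U) (\<phi> \<circ> H) (\<phi> ` U) (Jc (U, \<phi>) \<circ> inv_into U \<phi>)"
proof
  note f = chart_facts[OF c]
  show "open (dom U)" "smooth_on (dom U) (\<phi> \<circ> H)" "open (\<phi> ` U)" "smooth_on (\<phi> ` U) (Jc (U, \<phi>) \<circ> inv_into U \<phi>)"
    by (rule f)+
  show "(\<phi> \<circ> H) ` dom U \<subseteq> \<phi> ` U" by (auto simp: dom_def)
  show "(Jc (U, \<phi>) \<circ> inv_into U \<phi>) y o\<^sub>L (Jc (U, \<phi>) \<circ> inv_into U \<phi>) y = - id_blinfun" if "y \<in> \<phi> ` U" for y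
    using f(7)[OF inv_into_into[OF that]] by simp
  fix x assume x: "x \<in> dom U"
  obtain z w where zw: "x = (z, w)" by (cases x)
  have zwb: "z \<in> ball 0 1" "w \<in> ball 0 1" "H (z, w) \<in> U" using x by (auto simp: zw dom_def bidisc_def)
  have d: "frechet_derivative (\<lambda>t. \<phi> (H (z, t))) (at w) h = dd (\<phi> \<circ> H) (0, h) (z, w)" for h
    by (rule slice_derivative[OF c]) (use x zw in simp)
  have hi: "frechet_derivative (\<lambda>t. \<phi> (H (z, t))) (at w) \<circ> (\<lambda>t. \<i> * t) =
           blinfun_apply (Jc (U, \<phi>) (H (z, w))) \<circ> frechet_derivative (\<lambda>t. \<phi> (H (z, t))) (at w)"
    "inj (frechet_derivative (\<lambda>t. \<phi> (H (z, t))) (at w))"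
    using bspec[OF bspec[OF bspec[OF holo_imm zwb(1)] zwb(2)] c] zwb(3) by simp_all
  show "dd (\<phi> \<circ> H) (0, \<i> * t) x = (Jc (U, \<phi>) \<circ> inv_into U \<phi>) ((\<phi> \<circ> H) x) (dd (\<phi> \<circ> H) (0, t) x)" for t
    using fun_cong[OF hi(1), of t] zwb(3) f(5) by (simp add: d zw)
  show "dd (\<phi> \<circ> H) (0, 1) x \<noteq> 0"
  proof
    assume "dd (\<phi> \<circ> H) (0, 1) x = 0"
    moreover have "dd (\<phi> \<circ> H) (0, 0) x = 0"
      using linear_0[OF linear_frechet_derivative[OF smooth_on_differentiable[OF f(9) x]]] by (simp add: zero_prod_def)
    ultimately have "frechet_derivative (\<lambda>t. \<phi> (H (z, t))) (at w) 1 = frechet_derivative (\<lambda>t. \<phi> (H (z, t))) (at w) 0"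
      by (simp add: d zw)
    from injD[OF hi(2) this] show False by simp
  qed
qed

text \<open>\<open>orient\<close> is tested on the frame \<open>(ee x, v0)\<close> itself: the
  differential is this frame map composed with \<open>M\<close>, so the product of determinants is
  \<open>ldet M\<close> times a square, and \<open>ldet_beltrami\<close> turns its sign into
  \<open>norm (b x) < norm (a x)\<close>.\<close>

lemma J0_positive:
  assumes x: "x \<in> bidisc" and nc: "x \<notin> \<Sigma>"
  shows "Im (fst (J0 x (1, 0))) > 0"
proof -
  obtain U \<phi> where U: "chart (H x) = (U, \<phi>)" by (cases "chart (H x)")
  have c: "(U, \<phi>) \<in> A" "x \<in> dom U" using chart[of "H x"] U x by (auto simp: dom_def)
  interpret curves "dom U" "\<phi> \<circ> H" "\<phi> ` U" "Jc (U, \<phi>) \<circ> inv_into U \<phi>" by (rule chart_curves[OF c(1)])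
  obtain N' v0 s s' a b B B' where N': "open N'" "x \<in> N'" "N' \<subseteq> dom U"
    and sm: "smooth_on N' s" "smooth_on N' s'" "smooth_on N' a" "smooth_on N' b" "smooth_on N' B" "smooth_on N' B'"
    and bijF': "\<forall>x\<in>N'. bij (blinfun_apply (framemap (JJ x) (ee x) v0))"
    and rel': "\<forall>x\<in>N'. \<forall>\<zeta> \<omega>. dd (\<phi> \<circ> H) (\<zeta>, \<omega>) x =
        framemap (JJ x) (ee x) v0 (s x * \<zeta> + s' x * cnj \<zeta> + \<omega>, a x * \<zeta> + b x * cnj \<zeta>)"
    and eqs: "\<forall>x\<in>N'. (dd a (0, 1) x + \<i> * dd a (0, \<i>) x) / 2 = B x * a x + B' x * cnj (b x)"
      "\<forall>x\<in>N'. (dd b (0, 1) x + \<i> * dd b (0, \<i>) x) / 2 = B x * b x + B' x * cnj (a x)"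
    and const: "(\<exists>J0. \<forall>y\<in>\<phi> ` U. (Jc (U, \<phi>) \<circ> inv_into U \<phi>) y = J0) \<longrightarrow> (\<forall>x\<in>N'. B x = 0 \<and> B' x = 0)"
    using local_coords[OF c(2)] by (elim exE conjE) (rule that; assumption)
  note bijF = bspec[OF bijF' N'(2)] and rel = bspec[OF rel' N'(2), rule_format]
  define F where "F = framemap (JJ x) (ee x) v0"
  define M where "M = (\<lambda>(\<zeta>, \<omega>). (s x * \<zeta> + s' x * cnj \<zeta> + \<omega>, a x * \<zeta> + b x * cnj \<zeta>))"
  have dG: "frechet_derivative (\<phi> \<circ> H) (at x) = (\<lambda>u. F (M u))"
    by (rule ext) (use rel in \<open>auto simp: F_def M_def split: prod.splits\<close>)
  have JJ: "JJ x = Jc (U, \<phi>) (H x)" using c(2) chart_facts(5)[OF c(1)] by (simp add: JJ_def dom_def)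
  have lF: "linear (blinfun_apply F)" by (rule bounded_linear.linear[OF blinfun.bounded_linear_right])
  have Fc: "blinfun_apply F = cframe (Jc (U, \<phi>) (H x)) (ee x) v0" unfolding F_def framemap_cframe JJ ..
  have F0: "ldet (blinfun_apply F) \<noteq> 0" by (rule ldet_nonzero[OF lF]) (use bijF in \<open>simp add: F_def\<close>)
  have "ldet (frechet_derivative (\<phi> \<circ> H) (at x)) * ldet (cframe (Jc (U, \<phi>) (H x)) (ee x) v0) > 0"
  proof -
    have b: "x \<in> bidisc - \<Sigma>" "H x \<in> U" using x nc c(2) by (auto simp: dom_def)
    show ?thesis using bspec[OF bspec[OF orient b(1)] c(1), unfolded prod.case] b(2) F0 unfolding Fc by blast
  qed
  then have "ldet (blinfun_apply F) * ldet M * ldet (blinfun_apply F) > 0"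
    unfolding dG ldet_compose[OF lF, of M] Fc[symmetric] .
  then have "ldet M * (ldet (blinfun_apply F) * ldet (blinfun_apply F)) > 0" by (simp add: mult_ac)
  then have "ldet M > 0" using F0 by (simp add: zero_less_mult_iff not_square_less_zero)
  then have "(norm (b x))\<^sup>2 < (norm (a x))\<^sup>2" unfolding M_def ldet_beltrami by simp
  then have lt: "norm (b x) < norm (a x)" by (rule power2_less_imp_less) simp
  obtain j k where jk: "J0 x (1, 0) = (j, k)" by (cases "J0 x (1, 0)")
  have "F (M (j, k)) = Jc (U, \<phi>) (H x) (F (M (1, 0)))"
    using J0_chart(1)[OF c nc, of "(1, 0)"] unfolding dG jk .
  also have "\<dots> = F (\<i> * fst (M (1, 0)), \<i> * snd (M (1, 0)))"
    unfolding F_def JJ using framemap_i[OF chart_facts(7)[OF c(1)], of "H x" "ee x" v0 "fst (M (1, 0))" "snd (M (1, 0))"] c(2) by (simp add: dom_def)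
  finally have "M (j, k) = (\<i> * fst (M (1, 0)), \<i> * snd (M (1, 0)))"
    using bijF unfolding F_def bij_def inj_def by blast
  then have e: "a x * j + b x * cnj j = \<i> * (a x + b x)" by (simp add: M_def)
  show ?thesis using beltrami_orientation[OF _ e] lt by (simp add: jk)
qed

lemma chart_extension:
  assumes c: "(U, \<phi>) \<in> A"
  shows "extension (dom U) (\<phi> \<circ> H) (\<phi> ` U) (Jc (U, \<phi>) \<circ> inv_into U \<phi>) J0"
proof (rule extension.intro[OF chart_curves[OF c]], unfold_locales)
  fix x assume x: "x \<in> dom U" "bij (frechet_derivative (\<phi> \<circ> H) (at x))"
  have nc: "x \<notin> \<Sigma>" using noncritical_iff[OF c x(1)] x(2) by blast
  show "Im (fst (J0 x (1, 0))) > 0" by (rule J0_positive[OF _ nc]) (use x in \<open>simp add: dom_def\<close>)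
  show "dd (\<phi> \<circ> H) (J0 x v) x = (Jc (U, \<phi>) \<circ> inv_into U \<phi>) ((\<phi> \<circ> H) x) (dd (\<phi> \<circ> H) v x)" for v
    using J0_chart(1)[OF c x(1) nc] x(1) chart_facts(5)[OF c] by (simp add: dom_def)
qed

text \<open>Both alternatives of \<open>slice_dichotomy\<close> are open conditions on
  \<open>w\<close> and exclude each other. The disc is connected, and \<open>not_contained\<close>
  forbids that the critical alternative holds on all of it.\<close>

lemma punctured:
  assumes z: "z \<in> ball 0 1" and w: "w \<in> ball 0 1"
  shows "\<exists>r>0. \<forall>u\<in>ball w r - {w}. (z, u) \<in> bidisc \<and> (z, u) \<notin> \<Sigma>"
proof -
  have dich: "(\<exists>r>0. \<forall>u\<in>ball w r. (z, u) \<in> \<Sigma>) \<or> (\<exists>r>0. \<forall>u\<in>ball w r - {w}. (z, u) \<in> bidisc \<and> (z, u) \<notin> \<Sigma>)"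
    if w: "w \<in> ball 0 1" for w
  proof -
    obtain U \<phi> where U: "chart (H (z, w)) = (U, \<phi>)" by (cases "chart (H (z, w))")
    have c: "(U, \<phi>) \<in> A" "(z, w) \<in> dom U" using chart[of "H (z, w)"] U z w by (auto simp: dom_def bidisc_def)
    interpret extension "dom U" "\<phi> \<circ> H" "\<phi> ` U" "Jc (U, \<phi>) \<circ> inv_into U \<phi>" J0 by (rule chart_extension[OF c(1)])
    have reg: "regular x \<longleftrightarrow> x \<notin> \<Sigma>" if "x \<in> dom U" for x
      using noncritical_iff[OF c(1) that] by (simp add: regular_def)
    have "dom U \<subseteq> bidisc" by (auto simp: dom_def)
    then show ?thesis using slice_dichotomy[OF c(2)] reg by blast
  qed
  define E where "E = {w. \<exists>r>0. \<forall>u\<in>ball w r. (z, u) \<in> \<Sigma>}"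
  define P where "P = {w. \<exists>r>0. \<forall>u\<in>ball w r - {w}. (z, u) \<in> bidisc \<and> (z, u) \<notin> \<Sigma>}"
  have oE: "open E" unfolding open_contains_ball
  proof
    fix w assume "w \<in> E"
    then obtain r where r: "r > 0" "\<forall>u\<in>ball w r. (z, u) \<in> \<Sigma>" by (auto simp: E_def)
    have "w' \<in> E" if w': "w' \<in> ball w r" for w'
    proof -
      obtain e where "e > 0" "ball w' e \<subseteq> ball w r" using w' by (meson open_ball openE)
      then show ?thesis using r unfolding E_def by blast
    qed
    then show "\<exists>e>0. ball w e \<subseteq> E" using r by blast
  qed
  have oP: "open P" unfolding open_contains_ball
  proof
    fix w assume "w \<in> P"
    then obtain r where r: "r > 0" "\<forall>u\<in>ball w r - {w}. (z, u) \<in> bidisc \<and> (z, u) \<notin> \<Sigma>" by (auto simp: P_def)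
    have "w' \<in> P" if w': "w' \<in> ball w r" for w'
    proof (cases "w' = w")
      case True
      then show ?thesis using \<open>w \<in> P\<close> by simp
    next
      case False
      then have "w' \<in> ball w r - {w}" using w' by simp
      moreover have "open (ball w r - {w})" by (intro open_Diff) auto
      ultimately obtain e where "e > 0" "ball w' e \<subseteq> ball w r - {w}" by (meson openE)
      then show ?thesis using r unfolding P_def by blast
    qed
    then show "\<exists>e>0. ball w e \<subseteq> P" using r by blast
  qed
  have disj: "E \<inter> P = {}"
  proof (rule ccontr)
    assume "E \<inter> P \<noteq> {}"
    then obtain w where "w \<in> E" "w \<in> P" by blast
    then obtain r e where r: "r > 0" "\<forall>u\<in>ball w r. (z, u) \<in> \<Sigma>" and e: "e > 0" "\<forall>u\<in>ball w e - {w}. (z, u) \<notin> \<Sigma>"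
      by (auto simp: E_def P_def)
    define u where "u = w + of_real (min r e / 2)"
    have "dist w u = min r e / 2" using r e by (simp add: u_def dist_norm)
    then have "u \<in> ball w r" "u \<in> ball w e - {w}" using r(1) e(1) by auto
    then show False using r e by blast
  qed
  have cov: "ball 0 1 \<subseteq> E \<union> P" using dich unfolding E_def P_def by blast
  have "E \<inter> ball 0 1 = {} \<or> P \<inter> ball 0 1 = {}"
    by (rule connectedD[OF convex_connected[OF convex_ball] oE oP _ cov]) (use disj in blast)
  moreover have "P \<inter> ball 0 1 \<noteq> {}"
  proof
    assume "P \<inter> ball 0 1 = {}"
    then have "ball 0 1 \<subseteq> E" using cov by blast
    then have "(z, u) \<in> \<Sigma>" if "u \<in> ball 0 1" for u
    proof -
      from that \<open>ball 0 1 \<subseteq> E\<close> obtain r where "r > 0" "\<forall>u\<in>ball u r. (z, u) \<in> \<Sigma>" unfolding E_def by blast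
      then show ?thesis by simp
    qed
    then have "{z} \<times> ball 0 1 \<subseteq> \<Sigma>" by blast
    then show False using not_contained z by blast
  qed
  ultimately have "w \<in> P" using cov w by blast
  then show ?thesis by (simp add: P_def)
qed

end

subsection \<open>Gluing the local extensions\<close>

context family
begin

definition local_ext :: "complex \<Rightarrow> complex \<Rightarrow> real \<Rightarrow> (cc \<Rightarrow> cc \<Rightarrow>\<^sub>L cc) \<Rightarrow> real \<Rightarrow> real \<Rightarrow> bool" where
  "local_ext z0 w0 \<rho> J \<alpha> C \<longleftrightarrow> 0 < \<rho> \<and> ball z0 \<rho> \<times> ball w0 \<rho> \<subseteq> bidisc \<and> 0 < \<alpha> \<and> \<alpha> < 1 \<and> 0 \<le> C \<and>
    (\<forall>x\<in>ball z0 \<rho> \<times> ball w0 \<rho>. J x o\<^sub>L J x = - id_blinfun) \<and>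
    (\<forall>x\<in>ball z0 \<rho> \<times> ball w0 \<rho>. x \<notin> \<Sigma> \<longrightarrow> blinfun_apply (J x) = J0 x) \<and>
    (\<forall>z\<in>ball z0 \<rho>. \<forall>z'\<in>ball z0 \<rho>. \<forall>w\<in>ball w0 \<rho>. norm (J (z, w) - J (z', w)) \<le> C * norm (z - z') powr \<alpha>) \<and>
    (\<forall>z\<in>ball z0 \<rho>. \<forall>w\<in>ball w0 \<rho>. \<forall>w'\<in>ball w0 \<rho>. norm (J (z, w) - J (z, w')) \<le> C * norm (w - w'))"

lemma local_extD:
  assumes "local_ext z0 w0 \<rho> J \<alpha> C"
  shows "0 < \<rho>" "ball z0 \<rho> \<times> ball w0 \<rho> \<subseteq> bidisc" "0 < \<alpha>" "\<alpha> < 1" "0 \<le> C"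
    "\<And>x. x \<in> ball z0 \<rho> \<times> ball w0 \<rho> \<Longrightarrow> J x o\<^sub>L J x = - id_blinfun"
    "\<And>x. x \<in> ball z0 \<rho> \<times> ball w0 \<rho> \<Longrightarrow> x \<notin> \<Sigma> \<Longrightarrow> blinfun_apply (J x) = J0 x"
    "\<And>z z' w. z \<in> ball z0 \<rho> \<Longrightarrow> z' \<in> ball z0 \<rho> \<Longrightarrow> w \<in> ball w0 \<rho> \<Longrightarrow>
      norm (J (z, w) - J (z', w)) \<le> C * norm (z - z') powr \<alpha>"
    "\<And>z w w'. z \<in> ball z0 \<rho> \<Longrightarrow> w \<in> ball w0 \<rho> \<Longrightarrow> w' \<in> ball w0 \<rho> \<Longrightarrow>
      norm (J (z, w) - J (z, w')) \<le> C * norm (w - w')"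
proof -
  note h = assms[unfolded local_ext_def]
  show "0 < \<rho>" "ball z0 \<rho> \<times> ball w0 \<rho> \<subseteq> bidisc" "0 < \<alpha>" "\<alpha> < 1" "0 \<le> C" using h by - (elim conjE, assumption)+
  have 1: "\<forall>x\<in>ball z0 \<rho> \<times> ball w0 \<rho>. J x o\<^sub>L J x = - id_blinfun"
    and 2: "\<forall>x\<in>ball z0 \<rho> \<times> ball w0 \<rho>. x \<notin> \<Sigma> \<longrightarrow> blinfun_apply (J x) = J0 x"
    and 3: "\<forall>z\<in>ball z0 \<rho>. \<forall>z'\<in>ball z0 \<rho>. \<forall>w\<in>ball w0 \<rho>. norm (J (z, w) - J (z', w)) \<le> C * norm (z - z') powr \<alpha>"
    and 4: "\<forall>z\<in>ball z0 \<rho>. \<forall>w\<in>ball w0 \<rho>. \<forall>w'\<in>ball w0 \<rho>. norm (J (z, w) - J (z, w')) \<le> C * norm (w - w')"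
    using h by - (elim conjE, assumption)+
  show "J x o\<^sub>L J x = - id_blinfun" if "x \<in> ball z0 \<rho> \<times> ball w0 \<rho>" for x by (rule bspec[OF 1 that])
  show "blinfun_apply (J x) = J0 x" if "x \<in> ball z0 \<rho> \<times> ball w0 \<rho>" "x \<notin> \<Sigma>" for x
    by (rule mp[OF bspec[OF 2 that(1)] that(2)])
  show "norm (J (z, w) - J (z', w)) \<le> C * norm (z - z') powr \<alpha>"
    if "z \<in> ball z0 \<rho>" "z' \<in> ball z0 \<rho>" "w \<in> ball w0 \<rho>" for z z' w
    by (rule bspec[OF bspec[OF bspec[OF 3 that(1)] that(2)] that(3)])
  show "norm (J (z, w) - J (z, w')) \<le> C * norm (w - w')"
    if "z \<in> ball z0 \<rho>" "w \<in> ball w0 \<rho>" "w' \<in> ball w0 \<rho>" for z w w'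
    by (rule bspec[OF bspec[OF bspec[OF 4 that(1)] that(2)] that(3)])
qed

lemma local_ext_cong:
  assumes l: "local_ext z0 w0 \<rho> J \<alpha> C" and e: "\<And>x. x \<in> ball z0 \<rho> \<times> ball w0 \<rho> \<Longrightarrow> J' x = J x"
  shows "local_ext z0 w0 \<rho> J' \<alpha> C"
  unfolding local_ext_def
proof (intro conjI ballI impI)
  note d = local_extD[OF l]
  show "0 < \<rho>" "ball z0 \<rho> \<times> ball w0 \<rho> \<subseteq> bidisc" "0 < \<alpha>" "\<alpha> < 1" "0 \<le> C" by (rule d)+
  show "J' x o\<^sub>L J' x = - id_blinfun" if x: "x \<in> ball z0 \<rho> \<times> ball w0 \<rho>" for x
    unfolding e[OF x] by (rule d(6)[OF x])
  show "blinfun_apply (J' x) = J0 x" if x: "x \<in> ball z0 \<rho> \<times> ball w0 \<rho>" "x \<notin> \<Sigma>" for x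
    unfolding e[OF x(1)] by (rule d(7)[OF x])
  show "norm (J' (z, w) - J' (z', w)) \<le> C * norm (z - z') powr \<alpha>"
    if x: "z \<in> ball z0 \<rho>" "z' \<in> ball z0 \<rho>" "w \<in> ball w0 \<rho>" for z z' w
    unfolding e[OF SigmaI[OF x(1,3)]] e[OF SigmaI[OF x(2,3)]] by (rule d(8)[OF x])
  show "norm (J' (z, w) - J' (z, w')) \<le> C * norm (w - w')"
    if x: "z \<in> ball z0 \<rho>" "w \<in> ball w0 \<rho>" "w' \<in> ball w0 \<rho>" for z w w'
    unfolding e[OF SigmaI[OF x(1,2)]] e[OF SigmaI[OF x(1,3)]] by (rule d(9)[OF x])
qed

text \<open>Critical points are isolated in the slice, so arbitrarily close to \<open>w\<close>
  there are points where both extensions equal \<open>J0\<close>; the Lipschitz estimates in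
  \<open>w\<close> do the rest.\<close>

lemma local_ext_unique:
  assumes l: "local_ext z0 w0 \<rho> J \<alpha> C" "local_ext z1 w1 \<rho>' J' \<alpha>' C'"
    and x: "(z, w) \<in> ball z0 \<rho> \<times> ball w0 \<rho>" "(z, w) \<in> ball z1 \<rho>' \<times> ball w1 \<rho>'"
  shows "J (z, w) = J' (z, w)"
proof (rule ccontr)
  note d = local_extD[OF l(1)] and d' = local_extD[OF l(2)]
  assume "J (z, w) \<noteq> J' (z, w)"
  define n where "n = norm (J (z, w) - J' (z, w))"
  have n: "n > 0" using \<open>J (z, w) \<noteq> J' (z, w)\<close> by (simp add: n_def)
  have "(z, w) \<in> bidisc" using d(2) x(1) by blast
  then have zw: "z \<in> ball 0 1" "w \<in> ball 0 1" by (auto simp: bidisc_def)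
  obtain r where r: "r > 0" "\<And>u. u \<in> ball w r - {w} \<Longrightarrow> (z, u) \<notin> \<Sigma>" using punctured[OF zw] by blast
  have "w \<in> ball w0 \<rho> \<inter> ball w1 \<rho>'" using x by simp
  then obtain \<delta> where \<delta>: "\<delta> > 0" "ball w \<delta> \<subseteq> ball w0 \<rho> \<inter> ball w1 \<rho>'"
    using openE[OF open_Int[OF open_ball open_ball]] by metis
  have C: "C + C' + 1 > 0" using d(5) d'(5) by simp
  then have "0 < min r (min \<delta> (n / (C + C' + 1)))" using r(1) \<delta>(1) n by simp
  from dense[OF this] obtain t where "t > 0" "t < min r (min \<delta> (n / (C + C' + 1)))" by blast
  then have t: "t > 0" "t < r" "t < \<delta>" "t < n / (C + C' + 1)" by simp_all
  define u where "u = w + of_real t"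
  have nu: "norm (w - u) = t" using t(1) by (simp add: u_def)
  have u: "u \<in> ball w r - {w}" "u \<in> ball w \<delta>" using t nu by (auto simp: u_def dist_norm)
  have ub: "z \<in> ball z0 \<rho>" "u \<in> ball w0 \<rho>" "z \<in> ball z1 \<rho>'" "u \<in> ball w1 \<rho>'" "w \<in> ball w0 \<rho>" "w \<in> ball w1 \<rho>'"
    using u(2) \<delta>(2) x by auto
  have "blinfun_apply (J (z, u)) = blinfun_apply (J' (z, u))"
    using d(7)[OF SigmaI[OF ub(1,2)] r(2)[OF u(1)]] d'(7)[OF SigmaI[OF ub(3,4)] r(2)[OF u(1)]] by simp
  then have e: "J (z, u) = J' (z, u)" by (simp add: blinfun_apply_inject)
  have "n = norm ((J (z, w) - J (z, u)) - (J' (z, w) - J' (z, u)))" unfolding n_def e by simp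
  also have "\<dots> \<le> norm (J (z, w) - J (z, u)) + norm (J' (z, w) - J' (z, u))" by (rule norm_triangle_ineq4)
  also have "\<dots> \<le> C * t + C' * t"
    using d(9)[OF ub(1,5,2)] d'(9)[OF ub(3,6,4)] nu by (intro add_mono) simp_all
  also have "\<dots> < (C + C' + 1) * t" using t(1) by (simp add: algebra_simps)
  also have "\<dots> < n" using t(4) C by (simp add: pos_less_divide_eq mult.commute)
  finally have "n < n" .
  then show False by simp
qed

text \<open>Stated for any instance of \<open>extension\<close> rather than for an atlas chart, so
  that it serves holomorphic coordinates too, where the structure is constant.\<close>

lemma extension_at:
  assumes ext: "extension N G Y Jl J0" and sub: "N \<subseteq> bidisc" and x: "(z0, w0) \<in> N"
    and reg: "\<And>x. x \<in> N \<Longrightarrow> bij (frechet_derivative G (at x)) \<longleftrightarrow> x \<notin> \<Sigma>"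
  shows "\<exists>\<rho> J \<alpha> C. local_ext z0 w0 \<rho> J \<alpha> C \<and>
    ((\<exists>j. \<forall>y\<in>Y. Jl y = j) \<longrightarrow> smooth_on (ball z0 \<rho> \<times> ball w0 \<rho>) J)"
proof -
  interpret extension N G Y Jl J0 by (rule ext)
  have r: "regular x \<longleftrightarrow> x \<notin> \<Sigma>" if "x \<in> N" for x using reg[OF that] by (simp add: regular_def)
  have iso: "\<exists>r>0. \<forall>u\<in>ball w r - {w}. (z, u) \<in> N \<and> regular (z, u)" if zw: "(z, w) \<in> N" for z w
  proof -
    have "z \<in> ball 0 1" "w \<in> ball 0 1" using zw sub by (auto simp: bidisc_def)
    then obtain r1 where r1: "r1 > 0" "\<And>u. u \<in> ball w r1 - {w} \<Longrightarrow> (z, u) \<notin> \<Sigma>" using punctured by blast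
    obtain U V where UV: "open U" "open V" "(z, w) \<in> U \<times> V" "U \<times> V \<subseteq> N" using open_prod_elim[OF N zw] by blast
    obtain r2 where r2: "r2 > 0" "ball w r2 \<subseteq> V" using UV(2,3) openE by blast
    have "(z, u) \<in> N \<and> regular (z, u)" if u: "u \<in> ball w (min r1 r2) - {w}" for u
    proof -
      have "(z, u) \<in> N" using u r2(2) UV(3,4) by auto
      moreover have "(z, u) \<notin> \<Sigma>" by (rule r1(2)) (use u in auto)
      ultimately show ?thesis using r by blast
    qed
    then show ?thesis using r1(1) r2(1) by (intro exI[of _ "min r1 r2"]) simp
  qed
  obtain \<rho> J \<alpha> C where h: "0 < \<rho>" "ball z0 \<rho> \<times> ball w0 \<rho> \<subseteq> N" "0 < \<alpha>" "\<alpha> < 1" "0 \<le> C"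
    "\<forall>x\<in>ball z0 \<rho> \<times> ball w0 \<rho>. J x o\<^sub>L J x = - id_blinfun"
    "\<forall>x\<in>ball z0 \<rho> \<times> ball w0 \<rho>. regular x \<longrightarrow> blinfun_apply (J x) = J0 x"
    "\<forall>z\<in>ball z0 \<rho>. \<forall>z'\<in>ball z0 \<rho>. \<forall>w\<in>ball w0 \<rho>. norm (J (z, w) - J (z', w)) \<le> C * norm (z - z') powr \<alpha>"
    "\<forall>z\<in>ball z0 \<rho>. \<forall>w\<in>ball w0 \<rho>. \<forall>w'\<in>ball w0 \<rho>. norm (J (z, w) - J (z, w')) \<le> C * norm (w - w')"
    "(\<exists>J0. \<forall>y\<in>Y. Jl y = J0) \<longrightarrow> smooth_on (ball z0 \<rho> \<times> ball w0 \<rho>) J"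
    by (rule exE[OF local_extension[OF x]], erule iso, elim exE conjE) (rule that; assumption)
  have eq: "blinfun_apply (J y) = J0 y" if y: "y \<in> ball z0 \<rho> \<times> ball w0 \<rho>" "y \<notin> \<Sigma>" for y
    by (rule mp[OF bspec[OF h(7) y(1)]]) (use r y h(2) in blast)
  have "ball z0 \<rho> \<times> ball w0 \<rho> \<subseteq> bidisc" using h(2) sub by (rule subset_trans)
  then have "local_ext z0 w0 \<rho> J \<alpha> C"
    unfolding local_ext_def by (intro conjI h ballI[OF impI[OF eq]])
  then show ?thesis using h(10) by (intro exI conjI)
qed

lemma local_ext_exists:
  assumes x: "(z0, w0) \<in> bidisc"
  shows "\<exists>\<rho> J \<alpha> C. local_ext z0 w0 \<rho> J \<alpha> C"
proof -
  obtain U \<phi> where U: "chart (H (z0, w0)) = (U, \<phi>)" by (cases "chart (H (z0, w0))")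
  have c: "(U, \<phi>) \<in> A" "(z0, w0) \<in> dom U" using chart[of "H (z0, w0)"] U x by (auto simp: dom_def)
  have "dom U \<subseteq> bidisc" by (simp add: dom_def)
  from extension_at[OF chart_extension[OF c(1)] this c(2)] noncritical_iff[OF c(1)]
  show ?thesis by blast
qed

lemma global_extension: "\<exists>J. \<forall>z w. (z, w) \<in> bidisc \<longrightarrow> (\<exists>\<rho> \<alpha> C. local_ext z w \<rho> J \<alpha> C)"
proof -
  have "\<forall>x. \<exists>q. x \<in> bidisc \<longrightarrow>
    local_ext (fst x) (snd x) (fst q) (fst (snd q)) (fst (snd (snd q))) (snd (snd (snd q)))"
  proof (intro allI, cases)
    fix x assume "x \<in> bidisc"
    then obtain \<rho> J \<alpha> C where "local_ext (fst x) (snd x) \<rho> J \<alpha> C" using local_ext_exists[of "fst x" "snd x"] by auto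
    then show "\<exists>q. x \<in> bidisc \<longrightarrow>
        local_ext (fst x) (snd x) (fst q) (fst (snd q)) (fst (snd (snd q))) (snd (snd (snd q)))"
      by (intro exI[of _ "(\<rho>, J, \<alpha>, C)"]) simp
  qed blast
  from choice[OF this] obtain q where q: "\<And>x. x \<in> bidisc \<Longrightarrow>
      local_ext (fst x) (snd x) (fst (q x)) (fst (snd (q x))) (fst (snd (snd (q x)))) (snd (snd (snd (q x))))"
    by blast
  \<comment> \<open>At each point the value of the local extension centred there; by
    \<open>local_ext_unique\<close> it agrees with every other local extension around.\<close>
  define J where "J = (\<lambda>x. fst (snd (q x)) x)"
  have "local_ext z w (fst (q (z, w))) J (fst (snd (snd (q (z, w))))) (snd (snd (snd (q (z, w)))))" if zw: "(z, w) \<in> bidisc" for z w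
  proof -
    have l: "local_ext z w (fst (q (z, w))) (fst (snd (q (z, w)))) (fst (snd (snd (q (z, w))))) (snd (snd (snd (q (z, w)))))"
      using q[OF zw] by simp
    show ?thesis
    proof (rule local_ext_cong[OF l])
      fix x assume x: "x \<in> ball z (fst (q (z, w))) \<times> ball w (fst (q (z, w)))"
      obtain z' w' where x': "x = (z', w')" by (cases x)
      have xb: "(z', w') \<in> bidisc" using x local_extD(2)[OF l] x' by blast
      have l': "local_ext z' w' (fst (q (z', w'))) (fst (snd (q (z', w')))) (fst (snd (snd (q (z', w'))))) (snd (snd (snd (q (z', w')))))"
        using q[OF xb] by simp
      show "J x = fst (snd (q (z, w))) x"
        unfolding J_def x' by (rule local_ext_unique[OF l' l]) (use x x' local_extD(1)[OF l'] in auto)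
    qed
  qed
  then show ?thesis by blast
qed

lemma continuous_extension:
  assumes J: "\<And>z w. (z, w) \<in> bidisc \<Longrightarrow> \<exists>\<rho> \<alpha> C. local_ext z w \<rho> J \<alpha> C"
  shows "continuous_on bidisc J"
proof (rule continuous_at_imp_continuous_on, rule ballI)
  fix x assume "x \<in> bidisc"
  obtain z w where x: "x = (z, w)" by (cases x)
  obtain \<rho> \<alpha> C where l: "local_ext z w \<rho> J \<alpha> C" using J \<open>x \<in> bidisc\<close> x by blast
  note d = local_extD[OF l]
  define g where "g = (\<lambda>y::cc. C * norm (z - fst y) powr \<alpha> + C * norm (w - snd y))"
  have "open (ball z \<rho> \<times> ball w \<rho>)" by (intro open_Times open_ball)
  then have ev: "\<forall>\<^sub>F y in at x. y \<in> ball z \<rho> \<times> ball w \<rho>"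
    by (rule eventually_at_in_open'[THEN eventually_mono]) (use d(1) x in auto)
  have le: "norm (J y - J x) \<le> g y" if yb: "y \<in> ball z \<rho> \<times> ball w \<rho>" for y
  proof -
    obtain a b where y: "y = (a, b)" "a \<in> ball z \<rho>" "b \<in> ball w \<rho>" using yb by blast
    have c: "z \<in> ball z \<rho>" "w \<in> ball w \<rho>" using d(1) by auto
    have "norm (J y - J x) = norm ((J (a, b) - J (z, b)) + (J (z, b) - J (z, w)))" by (simp add: x y)
    also have "\<dots> \<le> norm (J (a, b) - J (z, b)) + norm (J (z, b) - J (z, w))" by (rule norm_triangle_ineq)
    also have "\<dots> \<le> C * norm (a - z) powr \<alpha> + C * norm (b - w)"
      by (intro add_mono d(8)[OF y(2) c(1) y(3)] d(9)[OF c(1) y(3) c(2)])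
    finally show ?thesis by (simp add: g_def y norm_minus_commute)
  qed
  have "((\<lambda>y. norm (z - fst y)) \<longlongrightarrow> norm (z - fst x)) (at x)" "((\<lambda>y. norm (w - snd y)) \<longlongrightarrow> norm (w - snd x)) (at x)"
    by (intro tendsto_intros)+
  then have t: "((\<lambda>y. norm (z - fst y)) \<longlongrightarrow> 0) (at x)" "((\<lambda>y. norm (w - snd y)) \<longlongrightarrow> 0) (at x)"
    by (simp_all add: x)
  have "((\<lambda>y. norm (z - fst y) powr \<alpha>) \<longlongrightarrow> 0 powr \<alpha>) (at x)"
    by (rule tendsto_powr'[OF t(1) tendsto_const]) (use d(3) in simp)
  then have "(g \<longlongrightarrow> C * (0 powr \<alpha>) + C * 0) (at x)"
    unfolding g_def by (intro tendsto_add tendsto_mult_left t(2))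
  then have "(g \<longlongrightarrow> 0) (at x)" by simp
  moreover have "\<forall>\<^sub>F y in at x. norm (J y - J x) \<le> g y" using ev by eventually_elim (rule le)
  ultimately have "((\<lambda>y. J y - J x) \<longlongrightarrow> 0) (at x)" by (rule Lim_null_comparison[rotated])
  then show "isCont J x" unfolding isCont_def by (rule LIM_zero_cancel)
qed

text \<open>A Lebesgue number of a finite cover puts close points into one common bidisc, where the
  local estimates apply; for points at distance at least \<open>e\<close> the bound of
  \<open>J\<close> on \<open>K\<close> suffices and costs \<open>2 * M / e\<close>.\<close>

lemma compact_estimates:
  assumes J: "\<And>z w. (z, w) \<in> bidisc \<Longrightarrow> \<exists>\<rho> \<alpha> C. local_ext z w \<rho> J \<alpha> C"
    and K: "compact K" "K \<subseteq> bidisc"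
  shows "\<exists>\<alpha> C. 0 < \<alpha> \<and> \<alpha> < 1 \<and>
     (\<forall>z z' w. (z, w) \<in> K \<and> (z', w) \<in> K \<longrightarrow> norm (J (z, w) - J (z', w)) \<le> C * norm (z - z') powr \<alpha>) \<and>
     (\<forall>z w w'. (z, w) \<in> K \<and> (z, w') \<in> K \<longrightarrow> norm (J (z, w) - J (z, w')) \<le> C * norm (w - w'))"
proof -
  have "\<forall>x. \<exists>q. x \<in> bidisc \<longrightarrow> local_ext (fst x) (snd x) (fst q) J (fst (snd q)) (snd (snd q))"
  proof (intro allI, cases)
    fix x assume "x \<in> bidisc"
    then obtain \<rho> \<alpha> C where "local_ext (fst x) (snd x) \<rho> J \<alpha> C" using J[of "fst x" "snd x"] by auto
    then show "\<exists>q. x \<in> bidisc \<longrightarrow> local_ext (fst x) (snd x) (fst q) J (fst (snd q)) (snd (snd q))"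
      by (intro exI[of _ "(\<rho>, \<alpha>, C)"]) simp
  qed blast
  from choice[OF this] obtain q where
    q: "\<And>x. x \<in> bidisc \<Longrightarrow> local_ext (fst x) (snd x) (fst (q x)) J (fst (snd (q x))) (snd (snd (q x)))" by blast
  define B where "B = (\<lambda>x. ball (fst x) (fst (q x)) \<times> ball (snd x) (fst (q x)))"
  define a where "a = (\<lambda>x. fst (snd (q x)))"
  define c where "c = (\<lambda>x. snd (snd (q x)))"
  have oB: "open (B x)" for x unfolding B_def by (intro open_Times open_ball)
  have "K \<subseteq> (\<Union>x\<in>K. B x)"
  proof
    fix x assume "x \<in> K"
    then have "0 < fst (q x)" using local_extD(1)[OF q] K(2) by blast
    then have "x \<in> B x" by (simp add: B_def mem_Times_iff)
    then show "x \<in> (\<Union>x\<in>K. B x)" using \<open>x \<in> K\<close> by blast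
  qed
  from compactE_image[OF K(1) oB this] obtain D where D: "D \<subseteq> K" "finite D" "K \<subseteq> (\<Union>x\<in>D. B x)" by blast
  have Dl: "local_ext (fst x) (snd x) (fst (q x)) J (a x) (c x)" if "x \<in> D" for x
    using q[of x] that D(1) K(2) by (auto simp: a_def c_def)
  obtain e0 where e0: "e0 > 0" "\<And>x. x \<in> K \<Longrightarrow> \<exists>G\<in>B ` D. ball x e0 \<subseteq> G"
    using Heine_Borel_lemma[OF K(1) D(3)] oB by (metis imageE)
  \<comment> \<open>Below distance 1 a smaller exponent gives the weaker estimate, so the local
    exponents may be replaced by their minimum.\<close>
  define e where "e = min e0 1"
  have e: "e > 0" "e \<le> 1" "e \<le> e0" using e0(1) by (auto simp: e_def)
  \<comment> \<open>The element \<open>1/2\<close> keeps the minimum defined and below 1 even for an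
    empty \<open>D\<close>.\<close>
  define \<alpha> where "\<alpha> = Min (insert (1/2) (a ` D))"
  have fin: "finite (insert (1/2) (a ` D))" using D(2) by simp
  have apos: "0 < \<alpha>" unfolding \<alpha>_def using Min_gr_iff[OF fin] local_extD(3)[OF Dl] by fastforce
  have "\<alpha> \<le> 1/2" unfolding \<alpha>_def by (rule Min_le[OF fin]) simp
  then have a1: "\<alpha> < 1" by simp
  have aD: "\<alpha> \<le> a x" if "x \<in> D" for x unfolding \<alpha>_def by (rule Min_le[OF fin]) (use that in simp)
  define C0 where "C0 = sum c D"
  have cD: "c x \<le> C0" if "x \<in> D" for x
    unfolding C0_def by (rule member_le_sum[OF that _ D(2)]) (use local_extD(5)[OF Dl] in blast)
  have C0: "0 \<le> C0" unfolding C0_def by (rule sum_nonneg) (use local_extD(5)[OF Dl] in blast)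
  have "continuous_on K J" by (rule continuous_on_subset[OF continuous_extension[OF J] K(2)])
  then have "bounded (J ` K)" by (intro compact_imp_bounded compact_continuous_image K(1))
  then obtain M where M: "M > 0" "\<And>x. x \<in> K \<Longrightarrow> norm (J x) \<le> M" unfolding bounded_pos by blast
  define C where "C = C0 + 2 * M / e"
  have far: "norm (J x - J y) \<le> 2 * M" if "x \<in> K" "y \<in> K" for x y
    using norm_triangle_ineq4[of "J x" "J y"] M(2)[OF that(1)] M(2)[OF that(2)] by linarith
  have far_le: "norm (J x - J y) \<le> C * t" if "x \<in> K" "y \<in> K" "e \<le> t" for x y t
  proof -
    have "2 * M = 2 * M / e * e" using e(1) by simp
    also have "\<dots> \<le> 2 * M / e * t" using M(1) e(1) that(3) by (intro mult_left_mono) auto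
    also have "\<dots> \<le> C * t" unfolding C_def using C0 e(1) that(3) by (intro mult_right_mono) auto
    finally show ?thesis using far[OF that(1,2)] by simp
  qed
  have C0C: "C0 \<le> C" unfolding C_def using M(1) e(1) by simp
  have near: "\<exists>d\<in>D. x \<in> B d \<and> y \<in> B d" if "x \<in> K" "dist x y < e" for x y
  proof -
    obtain d where d: "d \<in> D" "ball x e0 \<subseteq> B d" using e0(2)[OF \<open>x \<in> K\<close>] by blast
    have "x \<in> ball x e0" "y \<in> ball x e0" using that(2) e(3) e0(1) by auto
    then show ?thesis using d by blast
  qed
  have H1: "norm (J (z, w) - J (z', w)) \<le> C * norm (z - z') powr \<alpha>" if k: "(z, w) \<in> K" "(z', w) \<in> K" for z z' w
  proof (cases "norm (z - z') < e")
    case True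
    have "dist (z, w) (z', w) < e" using True by (simp add: dist_Pair_Pair dist_norm)
    from near[OF k(1) this] obtain d where d: "d \<in> D" "(z, w) \<in> B d" "(z', w) \<in> B d" by blast
    have "norm (J (z, w) - J (z', w)) \<le> c d * norm (z - z') powr a d"
      by (rule local_extD(8)[OF Dl[OF d(1)]]) (use d(2,3) in \<open>auto simp: B_def\<close>)
    also have "\<dots> \<le> C * norm (z - z') powr \<alpha>"
    proof (rule mult_mono)
      show "c d \<le> C" using cD[OF d(1)] C0C by simp
      show "norm (z - z') powr a d \<le> norm (z - z') powr \<alpha>"
        by (rule powr_mono'[OF aD[OF d(1)]]) (use True e(2) in auto)
    qed (use C0 C0C in auto)
    finally show ?thesis .
  next
    case False
    have "e = e powr 1" using e(1) by simp
    also have "\<dots> \<le> e powr \<alpha>" by (rule powr_mono') (use a1 e in auto)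
    also have "\<dots> \<le> norm (z - z') powr \<alpha>" by (rule powr_mono2) (use apos e False in auto)
    finally show ?thesis by (rule far_le[OF k])
  qed
  have H2: "norm (J (z, w) - J (z, w')) \<le> C * norm (w - w')" if k: "(z, w) \<in> K" "(z, w') \<in> K" for z w w'
  proof (cases "norm (w - w') < e")
    case True
    have "dist (z, w) (z, w') < e" using True by (simp add: dist_Pair_Pair dist_norm)
    from near[OF k(1) this] obtain d where d: "d \<in> D" "(z, w) \<in> B d" "(z, w') \<in> B d" by blast
    have "norm (J (z, w) - J (z, w')) \<le> c d * norm (w - w')"
      by (rule local_extD(9)[OF Dl[OF d(1)]]) (use d(2,3) in \<open>auto simp: B_def\<close>)
    also have "\<dots> \<le> C * norm (w - w')" using cD[OF d(1)] C0C by (intro mult_right_mono) auto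
    finally show ?thesis .
  next
    case False
    then show ?thesis by (intro far_le[OF k]) simp
  qed
  show ?thesis using apos a1 H1 H2 by (intro exI[of _ \<alpha>] exI[of _ C]) blast
qed

lemma discrete_critical:
  assumes z: "z \<in> ball 0 1"
  shows "discrete {w. (z, w) \<in> \<Sigma>}"
proof (rule discreteI)
  fix w assume w: "w \<in> {w. (z, w) \<in> \<Sigma>}"
  then have "w \<in> ball 0 1" by (auto simp: critical_set_def bidisc_def)
  then obtain r where r: "r > 0" "\<And>u. u \<in> ball w r - {w} \<Longrightarrow> (z, u) \<notin> \<Sigma>" using punctured[OF z] by blast
  have "u = w" if "u \<in> ball w r" "(z, u) \<in> \<Sigma>" for u using r(2) that by blast
  moreover have "w \<in> ball w r" using r(1) by simp
  ultimately have "ball w r \<inter> {w. (z, w) \<in> \<Sigma>} = {w}" using w by blast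
  then show "w isolated_in {w. (z, w) \<in> \<Sigma>}" unfolding isolated_in_def using w open_ball by blast
qed

end

subsection \<open>Integrable structures\<close>

lemma Jst_blinfun: "\<exists>L. blinfun_apply L = Jst \<and> L o\<^sub>L L = - id_blinfun"
proof -
  have J: "Jst = (\<lambda>u. (\<i> * fst u, \<i> * snd u))" by (auto simp: Jst_def)
  have b: "bounded_linear Jst"
    unfolding J by (intro bounded_linear_Pair bounded_linear_const_mult bounded_linear_fst bounded_linear_snd)
  have "Blinfun Jst o\<^sub>L Blinfun Jst = - id_blinfun"
    by (rule blinfun_eqI) (simp add: bounded_linear_Blinfun_apply[OF b] uminus_blinfun.rep_eq, simp add: J prod_eq_iff)
  then show ?thesis using bounded_linear_Blinfun_apply[OF b] by blast
qed

context family
begin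

text \<open>Followed by the holomorphic coordinates \<open>f\<close>, the chart carries the constant
  structure \<open>Jst\<close>, the case in which the local extension is smooth. \<open>J0\<close>
  remains the pulled back structure because \<open>f\<close> intertwines the two structures.\<close>

lemma integrable_local_ext:
  assumes int: "integrable_acs A Jc" and x: "(z0, w0) \<in> bidisc"
  shows "\<exists>\<rho> J \<alpha> C. local_ext z0 w0 \<rho> J \<alpha> C \<and> smooth_on (ball z0 \<rho> \<times> ball w0 \<rho>) J"
proof -
  obtain c where c': "c \<in> A" and ex: "case c of (U, \<phi>) \<Rightarrow> \<exists>W f g. H (z0, w0) \<in> W \<and> open W \<and> W \<subseteq> U \<and>
        smooth_on (\<phi> ` W) f \<and> open (f ` \<phi> ` W) \<and> smooth_on (f ` \<phi> ` W) g \<and>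
        (\<forall>y\<in>\<phi> ` W. g (f y) = y) \<and>
        (\<forall>y\<in>\<phi> ` W. frechet_derivative f (at y) \<circ> blinfun_apply (Jc (U, \<phi>) (inv_into U \<phi> y)) =
                      Jst \<circ> frechet_derivative f (at y))"
    using spec[OF int[unfolded integrable_acs_def], of "H (z0, w0)"] by (elim bexE) (rule that; assumption)
  obtain U \<phi> where cU: "c = (U, \<phi>)" by (cases c)
  note c = c'[unfolded cU]
  obtain W f g where W: "H (z0, w0) \<in> W" "open W" "W \<subseteq> U" and f: "smooth_on (\<phi> ` W) f" "open (f ` \<phi> ` W)"
    and g: "smooth_on (f ` \<phi> ` W) g" "\<forall>y\<in>\<phi> ` W. g (f y) = y"
    and fJ: "\<forall>y\<in>\<phi> ` W. frechet_derivative f (at y) \<circ> blinfun_apply (Jc (U, \<phi>) (inv_into U \<phi> y)) =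
                      Jst \<circ> frechet_derivative f (at y)"
    using ex[unfolded cU prod.case] by (elim exE conjE) (rule that; assumption)
  note cf = chart_facts[OF c]
  define N where "N = dom W"
  define V where "V = \<phi> ` W"
  define G where "G = \<phi> \<circ> H"
  have "continuous_on bidisc H" using Hsmooth unfolding smooth_map_bidisc_def by blast
  then have oN: "open N" unfolding N_def dom_def by (rule continuous_open_preimage[OF _ open_bidisc W(2)])
  have Nsub: "N \<subseteq> dom U" "N \<subseteq> bidisc" using W(3) by (auto simp: N_def dom_def)
  have "V = \<phi> ` U \<inter> inv_into U \<phi> -` W" using W(3) cf(5) by (auto simp: V_def image_iff)
  then have oV: "open V" using continuous_open_preimage[OF cf(4,2) W(2)] by simp
  have sG: "smooth_on N G" unfolding G_def by (rule smooth_on_subset[OF cf(9) Nsub(1)])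
  have GV: "G ` N \<subseteq> V" by (auto simp: G_def V_def N_def dom_def)
  have sfG: "smooth_on N (\<lambda>y. f (G y))" by (rule smooth_on_compose[OF oN oV GV sG]) (use f(1) in \<open>simp only: V_def\<close>)
  define F where "F = (\<lambda>y. frechet_derivative f (at y))"
  have df: "(f has_derivative F y) (at y)" if "y \<in> V" for y
    unfolding F_def by (rule smooth_on_has_derivative[OF f(1)]) (use that in \<open>simp only: V_def\<close>)
  have linF: "linear (F y)" if "y \<in> V" for y by (rule has_derivative_linear[OF df[OF that]])
  have injF: "inj (F y)" if y: "y \<in> V" for y
  proof -
    have "(g has_derivative frechet_derivative g (at (f y))) (at (f y))"
      by (rule smooth_on_has_derivative[OF g(1)]) (use y in \<open>simp only: V_def imageI\<close>)
    then have "((\<lambda>t. g (f t)) has_derivative (\<lambda>v. frechet_derivative g (at (f y)) (F y v))) (at y)"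
      by (rule has_derivative_compose[OF df[OF y]])
    then have "((\<lambda>t. t) has_derivative (\<lambda>v. frechet_derivative g (at (f y)) (F y v))) (at y)"
      by (rule has_derivative_transform_within_open[OF _ oV y]) (use g(2) in \<open>simp only: V_def\<close>)
    then have "(\<lambda>v. frechet_derivative g (at (f y)) (F y v)) = (\<lambda>v. v)"
      by (rule has_derivative_unique) (rule has_derivative_ident)
    then show ?thesis by (metis injI)
  qed
  have bijF: "bij (F y)" if "y \<in> V" for y
    unfolding bij_def using injF[OF that] linear_injective_imp_surjective[OF linF[OF that]] by blast
  have dfG: "dd (\<lambda>y. f (G y)) v y = F (G y) (dd G v y)" if y: "y \<in> N" for y v
  proof -
    have "G y \<in> V" using GV y by blast
    from fun_cong[OF frechet_derivative_at[OF has_derivative_compose[OF smooth_on_has_derivative[OF sG y] df[OF this]], symmetric], of v]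
    show ?thesis .
  qed
  obtain L where L: "blinfun_apply L = Jst" "L o\<^sub>L L = - id_blinfun" using Jst_blinfun by blast
  have FJ: "F (G y) (Jc (U, \<phi>) (H y) v) = L (F (G y) v)" if y: "y \<in> N" for y v
  proof -
    have "H y \<in> W" using y by (simp add: N_def dom_def)
    then have "G y \<in> \<phi> ` W" "inv_into U \<phi> (G y) = H y" using cf(5) W(3) by (auto simp: G_def)
    then show ?thesis using fun_cong[OF bspec[OF fJ], of "G y" v] by (simp add: F_def L(1))
  qed
  interpret U: curves "dom U" G "\<phi> ` U" "Jc (U, \<phi>) \<circ> inv_into U \<phi>" unfolding G_def by (rule chart_curves[OF c])
  have hol: "dd G (0, \<i> * t) y = Jc (U, \<phi>) (H y) (dd G (0, t) y)" if y: "y \<in> N" for y t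
  proof -
    have "y \<in> dom U" using y Nsub by blast
    then show ?thesis using U.holo[of y t] cf(5) by (simp add: G_def dom_def)
  qed
  have cur: "curves N (\<lambda>y. f (G y)) (f ` V) (\<lambda>_. L)"
  proof
    show "open N" "smooth_on N (\<lambda>y. f (G y))" by (rule oN, rule sfG)
    show "(\<lambda>y. f (G y)) ` N \<subseteq> f ` V" using GV by blast
    show o: "open (f ` V)" using f(2) by (simp add: V_def)
    show "smooth_on (f ` V) (\<lambda>_. L)" by (rule smooth_on_const[OF o])
    show "L o\<^sub>L L = - id_blinfun" by (rule L(2))
    show "dd (\<lambda>y. f (G y)) (0, \<i> * t) y = L (dd (\<lambda>y. f (G y)) (0, t) y)" if "y \<in> N" for y t
      unfolding dfG[OF that] hol[OF that] FJ[OF that] ..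
    show "dd (\<lambda>y. f (G y)) (0, 1) y \<noteq> 0" if y: "y \<in> N" for y
    proof -
      have V: "G y \<in> V" using GV y by blast
      have "dd G (0, 1) y \<noteq> 0" using U.imm[of y] y Nsub by blast
      then show ?thesis unfolding dfG[OF y] using linear_injective_0[OF linF[OF V]] injF[OF V] by blast
    qed
  qed
  have reg: "bij (frechet_derivative (\<lambda>y. f (G y)) (at y)) \<longleftrightarrow> y \<notin> \<Sigma>" if y: "y \<in> N" for y
  proof -
    have V: "G y \<in> V" using GV y by blast
    have yU: "y \<in> dom U" using y Nsub by blast
    have e: "frechet_derivative (\<lambda>y. f (G y)) (at y) = F (G y) \<circ> frechet_derivative G (at y)"
      by (rule ext) (simp add: dfG[OF y])
    have "bij (F (G y) \<circ> frechet_derivative G (at y)) \<longleftrightarrow> bij (frechet_derivative G (at y))"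
    proof
      assume "bij (F (G y) \<circ> frechet_derivative G (at y))"
      then have "inj (frechet_derivative G (at y))" unfolding bij_def using inj_on_imageI2 by blast
      moreover have "linear (frechet_derivative G (at y))"
        by (rule linear_frechet_derivative[OF smooth_on_differentiable[OF sG y]])
      ultimately show "bij (frechet_derivative G (at y))"
        unfolding bij_def using linear_injective_imp_surjective by blast
    qed (rule bij_comp[OF _ bijF[OF V]])
    then show ?thesis using noncritical_iff[OF c yU, folded G_def] unfolding e by blast
  qed
  have ext: "extension N (\<lambda>y. f (G y)) (f ` V) (\<lambda>_. L) J0"
  proof (rule extension.intro[OF cur], unfold_locales)
    fix y assume y: "y \<in> N" "bij (frechet_derivative (\<lambda>y. f (G y)) (at y))"
    have nc: "y \<notin> \<Sigma>" using reg[OF y(1)] y(2) by blast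
    have yU: "y \<in> dom U" "y \<in> bidisc" using y Nsub by blast+
    show "Im (fst (J0 y (1, 0))) > 0" by (rule J0_positive[OF yU(2) nc])
    show "dd (\<lambda>y. f (G y)) (J0 y v) y = L (dd (\<lambda>y. f (G y)) v y)" for v
      unfolding dfG[OF y(1)] using J0_chart(1)[OF c yU(1) nc, of v] FJ[OF y(1), of "dd G v y"] by (simp add: G_def)
  qed
  have x: "(z0, w0) \<in> N" using x W(1) by (simp add: N_def dom_def)
  from extension_at[OF ext Nsub(2) x] reg show ?thesis by blast
qed

lemma smooth_extension:
  assumes int: "integrable_acs A Jc" and J: "\<And>z w. (z, w) \<in> bidisc \<Longrightarrow> \<exists>\<rho> \<alpha> C. local_ext z w \<rho> J \<alpha> C"
  shows "smooth_on bidisc J"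
proof (rule smooth_on_local)
  fix x assume "x \<in> bidisc"
  then have zw: "(fst x, snd x) \<in> bidisc" by simp
  obtain \<rho> J' \<alpha> C where l: "local_ext (fst x) (snd x) \<rho> J' \<alpha> C" "smooth_on (ball (fst x) \<rho> \<times> ball (snd x) \<rho>) J'"
    using integrable_local_ext[OF int zw] by (elim exE conjE) (rule that; assumption)
  define B where "B = ball (fst x) \<rho> \<times> ball (snd x) \<rho>"
  have o: "open B" unfolding B_def by (intro open_Times open_ball)
  have eq: "J' (a, b) = J (a, b)" if ab: "(a, b) \<in> B" for a b
  proof -
    have "(a, b) \<in> bidisc" by (rule subsetD[OF local_extD(2)[OF l(1)] ab[unfolded B_def]])
    from J[OF this] show ?thesis
    proof (elim exE)
      fix \<rho>' \<alpha>' C' assume l': "local_ext a b \<rho>' J \<alpha>' C'"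
      have "(a, b) \<in> ball a \<rho>' \<times> ball b \<rho>'" using local_extD(1)[OF l'] by simp
      then show ?thesis by (rule local_ext_unique[OF l(1) l' ab[unfolded B_def]])
    qed
  qed
  have "smooth_on B J"
  proof (rule smooth_on_cong[OF o])
    show "smooth_on B J'" unfolding B_def by (rule l(2))
    show "J' y = J y" if "y \<in> B" for y using eq[of "fst y" "snd y"] that by simp
  qed
  moreover have "x \<in> B" using local_extD(1)[OF l(1)] by (simp add: B_def mem_Times_iff)
  ultimately show "\<exists>T. x \<in> T \<and> smooth_on T J" by (intro exI[of _ B] conjI)
qed

end

theorem theorem3p1:
  fixes A :: "('m::{t2_space, second_countable_topology} set \<times> ('m \<Rightarrow> cc)) set"
    and Jc :: "('m set \<times> ('m \<Rightarrow> cc)) \<Rightarrow> 'm \<Rightarrow> (cc \<Rightarrow>\<^sub>L cc)"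
    and H :: "cc \<Rightarrow> 'm"
  assumes atlas: "smooth_atlas A"
    and acs: "smooth_almost_complex A Jc"
    and Hsmooth: "smooth_map_bidisc A H"
    and holo_imm: "\<forall>z\<in>ball 0 1. \<forall>w\<in>ball 0 1. \<forall>(U, \<phi>)\<in>A. H (z, w) \<in> U \<longrightarrow>
         frechet_derivative (\<lambda>t. \<phi> (H (z, t))) (at w) \<circ> (\<lambda>t. \<i> * t) =
           blinfun_apply (Jc (U, \<phi>) (H (z, w))) \<circ> frechet_derivative (\<lambda>t. \<phi> (H (z, t))) (at w) \<and>
         inj (frechet_derivative (\<lambda>t. \<phi> (H (z, t))) (at w))"
    and not_contained: "\<forall>z\<in>ball 0 1. \<not> ({z} \<times> ball 0 1 \<subseteq> critical_set A H)"
    and orient: "\<forall>x\<in>bidisc - critical_set A H. \<forall>(U, \<phi>)\<in>A. H x \<in> U \<longrightarrow>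
         (\<forall>v u. ldet (cframe (Jc (U, \<phi>) (H x)) v u) \<noteq> 0 \<longrightarrow>
            ldet (frechet_derivative (\<phi> \<circ> H) (at x)) * ldet (cframe (Jc (U, \<phi>) (H x)) v u) > 0)"
  shows "(\<forall>z\<in>ball 0 1. discrete {w. (z, w) \<in> critical_set A H}) \<and>
    (\<exists>J :: cc \<Rightarrow> (cc \<Rightarrow>\<^sub>L cc).
       continuous_on bidisc J \<and>
       (\<forall>x\<in>bidisc. J x o\<^sub>L J x = - id_blinfun) \<and>
       (\<forall>x\<in>bidisc - critical_set A H. \<forall>(U, \<phi>)\<in>A. H x \<in> U \<longrightarrow>
          blinfun_apply (J x) = inv (frechet_derivative (\<phi> \<circ> H) (at x)) \<circ>
             blinfun_apply (Jc (U, \<phi>) (H x)) \<circ> frechet_derivative (\<phi> \<circ> H) (at x)) \<and>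
       (\<forall>K. compact K \<and> K \<subseteq> bidisc \<longrightarrow>
          (\<exists>\<alpha> C. 0 < \<alpha> \<and> \<alpha> < 1 \<and>
             (\<forall>z z' w. (z, w) \<in> K \<and> (z', w) \<in> K \<longrightarrow>
                norm (J (z, w) - J (z', w)) \<le> C * norm (z - z') powr \<alpha>) \<and>
             (\<forall>z w w'. (z, w) \<in> K \<and> (z, w') \<in> K \<longrightarrow>
                norm (J (z, w) - J (z, w')) \<le> C * norm (w - w')))) \<and>
       (integrable_acs A Jc \<longrightarrow> smooth_on bidisc J))"
proof -
  interpret family A Jc H by (rule family.intro[OF assms])
  obtain J where "\<forall>z w. (z, w) \<in> bidisc \<longrightarrow> (\<exists>\<rho> \<alpha> C. local_ext z w \<rho> J \<alpha> C)"
    by (rule exE[OF global_extension])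
  note J = this[rule_format]
  have at: "J x o\<^sub>L J x = - id_blinfun" "x \<notin> critical_set A H \<Longrightarrow> blinfun_apply (J x) = J0 x" if x: "x \<in> bidisc" for x
  proof -
    obtain z w where zw: "x = (z, w)" by (cases x)
    obtain \<rho> \<alpha> C where l: "local_ext z w \<rho> J \<alpha> C"
      using J[OF x[unfolded zw]] by (elim exE) (rule that; assumption)
    have "x \<in> ball z \<rho> \<times> ball w \<rho>" using local_extD(1)[OF l] zw by simp
    then show "J x o\<^sub>L J x = - id_blinfun" "x \<notin> critical_set A H \<Longrightarrow> blinfun_apply (J x) = J0 x"
      by (rule local_extD(6)[OF l], rule local_extD(7)[OF l])
  qed
  have pull: "blinfun_apply (J x) = inv (frechet_derivative (\<phi> \<circ> H) (at x)) \<circ>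
             blinfun_apply (Jc (U, \<phi>) (H x)) \<circ> frechet_derivative (\<phi> \<circ> H) (at x)"
    if x: "x \<in> bidisc - critical_set A H" "(U, \<phi>) \<in> A" "H x \<in> U" for x U \<phi>
  proof -
    have "x \<in> dom U" using x by (simp add: dom_def)
    from J0_chart(2)[OF x(2) this] at(2) x(1) show ?thesis by simp
  qed
  have disc: "\<forall>z\<in>ball 0 1. discrete {w. (z, w) \<in> critical_set A H}" by (intro ballI discrete_critical)
  show ?thesis
  proof (rule conjI[OF disc], rule exI[of _ J], intro conjI allI impI)
    show "continuous_on bidisc J" by (rule continuous_extension[OF J])
    show "\<forall>x\<in>bidisc. J x o\<^sub>L J x = - id_blinfun" by (intro ballI at(1))
    show "\<forall>x\<in>bidisc - critical_set A H. \<forall>(U, \<phi>)\<in>A. H x \<in> U \<longrightarrow>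
          blinfun_apply (J x) = inv (frechet_derivative (\<phi> \<circ> H) (at x)) \<circ>
             blinfun_apply (Jc (U, \<phi>) (H x)) \<circ> frechet_derivative (\<phi> \<circ> H) (at x)"
    proof (intro ballI)
      fix x c assume x: "x \<in> bidisc - critical_set A H" and c: "c \<in> A"
      obtain U \<phi> where "c = (U, \<phi>)" by (cases c)
      then show "case c of (U, \<phi>) \<Rightarrow> H x \<in> U \<longrightarrow>
          blinfun_apply (J x) = inv (frechet_derivative (\<phi> \<circ> H) (at x)) \<circ>
             blinfun_apply (Jc (U, \<phi>) (H x)) \<circ> frechet_derivative (\<phi> \<circ> H) (at x)"
        using pull[OF x, of U \<phi>] c by simp
    qed
    show "smooth_on bidisc J" if "integrable_acs A Jc" by (rule smooth_extension[OF that J])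
    fix K assume "compact K \<and> K \<subseteq> bidisc"
    then have K: "compact K" "K \<subseteq> bidisc" by auto
    show "\<exists>\<alpha> C. 0 < \<alpha> \<and> \<alpha> < 1 \<and>
             (\<forall>z z' w. (z, w) \<in> K \<and> (z', w) \<in> K \<longrightarrow>
                norm (J (z, w) - J (z', w)) \<le> C * norm (z - z') powr \<alpha>) \<and>
             (\<forall>z w w'. (z, w) \<in> K \<and> (z, w') \<in> K \<longrightarrow>
                norm (J (z, w) - J (z, w')) \<le> C * norm (w - w'))"
      by (rule compact_estimates[OF J K])
  qed
qed

end
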